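(* There is a constant $C>0$ such that, for $0<T<\infty$ and $0<R\le T$, if $u$ is a weak (Leray–Hopf) solution of the Navier–Stokes equations in $\mathbb R^3\times(0,T)$ and $$|u(x,t)|\leq \frac{C}{(T-t)^{1/2}}\qquad\text{for all }(x,t)\in\mathbb R^3\times(T-R,T),$$ then $u$ is bounded in $\mathbb R^3\times(T-R,T]$.
   Context: The Navier–Stokes equations in $\mathbb R^3\times(0,T)$ are $$\partial_tu-\Delta u+u\cdot\nabla u+\nabla p=0,\qquad \operatorname{div}u=0\qquad\text{in }\mathbb R^3\times(0,T),$$ where $u$ (velocity, $\mathbb R^3$-valued) and $p$ (pressure, scalar) are unknown. A function $u:\mathbb R^3\times(0,T)\to\mathbb R^3$ is called a weak solution (Leray–Hopf solution) if: (1) $u\in L^\infty(0,T;L^2(\mathbb R^3))\cap L^2(0,T;H^1(\mathbb R^3))$; (2) $\operatorname{div}u=0$ in $\mathbb R^3\times(0,T)$; (3) $\int_0^T\int_{\mathbb R^3}\{-u\cdot\partial_t\phi+\nabla u\cdot\nabla\phi+(u\cdot\nabla u)\cdot\phi\}\,dx\,dt=0$ for all $\mathbb R^3$-valued $\phi\in C_0^\infty(\mathbb R^3\times(0,T))$ with $\operatorname{div}\phi=0$. *)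

theory Defs
  imports "HOL-Analysis.Analysis"
begin

section \<open>Test functions\<close>

abbreviation dir_deriv ::
  "('a::real_normed_vector \<Rightarrow> 'b::real_normed_vector) \<Rightarrow> 'a \<Rightarrow> 'a \<Rightarrow> 'b" where
  "dir_deriv f v x \<equiv> frechet_derivative f (at x) v"

primrec times_cont_diff ::
  "nat \<Rightarrow> ('a::real_normed_vector \<Rightarrow> 'b::real_normed_vector) \<Rightarrow> bool" where
  "times_cont_diff 0 f \<longleftrightarrow> continuous_on UNIV f"
| "times_cont_diff (Suc k) f \<longleftrightarrow>
     (\<forall>x. f differentiable (at x)) \<and> (\<forall>v. times_cont_diff k (dir_deriv f v))"

definition smooth :: "('a::real_normed_vector \<Rightarrow> 'b::real_normed_vector) \<Rightarrow> bool" where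
  "smooth f \<longleftrightarrow> (\<forall>k. times_cont_diff k f)"

text \<open>\<open>test_function S f\<close> says that \<open>f\<close> lies in \<open>C\<^sub>0\<^sup>\<infinity>(S)\<close>, for open \<open>S\<close>; \<open>f\<close> is extended by
  zero outside \<open>S\<close>.\<close>

definition test_function ::
  "'a::real_normed_vector set \<Rightarrow> ('a \<Rightarrow> 'b::real_normed_vector) \<Rightarrow> bool" where
  "test_function S f \<longleftrightarrow>
     smooth f \<and> compact (closure {x. f x \<noteq> 0}) \<and> closure {x. f x \<noteq> 0} \<subseteq> S"


section \<open>The spaces \<open>L\<^sup>2\<close> and \<open>H\<^sup>1\<close> on three-dimensional space\<close>

definition in_L2 :: "(real^3 \<Rightarrow> 'b::euclidean_space) \<Rightarrow> bool" where
  "in_L2 f \<longleftrightarrow> f \<in> borel_measurable lebesgue \<and> integrable lebesgue (\<lambda>x. (norm (f x))\<^sup>2)"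

definition L2_norm :: "(real^3 \<Rightarrow> 'b::euclidean_space) \<Rightarrow> real" where
  "L2_norm f = sqrt (LINT x|lebesgue. (norm (f x))\<^sup>2)"

text \<open>The entry \<open>G x $ i $ j\<close> is the weak derivative of the \<open>i\<close>-th component of \<open>f\<close> in
  direction \<open>x\<^sub>j\<close>. The norm of \<^typ>\<open>real^3^3\<close> is the Frobenius norm and its inner product is
  the Frobenius inner product.\<close>

definition weak_gradient :: "(real^3 \<Rightarrow> real^3) \<Rightarrow> (real^3 \<Rightarrow> real^3^3) \<Rightarrow> bool" where
  "weak_gradient f G \<longleftrightarrow>
     (\<forall>\<psi> :: real^3 \<Rightarrow> real. test_function UNIV \<psi> \<longrightarrow>
        (\<forall>i j. (LINT x|lebesgue. f x $ i * dir_deriv \<psi> (axis j 1) x) =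
               - (LINT x|lebesgue. G x $ i $ j * \<psi> x)))"

definition H1_with_gradient :: "(real^3 \<Rightarrow> real^3) \<Rightarrow> (real^3 \<Rightarrow> real^3^3) \<Rightarrow> bool" where
  "H1_with_gradient f G \<longleftrightarrow> in_L2 f \<and> in_L2 G \<and> weak_gradient f G"


section \<open>Functions on space-time\<close>

text \<open>Only the values of \<open>u\<close> on the cylinder \<open>UNIV \<times> {0<..<T}\<close> matter, and only up to null sets.\<close>

definition Linf_L2 :: "real \<Rightarrow> ((real^3) \<times> real \<Rightarrow> 'b::euclidean_space) \<Rightarrow> bool" where
  "Linf_L2 T u \<longleftrightarrow>
     u \<in> borel_measurable (lebesgue_on (UNIV \<times> {0<..<T})) \<and>
     (\<exists>K. AE t in lebesgue_on {0<..<T}. in_L2 (\<lambda>x. u (x, t)) \<and> L2_norm (\<lambda>x. u (x, t)) \<le> K)"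

text \<open>\<open>L2_H1 T u Du\<close>: \<open>u\<close> belongs to \<open>L\<^sup>2(0,T;H\<^sup>1)\<close> and \<open>Du\<close> is its weak spatial gradient.\<close>

definition L2_H1 ::
  "real \<Rightarrow> ((real^3) \<times> real \<Rightarrow> real^3) \<Rightarrow> ((real^3) \<times> real \<Rightarrow> real^3^3) \<Rightarrow> bool" where
  "L2_H1 T u Du \<longleftrightarrow>
     u \<in> borel_measurable (lebesgue_on (UNIV \<times> {0<..<T})) \<and>
     Du \<in> borel_measurable (lebesgue_on (UNIV \<times> {0<..<T})) \<and>
     (AE t in lebesgue_on {0<..<T}. H1_with_gradient (\<lambda>x. u (x, t)) (\<lambda>x. Du (x, t))) \<and>
     integrable (lebesgue_on {0<..<T})
       (\<lambda>t. (L2_norm (\<lambda>x. u (x, t)))\<^sup>2 + (L2_norm (\<lambda>x. Du (x, t)))\<^sup>2)"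

text \<open>Classical derivatives of a field on space-time.\<close>

definition time_deriv ::
  "((real^3) \<times> real \<Rightarrow> real^3) \<Rightarrow> (real^3) \<times> real \<Rightarrow> real^3" where
  "time_deriv \<phi> z = dir_deriv \<phi> (0, 1) z"

definition space_gradient ::
  "((real^3) \<times> real \<Rightarrow> real^3) \<Rightarrow> (real^3) \<times> real \<Rightarrow> real^3^3" where
  "space_gradient \<phi> z = (\<chi> i j. dir_deriv \<phi> (axis j 1, 0) z $ i)"


section \<open>Leray--Hopf weak solutions\<close>

text \<open>The divergence is the trace of the (weak or classical) spatial gradient. The convective
  term \<open>u \<sqdot> \<nabla>u\<close> has components \<open>\<Sum>\<^sub>j u\<^sub>j \<partial>\<^sub>j u\<^sub>i\<close>, that is \<open>Du *v u\<close>.\<close>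

definition weak_solution :: "real \<Rightarrow> ((real^3) \<times> real \<Rightarrow> real^3) \<Rightarrow> bool" where
  "weak_solution T u \<longleftrightarrow>
     (\<exists>Du. Linf_L2 T u \<and> L2_H1 T u Du \<and>
        (AE z in lebesgue_on (UNIV \<times> {0<..<T}). trace (Du z) = 0) \<and>
        (\<forall>\<phi> :: (real^3) \<times> real \<Rightarrow> real^3.
           test_function (UNIV \<times> {0<..<T}) \<phi> \<and> (\<forall>z. trace (space_gradient \<phi> z) = 0) \<longrightarrow>
           (LINT z|lebesgue_on (UNIV \<times> {0<..<T}).
              - (u z \<bullet> time_deriv \<phi> z) + Du z \<bullet> space_gradient \<phi> z + (Du z *v u z) \<bullet> \<phi> z) = 0))"

text \<open>A weak solution is determined only up to a null set of space-time, so boundedness is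
  boundedness in \<open>L\<^sup>\<infinity>\<close>; likewise pointwise bounds on a weak solution are to be read almost
  everywhere.\<close>

definition ess_bounded_on ::
  "((real^3) \<times> real) set \<Rightarrow> ((real^3) \<times> real \<Rightarrow> real^3) \<Rightarrow> bool" where
  "ess_bounded_on S u \<longleftrightarrow> (\<exists>M. AE z in lebesgue_on S. norm (u z) \<le> M)"

end

theory Submission
  imports Defs "HOL-Probability.Distributions"
begin

text \<open>
  For scalar \<open>W\<close> the field \<open>\<phi>\<^sub>i = \<partial>\<^sub>i\<partial>\<^sub>k W - \<delta>\<^sub>i\<^sub>k \<Delta>W\<close> is divergence free, and \<open>u\<close> is orthogonal to gradients on almost every time
  slice, so testing the equation with \<open>\<phi>\<close> gives
  \<open>\<integral>\<integral> u\<^sub>k \<Delta>(\<partial>\<^sub>\<tau>W + \<Delta>W) = \<integral>\<integral> \<Sum>\<^sub>i\<^sub>j u\<^sub>i u\<^sub>j \<partial>\<^sub>j\<phi>\<^sub>i\<close>, from which the pressure has disappeared.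
  Take for \<open>W\<close> a cutoff in space and time times the backward heat kernel \<open>\<Gamma>(x\<^sub>0 - x, s - \<tau>)\<close>. On the right, third
  derivatives of \<open>\<Gamma>\<close> have \<open>L\<^sup>1\<close> norm of order \<open>(s - \<tau>) powr (-3/2)\<close>, and the cutoff errors live
  where \<open>\<Gamma>\<close> is harmless. Since \<open>\<Delta>\<Gamma> = \<partial>\<^sub>s\<Gamma>\<close>, integration over \<open>s\<close> from \<open>t\<close> to
  \<open>T + 1\<close> undoes the Laplacian on the left; when the time cutoff collapses to \<open>\<tau> = t\<close> this becomes
  \<open>\<bar>u(x\<^sub>0,t)\<bar> \<le> A + c \<integral> V(\<tau>) (t - \<tau>) powr (-1/2) d\<tau>\<close> whenever \<open>\<bar>u\<bar>\<^sup>2 \<le> V\<close>, with \<open>c\<close> absolute and \<open>A\<close>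
  depending only on the energy and on an early bound for \<open>u\<close>. For a small constant in the hypothesis, this inequality
  bootstraps to boundedness.
\<close>

section \<open>Calculus of smooth functions\<close>

text \<open>The pressure is nonlocal, while admissible fields are divergence free with compact
  support. Cutting off a divergence-free kernel would break the constraint, so the cutoff acts on
  the scalar potential \<open>W\<close>, underneath the second derivatives. The price is one more
  Laplacian on the linear side. Keeping it until the integration over s means that only explicit
  Gaussians occur and no singular integral operator is ever estimated. The exponent -1/2 in the
  hypothesis is scale invariant: inserting it for both factors of the quadratic term returns the
  same power of T - t, so nothing is gained. One factor therefore keeps the hypothesis and supplies
  the smallness, while the other carries a weaker weight (T - t)^(-p). Convergence of the integral
  of r^(-1-p) at infinity needs p > 0. In the last step the squared bound against (t -
  \<tau>)^(-1/2) must be integrable, which needs p < 1/4. The choice below is p = 1/8. The heat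
  kernel is not normalized; its mass \<open>gauss4\<close> stays as a factor and is divided out at
  the end.\<close>

definition pd :: "'a::real_normed_vector \<Rightarrow> ('a \<Rightarrow> 'b::real_normed_vector) \<Rightarrow> 'a \<Rightarrow> 'b" where
  "pd v f = (\<lambda>x. dir_deriv f v x)"

lemma pd_eqI: "(f has_derivative F) (at x) \<Longrightarrow> pd v f x = F v"
  by (metis frechet_derivative_at pd_def)

lemma smoothD: assumes "smooth f" shows "f differentiable (at x)" "smooth (pd v f)"
proof -
  have a: "times_cont_diff (Suc k) f" for k using assms by (simp add: smooth_def)
  show "f differentiable (at x)" using a[of 0] by simp
  show "smooth (pd v f)" unfolding smooth_def pd_def using a by simp
qed

lemma smooth_has_derivative: "smooth f \<Longrightarrow> (f has_derivative (\<lambda>v. pd v f x)) (at x)"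
  unfolding pd_def using frechet_derivative_works smoothD(1) by (metis eta_contract_eq)

lemma smooth_continuous: "smooth f \<Longrightarrow> continuous_on A f"
  by (meson continuous_at_imp_continuous_on differentiable_imp_continuous_within smoothD(1))

lemma smooth_borel: "smooth f \<Longrightarrow> f \<in> borel_measurable borel"
  by (simp add: borel_measurable_continuous_onI smooth_continuous)

text \<open>Induction on the order k inside the class \<open>P\<close>: order 0 needs only
  continuity, which differentiability supplies, and the step applies the induction hypothesis to
  \<open>pd v f\<close>. This spares a separate induction for every closure property.\<close>

lemma smooth_coinduct:
  assumes "P f" and step: "\<And>f x. P f \<Longrightarrow> f differentiable (at x)" "\<And>f v. P f \<Longrightarrow> P (pd v f)"
  shows "smooth f"
proof -
  have "\<forall>f. P f \<longrightarrow> times_cont_diff k f" for k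
  proof (induction k)
    case 0
    show ?case using step(1) by (auto intro!: continuous_at_imp_continuous_on differentiable_imp_continuous_within)
  next
    case (Suc k)
    show ?case using step Suc unfolding pd_def by auto
  qed
  then show ?thesis using assms(1) by (auto simp: smooth_def)
qed

text \<open>\<open>flat 0\<close> is the classical function exp(-1/x), extended by zero. The powers
  (1/x)^n are carried along so that the family is closed under differentiation up to linear
  combinations.\<close>

definition flat :: "nat \<Rightarrow> real \<Rightarrow> real" where
  "flat n x = (if x > 0 then (1/x) ^ n * exp (- (1/x)) else 0)"

lemma flat_tendsto: "(flat n \<longlongrightarrow> 0) (at_right 0)"
proof -
  have 1: "((\<lambda>y::real. y ^ n / exp y) \<longlongrightarrow> 0) at_top"
    by (rule tendsto_power_div_exp_0)
  have 2: "filterlim (\<lambda>x::real. 1/x) at_top (at_right 0)"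
    by (simp add: filterlim_inverse_at_top_right divide_inverse)
  have "((\<lambda>x::real. (1/x) ^ n / exp (1/x)) \<longlongrightarrow> 0) (at_right 0)"
    by (rule filterlim_compose[OF 1 2])
  then show ?thesis
    by (rule Lim_transform_eventually)
       (auto simp: eventually_at_right_less flat_def exp_minus divide_inverse intro!: eventually_at_right_less[THEN eventually_mono])
qed

lemma flat_DERIV: "(flat n has_real_derivative (flat (n+2) x - n * flat (n+1) x)) (at x)"
proof (cases "x = 0")
  case False
  show ?thesis
  proof (cases "x > 0")
    case True
    have *: "((\<lambda>x. (1/x) ^ n * exp (- (1/x))) has_real_derivative (flat (n+2) x - n * flat (n+1) x)) (at x)"
      apply (rule derivative_eq_intros refl | use True in force)+
      using True
      apply (cases n)
       apply (auto simp: flat_def field_simps power2_eq_square)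
      done
    show ?thesis
      by (rule DERIV_cong_ev[THEN iffD1, OF refl _ refl *])
         (use True in \<open>auto simp: flat_def intro!: eventually_mono[OF eventually_nhds_in_open[of "{0<..}"]]\<close>)
  next
    case False2: False
    have *: "((\<lambda>x. 0) has_real_derivative 0) (at x)" by simp
    have "(flat n has_real_derivative 0) (at x)"
      by (rule DERIV_cong_ev[THEN iffD1, OF refl _ refl *])
         (use False False2 in \<open>auto simp: flat_def intro!: eventually_mono[OF eventually_nhds_in_open[of "{..<0}"]]\<close>)
    then show ?thesis using False2 by (simp add: flat_def)
  qed
next
  case True
  \<comment> \<open>At the origin the difference quotient from the right is
    \<open>flat (Suc n) h\<close>, which tends to 0 by \<open>flat_tendsto\<close>; from the left it
    vanishes.\<close>
  have "((\<lambda>h. (flat n h - flat n 0) / (h - 0)) \<longlongrightarrow> 0) (at 0)"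
  proof (rule filterlim_split_at_real)
    show "((\<lambda>h. (flat n h - flat n 0) / (h - 0)) \<longlongrightarrow> 0) (at_left 0)"
      by (rule tendsto_eventually) (auto simp: flat_def eventually_at_filter)
    show "((\<lambda>h. (flat n h - flat n 0) / (h - 0)) \<longlongrightarrow> 0) (at_right 0)"
      by (rule Lim_transform_eventually[OF flat_tendsto[of "Suc n"]])
         (auto simp: flat_def eventually_at_filter)
  qed
  then have "(flat n has_real_derivative 0) (at 0)"
    by (simp add: has_field_derivative_iff)
  then show ?thesis using True by (simp add: flat_def)
qed

lemma flat_nonneg: "flat n x \<ge> 0" by (simp add: flat_def)
lemma flat_pos: "x > 0 \<Longrightarrow> flat n x > 0" by (simp add: flat_def)

text \<open>A class closed under directional derivatives: by coinduction its members are smooth, which yields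
  all closure properties of smooth functions at once.\<close>

inductive sm :: "('a::real_normed_vector \<Rightarrow> real) \<Rightarrow> bool" where
  sm_smooth: "smooth f \<Longrightarrow> sm f"
| sm_const: "sm (\<lambda>z. c)"
| sm_linear: "bounded_linear f \<Longrightarrow> sm f"
| sm_add: "sm f \<Longrightarrow> sm g \<Longrightarrow> sm (\<lambda>z. f z + g z)"
| sm_mult: "sm f \<Longrightarrow> sm g \<Longrightarrow> sm (\<lambda>z. f z * g z)"
| sm_powr: "sm f \<Longrightarrow> (\<And>z. f z > 0) \<Longrightarrow> sm (\<lambda>z. f z powr p)"
| sm_exp: "sm f \<Longrightarrow> sm (\<lambda>z. exp (f z))"
| sm_flat: "sm f \<Longrightarrow> sm (\<lambda>z. flat n (f z))"

lemma has_derivative_powr_const: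
  fixes f :: "'a::real_normed_vector \<Rightarrow> real"
  assumes "(f has_derivative F) (at x)" "f x > 0"
  shows "((\<lambda>z. f z powr p) has_derivative (\<lambda>v. p * f x powr (p - 1) * F v)) (at x)"
proof -
  have "((\<lambda>y. y powr p) has_derivative (\<lambda>h. p * f x powr (p - 1) * h)) (at (f x))"
    using has_real_derivative_powr[OF assms(2), of p] by (simp add: has_field_derivative_def)
  from has_derivative_compose[OF assms(1) this] show ?thesis .
qed

lemma has_derivative_flat:
  assumes "(f has_derivative F) (at x)"
  shows "((\<lambda>z. flat n (f z)) has_derivative (\<lambda>v. (flat (n+2) (f x) + (- real n) * flat (n+1) (f x)) * F v)) (at x)"
proof -
  have "(flat n has_derivative (\<lambda>h. (flat (n+2) (f x) + (- real n) * flat (n+1) (f x)) * h)) (at (f x))"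
    using flat_DERIV[of n "f x"] by (simp add: has_field_derivative_def)
  from has_derivative_compose[OF assms(1) this] show ?thesis .
qed

text \<open>Rule induction: the derivative formula of each constructor is again assembled from
  constructors. Arbitrary real exponents and all indices of \<open>flat\<close> belong to the class
  because differentiation shifts both.\<close>

lemma sm_closed: "sm f \<Longrightarrow> (\<forall>x. f differentiable (at x)) \<and> (\<forall>v. sm (pd v f))"
proof (induction rule: sm.induct)
  case (sm_smooth f)
  then show ?case by (auto intro: smoothD sm.sm_smooth)
next
  case (sm_const c)
  have "pd v (\<lambda>z::'a. c) = (\<lambda>z. 0)" for v
    by (rule ext, rule pd_eqI[of _ "\<lambda>_. 0"]) simp
  then show ?case by (auto intro: sm.sm_const)
next
  case (sm_linear f)
  then have "pd v f = (\<lambda>z. f v)" for v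
    by (intro ext pd_eqI) (rule bounded_linear_imp_has_derivative)
  then show ?case using sm_linear by (auto intro: sm.sm_const bounded_linear_imp_differentiable)
next
  case (sm_add f g)
  then have d: "(f has_derivative (\<lambda>v. pd v f x)) (at x)" "(g has_derivative (\<lambda>v. pd v g x)) (at x)" for x
    by (simp_all add: frechet_derivative_works pd_def)
  have D: "((\<lambda>z. f z + g z) has_derivative (\<lambda>v. pd v f x + pd v g x)) (at x)" for x
    by (intro derivative_intros d)
  then have "pd v (\<lambda>z. f z + g z) = (\<lambda>x. pd v f x + pd v g x)" for v
    by (intro ext pd_eqI)
  then show ?case using sm_add D by (auto intro: sm.sm_add simp: differentiable_def)
next
  case (sm_mult f g)
  then have d: "(f has_derivative (\<lambda>v. pd v f x)) (at x)" "(g has_derivative (\<lambda>v. pd v g x)) (at x)" for x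
    by (simp_all add: frechet_derivative_works pd_def)
  have D: "((\<lambda>z. f z * g z) has_derivative (\<lambda>v. f x * pd v g x + pd v f x * g x)) (at x)" for x
    by (intro has_derivative_mult d)
  then have "pd v (\<lambda>z. f z * g z) = (\<lambda>x. f x * pd v g x + pd v f x * g x)" for v
    by (intro ext pd_eqI)
  then show ?case using sm_mult D by (auto intro!: sm.sm_add sm.sm_mult simp: differentiable_def)
next
  case (sm_powr f p)
  then have d: "(f has_derivative (\<lambda>v. pd v f x)) (at x)" for x
    by (simp_all add: frechet_derivative_works pd_def)
  have D: "((\<lambda>z. f z powr p) has_derivative (\<lambda>v. p * f x powr (p - 1) * pd v f x)) (at x)" for x
    by (intro has_derivative_powr_const d sm_powr)
  then have "pd v (\<lambda>z. f z powr p) = (\<lambda>x. p * f x powr (p - 1) * pd v f x)" for v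
    by (intro ext pd_eqI)
  then show ?case using sm_powr D by (auto intro!: sm.sm_const sm.sm_powr sm.sm_mult simp: differentiable_def)
next
  case (sm_exp f)
  then have d: "(f has_derivative (\<lambda>v. pd v f x)) (at x)" for x
    by (simp_all add: frechet_derivative_works pd_def)
  have D: "((\<lambda>z. exp (f z)) has_derivative (\<lambda>v. pd v f x * exp (f x))) (at x)" for x
    using has_derivative_exp[OF d] by (simp add: mult_ac)
  then have "pd v (\<lambda>z. exp (f z)) = (\<lambda>x. pd v f x * exp (f x))" for v
    by (intro ext pd_eqI)
  then show ?case using sm_exp D by (auto intro!: sm.sm_exp sm.sm_mult simp: differentiable_def)
next
  case (sm_flat f n)
  then have d: "(f has_derivative (\<lambda>v. pd v f x)) (at x)" for x
    by (simp_all add: frechet_derivative_works pd_def)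
  note D = has_derivative_flat[OF d, of n]
  then have "pd v (\<lambda>z. flat n (f z)) = (\<lambda>x. (flat (n+2) (f x) + (- real n) * flat (n+1) (f x)) * pd v f x)" for v
    by (intro ext pd_eqI)
  moreover have "sm (\<lambda>x. (flat (n+2) (f x) + (- real n) * flat (n+1) (f x)) * pd v f x)" for v
    using sm_flat by (intro sm.sm_flat sm.sm_mult sm.sm_add sm.sm_const) auto
  ultimately show ?case using D unfolding differentiable_def by metis
qed

lemma sm_imp_smooth: "sm f \<Longrightarrow> smooth f"
  by (rule smooth_coinduct[of sm]) (auto dest: sm_closed)

lemma smooth_iff_sm: "smooth f \<longleftrightarrow> sm f" by (blast intro: sm_smooth sm_imp_smooth)

section \<open>Derivation rules for smooth functions\<close>

named_theorems smooth_intros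
named_theorems pd_simps

lemmas smooth_basic [smooth_intros] =
  sm_const[folded smooth_iff_sm] sm_add[folded smooth_iff_sm] sm_mult[folded smooth_iff_sm]
  sm_powr[folded smooth_iff_sm] sm_exp[folded smooth_iff_sm] sm_flat[folded smooth_iff_sm]

lemmas smooth_linear = sm_linear[folded smooth_iff_sm]

lemma smooth_pd [smooth_intros]: "smooth f \<Longrightarrow> smooth (pd v f)" by (rule smoothD)

lemma smooth_minus [smooth_intros]: fixes f :: "'a::real_normed_vector \<Rightarrow> real"
  shows "smooth f \<Longrightarrow> smooth (\<lambda>z. - f z)"
  using smooth_basic(3)[of "\<lambda>_. -1" f] smooth_basic(1)[of "-1"] by simp

lemma smooth_diff [smooth_intros]: fixes f g :: "'a::real_normed_vector \<Rightarrow> real"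
  shows "smooth f \<Longrightarrow> smooth g \<Longrightarrow> smooth (\<lambda>z. f z - g z)"
  using smooth_basic(2)[of f "\<lambda>z. - g z"] smooth_minus[of g] by simp

lemma smooth_sum [smooth_intros]: fixes f :: "'i \<Rightarrow> 'a::real_normed_vector \<Rightarrow> real"
  assumes "\<And>i. i \<in> I \<Longrightarrow> smooth (f i)" shows "smooth (\<lambda>z. \<Sum>i\<in>I. f i z)"
  using assms by (induction I rule: infinite_finite_induct) (auto intro: smooth_intros)

lemma pd_const [pd_simps]: "pd v (\<lambda>z. c) = (\<lambda>z. 0)"
  by (rule ext, rule pd_eqI[of _ "\<lambda>_. 0"]) simp

lemma pd_linear: "bounded_linear f \<Longrightarrow> pd v f = (\<lambda>z. f v)"
  by (intro ext pd_eqI) (rule bounded_linear_imp_has_derivative)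

lemma pd_add [pd_simps]: "smooth f \<Longrightarrow> smooth g \<Longrightarrow> pd v (\<lambda>z. f z + g z) = (\<lambda>z. pd v f z + pd v g z)"
  by (intro ext pd_eqI has_derivative_add smooth_has_derivative)

lemma pd_diff [pd_simps]: "smooth f \<Longrightarrow> smooth g \<Longrightarrow> pd v (\<lambda>z. f z - g z) = (\<lambda>z. pd v f z - pd v g z)"
  by (intro ext pd_eqI has_derivative_diff smooth_has_derivative)

lemma pd_mult [pd_simps]: fixes f g :: "'a::real_normed_vector \<Rightarrow> real"
  shows "smooth f \<Longrightarrow> smooth g \<Longrightarrow> pd v (\<lambda>z. f z * g z) = (\<lambda>z. f z * pd v g z + pd v f z * g z)"
  by (intro ext pd_eqI has_derivative_mult smooth_has_derivative)

lemma pd_sum [pd_simps]: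
  "(\<And>i. i \<in> I \<Longrightarrow> smooth (f i)) \<Longrightarrow> pd v (\<lambda>z. \<Sum>i\<in>I. f i z) = (\<lambda>z. \<Sum>i\<in>I. pd v (f i) z)"
  by (intro ext pd_eqI has_derivative_sum smooth_has_derivative)

lemma pd_powr [pd_simps]:
  fixes f :: "'a::real_normed_vector \<Rightarrow> real"
  assumes "smooth f" "\<And>z. f z > 0"
  shows "pd v (\<lambda>z. f z powr p) = (\<lambda>z. p * f z powr (p - 1) * pd v f z)"
proof
  fix z
  show "pd v (\<lambda>z. f z powr p) z = p * f z powr (p - 1) * pd v f z"
    using pd_eqI[OF has_derivative_powr_const[OF smooth_has_derivative[OF assms(1), of z] assms(2)]] .
qed

lemma pd_exp [pd_simps]: fixes f :: "'a::real_normed_vector \<Rightarrow> real"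
  shows "smooth f \<Longrightarrow> pd v (\<lambda>z. exp (f z)) = (\<lambda>z. exp (f z) * pd v f z)"
  by (intro ext, subst pd_eqI[OF has_derivative_exp[OF smooth_has_derivative]]) auto

text \<open>Functions of the form f(L z + c) with smooth f are stable under differentiation, because
  the direction \<open>v\<close> merely turns into \<open>L v\<close>. Coinduction on this class
  covers vector values, which \<open>sm\<close> does not.\<close>

lemma smooth_affine:
  fixes L :: "'a::real_normed_vector \<Rightarrow> 'b::real_normed_vector" and f :: "'b \<Rightarrow> 'c::real_normed_vector"
  assumes "smooth f" "bounded_linear L"
  shows "smooth (\<lambda>z. f (L z + c))" "pd v (\<lambda>z. f (L z + c)) = (\<lambda>z. pd (L v) f (L z + c))"
proof -
  have D: "((\<lambda>z. f (L z + c)) has_derivative (\<lambda>v. pd (L v) f (L z + c))) (at z)"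
    if "smooth f" for f :: "'b \<Rightarrow> 'c" and z
  proof -
    have "((\<lambda>z. L z + c) has_derivative L) (at z)"
      using bounded_linear_imp_has_derivative[OF assms(2)] by (rule has_derivative_add_const)
    from has_derivative_compose[OF this smooth_has_derivative[OF that]] show ?thesis .
  qed
  show "pd v (\<lambda>z. f (L z + c)) = (\<lambda>z. pd (L v) f (L z + c))"
    by (intro ext pd_eqI D assms)
  have E: "pd v (\<lambda>z. f (L z + c)) = (\<lambda>z. pd (L v) f (L z + c))" if "smooth f" for f :: "'b \<Rightarrow> 'c" and v
    by (intro ext pd_eqI D that)
  show "smooth (\<lambda>z. f (L z + c))"
    by (rule smooth_coinduct[where P="\<lambda>g. \<exists>f. smooth f \<and> g = (\<lambda>z. f (L z + c))"])
       (use assms D E smoothD(2) in \<open>auto simp: differentiable_def; blast\<close>)+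
qed

text \<open>Schwarz's theorem. The mixed second difference is symmetric in \<open>v\<close> and
  \<open>w\<close>; two applications of the mean value theorem express it through either order of
  differentiation at a point close to \<open>z\<close>.\<close>

lemma pd_commute:
  fixes f :: "'a::real_normed_vector \<Rightarrow> real"
  assumes f: "smooth f"
  shows "pd v (pd w f) = pd w (pd v f)"
proof
  fix z
  define Q where "Q h = f (z + h *\<^sub>R v + h *\<^sub>R w) - f (z + h *\<^sub>R v) - f (z + h *\<^sub>R w) + f z" for h
  have line: "((\<lambda>s. g (a + s *\<^sub>R b)) has_real_derivative pd b g (a + s *\<^sub>R b)) (at s)"
    if "smooth g" for g :: "'a \<Rightarrow> real" and a b s
  proof -
    have "((\<lambda>s. a + s *\<^sub>R b) has_derivative (\<lambda>h. h *\<^sub>R b)) (at s)"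
      by (auto intro!: derivative_eq_intros)
    from has_derivative_compose[OF this smooth_has_derivative[OF that]]
    have 1: "((\<lambda>s. g (a + s *\<^sub>R b)) has_derivative (\<lambda>h. pd (h *\<^sub>R b) g (a + s *\<^sub>R b))) (at s)" .
    interpret bounded_linear "\<lambda>v. pd v g (a + s *\<^sub>R b)"
      using smooth_has_derivative[OF that] by (rule has_derivative_bounded_linear)
    show ?thesis using 1 by (simp add: has_field_derivative_def scaleR mult.commute[of _ "pd b g (a + s *\<^sub>R b)"] real_scaleR_def)
  qed
  have key: "\<exists>a b. 0 < a \<and> a < h \<and> 0 < b \<and> b < h \<and> 
      f (z + h *\<^sub>R v + h *\<^sub>R w) - f (z + h *\<^sub>R v) - f (z + h *\<^sub>R w) + f z = h * h * pd w (pd v f) (z + a *\<^sub>R v + b *\<^sub>R w)"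
    if h0: "h > 0" for h v w
  proof -
    have d: "((\<lambda>s. f ((z + h *\<^sub>R w) + s *\<^sub>R v) - f (z + s *\<^sub>R v)) has_real_derivative 
        (pd v f ((z + h *\<^sub>R w) + s *\<^sub>R v) - pd v f (z + s *\<^sub>R v))) (at s)" for s
      by (intro derivative_intros line f)
    obtain a where a: "0 < a" "a < h" and 1: "(f ((z + h *\<^sub>R w) + h *\<^sub>R v) - f (z + h *\<^sub>R v)) - (f ((z + h *\<^sub>R w) + 0 *\<^sub>R v) - f (z + 0 *\<^sub>R v))
       = (h - 0) * (pd v f ((z + h *\<^sub>R w) + a *\<^sub>R v) - pd v f (z + a *\<^sub>R v))"
      using MVT2[OF h0, of "\<lambda>s. f ((z + h *\<^sub>R w) + s *\<^sub>R v) - f (z + s *\<^sub>R v)"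
          "\<lambda>s. pd v f ((z + h *\<^sub>R w) + s *\<^sub>R v) - pd v f (z + s *\<^sub>R v)"] d by blast
    have d2: "((\<lambda>s. pd v f ((z + a *\<^sub>R v) + s *\<^sub>R w)) has_real_derivative 
        pd w (pd v f) ((z + a *\<^sub>R v) + s *\<^sub>R w)) (at s)" for s
      by (intro line smooth_pd f)
    obtain b where b: "0 < b" "b < h" and 2: "pd v f ((z + a *\<^sub>R v) + h *\<^sub>R w) - pd v f ((z + a *\<^sub>R v) + 0 *\<^sub>R w)
       = (h - 0) * pd w (pd v f) ((z + a *\<^sub>R v) + b *\<^sub>R w)"
      using MVT2[OF h0, of "\<lambda>s. pd v f ((z + a *\<^sub>R v) + s *\<^sub>R w)"
          "\<lambda>s. pd w (pd v f) ((z + a *\<^sub>R v) + s *\<^sub>R w)"] d2 by blast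
    show ?thesis using a b 1 2 by (intro exI[of _ a] exI[of _ b]) (simp add: algebra_simps)
  qed
  \<comment> \<open>With step 1/(n+1) the rescaled second difference is the same sequence for both
    orders, and continuity of the second derivatives identifies its limit in two ways.\<close>
  have lim: "\<exists>X. (\<forall>n. X n = Q (1 / Suc n) * (Suc n)^2) \<and> X \<longlonglongrightarrow> pd w (pd v f) z" if
      Q: "\<And>h. Q h = f (z + h *\<^sub>R v + h *\<^sub>R w) - f (z + h *\<^sub>R v) - f (z + h *\<^sub>R w) + f z" for v w
  proof -
    have "\<forall>n. \<exists>a b. 0 < a \<and> a < 1 / Suc n \<and> 0 < b \<and> b < 1 / Suc n \<and> 
      Q (1 / Suc n) = (1 / Suc n) * (1 / Suc n) * pd w (pd v f) (z + a *\<^sub>R v + b *\<^sub>R w)"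
      unfolding Q by (intro allI key) simp
    then obtain a b where ab: "\<And>n. 0 < a n" "\<And>n. a n < 1 / Suc n" "\<And>n. 0 < b n" "\<And>n. b n < 1 / Suc n"
      "\<And>n. Q (1 / Suc n) = (1 / Suc n) * (1 / Suc n) * pd w (pd v f) (z + a n *\<^sub>R v + b n *\<^sub>R w)"
      by metis
    have l: "(\<lambda>n. 1 / real (Suc n)) \<longlonglongrightarrow> 0" using LIMSEQ_inverse_real_of_nat by (simp add: divide_inverse)
    have "a \<longlonglongrightarrow> 0" by (rule tendsto_sandwich[OF _ _ tendsto_const l]) (use ab in \<open>auto intro!: always_eventually less_imp_le\<close>)
    moreover have "b \<longlonglongrightarrow> 0" by (rule tendsto_sandwich[OF _ _ tendsto_const l]) (use ab in \<open>auto intro!: always_eventually less_imp_le\<close>)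
    ultimately have "(\<lambda>n. z + a n *\<^sub>R v + b n *\<^sub>R w) \<longlonglongrightarrow> z + 0 *\<^sub>R v + 0 *\<^sub>R w"
      by (intro tendsto_intros)
    then have "(\<lambda>n. pd w (pd v f) (z + a n *\<^sub>R v + b n *\<^sub>R w)) \<longlonglongrightarrow> pd w (pd v f) z"
      using continuous_on_tendsto_compose[OF smooth_continuous[OF smooth_pd[OF smooth_pd[OF f]], of UNIV], of _ z sequentially w v] by simp
    moreover have "1 / m * (1 / m) * d * m^2 = d" if "m > 0" for m d :: real
      using that by (simp add: power2_eq_square)
    then have "Q (1 / Suc n) * (Suc n)^2 = pd w (pd v f) (z + a n *\<^sub>R v + b n *\<^sub>R w)" for n
      unfolding ab(5)[of n] by simp
    ultimately show ?thesis
      by (intro exI[of _ "\<lambda>n. pd w (pd v f) (z + a n *\<^sub>R v + b n *\<^sub>R w)"] conjI allI) simp_all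
  qed
  obtain X Y where X: "\<And>n. X n = Q (1 / Suc n) * (Suc n)^2" "X \<longlonglongrightarrow> pd w (pd v f) z"
    and Y: "\<And>n. Y n = Q (1 / Suc n) * (Suc n)^2" "Y \<longlonglongrightarrow> pd v (pd w f) z"
    using lim[of v w] lim[of w v] unfolding Q_def by (auto simp: algebra_simps)
  have "X = Y" using X Y by auto
  then show "pd v (pd w f) z = pd w (pd v f) z" using X(2) Y(2) LIMSEQ_unique by blast
qed

section \<open>Integration on Euclidean spaces\<close>

lemma lborel_fst:
  fixes f :: "'a::euclidean_space \<times> 'b::euclidean_space \<Rightarrow> real"
  assumes "integrable lborel f"
  shows "(LINT x|lborel. LINT y|lborel. f (x, y)) = (LINT z|lborel. f z)"
  using lborel_pair.integral_fst'[of f] assms unfolding lborel_prod by blast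

lemma lborel_snd:
  fixes f :: "'a::euclidean_space \<times> 'b::euclidean_space \<Rightarrow> real"
  assumes "integrable lborel f"
  shows "(LINT y|lborel. LINT x|lborel. f (x, y)) = (LINT z|lborel. f z)"
  using lborel_pair.integral_snd[of "\<lambda>x y. f (x, y)"] assms unfolding lborel_prod by simp

lemma lborel_nn_fst:
  fixes f :: "'a::euclidean_space \<times> 'b::euclidean_space \<Rightarrow> ennreal"
  assumes "f \<in> borel_measurable borel"
  shows "(\<integral>\<^sup>+x. \<integral>\<^sup>+y. f (x, y) \<partial>lborel \<partial>lborel) = (\<integral>\<^sup>+z. f z \<partial>lborel)"
  using lborel.nn_integral_fst[of f lborel] assms unfolding lborel_prod by simp

lemma lborel_nn_snd:
  fixes f :: "'a::euclidean_space \<times> 'b::euclidean_space \<Rightarrow> ennreal"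
  assumes "f \<in> borel_measurable borel"
  shows "(\<integral>\<^sup>+y. \<integral>\<^sup>+x. f (x, y) \<partial>lborel \<partial>lborel) = (\<integral>\<^sup>+z. f z \<partial>lborel)"
  using lborel_pair.nn_integral_snd[of f] assms unfolding lborel_prod by simp

text \<open>The exceptional set lies in a Borel null set, and Tonelli makes almost every section of
  that set null. This is how almost-everywhere statements on space-time descend to time
  slices.\<close>

lemma lborel_AE_snd:
  fixes P :: "'a::euclidean_space \<times> 'b::euclidean_space \<Rightarrow> bool"
  assumes "AE z in lborel. P z"
  shows "AE y in lborel. AE x in lborel. P (x, y)"
proof -
  obtain N where N: "{z. \<not> P z} \<subseteq> N" "N \<in> sets borel" "emeasure lborel N = 0"
    using assms by (auto elim!: AE_E)
  note [measurable] = N(2)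
  have m: "indicator N \<in> borel_measurable (lborel \<Otimes>\<^sub>M lborel)" using N(2) by (simp add: lborel_prod)
  have "(\<integral>\<^sup>+y. \<integral>\<^sup>+x. indicator N (x, y) \<partial>lborel \<partial>lborel) = 0"
    using N by (subst lborel_nn_snd) auto
  then have "AE y in lborel. (\<integral>\<^sup>+x. indicator N (x, y) \<partial>lborel) = 0"
    using m by (subst (asm) nn_integral_0_iff_AE) (auto intro!: lborel.borel_measurable_nn_integral simp: borel_prod case_prod_unfold)
  then show ?thesis
  proof eventually_elim
    case (elim y)
    have "AE x in lborel. indicator N (x, y) = (0 :: ennreal)"
      using elim N(2) by (subst (asm) nn_integral_0_iff_AE) (auto simp: borel_prod)
    then show ?case by eventually_elim (use N(1) in \<open>auto simp: indicator_def split: if_splits\<close>)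
  qed
qed

lemma integrable_snd:
  fixes f :: "'a::euclidean_space \<times> 'b::euclidean_space \<Rightarrow> real"
  assumes "integrable lborel f"
  shows "AE y in lborel. integrable lborel (\<lambda>x. f (x, y))" "integrable lborel (\<lambda>y. LINT x|lborel. f (x, y))"
  using lborel_pair.AE_integrable_snd[of "\<lambda>x y. f (x, y)"] lborel_pair.integrable_snd[of "\<lambda>x y. f (x, y)"] assms
  unfolding lborel_prod by auto

lemma integrable_tensor:
  fixes a :: "'a::euclidean_space \<Rightarrow> real" and b :: "'b::euclidean_space \<Rightarrow> real"
  assumes a: "integrable lborel a" and b: "integrable lborel b"
  shows "integrable lborel (\<lambda>z. a (fst z) * b (snd z))"
proof (rule integrableI_bounded)
  have [measurable]: "a \<in> borel_measurable borel" "b \<in> borel_measurable borel"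
    using a b by auto
  show "(\<lambda>z. a (fst z) * b (snd z)) \<in> borel_measurable lborel"
    by (simp add: borel_prod[symmetric])
  have "(\<integral>\<^sup>+z. norm (a (fst z) * b (snd z)) \<partial>lborel) = (\<integral>\<^sup>+x. \<integral>\<^sup>+y. ennreal \<bar>a x\<bar> * ennreal \<bar>b y\<bar> \<partial>lborel \<partial>lborel)"
    by (subst lborel_nn_fst[symmetric]) (auto simp: borel_prod[symmetric] abs_mult ennreal_mult)
  also have "\<dots> = (\<integral>\<^sup>+x. ennreal \<bar>a x\<bar> \<partial>lborel) * (\<integral>\<^sup>+y. ennreal \<bar>b y\<bar> \<partial>lborel)"
    by (simp add: nn_integral_cmult nn_integral_multc)
  also have "\<dots> < \<infinity>"
    using a b by (auto simp: integrable_iff_bounded ennreal_mult_less_top)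
  finally show "(\<integral>\<^sup>+z. norm (a (fst z) * b (snd z)) \<partial>lborel) < \<infinity>" .
qed

section \<open>Translation and reflection of Lebesgue integrals; continuity of translations\<close>

lemma
  fixes f :: "'a::euclidean_space \<Rightarrow> real" and h :: 'a
  assumes [measurable]: "f \<in> borel_measurable borel"
  shows integral_shift: "(LINT x|lborel. f (h + x)) = (LINT x|lborel. f x)"
    and integrable_shift: "integrable lborel (\<lambda>x. f (h + x)) \<longleftrightarrow> integrable lborel f"
    and integral_reflect: "(LINT x|lborel. f (h - x)) = (LINT x|lborel. f x)"
    and integrable_reflect: "integrable lborel (\<lambda>x. f (h - x)) \<longleftrightarrow> integrable lborel f"
proof -
  have 1: "(lborel :: 'a measure) = distr lborel borel ((+) h)" by (simp add: lborel_distr_plus)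
  have 2: "(lborel :: 'a measure) = distr lborel borel (\<lambda>x. h - x)"
    by (subst lborel_affine[of "-1" h]) (auto simp: density_1)
  show "(LINT x|lborel. f (h + x)) = (LINT x|lborel. f x)"
    by (subst (2) 1, subst integral_distr) auto
  show "integrable lborel (\<lambda>x. f (h + x)) \<longleftrightarrow> integrable lborel f"
    by (subst (2) 1, subst integrable_distr_eq) auto
  show "(LINT x|lborel. f (h - x)) = (LINT x|lborel. f x)"
    by (subst (2) 2, subst integral_distr) auto
  show "integrable lborel (\<lambda>x. f (h - x)) \<longleftrightarrow> integrable lborel f"
    by (subst (2) 2, subst integrable_distr_eq) auto
qed

lemma nn_integral_shift:
  fixes f :: "'a::euclidean_space \<Rightarrow> ennreal"
  assumes [measurable]: "f \<in> borel_measurable borel"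
  shows "(\<integral>\<^sup>+x. f (h + x) \<partial>lborel) = (\<integral>\<^sup>+x. f x \<partial>lborel)"
proof -
  have 1: "(lborel :: 'a measure) = distr lborel borel ((+) h)" by (simp add: lborel_distr_plus)
  show ?thesis by (subst (2) 1, subst nn_integral_distr) auto
qed

text \<open>Continuity of translations in \<open>L\<^sup>1\<close>, first for indicators by regularity of the measure.\<close>

lemma translation_continuous_indicator:
  fixes A :: "'a::euclidean_space set"
  assumes A[measurable]: "A \<in> sets borel" and fin: "emeasure lborel A < \<infinity>" and e: "e > 0"
  shows "\<exists>d>0. \<forall>h. norm h < d \<longrightarrow> (LINT x|lborel. \<bar>indicator A (h + x) - indicator A x\<bar> :: real) \<le> e"
proof -
  have AL: "A \<in> sets lebesgue" using A by auto
  from sets_lebesgue_outer_open[OF AL, of "e/8"] e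
  obtain V where V: "open V" "A \<subseteq> V" "V - A \<in> lmeasurable" "emeasure lebesgue (V - A) < ennreal (e/8)" by auto
  have fa: "A \<in> lmeasurable" using AL fin by (simp add: fmeasurable_def)
  have fV: "V \<in> lmeasurable" using fmeasurable.Un[OF V(3) fa] V(2) by (metis Un_Diff_cancel2 sup.absorb1)
  from sets_lebesgue_inner_closed[OF AL, of "e/8"] e
  obtain F where F: "closed F" "F \<subseteq> A" "A - F \<in> lmeasurable" "emeasure lebesgue (A - F) < ennreal (e/8)" by auto
  
  have mF[measurable]: "F \<in> sets borel" and mV[measurable]: "V \<in> sets borel" using F V by auto
  have "(\<lambda>n. measure lborel (F \<inter> cball 0 (real n))) \<longlonglongrightarrow> measure lborel (\<Union>n. F \<inter> cball 0 (real n))"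
  proof (rule Lim_measure_incseq)
    show "incseq (\<lambda>n. F \<inter> cball 0 (real n))" by (auto simp: incseq_def)
    have "(\<Union>n. F \<inter> cball 0 (real n)) \<subseteq> A" using F by auto
    then have "emeasure lborel (\<Union>n. F \<inter> cball 0 (real n)) \<le> emeasure lborel A"
      by (intro emeasure_mono) auto
    then show "emeasure lborel (\<Union>n. F \<inter> cball 0 (real n)) \<noteq> \<infinity>" using fin by (auto simp: top_unique)
  qed auto
  moreover have "(\<Union>n. F \<inter> cball 0 (real n)) = F" using real_arch_simple by (auto; fastforce)
  ultimately have "(\<lambda>n. measure lborel (F \<inter> cball 0 (real n))) \<longlonglongrightarrow> measure lborel F" by simp
  then obtain n where n: "\<bar>measure lborel (F \<inter> cball 0 (real n)) - measure lborel F\<bar> < e/8"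
    using e by (metis LIMSEQ_iff divide_pos_pos order_refl real_norm_def zero_less_numeral)
  \<comment> \<open>Inner regularity only gives a closed set. A large ball makes it compact, so that
    it has positive distance from the complement of \<open>V\<close>.\<close>
  define K where "K = F \<inter> cball 0 (real n)"
  have K: "compact K" "K \<subseteq> A" and mK[measurable]: "K \<in> sets borel"
    using F by (auto simp: K_def intro!: closed_Int_compact)
  have disj: "K \<inter> (- V) = {}" using K V by auto
  obtain d where d: "d > 0" "\<And>x y. x \<in> K \<Longrightarrow> y \<in> - V \<Longrightarrow> d \<le> dist x y"
  proof (cases "K = {} \<or> - V = {}")
    case True then show ?thesis using that[of 1] by auto
  next
    case False
    have "closed (- V)" using V(1) by auto
    from separate_compact_closed[OF K(1) this disj] that show ?thesis by blast
  qed
  have iA: "integrable lborel (indicator A :: 'a \<Rightarrow> real)" using fin by simp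
  have iK: "integrable lborel (indicator K :: 'a \<Rightarrow> real)" using emeasure_mono[OF K(2), of lborel] fin A mK by auto
  have eV: "emeasure lborel V < \<infinity>" using fV unfolding fmeasurable_def by auto
  have iV: "integrable lborel (indicator V :: 'a \<Rightarrow> real)" using eV by simp
  have mVA: "measure lborel V - measure lborel A \<le> e/8"
  proof -
    have "measure lborel (V - A) = measure lborel V - measure lborel A"
      using V eV by (intro measure_Diff) auto
    moreover have "emeasure lborel (V - A) \<le> ennreal (e/8)" using V(4) by (simp add: less_imp_le)
    then have "measure lborel (V - A) \<le> e/8" unfolding measure_def by (intro enn2real_leI) (use e in auto)
    ultimately show ?thesis by simp
  qed
  have mAK: "measure lborel A - measure lborel K \<le> e/4"
  proof -
    have "measure lborel (A - F) = measure lborel A - measure lborel F"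
      using F fin by (intro measure_Diff) auto
    moreover have "emeasure lborel (A - F) \<le> ennreal (e/8)" using F(4) by (simp add: less_imp_le)
    then have "measure lborel (A - F) \<le> e/8" unfolding measure_def by (intro enn2real_leI) (use e in auto)
    ultimately show ?thesis using n unfolding K_def by linarith
  qed
  show ?thesis
  proof (intro exI[of _ d] conjI d(1) allI impI)
    fix h :: 'a assume h: "norm h < d"
    have inV: "x \<in> V" if "h + x \<in> K" for x
    proof (rule ccontr)
      assume "x \<notin> V"
      then have "d \<le> dist (h + x) x" using d(2) that by auto
      then show False using h by (simp add: dist_norm)
    qed
    note sh = integrable_shift[THEN iffD2]
    have i1: "integrable lborel (\<lambda>x. indicator A (h + x) :: real)" "integrable lborel (\<lambda>x. indicator K (h + x) :: real)"
      using iA iK by (auto intro!: sh)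
    \<comment> \<open>For \<open>norm h < d\<close> the translate of \<open>K\<close> lies in
      \<open>V\<close>, so the three differences are nonnegative. Their integrals are at most e/4,
      3e/8 and e/8.\<close>
    have bd: "\<bar>indicator A (h + x) - indicator A x\<bar> \<le> (indicator A (h + x) - indicator K (h + x)) + (indicator V x - indicator K (h+x)) + ((indicator V x :: real) - indicator A x)" for x
      using K V inV[of x] by (auto simp: indicator_def)
    have "(LINT x|lborel. \<bar>indicator A (h + x) - indicator A x\<bar> :: real)
       \<le> (LINT x|lborel. (indicator A (h + x) - indicator K (h + x)) + (indicator V x - indicator K (h+x)) + ((indicator V x :: real) - indicator A x))"
      using i1 iA iV by (intro integral_mono bd Bochner_Integration.integrable_add Bochner_Integration.integrable_diff integrable_abs)
    also have "\<dots> = (measure lborel A - measure lborel K) + (measure lborel V - measure lborel K) + (measure lborel V - measure lborel A)"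
      using i1 iA iV by (simp add: integral_shift)
    also have "\<dots> \<le> e" using mAK mVA e by linarith
    finally show "(LINT x|lborel. \<bar>indicator A (h + x) - indicator A x\<bar> :: real) \<le> e" .
  qed
qed

text \<open>Density argument: indicators and finite sums first; a limit function is then compared
  with an approximant at the cost of three errors e/3, one of them moved back by translation
  invariance.\<close>

lemma translation_continuous:
  fixes f :: "'a::euclidean_space \<Rightarrow> real"
  assumes f: "integrable lborel f"
  shows "\<forall>e>0. \<exists>d>0. \<forall>h. norm h < d \<longrightarrow> (LINT x|lborel. \<bar>f (h + x) - f x\<bar>) \<le> e"
  using f
proof (induction rule: integrable_induct)
  case (base A c)
  show ?case
  proof (intro allI impI)
    fix e :: real assume e: "e > 0"
    have "e / (\<bar>c\<bar> + 1) > 0" using e by simp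
    then obtain d where d: "d > 0" "\<And>h. norm h < d \<Longrightarrow> (LINT x|lborel. \<bar>indicator A (h + x) - indicator A x\<bar> :: real) \<le> e / (\<bar>c\<bar> + 1)"
      using translation_continuous_indicator[of A "e / (\<bar>c\<bar> + 1)"] base by auto
    show "\<exists>d>0. \<forall>h. norm h < d \<longrightarrow> (LINT x|lborel. \<bar>indicator A (h + x) *\<^sub>R c - indicator A x *\<^sub>R c\<bar>) \<le> e"
    proof (intro exI conjI allI impI)
      fix h :: 'a assume h: "norm h < d"
      have "(LINT x|lborel. \<bar>indicator A (h + x) *\<^sub>R c - indicator A x *\<^sub>R c\<bar>) = (LINT x|lborel. \<bar>indicator A (h + x) - indicator A x\<bar> * \<bar>c\<bar>)"
        by (auto simp: abs_mult[symmetric] algebra_simps intro!: Bochner_Integration.integral_cong)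
      also have "\<dots> = (LINT x|lborel. \<bar>indicator A (h + x) - indicator A x\<bar>) * \<bar>c\<bar>"
        by simp
      also have "\<dots> \<le> e / (\<bar>c\<bar> + 1) * \<bar>c\<bar>"
        using d(2)[OF h] by (intro mult_right_mono) auto
      also have "\<dots> \<le> e" using e by (simp add: field_simps)
      finally show "(LINT x|lborel. \<bar>indicator A (h + x) *\<^sub>R c - indicator A x *\<^sub>R c\<bar>) \<le> e" .
    qed (rule d)
  qed
next
  case (add f g)
  show ?case
  proof (intro allI impI)
    fix e :: real assume e: "e > 0"
    then have e2: "e/2 > 0" by simp
    obtain d1 where d1: "d1 > 0" "\<And>h. norm h < d1 \<Longrightarrow> (LINT x|lborel. \<bar>f (h + x) - f x\<bar>) \<le> e/2"
      using add.IH(1) e2 by blast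
    obtain d2 where d2: "d2 > 0" "\<And>h. norm h < d2 \<Longrightarrow> (LINT x|lborel. \<bar>g (h + x) - g x\<bar>) \<le> e/2"
      using add.IH(2) e2 by blast
    show "\<exists>d>0. \<forall>h. norm h < d \<longrightarrow> (LINT x|lborel. \<bar>f (h + x) + g (h + x) - (f x + g x)\<bar>) \<le> e"
    proof (intro exI[of _ "min d1 d2"] conjI allI impI)
      fix h :: 'a assume h: "norm h < min d1 d2"
      have i: "integrable lborel (\<lambda>x. f (h + x))" "integrable lborel (\<lambda>x. g (h + x))"
        using add.hyps by (auto intro!: integrable_shift[THEN iffD2])
      have "(LINT x|lborel. \<bar>f (h + x) + g (h + x) - (f x + g x)\<bar>) \<le> (LINT x|lborel. \<bar>f (h + x) - f x\<bar> + \<bar>g (h + x) - g x\<bar>)"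
        using i add.hyps by (intro integral_mono) (auto intro!: integrable_abs)
      also have "\<dots> = (LINT x|lborel. \<bar>f (h + x) - f x\<bar>) + (LINT x|lborel. \<bar>g (h + x) - g x\<bar>)"
        using i add.hyps by (intro Bochner_Integration.integral_add integrable_abs) auto
      also have "\<dots> \<le> e" using d1(2)[of h] d2(2)[of h] h by auto
      finally show "(LINT x|lborel. \<bar>f (h + x) + g (h + x) - (f x + g x)\<bar>) \<le> e" .
    qed (use d1 d2 in auto)
  qed
next
  case (lim f s)
  have lim1: "\<And>i. integrable lborel (s i)" and lim3: "\<And>x. (\<lambda>i. s i x) \<longlonglongrightarrow> f x"
    and lim4: "\<And>i x. \<bar>s i x\<bar> \<le> 2 * \<bar>f x\<bar>" and lim5: "integrable lborel f"
    using lim by auto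
  have L: "(\<lambda>i. LINT x|lborel. \<bar>s i x - f x\<bar>) \<longlonglongrightarrow> (LINT (x::'a)|lborel. 0 :: real)"
  proof (rule integral_dominated_convergence[where s="\<lambda>i x. \<bar>s i x - f x\<bar>" and f="\<lambda>x. 0" and w="\<lambda>x. 3 * \<bar>f x\<bar>"])
    show "AE x in lborel. (\<lambda>i. \<bar>s i x - f x\<bar>) \<longlonglongrightarrow> 0"
      using tendsto_rabs_zero[OF LIM_zero[OF lim3]] by (intro AE_I2) simp
    show "AE x in lborel. norm \<bar>s i x - f x\<bar> \<le> 3 * \<bar>f x\<bar>" for i
    proof (rule AE_I2)
      fix x :: 'a
      show "norm \<bar>s i x - f x\<bar> \<le> 3 * \<bar>f x\<bar>" using lim4[of i x] by (simp add: abs_if split: if_splits)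
    qed
  qed (use lim1 lim5 in \<open>auto simp: borel_measurable_integrable\<close>)
  show ?case
  proof (intro allI impI)
    fix e :: real assume e: "e > 0"
    from L have "\<forall>\<^sub>F i in sequentially. (LINT x|lborel. \<bar>s i x - f x\<bar>) < e/3"
      using e by (intro order_tendstoD) auto
    then obtain i where si: "(LINT x|lborel. \<bar>s i x - f x\<bar>) < e/3" by (auto simp: eventually_sequentially)
    have "e/3 > 0" using e by simp
    then obtain d where d: "d > 0" "\<And>h. norm h < d \<Longrightarrow> (LINT x|lborel. \<bar>s i (h + x) - s i x\<bar>) \<le> e/3"
      using lim.IH[of i] by blast
    show "\<exists>d>0. \<forall>h. norm h < d \<longrightarrow> (LINT x|lborel. \<bar>f (h + x) - f x\<bar>) \<le> e"
    proof (intro exI[of _ d] conjI allI impI)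
      fix h :: 'a assume h: "norm h < d"
      have i: "integrable lborel (\<lambda>x. f (h + x))" "integrable lborel (\<lambda>x. s i (h + x))"
        using lim1 lim5 by (auto intro!: integrable_shift[THEN iffD2])
      have id: "integrable lborel (\<lambda>x. \<bar>s i x - f x\<bar>)" using lim1 lim5 by auto
      have id2: "integrable lborel (\<lambda>x. \<bar>s i (h + x) - f (h + x)\<bar>)" using i by auto
      have id3: "integrable lborel (\<lambda>x. \<bar>s i (h + x) - s i x\<bar>)" using i lim1 by auto
      have "(LINT x|lborel. \<bar>f (h + x) - f x\<bar>) \<le> (LINT x|lborel. \<bar>s i (h + x) - f (h + x)\<bar> + \<bar>s i (h + x) - s i x\<bar> + \<bar>s i x - f x\<bar>)"
        using i lim1 lim5 by (intro integral_mono) (auto intro!: integrable_abs)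
      also have "\<dots> = (LINT x|lborel. \<bar>s i (h + x) - f (h + x)\<bar>) + (LINT x|lborel. \<bar>s i (h + x) - s i x\<bar>) + (LINT x|lborel. \<bar>s i x - f x\<bar>)"
        using id id2 id3 by (simp only: Bochner_Integration.integral_add Bochner_Integration.integrable_add)
      also have "(LINT x|lborel. \<bar>s i (h + x) - f (h + x)\<bar>) = (LINT x|lborel. \<bar>s i x - f x\<bar>)"
        using lim1 lim5 by (subst integral_shift[of "\<lambda>x. \<bar>s i x - f x\<bar>" h, symmetric]) auto
      finally show "(LINT x|lborel. \<bar>f (h + x) - f x\<bar>) \<le> e" using d(2)[OF h] si by linarith
    qed (rule d)
  qed
qed

section \<open>Convolutions and approximate identities\<close>

lemma integrable_convolution:
  fixes b r :: "'a::euclidean_space \<Rightarrow> real"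
  assumes b: "integrable lborel b" and r: "integrable lborel r"
  shows "integrable lborel (\<lambda>z. b (fst z - snd z) * r (snd z))"
proof (rule integrableI_bounded)
  have [measurable]: "b \<in> borel_measurable borel" "r \<in> borel_measurable borel"
    using assms by auto
  show [measurable]: "(\<lambda>z. b (fst z - snd z) * r (snd z)) \<in> borel_measurable lborel"
    by (simp add: borel_prod[symmetric])
  have "(\<integral>\<^sup>+z. norm (b (fst z - snd z) * r (snd z)) \<partial>lborel) = (\<integral>\<^sup>+w. \<integral>\<^sup>+x. ennreal \<bar>b (x - w)\<bar> * ennreal \<bar>r w\<bar> \<partial>lborel \<partial>lborel)"
    by (subst lborel_nn_snd[symmetric]) (auto simp: borel_prod[symmetric] abs_mult ennreal_mult)
  also have "\<dots> = (\<integral>\<^sup>+w. (\<integral>\<^sup>+x. ennreal \<bar>b x\<bar> \<partial>lborel) * ennreal \<bar>r w\<bar> \<partial>lborel)"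
  proof (rule nn_integral_cong)
    fix w :: 'a
    show "(\<integral>\<^sup>+x. ennreal \<bar>b (x - w)\<bar> * ennreal \<bar>r w\<bar> \<partial>lborel) = (\<integral>\<^sup>+x. ennreal \<bar>b x\<bar> \<partial>lborel) * ennreal \<bar>r w\<bar>"
      using nn_integral_shift[of "\<lambda>x. ennreal \<bar>b x\<bar>" "- w"] by (simp add: nn_integral_multc)
  qed
  also have "\<dots> < \<infinity>"
    using assms by (auto simp: nn_integral_cmult integrable_iff_bounded ennreal_mult_less_top)
  finally show "(\<integral>\<^sup>+z. norm (b (fst z - snd z) * r (snd z)) \<partial>lborel) < \<infinity>" .
qed

lemma approximate_identity:
  fixes \<rho> :: "nat \<Rightarrow> 'a::euclidean_space \<Rightarrow> real"
  assumes int: "\<And>n. integrable lborel (\<rho> n)"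
    and M: "\<And>n. (LINT w|lborel. \<bar>\<rho> n w\<bar>) \<le> M"
    and c: "(\<lambda>n. LINT w|lborel. \<rho> n w) \<longlonglongrightarrow> c"
    and tail: "\<And>d. d > 0 \<Longrightarrow> (\<lambda>n. LINT w|lborel. \<bar>\<rho> n w\<bar> * indicator {w. d \<le> norm w} w) \<longlonglongrightarrow> 0"
    and b: "integrable lborel b" and a[measurable]: "a \<in> borel_measurable borel" and A: "\<And>x. \<bar>a x\<bar> \<le> A"
  shows "(\<lambda>n. LINT x|lborel. a x * (LINT y|lborel. b y * \<rho> n (x - y))) \<longlonglongrightarrow> c * (LINT x|lborel. a x * b x)"
proof -
  have [measurable]: "b \<in> borel_measurable borel" and [measurable]: "\<And>n. \<rho> n \<in> borel_measurable borel"
    using b int by auto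
  have A0: "A \<ge> 0" using A[of 0] by linarith
  define H where "H w = (LINT x|lborel. a x * b (x - w))" for w
  have ib: "integrable lborel (\<lambda>x. b (x - w))" for w using integrable_shift[of b "- w"] b by simp
  have iab: "integrable lborel (\<lambda>x. a x * b (x - w))" for w
    by (rule Bochner_Integration.integrable_bound[OF integrable_mult_right[OF integrable_abs[OF ib[of w]], of A]])
       (auto simp: abs_mult intro!: AE_I2 mult_right_mono order_trans[OF A abs_ge_self])
  have H0: "H 0 = (LINT x|lborel. a x * b x)" by (simp add: H_def)
  have Hd: "\<bar>H w - H 0\<bar> \<le> A * (LINT x|lborel. \<bar>b (- w + x) - b x\<bar>)" for w
  proof -
    have "H w - H 0 = (LINT x|lborel. a x * (b (x - w) - b x))"
      unfolding H_def using iab[of w] iab[of 0] by (simp add: algebra_simps)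
    also have "\<bar>\<dots>\<bar> \<le> (LINT x|lborel. \<bar>a x * (b (x - w) - b x)\<bar>)" by (rule integral_abs_bound)
    also have "\<dots> \<le> (LINT x|lborel. A * \<bar>b (- w + x) - b x\<bar>)"
    proof (intro integral_mono)
      show "integrable lborel (\<lambda>x. \<bar>a x * (b (x - w) - b x)\<bar>)"
        using iab[of w] iab[of 0] by (simp add: algebra_simps)
      show "integrable lborel (\<lambda>x. A * \<bar>b (- w + x) - b x\<bar>)" using ib[of w] b by simp
      show "\<bar>a x * (b (x - w) - b x)\<bar> \<le> A * \<bar>b (- w + x) - b x\<bar>" for x
        using mult_right_mono[OF A, of "\<bar>b (- w + x) - b x\<bar>" x] by (simp add: abs_mult)
    qed
    finally show ?thesis by simp
  qed
  define B where "B = A * (2 * (LINT x|lborel. \<bar>b x\<bar>))"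
  have HB: "\<bar>H w - H 0\<bar> \<le> B" for w
  proof -
    have "(LINT x|lborel. \<bar>b (- w + x) - b x\<bar>) \<le> (LINT x|lborel. \<bar>b (- w + x)\<bar> + \<bar>b x\<bar>)"
      using ib[of w] b by (intro integral_mono) auto
    also have "\<dots> = (LINT x|lborel. \<bar>b (- w + x)\<bar>) + (LINT x|lborel. \<bar>b x\<bar>)"
      using ib[of w] b by simp
    also have "(LINT x|lborel. \<bar>b (- w + x)\<bar>) = (LINT x|lborel. \<bar>b x\<bar>)" by (rule integral_shift) simp
    finally show ?thesis unfolding B_def by (intro order_trans[OF Hd] mult_left_mono A0) simp
  qed
  have B0: "B \<ge> 0" using HB[of 0] by simp
  have swap: "(LINT x|lborel. a x * (LINT y|lborel. b y * \<rho> n (x - y))) = (LINT w|lborel. \<rho> n w * H w)"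
     and iH: "integrable lborel (\<lambda>w. \<rho> n w * H w)" for n
  proof -
    have i: "integrable lborel (\<lambda>z. a (fst z) * (b (fst z - snd z) * \<rho> n (snd z)))"
      by (rule Bochner_Integration.integrable_bound[OF integrable_mult_right[OF integrable_abs[OF integrable_convolution[OF b int]], of A]])
       (auto simp: abs_mult borel_prod[symmetric] intro!: AE_I2 mult_right_mono order_trans[OF A abs_ge_self])
    have H': "(LINT x|lborel. a x * (b (x - w) * \<rho> n w)) = \<rho> n w * H w" for w
    proof -
      have "(\<lambda>x. a x * (b (x - w) * \<rho> n w)) = (\<lambda>x. \<rho> n w * (a x * b (x - w)))" by (auto simp: mult_ac)
      then show ?thesis by (simp add: H_def)
    qed
    have "(LINT x|lborel. a x * (LINT y|lborel. b y * \<rho> n (x - y))) = (LINT x|lborel. LINT w|lborel. a x * (b (x - w) * \<rho> n w))"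
    proof (rule Bochner_Integration.integral_cong[OF refl])
      fix x :: 'a
      show "a x * (LINT y|lborel. b y * \<rho> n (x - y)) = (LINT w|lborel. a x * (b (x - w) * \<rho> n w))"
        using integral_reflect[of "\<lambda>y. b y * \<rho> n (x - y)" x] by simp
    qed
    also have "\<dots> = (LINT w|lborel. LINT x|lborel. a x * (b (x - w) * \<rho> n w))"
      using lborel_fst[OF i] lborel_snd[OF i] by (simp only: fst_conv snd_conv)
    also have "\<dots> = (LINT w|lborel. \<rho> n w * H w)" by (simp only: H')
    finally show "(LINT x|lborel. a x * (LINT y|lborel. b y * \<rho> n (x - y))) = (LINT w|lborel. \<rho> n w * H w)" .
    show "integrable lborel (\<lambda>w. \<rho> n w * H w)"
      using integrable_snd(2)[OF i] by (simp only: H' fst_conv snd_conv)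
  qed
  have "(\<lambda>n. (LINT w|lborel. \<rho> n w * H w) - (LINT w|lborel. \<rho> n w) * H 0) \<longlonglongrightarrow> 0"
  proof (rule LIMSEQ_I)
    fix r :: real assume r: "r > 0"
    have "0 \<le> (LINT w|lborel. \<bar>\<rho> 0 w\<bar>)" by (rule Bochner_Integration.integral_nonneg) simp
    with M[of 0] have M0: "M \<ge> 0" by linarith
    \<comment> \<open>Makes the contribution near the origin, at most \<open>A * e * M\<close>, no
      larger than r/2. Adding 1 to \<open>A\<close> and \<open>M\<close> keeps the denominator
      positive.\<close>
    define e where "e = r / (2 * (A + 1) * (M + 1))"
    have e: "e > 0" using r A0 M0 by (simp add: e_def)
    obtain d where d: "d > 0" "\<And>h. norm h < d \<Longrightarrow> (LINT x|lborel. \<bar>b (h + x) - b x\<bar>) \<le> e"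
      using translation_continuous[OF b] e by blast
    have "\<forall>\<^sub>F n in sequentially. (LINT w|lborel. \<bar>\<rho> n w\<bar> * indicator {w. d \<le> norm w} w) < r / (2 * (B + 1))"
      using order_tendstoD(2)[OF tail[OF d(1)]] r B0 by auto
    then obtain N where N: "\<And>n. n \<ge> N \<Longrightarrow> (LINT w|lborel. \<bar>\<rho> n w\<bar> * indicator {w. d \<le> norm w} w) < r / (2 * (B + 1))"
      by (auto simp: eventually_sequentially)
    show "\<exists>N. \<forall>n\<ge>N. norm ((LINT w|lborel. \<rho> n w * H w) - (LINT w|lborel. \<rho> n w) * H 0 - 0) < r"
    proof (intro exI[of _ N] allI impI)
      fix n assume n: "n \<ge> N"
      have it: "integrable lborel (\<lambda>w. \<bar>\<rho> n w\<bar> * indicator {w. d \<le> norm w} w)"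
        by (rule Bochner_Integration.integrable_bound[OF int[of n]]) (auto simp: indicator_def)
      have "(LINT w|lborel. \<rho> n w * H w) - (LINT w|lborel. \<rho> n w) * H 0 = (LINT w|lborel. \<rho> n w * (H w - H 0))"
        using iH[of n] int[of n] by (simp add: right_diff_distrib)
      also have "\<bar>\<dots>\<bar> \<le> (LINT w|lborel. \<bar>\<rho> n w * (H w - H 0)\<bar>)" by (rule integral_abs_bound)
      also have "\<dots> \<le> (LINT w|lborel. A * e * \<bar>\<rho> n w\<bar> + B * (\<bar>\<rho> n w\<bar> * indicator {w. d \<le> norm w} w))"
      proof (rule integral_mono)
        show "integrable lborel (\<lambda>w. \<bar>\<rho> n w * (H w - H 0)\<bar>)"
          using iH[of n] int[of n] by (simp add: right_diff_distrib)
        show "integrable lborel (\<lambda>w. A * e * \<bar>\<rho> n w\<bar> + B * (\<bar>\<rho> n w\<bar> * indicator {w. d \<le> norm w} w))"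
          using it int[of n] by (intro Bochner_Integration.integrable_add integrable_mult_right integrable_abs)
        fix w :: 'a
        show "\<bar>\<rho> n w * (H w - H 0)\<bar> \<le> A * e * \<bar>\<rho> n w\<bar> + B * (\<bar>\<rho> n w\<bar> * indicator {w. d \<le> norm w} w)"
        proof (cases "d \<le> norm w")
          case True
          have "\<bar>\<rho> n w\<bar> * \<bar>H w - H 0\<bar> \<le> \<bar>\<rho> n w\<bar> * B" by (intro mult_left_mono HB) auto
          moreover have "0 \<le> A * e * \<bar>\<rho> n w\<bar>" using A0 e by simp
          ultimately show ?thesis using True by (simp add: abs_mult mult_ac)
        next
          case False
          have "\<bar>H w - H 0\<bar> \<le> A * e"
            using False d(2)[of "- w"] by (intro order_trans[OF Hd] mult_left_mono A0) auto
          then have "\<bar>\<rho> n w\<bar> * \<bar>H w - H 0\<bar> \<le> \<bar>\<rho> n w\<bar> * (A * e)" by (intro mult_left_mono) auto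
          then show ?thesis using False by (simp add: abs_mult mult_ac)
        qed
      qed
      also have "\<dots> = A * e * (LINT w|lborel. \<bar>\<rho> n w\<bar>) + B * (LINT w|lborel. \<bar>\<rho> n w\<bar> * indicator {w. d \<le> norm w} w)"
        using it int[of n] by simp
      also have "\<dots> \<le> A * e * M + B * (r / (2 * (B + 1)))"
        using A0 B0 e N[OF n] M[of n] by (intro add_mono mult_left_mono) auto
      also have "\<dots> < r"
      proof -
        have "A * e * M \<le> (A + 1) * e * (M + 1)" using A0 M0 e by (intro mult_mono) auto
        also have "\<dots> = r / 2"
        proof -
          have "p * (r / (2 * p * q)) * q = r / 2" if "p > 0" "q > 0" for p q :: real using that by simp
          from this[of "A + 1" "M + 1"] show ?thesis using A0 M0 by (simp only: e_def)
        qed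
        finally have 1: "A * e * M \<le> r / 2" .
        have "B * (r / (2 * (B + 1))) < r / 2" using B0 r by (simp add: field_simps)
        then show ?thesis using 1 by linarith
      qed
      finally show "norm ((LINT w|lborel. \<rho> n w * H w) - (LINT w|lborel. \<rho> n w) * H 0 - 0) < r" by simp
    qed
  qed
  from tendsto_add[OF this tendsto_mult_right[OF c, of "H 0"]]
  show ?thesis by (simp add: swap H0)
qed

section \<open>Test functions\<close>

lemma test_functionI:
  assumes "smooth f" "compact K" "K \<subseteq> S" "\<And>x. x \<notin> K \<Longrightarrow> f x = 0"
  shows "test_function S f"
proof -
  have c: "closure {x. f x \<noteq> 0} \<subseteq> K"
    using assms by (intro closure_minimal compact_imp_closed) auto
  have "compact (K \<inter> closure {x. f x \<noteq> 0})"
    by (rule compact_Int_closed[OF assms(2) closed_closure])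
  then show ?thesis using assms c by (simp add: test_function_def inf.absorb2)
qed

lemma test_functionD:
  assumes "test_function S f"
  shows "\<exists>K. compact K \<and> K \<subseteq> S \<and> (\<forall>x. x \<notin> K \<longrightarrow> f x = 0)"
proof (intro exI[of _ "closure {x. f x \<noteq> 0}"] conjI allI impI)
  show "compact (closure {x. f x \<noteq> 0})" "closure {x. f x \<noteq> 0} \<subseteq> S"
    using assms by (auto simp: test_function_def)
  show "x \<notin> closure {x. f x \<noteq> 0} \<Longrightarrow> f x = 0" for x
    using closure_subset[of "{x. f x \<noteq> 0}"] by auto
qed

lemma test_smooth: "test_function S f \<Longrightarrow> smooth f" by (simp add: test_function_def)

lemma test_mono: "test_function S f \<Longrightarrow> S \<subseteq> S' \<Longrightarrow> test_function S' f"
  by (auto simp: test_function_def)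

lemma pd_eq_0:
  assumes "closed K" "\<And>x. x \<notin> K \<Longrightarrow> f x = 0" "x \<notin> K"
  shows "pd v f x = 0"
proof -
  have "(f has_derivative (\<lambda>_. 0)) (at x)"
    by (rule has_derivative_transform_within_open[of "\<lambda>_. 0" "\<lambda>_. 0" x UNIV "- K"]) (use assms in auto)
  then show ?thesis by (rule pd_eqI)
qed

lemma test_pd:
  assumes f: "test_function S f" shows "test_function S (pd v f)"
proof -
  obtain K where K: "compact K" "K \<subseteq> S" "\<And>x. x \<notin> K \<Longrightarrow> f x = 0" using test_functionD[OF f] by blast
  show ?thesis
    by (rule test_functionI[OF _ K(1,2)]) (use K f in \<open>auto intro: pd_eq_0 compact_imp_closed smoothD(2) test_smooth\<close>)
qed

lemma test_mult: fixes f g :: "'a::real_normed_vector \<Rightarrow> real"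
  assumes f: "test_function S f" and g: "smooth g" shows "test_function S (\<lambda>x. g x * f x)"
proof -
  obtain K where K: "compact K" "K \<subseteq> S" "\<And>x. x \<notin> K \<Longrightarrow> f x = 0" using test_functionD[OF f] by blast
  show ?thesis
    by (rule test_functionI[OF _ K(1,2)]) (use K test_smooth[OF f] g in \<open>auto intro!: smooth_intros\<close>)
qed

lemma test_add: fixes f g :: "'a::real_normed_vector \<Rightarrow> real"
  assumes "test_function S f" "test_function S g" shows "test_function S (\<lambda>x. f x + g x)"
proof -
  obtain K where K: "compact K" "K \<subseteq> S" "\<And>x. x \<notin> K \<Longrightarrow> f x = 0" using test_functionD[OF assms(1)] by blast
  obtain L where L: "compact L" "L \<subseteq> S" "\<And>x. x \<notin> L \<Longrightarrow> g x = 0" using test_functionD[OF assms(2)] by blast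
  show ?thesis
    by (rule test_functionI[of _ "K \<union> L"]) (use K L test_smooth[OF assms(1)] test_smooth[OF assms(2)] in \<open>auto intro!: smooth_intros\<close>)
qed

lemma test_zero: "test_function S (\<lambda>x. 0 :: real)"
  by (rule test_functionI[of _ "{}"]) (auto intro: smooth_intros)

lemma test_sum: fixes f :: "'i \<Rightarrow> 'a::real_normed_vector \<Rightarrow> real"
  shows "(\<And>i. i \<in> I \<Longrightarrow> test_function S (f i)) \<Longrightarrow> test_function S (\<lambda>x. \<Sum>i\<in>I. f i x)"
  by (induction I rule: infinite_finite_induct) (auto intro: test_zero test_add)

lemma test_cmult: fixes f :: "'a::real_normed_vector \<Rightarrow> real"
  shows "test_function S f \<Longrightarrow> test_function S (\<lambda>x. c * f x)"
  by (rule test_mult) (auto intro: smooth_intros)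

lemma test_diff: fixes f g :: "'a::real_normed_vector \<Rightarrow> real"
  assumes "test_function S f" "test_function S g" shows "test_function S (\<lambda>x. f x - g x)"
  using test_add[OF assms(1) test_cmult[OF assms(2), of "-1"]] by simp

lemma test_bounded:
  fixes f :: "'a::real_normed_vector \<Rightarrow> 'b::real_normed_vector"
  assumes "test_function S f" shows "\<exists>M\<ge>0. \<forall>x. norm (f x) \<le> M"
proof -
  obtain K where K: "compact K" "K \<subseteq> S" "\<And>x. x \<notin> K \<Longrightarrow> f x = 0" using test_functionD[OF assms] by blast
  have "compact (f ` K)" using K smooth_continuous[OF test_smooth[OF assms]] by (intro compact_continuous_image)
  then obtain M where M: "\<And>x. x \<in> K \<Longrightarrow> norm (f x) \<le> M" using compact_imp_bounded bounded_iff by (metis imageI)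
  show ?thesis
  proof (intro exI[of _ "max M 0"] conjI allI)
    fix x show "norm (f x) \<le> max M 0"
      using M[of x] K(3)[of x] by (cases "x \<in> K") auto
  qed simp
qed

text \<open>The bound \<open>\<bar>g\<bar> \<le> 1 + g\<^sup>2\<close> on the support of \<open>f\<close> avoids any appeal to the Cauchy--Schwarz inequality.\<close>

lemma integrable_mult_test:
  fixes f g :: "'a::euclidean_space \<Rightarrow> real"
  assumes f: "test_function S f" and g[measurable]: "g \<in> borel_measurable borel" and g2: "integrable lborel (\<lambda>x. (g x)\<^sup>2)"
  shows "integrable lborel (\<lambda>x. g x * f x)" "integrable lborel (\<lambda>x. f x * g x)"
proof -
  obtain K where K: "compact K" "K \<subseteq> S" "\<And>x. x \<notin> K \<Longrightarrow> f x = 0" using test_functionD[OF f] by blast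
  obtain M where M: "M \<ge> 0" "\<And>x. norm (f x) \<le> M" using test_bounded[OF f] by blast
  have [measurable]: "f \<in> borel_measurable borel" using f by (intro smooth_borel test_smooth)
  have mK: "emeasure lborel K < \<infinity>" using K(1) by (rule emeasure_compact_finite)
  have sK: "K \<in> sets lborel" using K by (simp add: borel_compact)
  show i: "integrable lborel (\<lambda>x. g x * f x)"
  proof (rule Bochner_Integration.integrable_bound)
    show "integrable lborel (\<lambda>x. M * (indicator K x + (g x)\<^sup>2))"
      using mK sK g2 by (intro integrable_mult_right Bochner_Integration.integrable_add) simp_all
    show "AE x in lborel. norm (g x * f x) \<le> norm (M * (indicator K x + (g x)\<^sup>2))"
    proof (rule AE_I2)
      fix x
      have 1: "\<bar>g x\<bar> \<le> 1 + (g x)\<^sup>2"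
        using zero_le_power2[of "\<bar>g x\<bar> - 1/2"] by (simp add: power2_eq_square algebra_simps)
      show "norm (g x * f x) \<le> norm (M * (indicator K x + (g x)\<^sup>2))"
      proof (cases "x \<in> K")
        case True
        have "\<bar>g x\<bar> * \<bar>f x\<bar> \<le> (1 + (g x)\<^sup>2) * M" using 1 M by (intro mult_mono) auto
        then show ?thesis using True M(1) by (simp add: abs_mult mult_ac)
      qed (simp add: K)
    qed
  qed simp
  then show "integrable lborel (\<lambda>x. f x * g x)" by (simp add: mult.commute)
qed

lemma test_integrable:
  fixes f :: "'a::euclidean_space \<Rightarrow> real"
  assumes f: "test_function S f" shows "integrable lborel f"
proof -
  obtain K where K: "compact K" "K \<subseteq> S" "\<And>x. x \<notin> K \<Longrightarrow> f x = 0" using test_functionD[OF f] by blast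
  obtain M where M: "M \<ge> 0" "\<And>x. norm (f x) \<le> M" using test_bounded[OF f] by blast
  have sK: "K \<in> sets lborel" using K by (simp add: borel_compact)
  show ?thesis
  proof (rule Bochner_Integration.integrable_bound)
    show "integrable lborel (\<lambda>x. M * indicator K x)"
      using emeasure_compact_finite[OF K(1)] sK by (intro integrable_mult_right) simp_all
    show "f \<in> borel_measurable lborel" using f by (simp add: smooth_borel test_smooth)
    show "AE x in lborel. norm (f x) \<le> norm (M * indicator K x)"
    proof (rule AE_I2)
      fix x show "norm (f x) \<le> norm (M * indicator K x)"
        using M(2)[of x] M(1) K(3)[of x] by (cases "x \<in> K") auto
    qed
  qed
qed

lemma test_slice:
  fixes f :: "'a::real_normed_vector \<times> real \<Rightarrow> real"
  assumes f: "test_function S f"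
  shows "test_function UNIV (\<lambda>x. f (x, t))" "pd v (\<lambda>x. f (x, t)) = (\<lambda>x. pd (v, 0) f (x, t))"
proof -
  obtain K where K: "compact K" "K \<subseteq> S" "\<And>x. x \<notin> K \<Longrightarrow> f x = 0" using test_functionD[OF f] by blast
  have L: "bounded_linear (\<lambda>x::'a. (x, 0::real))" by (intro bounded_linear_Pair bounded_linear_ident bounded_linear_zero)
  note A = smooth_affine[OF test_smooth[OF f] L, where c="(0, t)"]
  show "pd v (\<lambda>x. f (x, t)) = (\<lambda>x. pd (v, 0) f (x, t))" using A(2)[where v=v] by simp
  show "test_function UNIV (\<lambda>x. f (x, t))"
  proof (rule test_functionI)
    show "smooth (\<lambda>x. f (x, t))" using A(1) by simp
    show "compact (fst ` K)" using K(1) by (intro compact_continuous_image continuous_intros)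
    show "x \<notin> fst ` K \<Longrightarrow> f (x, t) = 0" for x using K(3)[of "(x, t)"] by force
  qed simp
qed

text \<open>The two values of \<open>c\<close> give translates and reflections, so that
  \<open>\<rho> (x - y)\<close> can serve as a test function in either variable.\<close>

lemma test_affine:
  fixes f :: "'a::euclidean_space \<Rightarrow> real"
  assumes f: "test_function UNIV f" and c: "c = 1 \<or> c = -1"
  shows "test_function UNIV (\<lambda>x. f (c *\<^sub>R x + y))" "pd v (\<lambda>x. f (c *\<^sub>R x + y)) = (\<lambda>x. c * pd v f (c *\<^sub>R x + y))"
proof -
  obtain K where K: "compact K" "\<And>x. x \<notin> K \<Longrightarrow> f x = 0" using test_functionD[OF f] by blast
  have L: "bounded_linear (\<lambda>x::'a. c *\<^sub>R x)" by (rule bounded_linear_scaleR_right)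
  note A = smooth_affine[OF test_smooth[OF f] L, where c=y]
  have B: "bounded_linear (\<lambda>v. pd v f z)" for z
    using smooth_has_derivative[OF test_smooth[OF f]] by (rule has_derivative_bounded_linear)
  show "pd v (\<lambda>x. f (c *\<^sub>R x + y)) = (\<lambda>x. c * pd v f (c *\<^sub>R x + y))"
    unfolding A(2) using linear_scale[OF bounded_linear.linear[OF B], of c v] by simp
  show "test_function UNIV (\<lambda>x. f (c *\<^sub>R x + y))"
  proof (rule test_functionI)
    show "smooth (\<lambda>x. f (c *\<^sub>R x + y))" using A(1) by simp
    show "compact ((\<lambda>z. c *\<^sub>R (z - y)) ` K)" using K(1) by (intro compact_continuous_image continuous_intros)
    show "f (c *\<^sub>R x + y) = 0" if "x \<notin> (\<lambda>z. c *\<^sub>R (z - y)) ` K" for x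
    proof (rule K(2), rule)
      assume "c *\<^sub>R x + y \<in> K"
      then have "c *\<^sub>R ((c *\<^sub>R x + y) - y) \<in> (\<lambda>z. c *\<^sub>R (z - y)) ` K" by blast
      then show False using that c by auto
    qed
  qed simp
qed

lemma smooth_norm2: "smooth (\<lambda>x::'a::euclidean_space. (norm x)\<^sup>2)"
proof -
  have "smooth (\<lambda>x::'a. \<Sum>b\<in>Basis. (x \<bullet> b) * (x \<bullet> b))"
    by (intro smooth_intros smooth_linear bounded_linear_inner_left)
  then show ?thesis by (simp add: power2_norm_eq_inner euclidean_inner[symmetric])
qed

text \<open>A \<open>flat\<close> profile of the squared distance to the sphere of radius
  \<open>e\<close>; it can be normalized because it is positive on a ball of positive
  measure.\<close>

lemma mollifier_exists:
  assumes e: "e > 0"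
  obtains \<rho> :: "'a::euclidean_space \<Rightarrow> real" where "test_function UNIV \<rho>" "\<And>x. \<rho> x \<ge> 0"
    "\<And>x. e \<le> norm x \<Longrightarrow> \<rho> x = 0" "(LINT x|lborel. \<rho> x) = 1"
proof -
  define \<beta> :: "'a \<Rightarrow> real" where "\<beta> x = flat 0 (e\<^sup>2 - (norm x)\<^sup>2)" for x
  have T: "test_function UNIV \<beta>"
  proof (rule test_functionI)
    show "smooth \<beta>" unfolding \<beta>_def by (intro smooth_intros smooth_norm2)
    show "\<beta> x = 0" if "x \<notin> cball 0 e" for x
      using that e power_strict_mono[of e "norm x" 2] by (auto simp: \<beta>_def flat_def)
  qed auto
  have nn: "\<beta> x \<ge> 0" for x by (simp add: \<beta>_def flat_nonneg)
  have z: "\<beta> x = 0" if "e \<le> norm x" for x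
  proof -
    have "e\<^sup>2 \<le> (norm x)\<^sup>2" using that e by (intro power_mono) auto
    then show ?thesis by (simp add: \<beta>_def flat_def)
  qed
  have p: "\<beta> x > 0" if "x \<in> ball 0 e" for x
    using that e power_strict_mono[of "norm x" e 2] by (auto simp: \<beta>_def intro!: flat_pos)
  have i: "integrable lborel \<beta>" using T by (rule test_integrable)
  have "(LINT x|lborel. \<beta> x) \<noteq> 0"
  proof
    assume "(LINT x|lborel. \<beta> x) = 0"
    then have "AE x in lborel. \<beta> x = 0" using i nn integral_nonneg_eq_0_iff_AE by blast
    then have "AE x in lborel. x \<notin> ball (0::'a) e" by eventually_elim (use p in force)
    then have "emeasure lborel (ball (0::'a) e) = 0"
      by (subst (asm) AE_iff_measurable[of "ball 0 e"]) auto
    then show False using content_ball_pos[OF e, of "0::'a"] by (simp add: measure_def)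
  qed
  moreover have "(LINT x|lborel. \<beta> x) \<ge> 0" using nn by simp
  ultimately have I: "(LINT x|lborel. \<beta> x) > 0" by simp
  show ?thesis
    by (rule that[of "\<lambda>x. inverse (LINT x|lborel. \<beta> x) * \<beta> x"])
       (use I nn z in \<open>auto intro!: test_cmult T\<close>)
qed

section \<open>Divergence-free fields at a fixed time\<close>

lemma swap_kernel:
  fixes a b r :: "'a::euclidean_space \<Rightarrow> real"
  assumes a: "integrable lborel a" and b: "integrable lborel b"
    and r[measurable]: "r \<in> borel_measurable borel" and M: "\<And>x. \<bar>r x\<bar> \<le> M"
  shows "(LINT x|lborel. a x * (LINT y|lborel. b y * r (x - y))) = (LINT y|lborel. b y * (LINT x|lborel. a x * r (x - y)))"
    and "integrable lborel (\<lambda>y. b y * (LINT x|lborel. a x * r (x - y)))"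
proof -
  have [measurable]: "a \<in> borel_measurable borel" "b \<in> borel_measurable borel" using a b by auto
  have i: "integrable lborel (\<lambda>z. (a (fst z) * b (snd z)) * r (fst z - snd z))"
  proof (rule Bochner_Integration.integrable_bound)
    show "integrable lborel (\<lambda>z. M * \<bar>a (fst z) * b (snd z)\<bar>)"
      using integrable_tensor[OF a b] by auto
    show "(\<lambda>z. (a (fst z) * b (snd z)) * r (fst z - snd z)) \<in> borel_measurable lborel"
      by (simp add: borel_prod[symmetric])
    show "AE z in lborel. norm ((a (fst z) * b (snd z)) * r (fst z - snd z)) \<le> norm (M * \<bar>a (fst z) * b (snd z)\<bar>)"
    proof (rule AE_I2)
      fix z :: "'a \<times> 'a"
      have "\<bar>a (fst z) * b (snd z)\<bar> * \<bar>r (fst z - snd z)\<bar> \<le> \<bar>a (fst z) * b (snd z)\<bar> * \<bar>M\<bar>"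
        using M by (intro mult_left_mono order_trans[OF M abs_ge_self]) auto
      then show "norm ((a (fst z) * b (snd z)) * r (fst z - snd z)) \<le> norm (M * \<bar>a (fst z) * b (snd z)\<bar>)"
        by (simp add: abs_mult mult_ac)
    qed
  qed
  have 1: "(LINT y|lborel. a x * b y * r (x - y)) = a x * (LINT y|lborel. b y * r (x - y))" for x
    by (simp add: mult.assoc)
  have 2: "(LINT x|lborel. a x * b y * r (x - y)) = b y * (LINT x|lborel. a x * r (x - y))" for y
  proof -
    have "(\<lambda>x. a x * b y * r (x - y)) = (\<lambda>x. b y * (a x * r (x - y)))" by (auto simp: mult_ac)
    then show ?thesis by simp
  qed
  show "(LINT x|lborel. a x * (LINT y|lborel. b y * r (x - y))) = (LINT y|lborel. b y * (LINT x|lborel. a x * r (x - y)))"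
    using lborel_fst[OF i] lborel_snd[OF i] by (simp only: fst_conv snd_conv 1 2)
  show "integrable lborel (\<lambda>y. b y * (LINT x|lborel. a x * r (x - y)))"
    using integrable_snd(2)[OF i] by (simp only: fst_conv snd_conv 2)
qed

text \<open>A single time slice of the velocity with its weak gradient, in Borel components. The
  bound \<open>M\<close> may vary with the slice and comes from the pointwise hypothesis; it makes
  \<open>U j\<close> times a test function a bounded multiplier, which is what
  \<open>approximate_identity\<close> asks for.\<close>

locale div_free_slice =
  fixes U :: "3 \<Rightarrow> real^3 \<Rightarrow> real" and G :: "3 \<Rightarrow> 3 \<Rightarrow> real^3 \<Rightarrow> real" and M :: real
  assumes U_meas [measurable]: "\<And>i. U i \<in> borel_measurable borel"
    and U2: "\<And>i. integrable lborel (\<lambda>x. (U i x)\<^sup>2)"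
    and U_bound: "\<And>i x. \<bar>U i x\<bar> \<le> M"
    and G_meas [measurable]: "\<And>i j. G i j \<in> borel_measurable borel"
    and G2: "\<And>i j. integrable lborel (\<lambda>x. (G i j x)\<^sup>2)"
    and weak_derivative: "\<And>\<psi> i j. test_function UNIV \<psi> \<Longrightarrow>
      (LINT x|lborel. U i x * pd (axis j 1) \<psi> x) = - (LINT x|lborel. G i j x * \<psi> x)"
    and trace_G: "AE x in lborel. (\<Sum>i\<in>UNIV. G i i x) = 0"
begin

lemma div_free:
  assumes \<psi>: "test_function UNIV \<psi>"
  shows "(\<Sum>i\<in>UNIV. LINT x|lborel. U i x * pd (axis i 1) \<psi> x) = 0"
proof -
  have [measurable]: "\<psi> \<in> borel_measurable borel" using \<psi> by (simp add: smooth_borel test_smooth)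
  have "(\<Sum>i\<in>UNIV. LINT x|lborel. U i x * pd (axis i 1) \<psi> x) = (\<Sum>i\<in>UNIV. - (LINT x|lborel. G i i x * \<psi> x))"
    by (simp add: weak_derivative[OF \<psi>])
  also have "\<dots> = - (LINT x|lborel. (\<Sum>i\<in>UNIV. G i i x) * \<psi> x)"
    using integrable_mult_test(1)[OF \<psi> G_meas G2] by (simp add: sum_negf sum_distrib_right)
  also have "(LINT x|lborel. (\<Sum>i\<in>UNIV. G i i x) * \<psi> x) = (LINT (x::real^3)|lborel. 0)"
  proof (rule integral_cong_AE)
    show "AE x in lborel. (\<Sum>i\<in>UNIV. G i i x) * \<psi> x = 0" using trace_G by eventually_elim simp
  qed auto
  finally show ?thesis by simp
qed

text \<open>Integration by parts in the nonlinear term. \<open>U j\<close> times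
  \<open>\<psi>\<close> is not smooth, so the weak derivative cannot be applied to it directly. One
  mollifies \<open>G i j\<close>, moves the derivative to the mollifier, exchanges the integrals,
  and is left with the divergence of \<open>U\<close> tested against a smooth function; then the
  mollification is removed.\<close>

lemma convection:
  assumes \<psi>: "test_function UNIV \<psi>"
  shows "(\<Sum>j\<in>UNIV. LINT x|lborel. U j x * G i j x * \<psi> x) = - (\<Sum>j\<in>UNIV. LINT x|lborel. U i x * U j x * pd (axis j 1) \<psi> x)"
proof -
  have [measurable]: "\<psi> \<in> borel_measurable borel" using \<psi> by (simp add: smooth_borel test_smooth)
  have [measurable]: "pd v \<psi> \<in> borel_measurable borel" for v by (rule smooth_borel[OF smooth_pd[OF test_smooth[OF \<psi>]]])
  obtain K where K: "compact K" "\<And>x. x \<notin> K \<Longrightarrow> \<psi> x = 0" using test_functionD[OF \<psi>] by blast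
  obtain R where R: "\<And>x. x \<in> K \<Longrightarrow> norm x \<le> R" using compact_imp_bounded[OF K(1)] by (auto simp: bounded_iff)
  have psi0: "\<psi> x = 0" "pd v \<psi> x = 0" if "\<not> norm x \<le> R" for x v
    using that R K pd_eq_0[of K \<psi> x v] compact_imp_closed by auto
  \<comment> \<open>The radius exceeds that of the support of \<open>\<psi>\<close> by 1, the
    largest mollifier radius, so a convolution evaluated on the support sees only \<open>B\<close>.
    Truncation is needed because \<open>G i j\<close> and \<open>U i\<close> are merely square
    integrable.\<close>
  define B where "B = cball (0::real^3) (R + 1)"
  have [measurable]: "B \<in> sets borel" by (simp add: B_def)
  have iB: "integrable lborel (\<lambda>x. g x * indicator B x)"
    if [measurable]: "g \<in> borel_measurable borel" and g2: "integrable lborel (\<lambda>x. (g x)\<^sup>2)" for g :: "real^3 \<Rightarrow> real"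
  proof (rule Bochner_Integration.integrable_bound)
    show "integrable lborel (\<lambda>x. indicator B x + (g x)\<^sup>2)"
      using g2 emeasure_compact_finite[OF compact_cball[of "0::real^3" "R + 1"]]
      by (intro Bochner_Integration.integrable_add) (auto simp: B_def)
    have 1: "\<bar>g x\<bar> \<le> 1 + (g x)\<^sup>2" for x
      using zero_le_power2[of "\<bar>g x\<bar> - 1/2"] by (simp add: power2_eq_square algebra_simps)
    show "AE x in lborel. norm (g x * indicator B x) \<le> norm (indicator B x + (g x)\<^sup>2)"
      using 1 by (auto simp: indicator_def)
  qed simp
  have "\<forall>n. \<exists>\<rho> :: real^3 \<Rightarrow> real. test_function UNIV \<rho> \<and> (\<forall>x. \<rho> x \<ge> 0) \<and> (\<forall>x. 1 / Suc n \<le> norm x \<longrightarrow> \<rho> x = 0) \<and> (LINT x|lborel. \<rho> x) = 1"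
    using mollifier_exists[of "1 / Suc n" for n] by (metis (no_types, lifting) of_nat_0_less_iff zero_less_Suc zero_less_divide_1_iff)
  then obtain \<rho> :: "nat \<Rightarrow> real^3 \<Rightarrow> real" where \<rho>: "\<And>n. test_function UNIV (\<rho> n)" "\<And>n x. \<rho> n x \<ge> 0"
    "\<And>n x. 1 / Suc n \<le> norm x \<Longrightarrow> \<rho> n x = 0" "\<And>n. (LINT x|lborel. \<rho> n x) = 1" by metis
  have [measurable]: "\<rho> n \<in> borel_measurable borel" "pd v (\<rho> n) \<in> borel_measurable borel" for n v
    by (rule smooth_borel[OF test_smooth[OF \<rho>(1)]], rule smooth_borel[OF smooth_pd[OF test_smooth[OF \<rho>(1)]]])
  have rho1: "\<rho> n x = 0" "pd v (\<rho> n) x = 0" if "\<not> norm x \<le> 1" for n v x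
  proof -
    have z: "\<rho> n x = 0" if "x \<notin> cball 0 1" for x
    proof (rule \<rho>(3))
      have "1 / real (Suc n) \<le> 1" by simp
      then show "1 / real (Suc n) \<le> norm x" using that by (simp only: mem_cball dist_0_norm)
    qed
    show "\<rho> n x = 0" "pd v (\<rho> n) x = 0"
      using that pd_eq_0[of "cball 0 1" "\<rho> n" x v] z by auto
  qed
  define a where "a j x = U j x * \<psi> x" for j x
  define a' where "a' j x = U j x * pd (axis j 1) \<psi> x" for j x
  define b where "b j x = G i j x * indicator B x" for j x
  define c where "c x = U i x * indicator B x" for x
  have [measurable]: "a j \<in> borel_measurable borel" "a' j \<in> borel_measurable borel" "b j \<in> borel_measurable borel" "c \<in> borel_measurable borel" for j
    unfolding a_def a'_def b_def c_def by measurable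
  have ia: "integrable lborel (a j)" "integrable lborel (a' j)" for j
    unfolding a_def a'_def
    by (rule integrable_mult_test(1)[OF \<psi> U_meas U2], rule integrable_mult_test(1)[OF test_pd[OF \<psi>] U_meas U2])
  have ib: "integrable lborel (b j)" "integrable lborel c" for j
    unfolding b_def c_def by (rule iB[OF G_meas G2], rule iB[OF U_meas U2])
  have M0: "M \<ge> 0" using U_bound[of undefined undefined] by linarith
  obtain N where N: "\<And>x. \<bar>\<psi> x\<bar> \<le> N" "\<And>j x. \<bar>pd (axis j 1) \<psi> x\<bar> \<le> N"
  proof -
    have "\<exists>N. \<forall>v\<in>insert \<psi> (range (\<lambda>j. pd (axis j 1) \<psi>)). \<forall>x. \<bar>v x\<bar> \<le> N"
    proof -
      have "\<forall>v\<in>insert \<psi> (range (\<lambda>j. pd (axis j 1) \<psi>)). \<exists>N. \<forall>x. \<bar>v x\<bar> \<le> N"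
        using test_bounded[OF \<psi>] test_bounded[OF test_pd[OF \<psi>]] by (auto; metis)
      then obtain N where N: "\<And>v x. v\<in>insert \<psi> (range (\<lambda>j. pd (axis j 1) \<psi>)) \<Longrightarrow> \<bar>v x\<bar> \<le> N v" by metis
      show ?thesis
        by (intro exI[of _ "Max (N ` insert \<psi> (range (\<lambda>j. pd (axis j 1) \<psi>)))"] ballI allI order_trans[OF N] Max_ge) auto
    qed
    then show ?thesis using that by auto
  qed
  have ba: "\<bar>a j x\<bar> \<le> M * N" "\<bar>a' j x\<bar> \<le> M * N" for j x
    unfolding a_def a'_def abs_mult by (intro mult_mono U_bound N M0 abs_ge_zero)+
  have AI: "(\<lambda>n. LINT x|lborel. f x * (LINT y|lborel. g y * \<rho> n (x - y))) \<longlonglongrightarrow> 1 * (LINT x|lborel. f x * g x)"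
    if "integrable lborel g" "f \<in> borel_measurable borel" "\<And>x. \<bar>f x\<bar> \<le> M * N" for f g
  proof (rule approximate_identity[where M=1 and A="M * N"])
    fix n
    show "integrable lborel (\<rho> n)" using \<rho>(1) by (rule test_integrable)
    show "(LINT w|lborel. \<bar>\<rho> n w\<bar>) \<le> 1" using \<rho>(2,4) by simp
  next
    fix d :: real assume d: "d > 0"
    show "(\<lambda>n. LINT w|lborel. \<bar>\<rho> n w\<bar> * indicator {w. d \<le> norm w} w) \<longlonglongrightarrow> 0"
    proof (rule tendsto_eventually)
      have "\<forall>\<^sub>F n in sequentially. 1 / real (Suc n) < d"
        using LIMSEQ_inverse_real_of_nat d by (intro order_tendstoD(2)[of _ 0]) (simp_all add: divide_inverse)
      then show "\<forall>\<^sub>F n in sequentially. (LINT w|lborel. \<bar>\<rho> n w\<bar> * indicator {w. d \<le> norm w} w) = 0"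
      proof eventually_elim
        case (elim n)
        have "(\<lambda>w. \<bar>\<rho> n w\<bar> * indicator {w. d \<le> norm w} w) = (\<lambda>w. 0)"
          using \<rho>(3)[of n] elim by (auto simp: indicator_def fun_eq_iff)
        then show ?case by simp
      qed
    qed
  qed (use that \<rho>(4) in auto)
  \<comment> \<open>\<open>X\<close> is the mollified left side and \<open>Y\<close> the mollified
    right side. Summed over j they cancel for every n, because for each y the test function
    \<open>\<rho> n (x - y)\<close> times \<open>\<psi> x\<close> meets a divergence-free
    field.\<close>
  define X where "X n j = (LINT x|lborel. a j x * (LINT y|lborel. b j y * \<rho> n (x - y)))" for n j
  define Y where "Y n j = (LINT x|lborel. a' j x * (LINT y|lborel. c y * \<rho> n (x - y)))" for n j
  have bc: "a j x * b j x = U j x * G i j x * \<psi> x" "a' j x * c x = U i x * U j x * pd (axis j 1) \<psi> x" for j x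
    using psi0[of x] by (auto simp: a_def b_def a'_def c_def B_def indicator_def)
  have "(\<lambda>n. \<Sum>j\<in>UNIV. X n j + Y n j) \<longlonglongrightarrow> (\<Sum>j\<in>UNIV. 1 * (LINT x|lborel. a j x * b j x) + 1 * (LINT x|lborel. a' j x * c x))"
    unfolding X_def Y_def by (intro tendsto_sum tendsto_add AI ib ba) auto
  moreover have "(\<Sum>j\<in>UNIV. X n j + Y n j) = 0" for n
  proof -
    obtain P where P: "\<And>x. \<bar>\<rho> n x\<bar> \<le> P" using test_bounded[OF \<rho>(1)[of n]] by auto
    have P': "\<exists>P. \<forall>x. \<bar>pd v (\<rho> n) x\<bar> \<le> P" for v using test_bounded[OF test_pd[OF \<rho>(1)[of n]]] by auto
    have X1: "X n j = (LINT y|lborel. c y * (LINT x|lborel. a j x * pd (axis j 1) (\<rho> n) (x - y)))"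
      and iX: "integrable lborel (\<lambda>y. c y * (LINT x|lborel. a j x * pd (axis j 1) (\<rho> n) (x - y)))" for j
    proof -
      obtain P1 where P1: "\<And>x. \<bar>pd (axis j 1) (\<rho> n) x\<bar> \<le> P1" using P' by blast
      have "X n j = (LINT x|lborel. a j x * (LINT y|lborel. c y * pd (axis j 1) (\<rho> n) (x - y)))"
        unfolding X_def
      proof (rule Bochner_Integration.integral_cong[OF refl])
        fix x
        show "a j x * (LINT y|lborel. b j y * \<rho> n (x - y)) = a j x * (LINT y|lborel. c y * pd (axis j 1) (\<rho> n) (x - y))"
        proof (cases "norm x \<le> R")
          case True
          \<comment> \<open>The minus sign from the weak derivative cancels against the one from
            reflecting the mollifier.\<close>
          have T': "test_function UNIV (\<lambda>y. \<rho> n (-1 *\<^sub>R y + x))" by (rule test_affine(1)[OF \<rho>(1)]) simp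
          have out: "\<not> norm (x - y) \<le> 1" if "y \<notin> B" for y
            using that True norm_triangle_ineq2[of y x] by (auto simp: B_def norm_minus_commute)
          have "(LINT y|lborel. b j y * \<rho> n (x - y)) = (LINT y|lborel. G i j y * \<rho> n (-1 *\<^sub>R y + x))"
            using rho1(1)[OF out] by (intro Bochner_Integration.integral_cong) (auto simp: b_def indicator_def)
          also have "\<dots> = - (LINT y|lborel. U i y * pd (axis j 1) (\<lambda>y. \<rho> n (-1 *\<^sub>R y + x)) y)"
            using weak_derivative[OF T', of i j] by linarith
          also have "\<dots> = (LINT y|lborel. U i y * pd (axis j 1) (\<rho> n) (x - y))"
            by (subst test_affine(2)[OF \<rho>(1)]) auto
          also have "\<dots> = (LINT y|lborel. c y * pd (axis j 1) (\<rho> n) (x - y))"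
            using rho1(2)[OF out] by (intro Bochner_Integration.integral_cong) (auto simp: c_def indicator_def)
          finally show ?thesis by simp
        next
          case False
          then show ?thesis by (simp add: a_def psi0)
        qed
      qed
      also have "\<dots> = (LINT y|lborel. c y * (LINT x|lborel. a j x * pd (axis j 1) (\<rho> n) (x - y)))"
        by (rule swap_kernel(1)[OF ia(1) ib(2) _ P1]) simp
      finally show "X n j = (LINT y|lborel. c y * (LINT x|lborel. a j x * pd (axis j 1) (\<rho> n) (x - y)))" .
      show "integrable lborel (\<lambda>y. c y * (LINT x|lborel. a j x * pd (axis j 1) (\<rho> n) (x - y)))"
        by (rule swap_kernel(2)[OF ia(1) ib(2) _ P1]) simp
    qed
    have Y1: "Y n j = (LINT y|lborel. c y * (LINT x|lborel. a' j x * \<rho> n (x - y)))"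
      and iY: "integrable lborel (\<lambda>y. c y * (LINT x|lborel. a' j x * \<rho> n (x - y)))" for j
      unfolding Y_def by (rule swap_kernel[OF ia(2) ib(2) _ P], simp)+
    have "(\<Sum>j\<in>UNIV. X n j + Y n j) = (LINT y|lborel. (\<Sum>j\<in>UNIV. c y * (LINT x|lborel. a j x * pd (axis j 1) (\<rho> n) (x - y)) + c y * (LINT x|lborel. a' j x * \<rho> n (x - y))))"
      using iX iY by (simp add: X1 Y1)
    also have "\<dots> = (LINT (y::real^3)|lborel. 0)"
    proof (rule Bochner_Integration.integral_cong[OF refl])
      fix y :: "real^3"
      have tr: "test_function UNIV (\<lambda>x. \<rho> n (1 *\<^sub>R x + - y))" by (rule test_affine[OF \<rho>(1)]) simp
      have sr: "smooth (\<lambda>x. \<rho> n (1 *\<^sub>R x + - y))" by (rule test_smooth[OF tr])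
      have T: "test_function UNIV (\<lambda>x. \<rho> n (1 *\<^sub>R x + - y) * \<psi> x)" by (rule test_mult[OF \<psi> sr])
      have pdT: "pd v (\<lambda>x. \<rho> n (1 *\<^sub>R x + - y) * \<psi> x) = (\<lambda>x. \<rho> n (x - y) * pd v \<psi> x + pd v (\<rho> n) (x - y) * \<psi> x)" for v
        by (subst pd_mult[OF sr test_smooth[OF \<psi>]], subst test_affine(2)[OF \<rho>(1)]) auto
      have i1: "integrable lborel (\<lambda>x. a j x * pd (axis j 1) (\<rho> n) (x - y))" for j
      proof -
        have "integrable lborel (\<lambda>x. U j x * (pd (axis j 1) (\<lambda>x. \<rho> n (1 *\<^sub>R x + - y)) x * \<psi> x))"
          by (rule integrable_mult_test(1)[OF test_mult[OF \<psi> smooth_pd[OF sr]] U_meas U2])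
        then show ?thesis by (subst (asm) test_affine(2)[OF \<rho>(1)]) (simp_all add: a_def mult_ac)
      qed
      have i2: "integrable lborel (\<lambda>x. a' j x * \<rho> n (x - y))" for j
      proof -
        have "integrable lborel (\<lambda>x. U j x * (\<rho> n (1 *\<^sub>R x + - y) * pd (axis j 1) \<psi> x))"
          by (rule integrable_mult_test(1)[OF test_mult[OF test_pd[OF \<psi>] sr] U_meas U2])
        then show ?thesis by (simp_all add: a'_def mult_ac)
      qed
      have "(\<Sum>j\<in>UNIV. (LINT x|lborel. a j x * pd (axis j 1) (\<rho> n) (x - y)) + (LINT x|lborel. a' j x * \<rho> n (x - y)))
        = (\<Sum>j\<in>UNIV. LINT x|lborel. U j x * pd (axis j 1) (\<lambda>x. \<rho> n (1 *\<^sub>R x + - y) * \<psi> x) x)"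
      proof (rule sum.cong[OF refl])
        fix j :: 3
        have "(LINT x|lborel. a j x * pd (axis j 1) (\<rho> n) (x - y)) + (LINT x|lborel. a' j x * \<rho> n (x - y))
           = (LINT x|lborel. a j x * pd (axis j 1) (\<rho> n) (x - y) + a' j x * \<rho> n (x - y))"
          by (rule Bochner_Integration.integral_add[OF i1 i2, symmetric])
        also have "\<dots> = (LINT x|lborel. U j x * pd (axis j 1) (\<lambda>x. \<rho> n (1 *\<^sub>R x + - y) * \<psi> x) x)"
          unfolding pdT by (rule Bochner_Integration.integral_cong[OF refl]) (simp add: a_def a'_def algebra_simps)
        finally show "(LINT x|lborel. a j x * pd (axis j 1) (\<rho> n) (x - y)) + (LINT x|lborel. a' j x * \<rho> n (x - y)) = \<dots>" .
      qed
      also have "\<dots> = 0" by (rule div_free[OF T])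
      finally show "(\<Sum>j\<in>UNIV. c y * (LINT x|lborel. a j x * pd (axis j 1) (\<rho> n) (x - y)) + c y * (LINT x|lborel. a' j x * \<rho> n (x - y))) = 0"
        by (simp add: distrib_left[symmetric] sum_distrib_left[symmetric])
    qed
    finally show ?thesis by simp
  qed
  ultimately have "(\<lambda>n. 0) \<longlonglongrightarrow> (\<Sum>j\<in>UNIV. (LINT x|lborel. a j x * b j x) + (LINT x|lborel. a' j x * c x))"
    by (simp only: mult_1)
  from LIMSEQ_unique[OF this tendsto_const]
  have "(\<Sum>j\<in>UNIV. (LINT x|lborel. a j x * b j x) + (LINT x|lborel. a' j x * c x)) = 0" .
  then show ?thesis by (simp add: bc sum.distrib eq_neg_iff_add_eq_0)
qed

end

section \<open>Elimination of the pressure\<close>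

definition ex :: "3 \<Rightarrow> (real^3) \<times> real" where "ex i = (axis i 1, 0)"
definition et :: "(real^3) \<times> real" where "et = (0, 1)"
definition lap :: "((real^3) \<times> real \<Rightarrow> real) \<Rightarrow> (real^3) \<times> real \<Rightarrow> real" where
  "lap f = (\<lambda>z. \<Sum>l\<in>UNIV. pd (ex l) (pd (ex l) f) z)"
text \<open>The backward heat operator: up to sign the formal adjoint of the operator governing the
  linear part of the equation.\<close>

definition bheat :: "((real^3) \<times> real \<Rightarrow> real) \<Rightarrow> (real^3) \<times> real \<Rightarrow> real" where
  "bheat f = (\<lambda>z. pd et f z + lap f z)"

lemma smooth_lap [smooth_intros]: "smooth f \<Longrightarrow> smooth (lap f)"
  unfolding lap_def by (intro smooth_intros)
lemma test_lap: "test_function S f \<Longrightarrow> test_function S (lap f)"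
  unfolding lap_def by (intro test_sum test_pd)
lemma test_bheat: "test_function S f \<Longrightarrow> test_function S (bheat f)"
  unfolding bheat_def by (intro test_add test_lap test_pd)

lemma lap_pd: "smooth f \<Longrightarrow> lap (pd v f) = pd v (lap f)"
  unfolding lap_def by (subst pd_sum) (auto intro!: smooth_intros simp: pd_commute[of f _ v] pd_commute[of "pd _ f" _ v] smooth_pd)

lemma lap_add: "smooth f \<Longrightarrow> smooth g \<Longrightarrow> lap (\<lambda>z. f z + g z) = (\<lambda>z. lap f z + lap g z)"
  by (simp add: lap_def pd_add smooth_pd sum.distrib)

lemma bheat_pd: "smooth f \<Longrightarrow> bheat (pd v f) = pd v (bheat f)"
  unfolding bheat_def by (subst pd_add) (auto intro!: smooth_intros simp: lap_pd pd_commute[of f _ v])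

lemma bheat_lap: "smooth f \<Longrightarrow> bheat (lap f) = lap (bheat f)"
  unfolding bheat_def by (subst lap_add) (auto intro!: smooth_intros simp: lap_pd)

lemma pd_diff_cmult:
  fixes f g :: "'a::real_normed_vector \<Rightarrow> real"
  assumes "smooth f" "smooth g"
  shows "pd v (\<lambda>z. f z - c * g z) = (\<lambda>z. pd v f z - c * pd v g z)"
proof -
  have "smooth (\<lambda>z. c * g z)" using assms by (intro smooth_intros)
  then show ?thesis using assms
    by (simp add: pd_diff pd_mult pd_const smooth_basic(1))
qed

lemma bheat_diff_cmult:
  assumes "smooth f" "smooth g"
  shows "bheat (\<lambda>z. f z - c * g z) = (\<lambda>z. bheat f z - c * bheat g z)"
  using assms by (simp add: bheat_def lap_def pd_diff_cmult smooth_pd sum_subtractf sum_distrib_left algebra_simps)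

lemma integrable_mult_squares:
  fixes g h :: "'a::euclidean_space \<Rightarrow> real"
  assumes [measurable]: "g \<in> borel_measurable borel" "h \<in> borel_measurable borel"
    and "integrable lborel (\<lambda>x. (g x)\<^sup>2)" "integrable lborel (\<lambda>x. (h x)\<^sup>2)"
  shows "integrable lborel (\<lambda>x. g x * h x)"
proof (rule Bochner_Integration.integrable_bound)
  show "integrable lborel (\<lambda>x. (g x)\<^sup>2 + (h x)\<^sup>2)" using assms by auto
  show "AE x in lborel. norm (g x * h x) \<le> norm ((g x)\<^sup>2 + (h x)\<^sup>2)"
  proof (rule AE_I2)
    fix x
    have "2 * (\<bar>g x\<bar> * \<bar>h x\<bar>) \<le> (g x)\<^sup>2 + (h x)\<^sup>2"
      using sum_squares_bound[of "\<bar>g x\<bar>" "\<bar>h x\<bar>"] by simp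
    moreover have "0 \<le> \<bar>g x\<bar> * \<bar>h x\<bar>" by simp
    ultimately have "\<bar>g x\<bar> * \<bar>h x\<bar> \<le> (g x)\<^sup>2 + (h x)\<^sup>2" by linarith
    then show "norm (g x * h x) \<le> norm ((g x)\<^sup>2 + (h x)\<^sup>2)" by (simp add: abs_mult)
  qed
qed simp

lemma integrable_mult_squares_test:
  fixes g h f :: "'a::euclidean_space \<Rightarrow> real"
  assumes m[measurable]: "g \<in> borel_measurable borel" "h \<in> borel_measurable borel"
    and i: "integrable lborel (\<lambda>x. (g x)\<^sup>2)" "integrable lborel (\<lambda>x. (h x)\<^sup>2)" and f: "test_function S f"
  shows "integrable lborel (\<lambda>x. g x * h x * f x)"
proof -
  have [measurable]: "f \<in> borel_measurable borel" by (rule smooth_borel[OF test_smooth[OF f]])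
  obtain N where N: "N \<ge> 0" "\<And>x. norm (f x) \<le> N" using test_bounded[OF f] by auto
  show ?thesis
  proof (rule Bochner_Integration.integrable_bound)
  show "integrable lborel (\<lambda>x. N * \<bar>g x * h x\<bar>)" using integrable_mult_squares[OF m i] by auto
  show "(\<lambda>x. g x * h x * f x) \<in> borel_measurable lborel" by simp
  show "AE x in lborel. norm (g x * h x * f x) \<le> norm (N * \<bar>g x * h x\<bar>)"
  proof (rule AE_I2)
    fix x
    have "\<bar>g x * h x\<bar> * \<bar>f x\<bar> \<le> \<bar>g x * h x\<bar> * N" using N by (intro mult_left_mono) auto
    then show "norm (g x * h x * f x) \<le> norm (N * \<bar>g x * h x\<bar>)" using N by (simp add: abs_mult mult_ac)
  qed
  qed
qed

lemma sum_delta_mult: "(\<Sum>i\<in>UNIV. (if i = k then 1 else 0) * f i) = (f k :: real)" for k :: "'i::finite"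
  by (simp add: if_distrib[of "\<lambda>c. c * _"] cong: if_cong)

text \<open>The working form of a solution on the time interval from \<open>a0\<close> to
  \<open>T\<close>: real Borel components on all of space-time, so that Fubini for
  \<open>lborel\<close> applies without restricted measures. In the instance constructed later the
  fields vanish outside the interval, where the slice and energy conditions are trivial.\<close>

locale weak_flow =
  fixes a0 T K :: real and u :: "3 \<Rightarrow> (real^3) \<times> real \<Rightarrow> real" and D :: "3 \<Rightarrow> 3 \<Rightarrow> (real^3) \<times> real \<Rightarrow> real"
  assumes u_meas [measurable]: "\<And>i. u i \<in> borel_measurable borel"
    and D_meas [measurable]: "\<And>i j. D i j \<in> borel_measurable borel"
    and u2: "\<And>i. integrable lborel (\<lambda>z. (u i z)\<^sup>2)"
    and D2: "\<And>i j. integrable lborel (\<lambda>z. (D i j z)\<^sup>2)"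
    and slices: "AE t in lborel. \<exists>M. div_free_slice (\<lambda>i x. u i (x, t)) (\<lambda>i j x. D i j (x, t)) M"
    and energy: "AE t in lborel. \<forall>i. (LINT x|lborel. (u i (x, t))\<^sup>2) \<le> K"
    and K_nonneg: "K \<ge> 0"
    and weak_form: "\<And>\<phi>. (\<And>i. test_function (UNIV \<times> {a0<..<T}) (\<phi> i)) \<Longrightarrow> (\<And>z. (\<Sum>i\<in>UNIV. pd (ex i) (\<phi> i) z) = 0) \<Longrightarrow>
      (LINT z|lborel. (\<Sum>i\<in>UNIV. - (u i z * pd et (\<phi> i) z)) + (\<Sum>i\<in>UNIV. \<Sum>j\<in>UNIV. D i j z * pd (ex j) (\<phi> i) z)
         + (\<Sum>i\<in>UNIV. \<Sum>j\<in>UNIV. u j z * D i j z * \<phi> i z)) = 0"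
begin

text \<open>The \<open>i\<close>-th component of the curl of the curl of \<open>W\<close> times the \<open>k\<close>-th unit vector.\<close>

definition flux :: "3 \<Rightarrow> ((real^3) \<times> real \<Rightarrow> real) \<Rightarrow> 3 \<Rightarrow> (real^3) \<times> real \<Rightarrow> real" where
  "flux k W i = (\<lambda>z. pd (ex i) (pd (ex k) W) z - (if i = k then 1 else 0) * lap W z)"

text \<open>The time derivative stays on the test field; only spatial integrations by parts are
  made, slice by slice under the time integral, so no regularity of \<open>u\<close> in time
  enters.\<close>

lemma pressure_free:
  assumes W: "test_function (UNIV \<times> {a0<..<T}) W"
  shows "(LINT z|lborel. u k z * lap (bheat W) z) = (LINT z|lborel. (\<Sum>i\<in>UNIV. \<Sum>j\<in>UNIV. u i z * u j z * pd (ex j) (flux k W i) z))"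
proof -
  let ?S = "UNIV \<times> {a0<..<T}"
  define \<phi> where "\<phi> = flux k W"
  have sW: "smooth W" by (rule test_smooth[OF W])
  have T\<phi>: "test_function ?S (\<phi> i)" for i
    unfolding \<phi>_def flux_def by (intro test_diff test_pd test_cmult test_lap W)
  have s\<phi>: "smooth (\<phi> i)" for i by (rule test_smooth[OF T\<phi>])
  have div: "(\<Sum>i\<in>UNIV. pd (ex i) (\<phi> i) z) = 0" for z
  proof -
    have "pd (ex i) (\<phi> i) z = pd (ex i) (pd (ex i) (pd (ex k) W)) z - (if i = k then 1 else 0) * pd (ex i) (lap W) z" for i
      unfolding \<phi>_def flux_def by (subst pd_diff_cmult) (auto intro!: smooth_intros sW)
    then have "(\<Sum>i\<in>UNIV. pd (ex i) (\<phi> i) z) = lap (pd (ex k) W) z - (\<Sum>i\<in>UNIV. (if i = k then 1 else 0) * pd (ex i) (lap W) z)"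
      by (simp add: lap_def sum_subtractf)
    also have "(\<Sum>i\<in>UNIV. (if i = k then 1 else 0) * pd (ex i) (lap W) z) = pd (ex k) (lap W) z"
by (rule sum_delta_mult)
    finally show ?thesis by (simp add: lap_pd[OF sW])
  qed
  \<comment> \<open>Constant-coefficient operators commute, so \<open>bheat\<close> of the field is
    the gradient of \<open>Q\<close>, which every slice annihilates, minus a term that survives only
    in the component k.\<close>
  define Q where "Q = bheat (pd (ex k) W)"
  have TQ: "test_function ?S Q" unfolding Q_def by (intro test_bheat test_pd W)
  have bheat\<phi>: "bheat (\<phi> i) = (\<lambda>z. pd (ex i) Q z - (if i = k then 1 else 0) * lap (bheat W) z)" for i
    unfolding \<phi>_def flux_def Q_def
    by (subst bheat_diff_cmult) (auto intro!: smooth_intros sW simp: bheat_pd bheat_lap sW smooth_pd)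
  define F where "F z = (\<Sum>i\<in>UNIV. - (u i z * pd et (\<phi> i) z)) + (\<Sum>i\<in>UNIV. \<Sum>j\<in>UNIV. D i j z * pd (ex j) (\<phi> i) z)
         + (\<Sum>i\<in>UNIV. \<Sum>j\<in>UNIV. u j z * D i j z * \<phi> i z)" for z
  define H1 where "H1 z = u k z * lap (bheat W) z" for z
  define H2 where "H2 z = (\<Sum>i\<in>UNIV. \<Sum>j\<in>UNIV. u i z * u j z * pd (ex j) (\<phi> i) z)" for z
  have iF: "integrable lborel F"
    unfolding F_def
    by (intro Bochner_Integration.integrable_add Bochner_Integration.integrable_sum integrable_minus
        integrable_mult_test(1)[OF test_pd[OF T\<phi>] u_meas u2] integrable_mult_test(1)[OF test_pd[OF T\<phi>] D_meas D2]
        integrable_mult_squares_test[OF u_meas D_meas u2 D2 T\<phi>])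
  have iH1: "integrable lborel H1"
    unfolding H1_def by (rule integrable_mult_test(1)[OF test_lap[OF test_bheat[OF W]] u_meas u2])
  have iH2: "integrable lborel H2"
    unfolding H2_def by (intro Bochner_Integration.integrable_sum integrable_mult_squares_test[OF u_meas u_meas u2 u2 test_pd[OF T\<phi>]])
  have slice: "(LINT x|lborel. F (x, t)) = (LINT x|lborel. H1 (x, t) - H2 (x, t))"
    if "div_free_slice (\<lambda>i x. u i (x, t)) (\<lambda>i j x. D i j (x, t)) M" for t M
  proof -
    interpret div_free_slice "\<lambda>i x. u i (x, t)" "\<lambda>i j x. D i j (x, t)" M by (rule that)
    have sl: "test_function UNIV (\<lambda>x. f (x, t))" if "test_function ?S f" for f :: "(real^3) \<times> real \<Rightarrow> real" by (rule test_slice(1)[OF that])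
    have sp: "pd (axis j 1) (\<lambda>x. f (x, t)) = (\<lambda>x. pd (ex j) f (x, t))" if "test_function ?S f" for f :: "(real^3) \<times> real \<Rightarrow> real" and j
      unfolding ex_def by (rule test_slice(2)[OF that])
    note iU = integrable_mult_test(1)[OF sl U_meas U2]
    note iG = integrable_mult_test(1)[OF sl G_meas G2]
    note iUU = integrable_mult_squares_test[OF U_meas U_meas U2 U2 sl]
    note iUG = integrable_mult_squares_test[OF U_meas G_meas U2 G2 sl]
    have 1: "(LINT x|lborel. F (x, t)) = (\<Sum>i\<in>UNIV. - (LINT x|lborel. u i (x, t) * pd et (\<phi> i) (x, t)))
       + (\<Sum>i\<in>UNIV. \<Sum>j\<in>UNIV. (LINT x|lborel. D i j (x, t) * pd (ex j) (\<phi> i) (x, t)))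
       + (\<Sum>i\<in>UNIV. \<Sum>j\<in>UNIV. (LINT x|lborel. u j (x, t) * D i j (x, t) * \<phi> i (x, t)))"
      unfolding F_def
      by (simp only: Bochner_Integration.integral_add Bochner_Integration.integral_sum Bochner_Integration.integral_minus
        Bochner_Integration.integrable_add Bochner_Integration.integrable_sum integrable_minus
        iU[OF test_pd[OF T\<phi>]] iG[OF test_pd[OF T\<phi>]] iUG[OF T\<phi>])
    have 2: "(LINT x|lborel. D i j (x, t) * pd (ex j) (\<phi> i) (x, t)) = - (LINT x|lborel. u i (x, t) * pd (ex j) (pd (ex j) (\<phi> i)) (x, t))" for i j
      using weak_derivative[OF sl[OF test_pd[OF T\<phi>[of i]]], of i j "ex j"] by (subst (asm) sp[OF test_pd[OF T\<phi>]]) simp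
    have 3: "(\<Sum>j\<in>UNIV. (LINT x|lborel. u j (x, t) * D i j (x, t) * \<phi> i (x, t))) = - (\<Sum>j\<in>UNIV. (LINT x|lborel. u i (x, t) * u j (x, t) * pd (ex j) (\<phi> i) (x, t)))" for i
      using convection[OF sl[OF T\<phi>[of i]], of i] by (simp only: sp[OF T\<phi>])
    have 4: "(LINT x|lborel. u i (x, t) * bheat (\<phi> i) (x, t)) = (LINT x|lborel. u i (x, t) * pd et (\<phi> i) (x, t)) + (\<Sum>j\<in>UNIV. LINT x|lborel. u i (x, t) * pd (ex j) (pd (ex j) (\<phi> i)) (x, t))" for i
      unfolding bheat_def lap_def
      by (simp only: distrib_left sum_distrib_left Bochner_Integration.integral_add Bochner_Integration.integral_sum
         Bochner_Integration.integrable_sum iU[OF test_pd[OF T\<phi>]] iU[OF test_pd[OF test_pd[OF T\<phi>]]])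
    have 5: "(LINT x|lborel. u i (x, t) * bheat (\<phi> i) (x, t)) = (LINT x|lborel. u i (x, t) * pd (ex i) Q (x, t)) - (if i = k then 1 else 0) * (LINT x|lborel. u i (x, t) * lap (bheat W) (x, t))" for i
      unfolding bheat\<phi>
      using iU[OF test_pd[OF TQ]] iU[OF test_lap[OF test_bheat[OF W]]] by (simp add: right_diff_distrib)
    have 6: "(\<Sum>i\<in>UNIV. LINT x|lborel. u i (x, t) * pd (ex i) Q (x, t)) = 0"
      using div_free[OF sl[OF TQ]] by (simp only: sp[OF TQ])
    have 7: "(\<Sum>i\<in>UNIV. (if i = k then 1 else 0) * (LINT x|lborel. u i (x, t) * lap (bheat W) (x, t))) = (LINT x|lborel. H1 (x, t))"
      unfolding H1_def by (rule sum_delta_mult)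
    have 8: "(LINT x|lborel. H2 (x, t)) = (\<Sum>i\<in>UNIV. \<Sum>j\<in>UNIV. LINT x|lborel. u i (x, t) * u j (x, t) * pd (ex j) (\<phi> i) (x, t))"
      unfolding H2_def by (simp only: Bochner_Integration.integral_sum Bochner_Integration.integrable_sum iUU[OF test_pd[OF T\<phi>]])
    have iH1t: "integrable lborel (\<lambda>x. H1 (x, t))"
      unfolding H1_def by (rule iU[OF test_lap[OF test_bheat[OF W]]])
    have iH2t: "integrable lborel (\<lambda>x. H2 (x, t))"
      unfolding H2_def by (intro Bochner_Integration.integrable_sum iUU[OF test_pd[OF T\<phi>]])
    have "(LINT x|lborel. F (x, t)) = - (\<Sum>i\<in>UNIV. LINT x|lborel. u i (x, t) * bheat (\<phi> i) (x, t)) - (LINT x|lborel. H2 (x, t))"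
      unfolding 1 2 3 4 8 by (simp add: sum_negf sum.distrib)
    also have "\<dots> = (LINT x|lborel. H1 (x, t)) - (LINT x|lborel. H2 (x, t))"
      unfolding 5 by (simp only: sum_subtractf 6 7)
    finally show ?thesis using iH1t iH2t by simp
  qed
  have iH: "integrable lborel (\<lambda>z. H1 z - H2 z)" using iH1 iH2 by simp
  have "0 = (LINT z|lborel. F z)" unfolding F_def by (rule weak_form[OF T\<phi> div, symmetric])
  also have "\<dots> = (LINT t|lborel. LINT x|lborel. F (x, t))" by (rule lborel_snd[OF iF, symmetric])
  also have "\<dots> = (LINT t|lborel. LINT x|lborel. H1 (x, t) - H2 (x, t))"
  proof (rule integral_cong_AE)
    show "AE t in lborel. (LINT x|lborel. F (x, t)) = (LINT x|lborel. H1 (x, t) - H2 (x, t))"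
      using slices by eventually_elim (auto intro: slice)
  qed (use integrable_snd(2)[OF iF] integrable_snd(2)[OF iH] in auto)
  also have "\<dots> = (LINT z|lborel. H1 z - H2 z)" by (rule lborel_snd[OF iH])
  finally have "(LINT z|lborel. H1 z) = (LINT z|lborel. H2 z)" using iH1 iH2 by simp
  then show ?thesis by (simp add: H1_def H2_def \<phi>_def)
qed

end

section \<open>Cutoff functions\<close>

text \<open>The usual smooth transition from 0 to 1. The quotient is written with a real power of a
  positive function, which is the form of division covered by the closure rules.\<close>

definition step :: "real \<Rightarrow> real" where
  "step x = flat 0 x * (flat 0 x + flat 0 (1 - x)) powr (-1)"

lemma step_den_pos: "flat 0 x + flat 0 (1 - x) > 0"
  using flat_pos[of x 0] flat_pos[of "1 - x" 0] flat_nonneg[of 0 x] flat_nonneg[of 0 "1 - x"]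
  by (cases "x > 0") (linarith, smt (verit))

lemma smooth_step [smooth_intros]: "smooth f \<Longrightarrow> smooth (\<lambda>z. step (f z))"
  unfolding step_def by (intro smooth_intros step_den_pos)

lemma smooth_id: "smooth (\<lambda>x::real. x)" by (rule smooth_linear) (rule bounded_linear_ident)

lemma smooth_step': "smooth step" using smooth_step[OF smooth_id] .

lemma step_le0: "x \<le> 0 \<Longrightarrow> step x = 0" by (simp add: step_def flat_def)

lemma step_ge1: "x \<ge> 1 \<Longrightarrow> step x = 1"
  using flat_pos[of x 0] by (simp add: step_def flat_def powr_minus)

lemma step_bounds: "0 \<le> step x" "step x \<le> 1"
proof -
  have "step x = flat 0 x / (flat 0 x + flat 0 (1 - x))"
    using step_den_pos[of x] by (simp add: step_def powr_minus divide_inverse)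
  then show "0 \<le> step x" "step x \<le> 1"
    using step_den_pos[of x] flat_nonneg[of 0 x] flat_nonneg[of 0 "1 - x"] by (auto simp: divide_le_eq)
qed

lemma pd_locally_const:
  assumes "open U" "x \<in> U" "\<And>y. y \<in> U \<Longrightarrow> f y = c"
  shows "pd v f x = 0"
proof -
  have "(f has_derivative (\<lambda>_. 0)) (at x)"
    by (rule has_derivative_transform_within_open[of "\<lambda>_. c" "\<lambda>_. 0" x UNIV U]) (use assms in auto)
  then show ?thesis by (rule pd_eqI)
qed

definition deriv1 :: "(real \<Rightarrow> real) \<Rightarrow> real \<Rightarrow> real" where "deriv1 h = pd 1 h"

lemma smooth_deriv1: "smooth h \<Longrightarrow> smooth (deriv1 h)" unfolding deriv1_def by (rule smooth_pd)

lemma smooth_DERIV: "smooth h \<Longrightarrow> (h has_real_derivative deriv1 h x) (at x)"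
proof -
  assume h: "smooth h"
  have "pd v h x = deriv1 h x * v" for v
    using linear_scale[OF has_derivative_linear[OF smooth_has_derivative[OF h]], of v 1 x]
    by (simp add: deriv1_def)
  then have "(\<lambda>v. pd v h x) = (*) (deriv1 h x)" by auto
  then show ?thesis using smooth_has_derivative[OF h, of x] by (simp add: has_field_derivative_def)
qed

lemma deriv1_eqI: "(h has_real_derivative d) (at x) \<Longrightarrow> deriv1 h x = d"
  using pd_eqI[of h "(*) d" x 1] by (simp add: deriv1_def has_field_derivative_def)

lemma pd_compose1:
  assumes "smooth h" "smooth f"
  shows "pd v (\<lambda>z. h (f z)) = (\<lambda>z. deriv1 h (f z) * pd v f z)"
proof
  fix z
  have "(h has_derivative (\<lambda>v. deriv1 h (f z) * v)) (at (f z))"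
    using smooth_DERIV[OF assms(1), of "f z"] by (simp add: has_field_derivative_def)
  from has_derivative_compose[OF smooth_has_derivative[OF assms(2), of z] this]
  show "pd v (\<lambda>z. h (f z)) z = deriv1 h (f z) * pd v f z" by (rule pd_eqI)
qed

lemma deriv1_step_0: "x < 0 \<or> x > 1 \<Longrightarrow> deriv1 step x = 0"
  unfolding deriv1_def
  using pd_locally_const[of "{..<0}" x step 0 1] pd_locally_const[of "{1<..}" x step 1 1] step_le0 step_ge1
  by auto

lemma deriv1_step_bounded: "\<exists>B\<ge>0. \<forall>x. \<bar>deriv1 step x\<bar> \<le> B"
proof -
  have "compact (deriv1 step ` {0..1})"
    by (intro compact_continuous_image smooth_continuous smooth_deriv1 smooth_step') auto
  then obtain B where B: "\<And>x. x \<in> {0..1} \<Longrightarrow> \<bar>deriv1 step x\<bar> \<le> B"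
    using compact_imp_bounded bounded_iff by (metis imageI real_norm_def)
  have "\<bar>deriv1 step x\<bar> \<le> max B 0" for x
  proof (cases "x \<in> {0..1}")
    case True then show ?thesis using B[of x] by simp
  next
    case False then have "x < 0 \<or> x > 1" by auto
    then show ?thesis by (simp add: deriv1_step_0)
  qed
  then show ?thesis by (intro exI[of _ "max B 0"]) simp
qed

text \<open>The squared norm is used because it is smooth at the origin; the transition therefore
  takes place where |y|^2 lies between 1 and 2.\<close>

definition cut :: "real^3 \<Rightarrow> real" where "cut y = 1 - step ((norm y)\<^sup>2 - 1)"

lemma smooth_cut: "smooth cut"
  unfolding cut_def by (intro smooth_intros smooth_norm2)

lemma cut_1: "(norm y)\<^sup>2 \<le> 1 \<Longrightarrow> cut y = 1" by (simp add: cut_def step_le0)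
lemma cut_0: "(norm y)\<^sup>2 \<ge> 2 \<Longrightarrow> cut y = 0" by (simp add: cut_def step_ge1)
lemma cut_bounds: "0 \<le> cut y" "cut y \<le> 1" using step_bounds by (simp_all add: cut_def)

lemma test_cut: "test_function UNIV cut"
proof (rule test_functionI[of _ "cball 0 2", OF smooth_cut])
  show "cut x = 0" if "x \<notin> cball 0 2" for x
  proof (rule cut_0)
    have "(2::real)\<^sup>2 \<le> (norm x)\<^sup>2" using that by (intro power_mono) auto
    then show "(norm x)\<^sup>2 \<ge> 2" by simp
  qed
qed auto

section \<open>Iterated derivatives\<close>

definition pds :: "('i \<Rightarrow> 'a::real_normed_vector) \<Rightarrow> 'i list \<Rightarrow> ('a \<Rightarrow> real) \<Rightarrow> 'a \<Rightarrow> real" where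
  "pds e js f = foldr (\<lambda>j. pd (e j)) js f"

lemma pds_simps [simp]: "pds e [] f = f" "pds e (j # js) f = pd (e j) (pds e js f)"
  by (simp_all add: pds_def)

lemma smooth_pds [smooth_intros]: "smooth f \<Longrightarrow> smooth (pds e js f)"
  by (induction js) (auto intro: smooth_intros)

lemma test_pds: "test_function S f \<Longrightarrow> test_function S (pds e js f)"
  by (induction js) (auto intro: test_pd)

text \<open>The index set of the Leibniz rule: all ways to distribute a list of derivatives over two
  factors. The order is arranged so that the head puts every derivative on the second
  factor.\<close>

primrec splits :: "'i list \<Rightarrow> ('i list \<times> 'i list) list" where
  "splits [] = [([], [])]"
| "splits (v # vs) = map (\<lambda>p. (fst p, v # snd p)) (splits vs) @ map (\<lambda>p. (v # fst p, snd p)) (splits vs)"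

lemma splits_not_Nil: "splits vs \<noteq> []" by (induction vs) auto

lemma hd_splits: "hd (splits vs) = ([], vs)"
  by (induction vs) (auto simp: hd_append hd_map splits_not_Nil)

lemma tl_splits:
  "p \<in> set (tl (splits vs)) \<Longrightarrow> fst p \<noteq> [] \<and> length (fst p) \<le> length vs \<and> length (snd p) < length vs"
  "p \<in> set (splits vs) \<Longrightarrow> length (fst p) + length (snd p) = length vs"
proof (induction vs arbitrary: p)
  case (Cons v vs)
  {
    case 1
    then show ?case using Cons splits_not_Nil[of vs]
      by (cases "splits vs") (fastforce simp: hd_splits tl_append split: list.splits)+
  next
    case 2
    then show ?case using Cons by fastforce
  }
qed auto

lemma length_splits: "length (splits vs) = 2 ^ length vs" by (induction vs) auto

lemma sum_list_pd:
  fixes F :: "'p \<Rightarrow> 'a::real_normed_vector \<Rightarrow> real"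
  assumes "\<And>p. p \<in> set xs \<Longrightarrow> smooth (F p)"
  shows "pd v (\<lambda>z. \<Sum>p\<leftarrow>xs. F p z) = (\<lambda>z. \<Sum>p\<leftarrow>xs. pd v (F p) z) \<and> smooth (\<lambda>z. \<Sum>p\<leftarrow>xs. F p z)"
  using assms by (induction xs) (auto simp: pd_const pd_add intro: smooth_intros)

lemma pds_mult:
  assumes f: "smooth f" and g: "smooth g"
  shows "pds e vs (\<lambda>z. f z * g z) = (\<lambda>z. \<Sum>p\<leftarrow>splits vs. pds e (fst p) f z * pds e (snd p) g z)"
proof (induction vs)
  case (Cons v vs)
  have s: "smooth (\<lambda>z. pds e (fst p) f z * pds e (snd p) g z)" for p using f g by (intro smooth_intros)
  have "pds e (v # vs) (\<lambda>z. f z * g z) = (\<lambda>z. \<Sum>p\<leftarrow>splits vs. pd (e v) (\<lambda>z. pds e (fst p) f z * pds e (snd p) g z) z)"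
    using sum_list_pd[of "splits vs" "\<lambda>p z. pds e (fst p) f z * pds e (snd p) g z"] s by (simp add: Cons)
  also have "\<dots> = (\<lambda>z. \<Sum>p\<leftarrow>splits (v # vs). pds e (fst p) f z * pds e (snd p) g z)"
    using f g by (simp add: pd_mult smooth_pds sum_list_addf o_def)
  finally show ?case .
qed simp

text \<open>Of the Leibniz terms only the head leaves \<open>f\<close> undifferentiated. The others
  all carry a derivative of \<open>f\<close>, which for a cutoff function confines them to its
  transition region.\<close>

lemma pds_mult_error:
  assumes f: "smooth f" and g: "smooth g" and C: "0 \<le> C"
    and FG: "\<And>js ks. js \<noteq> [] \<Longrightarrow> length js \<le> length vs \<Longrightarrow> length ks < length vs \<Longrightarrow>
      \<bar>pds e js f z * pds e ks g z\<bar> \<le> C"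
  shows "\<bar>pds e vs (\<lambda>z. f z * g z) z - f z * pds e vs g z\<bar> \<le> 2 ^ length vs * C"
proof -
  have eq: "splits vs = ([], vs) # tl (splits vs)"
    using hd_splits[of vs] splits_not_Nil[of vs] by (metis list.collapse)
  have "pds e vs (\<lambda>z. f z * g z) z = f z * pds e vs g z + (\<Sum>p\<leftarrow>tl (splits vs). pds e (fst p) f z * pds e (snd p) g z)"
    unfolding pds_mult[OF f g] by (subst eq) simp
  moreover have "\<bar>\<Sum>p\<leftarrow>tl (splits vs). pds e (fst p) f z * pds e (snd p) g z\<bar> \<le> (\<Sum>p\<leftarrow>tl (splits vs). \<bar>pds e (fst p) f z * pds e (snd p) g z\<bar>)"
    using sum_list_abs[of "map (\<lambda>p. pds e (fst p) f z * pds e (snd p) g z) (tl (splits vs))"] by (simp add: o_def)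
  moreover have "(\<Sum>p\<leftarrow>tl (splits vs). \<bar>pds e (fst p) f z * pds e (snd p) g z\<bar>) \<le> (\<Sum>p\<leftarrow>tl (splits vs). C)"
    by (rule sum_list_mono) (metis FG tl_splits(1))
  moreover have "(\<Sum>p\<leftarrow>tl (splits vs). C) \<le> 2 ^ length vs * C"
    using C by (simp add: sum_list_triv length_splits mult_right_mono)
  ultimately show ?thesis by linarith
qed

text \<open>Order four is what \<open>lap (bheat W)\<close> requires. There are finitely many index
  lists, so a maximum exists; off the annulus \<open>cut\<close> is locally constant and all its
  derivatives vanish.\<close>

lemma cut_derivatives:
  "\<exists>N\<ge>0. \<forall>js y. js \<noteq> [] \<longrightarrow> length js \<le> 4 \<longrightarrow>
     \<bar>pds (\<lambda>j::3. axis j 1) js cut y\<bar> \<le> N \<and> (pds (\<lambda>j. axis j 1) js cut y \<noteq> 0 \<longrightarrow> 1 \<le> (norm y)\<^sup>2 \<and> (norm y)\<^sup>2 \<le> 2)"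
proof -
  let ?L = "{js :: 3 list. set js \<subseteq> UNIV \<and> length js \<le> 4}"
  have fin: "finite ?L" by (rule finite_lists_length_le) simp
  have "\<forall>js. \<exists>N. \<forall>y. \<bar>pds (\<lambda>j::3. axis j 1) js cut y\<bar> \<le> N"
    using test_bounded[OF test_pds[OF test_cut]] by (metis real_norm_def)
  then obtain N where N: "\<And>js y. \<bar>pds (\<lambda>j::3. axis j 1) js cut y\<bar> \<le> N js" by metis
  have "\<bar>pds (\<lambda>j::3. axis j 1) js cut y\<bar> \<le> max 0 (Max (N ` ?L))" if "length js \<le> 4" for js y
  proof -
    have "N js \<le> Max (N ` ?L)" using fin that by (intro Max_ge) auto
    then show ?thesis using N[of js y] by linarith
  qed
  moreover have "1 \<le> (norm y)\<^sup>2 \<and> (norm y)\<^sup>2 \<le> 2" if nz: "pds (\<lambda>j::3. axis j 1) js cut y \<noteq> 0" and "js \<noteq> []" for js y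
  proof (rule ccontr)
    have op: "open {y::real^3. (norm y)\<^sup>2 < 1}" "open {y::real^3. 2 < (norm y)\<^sup>2}"
      by (intro open_Collect_less continuous_intros)+
    assume "\<not> (1 \<le> (norm y)\<^sup>2 \<and> (norm y)\<^sup>2 \<le> 2)"
    then have "\<exists>U c. open U \<and> y \<in> U \<and> (\<forall>w\<in>U. cut w = c)"
      using op cut_1 cut_0 by (cases "(norm y)\<^sup>2 < 1") (force intro: less_imp_le)+
    then obtain U c where U: "open U" "y \<in> U" "\<And>w. w \<in> U \<Longrightarrow> cut w = c" by blast
    have "\<exists>c. \<forall>w\<in>U. pds (\<lambda>j::3. axis j 1) js cut w = c \<and> (js \<noteq> [] \<longrightarrow> c = 0)" for js
    proof (induction js)
      case Nil then show ?case using U by auto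
    next
      case (Cons j js)
      then obtain c where c: "\<And>w. w \<in> U \<Longrightarrow> pds (\<lambda>j::3. axis j 1) js cut w = c" by blast
      have "pd (axis j 1) (pds (\<lambda>j::3. axis j 1) js cut) w = 0" if "w \<in> U" for w
        by (rule pd_locally_const[OF U(1) that c])
      then show ?case by auto
    qed
    then show False using nz U \<open>js \<noteq> []\<close> by blast
  qed
  ultimately show ?thesis by (intro exI[of _ "max 0 (Max (N ` ?L))"]) auto
qed

section \<open>The heat kernel\<close>

text \<open>A single term of the exponential series. It serves to trade powers of the inverse time
  for a part of the Gaussian decay.\<close>

lemma power_le_fact_exp: "x \<ge> 0 \<Longrightarrow> x ^ n \<le> fact n * exp (x::real)"
proof -
  assume x: "x \<ge> 0"
  have s: "(\<lambda>n. x ^ n / fact n) sums exp x" using exp_converges[of x] by (simp add: divide_inverse mult.commute)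
  have "sum (\<lambda>n. x ^ n / fact n) {n} \<le> (\<Sum>n. x ^ n / fact n)"
    using s x by (intro sum_le_suminf) (auto simp: sums_iff)
  then have "x ^ n / fact n \<le> exp x" using s by (simp add: sums_iff)
  then show ?thesis by (simp add: field_simps)
qed

text \<open>Here \<open>lam\<close> is a positive smooth function that agrees with \<open>s - \<tau>\<close> on the support of the time
  cutoff \<open>th\<close>; this keeps the heat kernel \<open>P\<close> smooth on all of space-time.\<close>

locale heat_test =
  fixes x0 :: "real^3" and lam th :: "real \<Rightarrow> real"
  assumes lam: "smooth lam" and lam_pos: "\<And>r. lam r > 0" and th: "smooth th"
    and lam_th: "\<And>r. th r \<noteq> 0 \<Longrightarrow> deriv1 lam r = -1"
begin

definition Y :: "3 \<Rightarrow> (real^3) \<times> real \<Rightarrow> real" where "Y i z = fst z $ i - x0 $ i"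
definition mu :: "(real^3) \<times> real \<Rightarrow> real" where "mu z = lam (snd z) powr (-1)"
text \<open>The Gaussian heat kernel at elapsed time \<open>lam\<close>, without the factor (4
  pi)^(-3/2).\<close>

definition P :: "(real^3) \<times> real \<Rightarrow> real" where
  "P z = lam (snd z) powr (-3/2) * exp (- (1/4) * (mu z * (\<Sum>i\<in>UNIV. Y i z * Y i z)))"
definition A :: "(real^3) \<times> real \<Rightarrow> real" where "A z = cut (fst z - x0)"
definition W :: "(real^3) \<times> real \<Rightarrow> real" where "W z = A z * (th (snd z) * P z)"

lemma sum_Y: "(\<Sum>i\<in>UNIV. Y i z * Y i z) = (norm (fst z - x0))\<^sup>2"
  by (simp add: Y_def power2_norm_eq_inner inner_vec_def)

lemma Y_props: "smooth (Y i)" "pd (ex j) (Y i) = (\<lambda>z. if i = j then 1 else 0)" "pd et (Y i) = (\<lambda>z. 0)"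
proof -
  have L: "bounded_linear (\<lambda>z::(real^3) \<times> real. fst z $ i)"
    using bounded_linear_compose[OF bounded_linear_vec_nth bounded_linear_fst] .
  note S = smooth_linear[OF L]
  show "smooth (Y i)" unfolding Y_def[abs_def] by (intro smooth_intros S)
  have "pd v (Y i) = (\<lambda>z. fst v $ i)" for v
    unfolding Y_def[abs_def] by (simp add: pd_diff[OF S smooth_basic(1)] pd_linear[OF L] pd_const)
  then show "pd (ex j) (Y i) = (\<lambda>z. if i = j then 1 else 0)" "pd et (Y i) = (\<lambda>z. 0)"
    by (auto simp: ex_def et_def axis_def)
qed

lemma snd_props:
  assumes "smooth h"
  shows "smooth (\<lambda>z::(real^3) \<times> real. h (snd z))" "pd (ex j) (\<lambda>z. h (snd z)) = (\<lambda>z. 0)"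
    "pd et (\<lambda>z. h (snd z)) = (\<lambda>z. deriv1 h (snd z))"
proof -
  have L: "bounded_linear (snd :: (real^3) \<times> real \<Rightarrow> real)" by (rule bounded_linear_snd)
  note a = smooth_affine[OF assms L, where c=0]
  show "smooth (\<lambda>z::(real^3) \<times> real. h (snd z))" using a(1) by simp
  show "pd (ex j) (\<lambda>z. h (snd z)) = (\<lambda>z. 0)" "pd et (\<lambda>z. h (snd z)) = (\<lambda>z. deriv1 h (snd z))"
    using pd_compose1[OF assms smooth_linear[OF L]] by (auto simp: pd_linear[OF L] ex_def et_def)
qed

lemma smooth_mu: "smooth mu" unfolding mu_def[abs_def] by (intro smooth_intros snd_props lam lam_pos)

lemma smooth_P: "smooth P" unfolding P_def[abs_def] by (intro smooth_intros snd_props lam lam_pos smooth_mu Y_props)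

lemma mu_props: "pd (ex j) mu = (\<lambda>z. 0)" "pd et mu = (\<lambda>z. - (mu z * mu z * deriv1 lam (snd z)))" "mu z > 0"
proof -
  note s = snd_props(1)[OF lam]
  show "mu z > 0" using lam_pos[of "snd z"] by (simp add: mu_def)
  show "pd (ex j) mu = (\<lambda>z. 0)"
    unfolding mu_def[abs_def] by (subst pd_powr[OF s lam_pos]) (simp add: snd_props[OF lam])
  have "lam r powr (-2) = lam r powr (-1) * lam r powr (-1)" for r by (subst powr_add[symmetric]) simp
  then show "pd et mu = (\<lambda>z. - (mu z * mu z * deriv1 lam (snd z)))"
    unfolding mu_def[abs_def] by (subst pd_powr[OF s lam_pos]) (simp add: snd_props[OF lam])
qed

lemma P_deriv1: "pd (ex i) P = (\<lambda>z. (-(1/2) * (mu z * Y i z)) * P z)"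
proof -
  note s = snd_props(1)[OF lam]
  have 1: "smooth (\<lambda>z::(real^3) \<times> real. lam (snd z) powr (-3/2) :: real)" "pd (ex i) (\<lambda>z. lam (snd z) powr (-3/2)) = (\<lambda>z. 0)"
    by (intro smooth_intros s lam_pos) (subst pd_powr[OF s lam_pos], simp add: snd_props[OF lam])
  have 2: "smooth (\<lambda>z. \<Sum>i\<in>UNIV. Y i z * Y i z)" "pd (ex i) (\<lambda>z. \<Sum>i\<in>UNIV. Y i z * Y i z) = (\<lambda>z. 2 * Y i z)"
    by (intro smooth_intros Y_props) (subst pd_sum, auto intro!: smooth_intros Y_props simp: pd_mult Y_props if_distrib[of "\<lambda>c. _ * c"] if_distrib[of "\<lambda>c. c * _"] sum.distrib cong: if_cong)
  have 3: "smooth (\<lambda>z. - (1/4) * (mu z * (\<Sum>i\<in>UNIV. Y i z * Y i z)))"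
    "pd (ex i) (\<lambda>z. - (1/4) * (mu z * (\<Sum>i\<in>UNIV. Y i z * Y i z))) = (\<lambda>z. - (1/4) * (mu z * (2 * Y i z)))"
    by (intro smooth_intros 2 smooth_mu)
       (subst pd_mult, auto intro!: smooth_intros 2 smooth_mu simp: pd_mult[OF smooth_mu 2(1)] 2(2) mu_props pd_const)
  show ?thesis
    unfolding P_def[abs_def] pd_mult[OF 1(1) smooth_basic(5)[OF 3(1)]] pd_exp[OF 3(1)] 1(2) 3(2) by auto
qed

lemma P_deriv2: "pd (ex j) (pd (ex i) P) = (\<lambda>z. ((1/4) * (mu z * mu z * (Y i z * Y j z)) - (1/2) * (mu z * (if i = j then 1 else 0))) * P z)"
proof -
  have 1: "smooth (\<lambda>z. -(1/2) * (mu z * Y i z))" "pd (ex j) (\<lambda>z. -(1/2) * (mu z * Y i z)) = (\<lambda>z. -(1/2) * (mu z * (if i = j then 1 else 0)))"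
    by (intro smooth_intros smooth_mu Y_props)
       (subst pd_mult, auto intro!: smooth_intros smooth_mu Y_props simp: pd_mult[OF smooth_mu Y_props(1)] mu_props Y_props pd_const)
  show ?thesis unfolding P_deriv1 pd_mult[OF 1(1) smooth_P] 1(2) by (auto simp: algebra_simps)
qed

lemma P_deriv3: "pd (ex k) (pd (ex j) (pd (ex i) P)) = (\<lambda>z. (-(1/8) * (mu z * mu z * mu z * (Y i z * Y j z * Y k z))
    + (1/4) * (mu z * mu z * ((if i = k then Y j z else 0) + (if j = k then Y i z else 0) + (if i = j then Y k z else 0)))) * P z)"
proof -
  note si = smooth_intros smooth_mu Y_props
  have 1: "pd (ex k) (\<lambda>z. Y i z * Y j z) = (\<lambda>z. (if i = k then Y j z else 0) + (if j = k then Y i z else 0))"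
    by (subst pd_mult) (auto intro!: si simp: Y_props)
  have 2: "pd (ex k) (\<lambda>z. mu z * mu z * (Y i z * Y j z)) = (\<lambda>z. mu z * mu z * ((if i = k then Y j z else 0) + (if j = k then Y i z else 0)))"
    by (subst pd_mult) (auto intro!: si simp: pd_mult[OF smooth_mu smooth_mu] mu_props 1)
  have 3: "pd (ex k) (\<lambda>z. (1/4) * (mu z * mu z * (Y i z * Y j z))) = (\<lambda>z. (1/4) * (mu z * mu z * ((if i = k then Y j z else 0) + (if j = k then Y i z else 0))))"
    by (subst pd_mult) (auto intro!: si simp: 2 pd_const)
  have 4: "pd (ex k) (\<lambda>z. (1/2) * (mu z * (if i = j then 1 else 0))) = (\<lambda>z. 0)"
    by (subst pd_mult) (auto intro!: si simp: pd_mult[OF smooth_mu smooth_basic(1)] mu_props pd_const)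
  have 7: "smooth (\<lambda>z. (1/4) * (mu z * mu z * (Y i z * Y j z)))" by (intro si)
  have 8: "smooth (\<lambda>z. (1/2) * (mu z * (if i = j then 1 else 0)))" by (intro si)
  have 5: "pd (ex k) (\<lambda>z. (1/4) * (mu z * mu z * (Y i z * Y j z)) - (1/2) * (mu z * (if i = j then 1 else 0)))
    = (\<lambda>z. (1/4) * (mu z * mu z * ((if i = k then Y j z else 0) + (if j = k then Y i z else 0))))"
    unfolding pd_diff[OF 7 8] 3 4 by simp
  have 6: "smooth (\<lambda>z. (1/4) * (mu z * mu z * (Y i z * Y j z)) - (1/2) * (mu z * (if i = j then 1 else 0)))"
    by (intro si)
  show ?thesis by (subst P_deriv2, subst pd_mult[OF 6 smooth_P], subst 5, subst P_deriv1) (auto simp: algebra_simps)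
qed

lemma lap_P: "lap P = (\<lambda>z. ((1/4) * (mu z * mu z * (norm (fst z - x0))\<^sup>2) - (3/2) * mu z) * P z)"
proof
  fix z
  have "lap P z = (\<Sum>i\<in>UNIV. ((1/4) * (mu z * mu z * (Y i z * Y i z)) - (1/2) * mu z) * P z)"
    by (simp add: lap_def P_deriv2)
  also have "\<dots> = ((1/4) * (mu z * mu z * (\<Sum>i\<in>UNIV. Y i z * Y i z)) - (3/2) * mu z) * P z"
    by (simp add: sum_3 algebra_simps)
  finally show "lap P z = ((1/4) * (mu z * mu z * (norm (fst z - x0))\<^sup>2) - (3/2) * mu z) * P z" by (simp add: sum_Y)
qed

text \<open>As a function of space and of \<open>lam\<close> the kernel solves the heat equation,
  and the chain rule contributes \<open>deriv1 lam\<close>. Where \<open>th\<close> is nonzero this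
  factor is -1, so \<open>P\<close> solves the backward equation there.\<close>

lemma P_time: "pd et P = (\<lambda>z. deriv1 lam (snd z) * lap P z)"
proof -
  note s = snd_props(1)[OF lam]
  have pw: "lam r powr (-3/2 - 1) = lam r powr (-1) * lam r powr (-3/2)" for r by (subst powr_add[symmetric]) simp
  have 1: "smooth (\<lambda>z::(real^3) \<times> real. lam (snd z) powr (-3/2) :: real)"
     "pd et (\<lambda>z. lam (snd z) powr (-3/2)) = (\<lambda>z. -3/2 * (mu z * lam (snd z) powr (-3/2)) * deriv1 lam (snd z))"
    by (intro smooth_intros s lam_pos) (subst pd_powr[OF s lam_pos], unfold pw snd_props(3)[OF lam] mu_def, simp)
  have 2: "smooth (\<lambda>z. \<Sum>i\<in>UNIV. Y i z * Y i z)" "pd et (\<lambda>z. \<Sum>i\<in>UNIV. Y i z * Y i z) = (\<lambda>z. 0)"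
    by (intro smooth_intros Y_props) (subst pd_sum, auto intro!: smooth_intros Y_props simp: pd_mult Y_props)
  have 3: "smooth (\<lambda>z. - (1/4) * (mu z * (\<Sum>i\<in>UNIV. Y i z * Y i z)))"
    "pd et (\<lambda>z. - (1/4) * (mu z * (\<Sum>i\<in>UNIV. Y i z * Y i z))) = (\<lambda>z. (1/4) * (mu z * mu z * deriv1 lam (snd z) * (\<Sum>i\<in>UNIV. Y i z * Y i z)))"
    by (intro smooth_intros 2 smooth_mu)
       (subst pd_mult, auto intro!: smooth_intros 2 smooth_mu simp: pd_mult[OF smooth_mu 2(1)] 2(2) mu_props pd_const)
  show ?thesis
    unfolding lap_P sum_Y[symmetric] unfolding P_def[abs_def] pd_mult[OF 1(1) smooth_basic(5)[OF 3(1)]] pd_exp[OF 3(1)] 1(2) 3(2)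
    by (auto simp: algebra_simps)
qed

end

section \<open>Size of the kernel derivatives, with and without cutoffs\<close>

lemma pds_append: "pds e (js @ ks) f = pds e js (pds e ks f)" by (simp add: pds_def)

lemma pds_sum:
  assumes "\<And>i. i \<in> I \<Longrightarrow> smooth (f i)"
  shows "pds e js (\<lambda>z. \<Sum>i\<in>I. f i z) = (\<lambda>z. \<Sum>i\<in>I. pds e js (f i) z)"
  by (induction js) (use assms in \<open>auto simp: pd_sum smooth_pds\<close>)

lemma pds_diff:
  assumes "smooth f" "smooth g"
  shows "pds e js (\<lambda>z. f z - g z) = (\<lambda>z. pds e js f z - pds e js g z)"
  by (induction js) (use assms in \<open>auto simp: pd_diff smooth_pds\<close>)

lemma lap_pds: "lap f = (\<lambda>z. \<Sum>l\<in>UNIV. pds ex [l, l] f z)" by (simp add: lap_def)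

text \<open>122880 is \<open>4 ^ 5 * fact 5\<close>, from absorbing a fifth power of
  \<open>1 + mu\<close> into the exponential of a quarter of it. Likewise 128 in
  \<open>kernel_const\<close> is \<open>8 ^ 2 * fact 2\<close>, from a second power absorbed at rate
  1/8.\<close>

definition annulus_const :: real where "annulus_const = 122880 * exp (1/4)"
definition kernel_const :: real where "kernel_const = 128 * exp (1/8)"

lemma annulus_const_nonneg: "annulus_const \<ge> 0" by (simp add: annulus_const_def)
lemma kernel_const_nonneg: "kernel_const \<ge> 0" by (simp add: kernel_const_def)

context heat_test
begin

definition q :: "(real^3) \<times> real \<Rightarrow> real" where "q z = (norm (fst z - x0))\<^sup>2"

lemma Y_le: "\<bar>Y i z\<bar> \<le> sqrt (q z)"
  unfolding q_def Y_def using component_le_norm_cart[of "fst z - x0" i] by simp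

lemma P_mu: "P z = mu z powr (3/2) * exp (- (1/4) * (mu z * q z))"
proof -
  have "lam (snd z) powr (-3/2) = mu z powr (3/2)" unfolding mu_def powr_powr by simp
  then show ?thesis by (simp add: P_def sum_Y q_def)
qed

lemma P_pos: "P z > 0" using mu_props(3)[of z] by (simp add: P_mu)

lemma pds_le3_cases:
  assumes "length js \<le> 3"
  obtains "js = []" | i where "js = [i]" | i j where "js = [j, i]" | i j k where "js = [k, j, i]"
  using assms by (auto simp: le_Suc_eq numeral_3_eq_3 length_Suc_conv)

text \<open>At distance at least 1 from the centre the factor exp(-mu/4) beats every power of
  \<open>mu\<close>: three derivatives cost at most (1 + mu)^3 and the prefactor at most (1 + mu)^2.
  Hence the bound is uniform in \<open>lam\<close>, even as the elapsed time tends to 0, and this is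
  why cutting off in space is harmless.\<close>

lemma P_annulus:
  assumes len: "length js \<le> 3" and ann: "1 \<le> q z" "q z \<le> 2"
  shows "\<bar>pds ex js P z\<bar> \<le> annulus_const"
proof -
  let ?m = "mu z"
  have m: "?m > 0" by (rule mu_props)
  have Y2: "\<bar>Y i z\<bar> \<le> 2" for i
  proof -
    have "sqrt (q z) \<le> sqrt 4" using ann by (intro real_sqrt_le_mono) simp
    then show ?thesis using Y_le[of i z] by simp
  qed
  have YY: "\<bar>Y i z * Y j z\<bar> \<le> 4" for i j
    using mult_mono[OF Y2[of i] Y2[of j]] by (simp add: abs_mult)
  have YYY: "\<bar>Y i z * Y j z * Y k z\<bar> \<le> 8" for i j k
    using mult_mono[OF YY[of i j] Y2[of k]] by (simp add: abs_mult)
  have c: "\<bar>pds ex js P z\<bar> \<le> (1 + ?m) ^ 3 * P z"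
  proof -
    have "\<exists>c. pds ex js P z = c * P z \<and> \<bar>c\<bar> \<le> (1 + ?m) ^ 3"
      using len
    proof (cases rule: pds_le3_cases)
      case 1 then show ?thesis using m by (intro exI[of _ 1]) auto
    next
      case (2 i)
      have "\<bar>- (1/2) * (?m * Y i z)\<bar> = (1/2) * (?m * \<bar>Y i z\<bar>)" using m by (simp add: abs_mult)
      also have "\<dots> \<le> (1/2) * (?m * 2)" using m Y2 by (intro mult_left_mono) auto
      also have "\<dots> \<le> (1 + ?m) ^ 3" using m by (simp add: power3_eq_cube algebra_simps)
      finally show ?thesis using 2 by (intro exI[of _ "- (1/2) * (?m * Y i z)"]) (simp add: P_deriv1)
    next
      case (3 i j)
      have "\<bar>(1/4) * (?m * ?m * (Y i z * Y j z)) - (1/2) * (?m * (if i = j then 1 else 0))\<bar> \<le> (1/4) * (?m * ?m * \<bar>Y i z * Y j z\<bar>) + (1/2) * ?m"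
        using m by (intro order_trans[OF abs_triangle_ineq4] add_mono) (auto simp: abs_mult)
      also have "\<dots> \<le> (1/4) * (?m * ?m * 4) + (1/2) * ?m" using m YY by (intro add_mono mult_left_mono) auto
      also have "\<dots> \<le> (1 + ?m) ^ 3" using m by (simp add: power3_eq_cube algebra_simps)
      finally show ?thesis using 3
        by (intro exI[of _ "(1/4) * (?m * ?m * (Y i z * Y j z)) - (1/2) * (?m * (if i = j then 1 else 0))"]) (simp only: pds_simps P_deriv2)
    next
      case (4 i j k)
      let ?s = "(if i = k then Y j z else 0) + (if j = k then Y i z else 0) + (if i = j then Y k z else 0)"
      have s: "\<bar>?s\<bar> \<le> 6" using Y2[of i] Y2[of j] Y2[of k] by auto
      have "\<bar>-(1/8) * (?m * ?m * ?m * (Y i z * Y j z * Y k z)) + (1/4) * (?m * ?m * ?s)\<bar> \<le> (1/8) * (?m * ?m * ?m * \<bar>Y i z * Y j z * Y k z\<bar>) + (1/4) * (?m * ?m * \<bar>?s\<bar>)"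
        using m by (intro order_trans[OF abs_triangle_ineq] add_mono) (auto simp: abs_mult)
      also have "\<dots> \<le> (1/8) * (?m * ?m * ?m * 8) + (1/4) * (?m * ?m * 6)" using m YYY s by (intro add_mono mult_left_mono) auto
      also have "\<dots> \<le> (1 + ?m) ^ 3" using m by (simp add: power3_eq_cube algebra_simps)
      finally show ?thesis using 4
        by (intro exI[of _ "-(1/8) * (?m * ?m * ?m * (Y i z * Y j z * Y k z)) + (1/4) * (?m * ?m * ?s)"]) (simp only: pds_simps P_deriv3)
    qed
    then show ?thesis using P_pos[of z] by (auto simp: abs_mult intro!: mult_right_mono)
  qed
  have "P z \<le> (1 + ?m) ^ 2 * exp (- (1/4) * ?m)"
  proof -
    have "?m powr (3/2) \<le> (1 + ?m) powr (3/2)" using m by (intro powr_mono2) auto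
    also have "\<dots> \<le> (1 + ?m) powr 2" using m by (intro powr_mono) auto
    also have "\<dots> = (1 + ?m) ^ 2" using m by simp
    finally have a: "?m powr (3/2) \<le> (1 + ?m) ^ 2" .
    have "?m * 1 \<le> ?m * q z" using m ann by (intro mult_left_mono) auto
    then have b: "exp (- (1/4) * (?m * q z)) \<le> exp (- (1/4) * ?m)" by simp
    show ?thesis unfolding P_mu by (rule mult_mono[OF a b]) auto
  qed
  then have "(1 + ?m) ^ 3 * P z \<le> (1 + ?m) ^ 3 * ((1 + ?m) ^ 2 * exp (- (1/4) * ?m))"
    using m by (intro mult_left_mono) auto
  also have "\<dots> = 1024 * ((1 + ?m) / 4) ^ 5 * exp (- (1/4) * ?m)"
    by (simp add: power_divide eval_nat_numeral)
  also have "\<dots> \<le> 1024 * (fact 5 * exp ((1 + ?m) / 4)) * exp (- (1/4) * ?m)"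
    using m by (intro mult_right_mono mult_left_mono power_le_fact_exp) auto
  also have "\<dots> = annulus_const"
  proof -
    have "exp ((1 + ?m) / 4) * exp (- (1/4) * ?m) = exp (1/4)" by (simp add: exp_add[symmetric] add_divide_distrib)
    then show ?thesis by (simp add: annulus_const_def fact_numeral)
  qed
  finally show ?thesis using c by linarith
qed

text \<open>Parabolic scaling: with r the root of \<open>mu\<close> and w = r |x - x0|, the third
  derivative is r^3 times a cubic polynomial in w times the kernel, which has a further r^3. Half of
  the Gaussian exponent pays for the polynomial, so the rate drops from 1/4 to 1/8.\<close>

lemma P3_bound: "\<bar>pds ex [k, j, i] P z\<bar> \<le> kernel_const * mu z ^ 3 * exp (- (1/8) * (mu z * q z))"
proof -
  let ?m = "mu z" and ?v = "mu z * q z"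
  define r where "r = sqrt ?m"
  have m: "?m > 0" by (rule mu_props)
  have r: "r > 0" "?m = r * r" using m by (auto simp: r_def)
  have q0: "q z \<ge> 0" by (simp add: q_def)
  define w where "w = sqrt ?v"
  have w: "w \<ge> 0" "w * w = ?v" using m q0 by (auto simp: w_def)
  have wr: "w = r * sqrt (q z)" by (simp add: w_def r_def real_sqrt_mult)
  have rY: "\<bar>r * Y i z\<bar> \<le> w" for i
    using mult_left_mono[OF Y_le[of i z], of r] r(1) by (simp add: wr abs_mult)
  have rYYY: "\<bar>(r * Y i z) * (r * Y j z) * (r * Y k z)\<bar> \<le> w * w * w" for i j k
    unfolding abs_mult[of "_ * _"] abs_mult[of "r * Y i z"] by (intro mult_mono rY) (use w(1) in auto)
  let ?s = "(if i = k then Y j z else 0) + (if j = k then Y i z else 0) + (if i = j then Y k z else 0)"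
  have s: "\<bar>r * ?s\<bar> \<le> 3 * w" using rY[of i] rY[of j] rY[of k] w by (auto simp: distrib_left)
  let ?c = "-(1/8) * (?m * ?m * ?m * (Y i z * Y j z * Y k z)) + (1/4) * (?m * ?m * ?s)"
  have "?c = (r * r * r) * (-(1/8) * ((r * Y i z) * (r * Y j z) * (r * Y k z)) + (1/4) * (r * ?s))"
    unfolding r(2) by (simp add: algebra_simps)
  also have "\<bar>\<dots>\<bar> \<le> (r * r * r) * ((1/8) * (w * w * w) + (1/4) * (3 * w))"
  proof -
    have t: "\<bar>-(1/8) * X + (1/4) * Z\<bar> \<le> (1/8) * x + (1/4) * z" if "\<bar>X\<bar> \<le> x" "\<bar>Z\<bar> \<le> z" for X Z x z :: real
      using that by linarith
    show ?thesis
      unfolding abs_mult[of "r * r * r"] using r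
      by (subst abs_of_pos[of "r * r * r"]) (simp_all only: mult_pos_pos mult_left_mono[OF t[OF rYYY s]] less_imp_le)
  qed
  also have "\<dots> \<le> (r * r * r) * (1 + ?v) ^ 2"
  proof -
    have w1: "w \<le> 1 + ?v" using w zero_le_power2[of "w - 1/2"] by (simp add: power2_eq_square algebra_simps)
    have v0: "0 \<le> ?v" using w by (metis zero_le_square)
    have "w * w * w \<le> (1 + ?v) * (1 + ?v)" unfolding w(2) using w1 v0 w by (intro mult_mono) auto
    moreover have "w \<le> (1 + ?v) * (1 + ?v)" using w1 v0 mult_mono[of 1 "1 + ?v" w "1 + ?v"] w(1) by auto
    ultimately have "(1/8) * (w * w * w) + (1/4) * (3 * w) \<le> (1 + ?v) ^ 2"
      using w(1) by (simp add: power2_eq_square)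
    then show ?thesis using r by (intro mult_left_mono) auto
  qed
  finally have c: "\<bar>?c\<bar> \<le> (r * r * r) * (1 + ?v) ^ 2" .
  have "?m powr (3/2) = r * r * r"
  proof -
    have "r = ?m powr (1/2)" using m by (simp add: r_def powr_half_sqrt)
    then have "r * r * r = ?m powr (1/2 + 1/2 + 1/2)" by (simp only: powr_add)
    then show ?thesis by simp
  qed
  then have P: "P z = r * r * r * exp (- (1/4) * ?v)" by (simp add: P_mu)
  have v0: "0 \<le> ?v" using w by (metis zero_le_square)
  have "\<bar>pds ex [k, j, i] P z\<bar> = \<bar>?c\<bar> * P z" using P_pos[of z] by (simp only: pds_simps P_deriv3 abs_mult abs_of_pos)
  also have "\<dots> \<le> (r * r * r) * (1 + ?v) ^ 2 * (r * r * r * exp (- (1/4) * ?v))"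
    unfolding P by (rule mult_right_mono[OF c]) (use r in auto)
  also have "\<dots> = ?m ^ 3 * (64 * ((1 + ?v) / 8) ^ 2 * exp (- (1/4) * ?v))"
    unfolding r(2) by (simp add: power_divide eval_nat_numeral)
  also have "\<dots> \<le> ?m ^ 3 * (64 * (fact 2 * exp ((1 + ?v) / 8)) * exp (- (1/4) * ?v))"
    using m v0 by (intro mult_left_mono mult_right_mono power_le_fact_exp) auto
  also have "\<dots> = kernel_const * ?m ^ 3 * exp (- (1/8) * ?v)"
  proof -
    have "exp ((1 + ?v) / 8) * exp (- (1/4) * ?v) = exp (1/8) * exp (- (1/8) * ?v)"
      by (simp add: exp_add[symmetric] add_divide_distrib)
    then show ?thesis by (simp add: kernel_const_def fact_numeral mult_ac)
  qed
  finally show ?thesis .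
qed

text \<open>The factor of \<open>W\<close> that depends on the kernel and the time cutoff; the
  spatial cutoff \<open>A\<close> is kept apart for the Leibniz estimates.\<close>

definition G :: "(real^3) \<times> real \<Rightarrow> real" where "G z = th (snd z) * P z"

lemma smooth_G: "smooth G" unfolding G_def[abs_def] by (intro smooth_intros snd_props th smooth_P)

lemma pds_time_mult:
  assumes "smooth h" "smooth f"
  shows "pds ex js (\<lambda>z. h (snd z) * f z) = (\<lambda>z. h (snd z) * pds ex js f z)"
proof (induction js)
  case (Cons j js)
  show ?case
    by (simp add: Cons pd_mult[OF snd_props(1)[OF assms(1)] smooth_pds[OF assms(2)]] snd_props(2)[OF assms(1)])
qed simp

lemma pds_G: "pds ex js G = (\<lambda>z. th (snd z) * pds ex js P z)"
  unfolding G_def[abs_def] by (rule pds_time_mult[OF th smooth_P])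

lemma G_time: "pd et G = (\<lambda>z. deriv1 th (snd z) * P z - th (snd z) * lap P z)"
proof
  fix z
  have "pd et G z = th (snd z) * (deriv1 lam (snd z) * lap P z) + deriv1 th (snd z) * P z"
    unfolding G_def[abs_def] by (simp add: pd_mult[OF snd_props(1)[OF th] smooth_P] snd_props(3)[OF th] P_time)
  then show "pd et G z = deriv1 th (snd z) * P z - th (snd z) * lap P z"
    using lam_th[of "snd z"] by (cases "th (snd z) = 0") auto
qed

text \<open>The kernel itself is annihilated where \<open>th\<close> is nonzero, so only the
  derivative of the time cutoff remains. This produces the boundary layers on the linear
  side.\<close>

lemma bheat_G: "bheat G = (\<lambda>z. deriv1 th (snd z) * P z)"
  unfolding bheat_def lap_pds[of G] pds_G G_time by (simp add: lap_pds[of P] sum_distrib_left)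

lemma pds_G_time: "pds ex js (pd et G) z = deriv1 th (snd z) * pds ex js P z - th (snd z) * (\<Sum>i\<in>UNIV. pds ex (js @ [i, i]) P z)"
proof -
  have 1: "smooth (\<lambda>z. deriv1 th (snd z) * P z)" by (intro smooth_intros snd_props smooth_deriv1 th smooth_P)
  have 2: "smooth (\<lambda>z. th (snd z) * lap P z)" by (intro smooth_intros snd_props th smooth_P)
  have 3: "pds ex js (lap P) = (\<lambda>z. \<Sum>i\<in>UNIV. pds ex (js @ [i, i]) P z)"
    unfolding lap_pds pds_append by (rule pds_sum) (intro smooth_pds smooth_P)
  show ?thesis
    unfolding G_time pds_diff[OF 1 2] pds_time_mult[OF smooth_deriv1[OF th] smooth_P] pds_time_mult[OF th smooth_lap[OF smooth_P]] 3 ..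
qed

lemma smooth_A: "smooth A" and pd_A: "pds ex js A = (\<lambda>z. pds (\<lambda>j. axis j 1) js cut (fst z - x0))" and A_time: "pd et A = (\<lambda>z. 0)"
proof -
  have L: "bounded_linear (fst :: (real^3) \<times> real \<Rightarrow> real^3)" by (rule bounded_linear_fst)
  note a = smooth_affine[OF _ L, where c="- x0"]
  show "smooth A" unfolding A_def[abs_def] using a(1)[OF smooth_cut] by simp
  show "pds ex js A = (\<lambda>z. pds (\<lambda>j. axis j 1) js cut (fst z - x0))"
  proof (induction js)
    case Nil show ?case by (simp add: A_def[abs_def])
  next
    case (Cons j js)
    have "fst (ex j) = axis j 1" by (simp add: ex_def)
    then show ?case using a(2)[OF smooth_pds[OF smooth_cut, of "\<lambda>j. axis j 1" js], of "ex j"] by (simp add: Cons)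
  qed
  have "pd et A = (\<lambda>z. pd 0 cut (fst z - x0))"
    unfolding A_def[abs_def] using a(2)[OF smooth_cut] by (simp add: et_def)
  then show "pd et A = (\<lambda>z. 0)"
    using has_derivative_linear[OF smooth_has_derivative[OF smooth_cut]] linear_0 by fastforce
qed

lemma A_bounds: "0 \<le> A z" "A z \<le> 1" "q z \<ge> 2 \<Longrightarrow> A z = 0" "q z \<le> 1 \<Longrightarrow> A z = 1"
  by (simp_all add: A_def cut_bounds cut_0 cut_1 q_def)

lemma W_eq: "W = (\<lambda>z. A z * G z)" by (auto simp: W_def G_def)

context
  fixes N :: real
  assumes N0: "N \<ge> 0"
    and N: "\<And>js y. js \<noteq> [] \<Longrightarrow> length js \<le> 4 \<Longrightarrow> \<bar>pds (\<lambda>j::3. axis j 1) js cut y\<bar> \<le> N \<and>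
       (pds (\<lambda>j. axis j 1) js cut y \<noteq> 0 \<longrightarrow> 1 \<le> (norm y)\<^sup>2 \<and> (norm y)\<^sup>2 \<le> 2)"
begin

lemma product_annulus:
  assumes "js \<noteq> []" "length js \<le> 4" and B: "0 \<le> B" and f: "\<And>z. 1 \<le> q z \<Longrightarrow> q z \<le> 2 \<Longrightarrow> \<bar>f z\<bar> \<le> B"
  shows "\<bar>pds ex js A z * f z\<bar> \<le> N * B * indicator {z. q z \<le> 2} z"
proof (cases "pds ex js A z = 0")
  case True then show ?thesis using N0 B by simp
next
  case False
  then have "1 \<le> q z" "q z \<le> 2" using N[OF assms(1,2), of "fst z - x0"] by (auto simp: pd_A q_def)
  moreover have "\<bar>pds ex js A z\<bar> \<le> N" using N[OF assms(1,2)] by (simp add: pd_A)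
  ultimately show ?thesis using f[of z] N0 by (auto simp: abs_mult intro!: mult_mono)
qed

text \<open>The undifferentiated cutoff gives the genuine kernel term; the other Leibniz terms,
  counted by 8 = 2^3, live in the annulus, where the kernel derivatives are bounded.\<close>

lemma W3_bound:
  "\<bar>pds ex [c, b, a] W z\<bar> \<le> \<bar>th (snd z)\<bar> * (kernel_const * mu z ^ 3 * exp (- (1/8) * (mu z * q z))
      + 8 * N * annulus_const * indicator {z. q z \<le> 2} z)"
proof -
  let ?t = "\<bar>th (snd z)\<bar>" and ?I = "indicator {z. q z \<le> 2} z :: real"
  have "\<bar>pds ex [c, b, a] W z - A z * pds ex [c, b, a] G z\<bar> \<le> 2 ^ length [c, b, a] * (?t * (N * annulus_const * ?I))"
    unfolding W_eq
  proof (rule pds_mult_error[OF smooth_A smooth_G])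
    fix js ks :: "3 list"
    assume js: "js \<noteq> []" "length js \<le> length [c, b, a]" and ks: "length ks < length [c, b, a]"
    have "\<bar>pds ex js A z * pds ex ks P z\<bar> \<le> N * annulus_const * ?I"
      using js ks by (intro product_annulus P_annulus annulus_const_nonneg) auto
    from mult_left_mono[OF this, of ?t]
    show "\<bar>pds ex js A z * pds ex ks G z\<bar> \<le> ?t * (N * annulus_const * ?I)"
      by (simp add: pds_G abs_mult mult_ac)
  qed (use N0 annulus_const_nonneg in auto)
  moreover have "\<bar>A z * pds ex [c, b, a] G z\<bar> \<le> 1 * (?t * (kernel_const * mu z ^ 3 * exp (- (1/8) * (mu z * q z))))"
    unfolding pds_G abs_mult[of "A z"] abs_mult[of "th (snd z)"]
    using A_bounds(1,2)[of z] by (intro mult_mono P3_bound) auto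
  ultimately show ?thesis by (simp add: algebra_simps)
qed

text \<open>All derivatives on \<open>G\<close> give the main term, by \<open>bheat_G\<close>. In
  the errors \<open>A\<close> is differentiated at least once, and \<open>G_time\<close> replaces
  the time derivative by two spatial ones; so at most three derivatives reach \<open>P\<close>, as
  \<open>P_annulus\<close> allows.\<close>

lemma lap_bheat_W:
  "\<bar>lap (bheat W) z - A z * (deriv1 th (snd z) * lap P z)\<bar> \<le> 200 * N * annulus_const * (\<bar>th (snd z)\<bar> + \<bar>deriv1 th (snd z)\<bar>) * indicator {z. q z \<le> 2} z"
proof -
  let ?t = "\<bar>th (snd z)\<bar>" and ?d = "\<bar>deriv1 th (snd z)\<bar>" and ?I = "indicator {z. q z \<le> 2} z :: real"
  have sW: "smooth W" unfolding W_eq by (intro smooth_intros smooth_A smooth_G)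
  have sGt: "smooth (pd et G)" by (intro smooth_intros smooth_G)
  have Wt: "pd et W = (\<lambda>z. A z * pd et G z)"
    unfolding W_eq pd_mult[OF smooth_A smooth_G] A_time by simp
  have E4: "\<bar>pds ex [l, l, i, i] W z - A z * pds ex [l, l, i, i] G z\<bar> \<le> 16 * (?t * (N * annulus_const * ?I))" for i l
  proof -
    have "\<bar>pds ex [l, l, i, i] W z - A z * pds ex [l, l, i, i] G z\<bar> \<le> 2 ^ length [l, l, i, i] * (?t * (N * annulus_const * ?I))"
      unfolding W_eq
    proof (rule pds_mult_error[OF smooth_A smooth_G])
      fix js ks :: "3 list"
      assume js: "js \<noteq> []" "length js \<le> length [l, l, i, i]" and ks: "length ks < length [l, l, i, i]"
      have "\<bar>pds ex js A z * pds ex ks P z\<bar> \<le> N * annulus_const * ?I"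
        using js ks by (intro product_annulus P_annulus annulus_const_nonneg) auto
      from mult_left_mono[OF this, of ?t]
      show "\<bar>pds ex js A z * pds ex ks G z\<bar> \<le> ?t * (N * annulus_const * ?I)"
        by (simp add: pds_G abs_mult mult_ac)
    qed (use N0 annulus_const_nonneg in auto)
    then show ?thesis by simp
  qed
  have E2: "\<bar>pds ex [l, l] (pd et W) z - A z * pds ex [l, l] (pd et G) z\<bar> \<le> 4 * ((?d + 3 * ?t) * (N * annulus_const * ?I))" for l
  proof -
    have "\<bar>pds ex [l, l] (pd et W) z - A z * pds ex [l, l] (pd et G) z\<bar> \<le> 2 ^ length [l, l] * ((?d + 3 * ?t) * (N * annulus_const * ?I))"
      unfolding Wt
    proof (rule pds_mult_error[OF smooth_A sGt])
      fix js ks :: "3 list"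
      assume js: "js \<noteq> []" "length js \<le> length [l, l]" and ks: "length ks < length [l, l]"
      have 1: "\<bar>pds ex js A z * pds ex ks P z\<bar> \<le> N * annulus_const * ?I"
        using js ks by (intro product_annulus P_annulus annulus_const_nonneg) auto
      have 2: "\<bar>pds ex js A z * pds ex (ks @ [i, i]) P z\<bar> \<le> N * annulus_const * ?I" for i
        using js ks by (intro product_annulus P_annulus annulus_const_nonneg) auto
      have eq: "pds ex js A z * pds ex ks (pd et G) z = deriv1 th (snd z) * (pds ex js A z * pds ex ks P z)
          - th (snd z) * (\<Sum>i\<in>UNIV. pds ex js A z * pds ex (ks @ [i, i]) P z)"
        unfolding pds_G_time by (simp add: algebra_simps sum_distrib_left)
      have "\<bar>pds ex js A z * pds ex ks (pd et G) z\<bar> \<le> ?d * \<bar>pds ex js A z * pds ex ks P z\<bar> + ?t * \<bar>\<Sum>i\<in>UNIV. pds ex js A z * pds ex (ks @ [i, i]) P z\<bar>"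
        unfolding eq by (rule order_trans[OF abs_triangle_ineq4]) (simp only: abs_mult order_refl)
      also have "\<dots> \<le> ?d * \<bar>pds ex js A z * pds ex ks P z\<bar> + ?t * (\<Sum>i\<in>UNIV. \<bar>pds ex js A z * pds ex (ks @ [i, i]) P z\<bar>)"
        by (intro add_left_mono mult_left_mono sum_abs) auto
      also have "\<dots> \<le> ?d * (N * annulus_const * ?I) + ?t * (\<Sum>i\<in>(UNIV::3 set). N * annulus_const * ?I)"
        by (intro add_mono mult_left_mono 1 sum_mono 2) auto
      finally show "\<bar>pds ex js A z * pds ex ks (pd et G) z\<bar> \<le> (?d + 3 * ?t) * (N * annulus_const * ?I)"
        by (simp add: algebra_simps)
    qed (use N0 annulus_const_nonneg in auto)
    then show ?thesis by simp
  qed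
  have split: "lap (bheat f) z = (\<Sum>l\<in>UNIV. pds ex [l, l] (pd et f) z) + (\<Sum>l\<in>UNIV. \<Sum>i\<in>UNIV. pds ex [l, l, i, i] f z)" if "smooth f" for f
  proof -
    have "lap (bheat f) z = lap (pd et f) z + lap (\<lambda>z. \<Sum>i\<in>UNIV. pds ex [i, i] f z) z"
      unfolding bheat_def lap_pds[of f] using that by (subst lap_add) (auto intro!: smooth_intros)
    also have "lap (\<lambda>z. \<Sum>i\<in>UNIV. pds ex [i, i] f z) z = (\<Sum>l\<in>UNIV. \<Sum>i\<in>UNIV. pds ex [l, l, i, i] f z)"
      unfolding lap_pds using that by (subst pds_sum) (auto intro!: smooth_intros)
    finally show ?thesis by (simp add: lap_pds[of "pd et f"])
  qed
  have main: "A z * (deriv1 th (snd z) * lap P z) = A z * lap (bheat G) z"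
    unfolding bheat_G lap_pds pds_time_mult[OF smooth_deriv1[OF th] smooth_P] by (simp add: sum_distrib_left)
  have eq: "lap (bheat W) z - A z * (deriv1 th (snd z) * lap P z)
     = (\<Sum>l\<in>UNIV. pds ex [l, l] (pd et W) z - A z * pds ex [l, l] (pd et G) z)
      + (\<Sum>l\<in>UNIV. \<Sum>i\<in>UNIV. pds ex [l, l, i, i] W z - A z * pds ex [l, l, i, i] G z)"
    unfolding main split[OF sW] split[OF smooth_G] by (simp only: distrib_left sum_distrib_left sum_subtractf add_diff_add)
  have "\<bar>lap (bheat W) z - A z * (deriv1 th (snd z) * lap P z)\<bar> \<le> (\<Sum>l\<in>(UNIV::3 set). 4 * ((?d + 3 * ?t) * (N * annulus_const * ?I))) + (\<Sum>l\<in>(UNIV::3 set). \<Sum>i\<in>(UNIV::3 set). 16 * (?t * (N * annulus_const * ?I)))"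
    unfolding eq
  proof (rule order_trans[OF abs_triangle_ineq], rule add_mono)
    show "\<bar>\<Sum>l\<in>UNIV. pds ex [l, l] (pd et W) z - A z * pds ex [l, l] (pd et G) z\<bar> \<le> (\<Sum>l\<in>(UNIV::3 set). 4 * ((?d + 3 * ?t) * (N * annulus_const * ?I)))"
      by (rule order_trans[OF sum_abs], rule sum_mono, rule E2)
    show "\<bar>\<Sum>l\<in>UNIV. \<Sum>i\<in>UNIV. pds ex [l, l, i, i] W z - A z * pds ex [l, l, i, i] G z\<bar> \<le> (\<Sum>l\<in>(UNIV::3 set). \<Sum>i\<in>(UNIV::3 set). 16 * (?t * (N * annulus_const * ?I)))"
      by (rule order_trans[OF sum_abs], rule sum_mono, rule order_trans[OF sum_abs], rule sum_mono, rule E4)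
  qed
  \<comment> \<open>Three terms of size 4 (d + 3t) from the time derivative and nine of size 16 t
    from the fourth derivatives; 200 is a round majorant of both coefficients.\<close>
  also have "\<dots> = (12 * ?d + 180 * ?t) * (N * annulus_const * ?I)" by (simp add: algebra_simps)
  also have "\<dots> \<le> (200 * (?t + ?d)) * (N * annulus_const * ?I)"
    using N0 annulus_const_nonneg by (intro mult_right_mono) auto
  finally show ?thesis by (simp add: mult_ac)
qed

end

end

section \<open>Integrals of the heat kernel and time cutoffs\<close>

text \<open>The profile of \<open>P\<close> as a function of displacement and elapsed time, in which
  \<open>lam\<close> no longer appears.\<close>

definition hk :: "real^3 \<Rightarrow> real \<Rightarrow> real" where
  "hk y r = r powr (-3/2) * exp (- (1/4) * (r powr (-1) * (norm y)\<^sup>2))"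
text \<open>The time derivative of \<^term>\<open>hk\<close>, which equals its Laplacian in \<open>y\<close>.\<close>

definition dhk :: "real^3 \<Rightarrow> real \<Rightarrow> real" where
  "dhk y r = ((1/4) * (r powr (-1) * r powr (-1) * (norm y)\<^sup>2) - (3/2) * r powr (-1)) * hk y r"

lemma hk_deriv: assumes "r > 0" shows "(hk y has_real_derivative dhk y r) (at r)"
proof -
  have pw: "r powr (-3/2 - 1) = r powr (-1) * r powr (-3/2)" "r powr (-1 - 1) = r powr (-1) * r powr (-1)"
    by (subst powr_add[symmetric], simp)+
  have 1: "((\<lambda>r. r powr p) has_real_derivative p * r powr (p - 1)) (at r)" for p
    using has_real_derivative_powr[OF assms] by simp
  have 2: "((\<lambda>r. - (1/4) * (r powr (-1) * (norm y)\<^sup>2)) has_real_derivative (1/4) * (r powr (-1) * r powr (-1) * (norm y)\<^sup>2)) (at r)"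
    using DERIV_cmult[OF DERIV_cmult_right[OF 1[of "-1"], of "(norm y)\<^sup>2"], of "-(1/4)"] unfolding pw by (simp add: mult_ac)
  have 3: "((\<lambda>r. exp (- (1/4) * (r powr (-1) * (norm y)\<^sup>2))) has_real_derivative exp (- (1/4) * (r powr (-1) * (norm y)\<^sup>2)) * ((1/4) * (r powr (-1) * r powr (-1) * (norm y)\<^sup>2))) (at r)"
    by (rule DERIV_chain2[OF DERIV_exp 2])
  show ?thesis
    using DERIV_mult[OF 1[of "-3/2"] 3] unfolding pw hk_def[abs_def] dhk_def
    by (rule DERIV_cong) (simp add: algebra_simps)
qed

lemma hk_nonneg: "hk y r \<ge> 0" by (simp add: hk_def)

lemma hk_even: "hk (- y) r = hk y r" by (simp add: hk_def)

lemma hk_measurable [measurable (raw)]: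
  assumes [measurable]: "f \<in> borel_measurable M" "g \<in> borel_measurable M"
  shows "(\<lambda>w. hk (f w) (g w)) \<in> borel_measurable M"
  unfolding hk_def by (intro borel_measurable_times powr_real_measurable borel_measurable_const assms
      measurable_compose[OF _ borel_measurable_exp] borel_measurable_power measurable_compose[OF _ borel_measurable_norm])

lemma dhk_measurable [measurable (raw)]:
  assumes [measurable]: "f \<in> borel_measurable M" "g \<in> borel_measurable M"
  shows "(\<lambda>w. dhk (f w) (g w)) \<in> borel_measurable M"
  unfolding dhk_def by (intro borel_measurable_times borel_measurable_diff powr_real_measurable borel_measurable_const assms hk_measurable
      borel_measurable_power measurable_compose[OF _ borel_measurable_norm])

lemma hk_le: assumes "r \<ge> d" "d > 0" shows "hk y r \<le> d powr (-3/2)"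
proof -
  have "hk y r \<le> r powr (-3/2) * 1" unfolding hk_def by (intro mult_left_mono) auto
  also have "\<dots> \<le> d powr (-3/2)" using assms powr_mono2'[of "-3/2" d r] by simp
  finally show ?thesis .
qed

lemma dhk_le: assumes "r \<ge> d" "d > 0" "(norm y)\<^sup>2 \<le> 2"
  shows "\<bar>dhk y r\<bar> \<le> (d powr (-1) * d powr (-1) + 2 * d powr (-1)) * d powr (-3/2)"
proof -
  have r: "r powr (-1) \<le> d powr (-1)" using assms powr_mono2'[of "-1" d r] by simp
  have "\<bar>(1/4) * (r powr (-1) * r powr (-1) * (norm y)\<^sup>2) - (3/2) * r powr (-1)\<bar>
     \<le> (1/4) * (r powr (-1) * r powr (-1) * (norm y)\<^sup>2) + (3/2) * r powr (-1)"
    by (intro order_trans[OF abs_triangle_ineq4]) simp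
  also have "\<dots> \<le> (1/4) * (d powr (-1) * d powr (-1) * 2) + (3/2) * d powr (-1)"
    using r assms by (intro add_mono mult_mono mult_left_mono) auto
  also have "\<dots> \<le> d powr (-1) * d powr (-1) + 2 * d powr (-1)"
  proof -
    have "(1/4) * (x * x * 2) + (3/2) * x \<le> x * x + 2 * x" if "x \<ge> 0" for x :: real
      using that zero_le_square[of x] by linarith
    then show ?thesis by (metis powr_ge_zero)
  qed
  finally show ?thesis unfolding dhk_def abs_mult
    using hk_le[OF assms(1,2), of y] hk_nonneg[of y r] by (intro mult_mono) auto
qed

definition gauss :: "real \<Rightarrow> ennreal" where
  "gauss c = (\<integral>\<^sup>+(y::real^3). ennreal (exp (- c * (norm y)\<^sup>2)) \<partial>lborel)"

text \<open>The integrand is a product over the coordinates, and each factor is a multiple of a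
  normal density of variance 1/(2c).\<close>

lemma gauss_finite: assumes "c > 0" shows "gauss c < \<infinity>"
proof -
  have one: "(\<integral>\<^sup>+(x::real). ennreal (exp (- c * x\<^sup>2)) \<partial>lborel) < \<infinity>"
  proof -
    define \<sigma> where "\<sigma> = sqrt (1 / (2 * c))"
    have s: "\<sigma> > 0" "\<sigma>\<^sup>2 = 1 / (2 * c)" using assms by (simp_all add: \<sigma>_def)
    have "integrable lborel (\<lambda>x. sqrt (2 * pi * \<sigma>\<^sup>2) * normal_density 0 \<sigma> x)"
      using s(1) by (intro integrable_mult_right integrable_normal_density)
    moreover have "(\<lambda>x. sqrt (2 * pi * \<sigma>\<^sup>2) * normal_density 0 \<sigma> x) = (\<lambda>x. exp (- c * x\<^sup>2))"
    proof
      fix x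
      have "sqrt (2 * pi * (1 / (2 * c))) > 0" using assms by simp
      then show "sqrt (2 * pi * \<sigma>\<^sup>2) * normal_density 0 \<sigma> x = exp (- c * x\<^sup>2)"
        unfolding normal_density_def s(2) using assms by (simp add: mult.commute)
    qed
    ultimately show ?thesis by (simp add: integrable_iff_bounded)
  qed
  have "gauss c = (\<integral>\<^sup>+(y::real^3). (\<Prod>b\<in>Basis. ennreal (exp (- c * (y \<bullet> b)\<^sup>2))) \<partial>lborel)"
    unfolding gauss_def
  proof (intro nn_integral_cong)
    fix y :: "real^3"
    have "(norm y)\<^sup>2 = (\<Sum>b\<in>Basis. (y \<bullet> b) * (y \<bullet> b))"
      by (simp only: power2_norm_eq_inner euclidean_inner[symmetric])
    then have "exp (- c * (norm y)\<^sup>2) = exp (\<Sum>b\<in>Basis. - c * (y \<bullet> b)\<^sup>2)"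
      by (simp only: sum_distrib_left power2_eq_square)
    also have "\<dots> = (\<Prod>b\<in>Basis. exp (- c * (y \<bullet> b)\<^sup>2))" by (rule exp_sum) simp
    finally show "ennreal (exp (- c * (norm y)\<^sup>2)) = (\<Prod>b\<in>Basis. ennreal (exp (- c * (y \<bullet> b)\<^sup>2)))"
      by (simp only: prod_ennreal exp_ge_zero)
  qed
  also have "\<dots> = (\<Prod>b\<in>(Basis :: (real^3) set). (\<integral>\<^sup>+(x::real). ennreal (exp (- c * x\<^sup>2)) \<partial>lborel))"
    by (rule nn_integral_lborel_prod) auto
  also have "\<dots> < \<infinity>" using one by (simp add: power_less_top_ennreal)
  finally show ?thesis .
qed

lemma gauss_scaled:
  assumes r: "r > 0"
  shows "(\<integral>\<^sup>+x. ennreal (exp (- c * (r powr (-1) * (norm (x - x0 :: real^3))\<^sup>2))) \<partial>lborel) = ennreal (r powr (3/2)) * gauss c"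
proof -
  let ?k = "sqrt r"
  have k: "?k \<noteq> 0" "?k > 0" using r by auto
  have "(\<integral>\<^sup>+x. ennreal (exp (- c * (r powr (-1) * (norm (x - x0 :: real^3))\<^sup>2))) \<partial>lborel)
     = (\<integral>\<^sup>+y. ennreal (\<bar>?k\<bar> ^ DIM(real^3)) * ennreal (exp (- c * (r powr (-1) * (norm (x0 + ?k *\<^sub>R y - x0))\<^sup>2))) \<partial>lborel)"
    by (subst lborel_affine[OF k(1), of x0]) (simp add: nn_integral_density nn_integral_distr)
  also have "\<dots> = (\<integral>\<^sup>+y. ennreal (\<bar>?k\<bar> ^ 3) * ennreal (exp (- c * (norm (y::real^3))\<^sup>2)) \<partial>lborel)"
  proof (intro nn_integral_cong)
    fix y :: "real^3"
    have "r powr (-1) * (norm (x0 + ?k *\<^sub>R y - x0))\<^sup>2 = (norm y)\<^sup>2"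
      using r by (simp add: power_mult_distrib powr_minus)
    then show "ennreal (\<bar>?k\<bar> ^ DIM(real^3)) * ennreal (exp (- c * (r powr (-1) * (norm (x0 + ?k *\<^sub>R y - x0))\<^sup>2))) = ennreal (\<bar>?k\<bar> ^ 3) * ennreal (exp (- c * (norm (y::real^3))\<^sup>2))"
      by simp
  qed
  also have "\<dots> = ennreal (\<bar>?k\<bar> ^ 3) * gauss c" unfolding gauss_def by (rule nn_integral_cmult) simp
  also have "\<bar>?k\<bar> ^ 3 = r powr (3/2)"
    using r by (simp add: powr_half_sqrt[symmetric] powr_powr flip: powr_realpow)
  finally show ?thesis .
qed

lemma hk_integral:
  assumes r: "r > 0"
  shows "(\<integral>\<^sup>+x. ennreal (hk (x - x0) r) \<partial>lborel) = gauss (1/4)"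
proof -
  have "(\<integral>\<^sup>+x. ennreal (hk (x - x0) r) \<partial>lborel) = (\<integral>\<^sup>+x. ennreal (r powr (-3/2)) * ennreal (exp (- (1/4) * (r powr (-1) * (norm (x - x0))\<^sup>2))) \<partial>lborel)"
    unfolding hk_def by (simp add: ennreal_mult)
  also have "\<dots> = ennreal (r powr (-3/2)) * (ennreal (r powr (3/2)) * gauss (1/4))"
    by (subst nn_integral_cmult) (simp, subst gauss_scaled[OF r], simp)
  also have "\<dots> = ennreal (r powr (-3/2) * r powr (3/2)) * gauss (1/4)"
    by (simp add: ennreal_mult mult.assoc)
  also have "r powr (-3/2) * r powr (3/2) = 1" using r by (simp add: powr_add[symmetric])
  finally show ?thesis by simp
qed

text \<open>Integrating over the final time gains one full power: the nonintegrable exponent -3/2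
  becomes -1/2. The bound is independent of the upper limit \<open>S\<close>.\<close>

lemma time_integral:
  assumes "\<tau> < t"
  shows "(\<integral>\<^sup>+s. ennreal ((s - \<tau>) powr (-3/2)) * indicator {t..S} s \<partial>lborel) \<le> ennreal (2 * (t - \<tau>) powr (-1/2))"
proof (cases "t \<le> S")
  case True
  have "(\<integral>\<^sup>+s. ennreal ((s - \<tau>) powr (-3/2)) * indicator {t..S} s \<partial>lborel) = ennreal ((- 2 * (S - \<tau>) powr (-1/2)) - (- 2 * (t - \<tau>) powr (-1/2)))"
  proof (rule nn_integral_FTC_Icc)
    fix s assume s: "s \<in> {t..S}"
    then have "s - \<tau> > 0" using assms by simp
    have "((\<lambda>s. s - \<tau>) has_real_derivative 1) (at s)" by (auto intro!: derivative_eq_intros)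
    from DERIV_cmult[OF DERIV_chain2[OF has_real_derivative_powr[OF \<open>s - \<tau> > 0\<close>, of "-1/2"] this], of "-2"]
    have "((\<lambda>s. - 2 * (s - \<tau>) powr (-1/2)) has_real_derivative - 2 * ((- 1/2) * (s - \<tau>) powr (-1/2 - 1) * 1)) (at s)" .
    then show "((\<lambda>s. - 2 * (s - \<tau>) powr (-1/2)) has_real_derivative (s - \<tau>) powr (-3/2)) (at s)" by simp
  qed (use True in auto)
  also have "\<dots> \<le> ennreal (2 * (t - \<tau>) powr (-1/2))" by (intro ennreal_leI) simp
  finally show ?thesis .
next
  case False
  then have "{t..S} = {}" by auto
  then show ?thesis by simp
qed

text \<open>Rises from 0 to 1 on [a,b] and falls back to 0 on [t - 2\<delta>, t - \<delta>]. The
  first layer stays fixed and the second concentrates at t; the gap \<delta> before t keeps the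
  kernel away from its singularity for every s \<ge> t.\<close>

definition tcut :: "real \<Rightarrow> real \<Rightarrow> real \<Rightarrow> real \<Rightarrow> real \<Rightarrow> real" where
  "tcut a b t \<delta> \<tau> = step ((\<tau> - a) / (b - a)) * step ((t - \<tau>) / \<delta> - 1)"
text \<open>A convex combination of the constant 1 and s - \<tau>: equal to 1 for s - \<tau> \<le>
  \<delta>/4 and to s - \<tau> from \<delta>/2 on. Both are positive in between, hence positivity
  everywhere.\<close>

definition plam :: "real \<Rightarrow> real \<Rightarrow> real \<Rightarrow> real" where
  "plam \<delta> s \<tau> = 1 + ((s - \<tau>) - 1) * step (4 * (s - \<tau>) / \<delta> - 1)"

lemma smooth_affine1: "smooth (\<lambda>\<tau>::real. (\<tau> - a) * c)" "smooth (\<lambda>\<tau>::real. (t - \<tau>) * c - d)"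
  by (intro smooth_intros smooth_id)+

lemma step_affine_smooth: "smooth (\<lambda>\<tau>::real. step ((\<tau> - a) / c))" "smooth (\<lambda>\<tau>::real. step ((t - \<tau>) / c - 1))"
  using smooth_step[OF smooth_affine1(1)[of a "1/c"]] smooth_step[OF smooth_affine1(2)[of t "1/c" 1]] by simp_all

lemma step_affine_deriv: "deriv1 (\<lambda>\<tau>::real. step ((\<tau> - a) / c)) \<tau> = deriv1 step ((\<tau> - a) / c) / c"
  "deriv1 (\<lambda>\<tau>::real. step ((t - \<tau>) / c - 1)) \<tau> = - (deriv1 step ((t - \<tau>) / c - 1) / c)"
proof -
  have 1: "((\<lambda>\<tau>. (\<tau> - a) / c) has_real_derivative 1 / c) (at \<tau>)"
    by (cases "c = 0") (auto intro!: derivative_eq_intros)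
  show "deriv1 (\<lambda>\<tau>::real. step ((\<tau> - a) / c)) \<tau> = deriv1 step ((\<tau> - a) / c) / c"
    using DERIV_chain2[OF smooth_DERIV[OF smooth_step'] 1] by (intro deriv1_eqI) simp
  have 2: "((\<lambda>\<tau>. (t - \<tau>) / c - 1) has_real_derivative - 1 / c) (at \<tau>)"
    by (cases "c = 0") (auto intro!: derivative_eq_intros)
  show "deriv1 (\<lambda>\<tau>::real. step ((t - \<tau>) / c - 1)) \<tau> = - (deriv1 step ((t - \<tau>) / c - 1) / c)"
    using DERIV_chain2[OF smooth_DERIV[OF smooth_step'] 2] by (intro deriv1_eqI) simp
qed

lemma tcut_props:
  assumes "a < b" "\<delta> > 0" "b \<le> t - 2 * \<delta>"
  shows "smooth (tcut a b t \<delta>)" "0 \<le> tcut a b t \<delta> \<tau>" "tcut a b t \<delta> \<tau> \<le> 1"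
    "\<tau> \<le> a \<or> \<tau> \<ge> t - \<delta> \<Longrightarrow> tcut a b t \<delta> \<tau> = 0"
    "deriv1 (tcut a b t \<delta>) \<tau> = deriv1 step ((\<tau> - a) / (b - a)) / (b - a) - deriv1 step ((t - \<tau>) / \<delta> - 1) / \<delta>"
proof -
  show "smooth (tcut a b t \<delta>)" unfolding tcut_def[abs_def] by (intro smooth_intros step_affine_smooth)
  show "0 \<le> tcut a b t \<delta> \<tau>" by (simp add: tcut_def step_bounds)
  show "tcut a b t \<delta> \<tau> \<le> 1" unfolding tcut_def by (intro mult_le_one step_bounds)
  show "tcut a b t \<delta> \<tau> = 0" if "\<tau> \<le> a \<or> \<tau> \<ge> t - \<delta>"
    using that
  proof
    assume "\<tau> \<le> a" then show ?thesis using assms by (simp add: tcut_def step_le0 divide_nonpos_pos)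
  next
    assume "\<tau> \<ge> t - \<delta>" then show ?thesis using assms by (simp add: tcut_def step_le0 divide_le_eq)
  qed
  let ?x = "(\<tau> - a) / (b - a)" and ?y = "(t - \<tau>) / \<delta> - 1"
  have "deriv1 (tcut a b t \<delta>) \<tau> = step ?x * - (deriv1 step ?y / \<delta>) + deriv1 step ?x / (b - a) * step ?y"
    unfolding tcut_def[abs_def] deriv1_def
    by (subst pd_mult[OF step_affine_smooth]) (simp add: step_affine_deriv[unfolded deriv1_def])
  \<comment> \<open>The hypothesis \<open>b \<le> t - 2 * \<delta>\<close> separates the two layers:
    wherever one factor varies, the other equals 1, so the product rule reduces to a difference of
    two pure terms.\<close>
  moreover have "step ?x * deriv1 step ?y = deriv1 step ?y"
  proof (cases "\<tau> \<ge> b")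
    case True then have "?x \<ge> 1" using assms by (simp add: le_divide_eq)
    then show ?thesis by (simp add: step_ge1)
  next
    case False
    have "t - \<tau> > 2 * \<delta>" using False assms by linarith
    then have "?y > 1" using assms by (simp add: less_divide_eq)
    then show ?thesis by (simp add: deriv1_step_0)
  qed
  moreover have "deriv1 step ?x * step ?y = deriv1 step ?x"
  proof (cases "\<tau> \<le> b")
    case True
    have "t - \<tau> \<ge> 2 * \<delta>" using True assms by linarith
    then have "?y \<ge> 1" using assms by (simp add: le_divide_eq)
    then show ?thesis by (simp add: step_ge1)
  next
    case False then have "?x > 1" using assms by (simp add: less_divide_eq)
    then show ?thesis by (simp add: deriv1_step_0)
  qed
  ultimately show "deriv1 (tcut a b t \<delta>) \<tau> = deriv1 step ?x / (b - a) - deriv1 step ?y / \<delta>"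
    by (simp add: algebra_simps)
qed

lemma plam_props:
  assumes "\<delta> > 0"
  shows "smooth (plam \<delta> s)" "plam \<delta> s \<tau> > 0" "s - \<tau> \<ge> \<delta> / 2 \<Longrightarrow> plam \<delta> s \<tau> = s - \<tau>"
    "s - \<tau> > \<delta> / 2 \<Longrightarrow> deriv1 (plam \<delta> s) \<tau> = -1"
proof -
  have eq: "4 * (s - \<tau>) / \<delta> - 1 = (s - \<tau>) * (4 / \<delta>) - 1" for \<tau> by simp
  show "smooth (plam \<delta> s)"
    unfolding plam_def[abs_def] eq by (intro smooth_intros smooth_affine1 smooth_id)
  show e: "plam \<delta> s \<tau> = s - \<tau>" if "s - \<tau> \<ge> \<delta> / 2" for \<tau>
  proof -
    have "4 * (s - \<tau>) / \<delta> - 1 \<ge> 1" using that assms by (simp add: le_divide_eq)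
    then show ?thesis by (simp add: plam_def step_ge1)
  qed
  show "plam \<delta> s \<tau> > 0"
  proof (cases "s - \<tau> > 0")
    case True
    let ?e = "step (4 * (s - \<tau>) / \<delta> - 1)"
    have eq: "plam \<delta> s \<tau> = (1 - ?e) + (s - \<tau>) * ?e" by (simp add: plam_def algebra_simps)
    show ?thesis
    proof (cases "?e = 0")
      case False
      then have "?e > 0" using step_bounds(1)[of "4 * (s - \<tau>) / \<delta> - 1"] by linarith
      then have "(s - \<tau>) * ?e > 0" using True by simp
      then show ?thesis unfolding eq using step_bounds(2)[of "4 * (s - \<tau>) / \<delta> - 1"] by linarith
    qed (simp add: eq)
  next
    case False
    then have "4 * (s - \<tau>) / \<delta> - 1 \<le> 0" using assms by (simp add: divide_le_eq)
    then show ?thesis by (simp add: plam_def step_le0)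
  qed
  assume *: "s - \<tau> > \<delta> / 2"
  have "((\<lambda>\<tau>. s - \<tau>) has_real_derivative -1) (at \<tau>)" by (rule derivative_eq_intros refl)+ simp
  moreover have "\<forall>\<^sub>F x in nhds \<tau>. s - x = plam \<delta> s x"
  proof -
    have op: "open {x. \<delta> / 2 < s - x}" by (intro open_Collect_less continuous_intros)
    have "\<forall>\<^sub>F x in nhds \<tau>. x \<in> {x. \<delta> / 2 < s - x}" by (rule eventually_nhds_in_open[OF op]) (use * in simp)
    then show ?thesis by eventually_elim (simp add: e)
  qed
  ultimately have "(plam \<delta> s has_real_derivative -1) (at \<tau>)"
    by (subst (asm) DERIV_cong_ev[OF refl _ refl]) auto
  then show "deriv1 (plam \<delta> s) \<tau> = -1" by (rule deriv1_eqI)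
qed

context heat_test
begin

lemma P_hk: "P z = hk (fst z - x0) (lam (snd z))"
  by (simp add: P_def hk_def sum_Y mu_def)

lemma lap_P_dhk: "lap P z = dhk (fst z - x0) (lam (snd z))"
  unfolding lap_P P_hk by (simp add: dhk_def mu_def)

lemma test_W:
  assumes "\<And>r. r \<notin> {c..d} \<Longrightarrow> th r = 0" "{c..d} \<subseteq> I"
  shows "test_function (UNIV \<times> I) W"
proof (rule test_functionI)
  show "smooth W" unfolding W_eq by (intro smooth_intros smooth_A smooth_G)
  show "compact (cball x0 2 \<times> {c..d})" by (intro compact_Times) auto
  show "cball x0 2 \<times> {c..d} \<subseteq> UNIV \<times> I" using assms by auto
  show "W z = 0" if "z \<notin> cball x0 2 \<times> {c..d}" for z
  proof (cases "fst z \<in> cball x0 2")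
    case True then show ?thesis using that assms(1)[of "snd z"] by (cases z) (auto simp: W_def)
  next
    case False
    then have "2\<^sup>2 \<le> (norm (fst z - x0))\<^sup>2" by (intro power_mono) (auto simp: dist_norm norm_minus_commute)
    then have "A z = 0" by (intro A_bounds) (simp add: q_def)
    then show ?thesis by (simp add: W_def)
  qed
qed

end

section \<open>The localized estimate for a fixed final time\<close>

text \<open>Fixed by choice once and for all, so that the estimates for all centres and all times
  share one constant.\<close>

definition cut_const :: real where
  "cut_const = (SOME N. N \<ge> 0 \<and> (\<forall>js y. js \<noteq> [] \<longrightarrow> length js \<le> 4 \<longrightarrow>
     \<bar>pds (\<lambda>j::3. axis j 1) js cut y\<bar> \<le> N \<and> (pds (\<lambda>j. axis j 1) js cut y \<noteq> 0 \<longrightarrow> 1 \<le> (norm y)\<^sup>2 \<and> (norm y)\<^sup>2 \<le> 2)))"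

lemma cut_const: "cut_const \<ge> 0"
  "js \<noteq> [] \<Longrightarrow> length js \<le> 4 \<Longrightarrow> \<bar>pds (\<lambda>j::3. axis j 1) js cut y\<bar> \<le> cut_const \<and>
     (pds (\<lambda>j. axis j 1) js cut y \<noteq> 0 \<longrightarrow> 1 \<le> (norm y)\<^sup>2 \<and> (norm y)\<^sup>2 \<le> 2)"
  using someI_ex[OF cut_derivatives, folded cut_const_def] by blast+

definition step_const :: real where
  "step_const = (SOME B. B \<ge> 0 \<and> (\<forall>x. \<bar>deriv1 step x\<bar> \<le> B))"

lemma step_const: "step_const \<ge> 0" "\<bar>deriv1 step x\<bar> \<le> step_const"
  using someI_ex[OF deriv1_step_bounded, folded step_const_def] by blast+

definition gauss8 :: real where "gauss8 = enn2real (gauss (1/8))"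

lemma gauss8: "ennreal gauss8 = gauss (1/8)" "gauss8 \<ge> 0"
  using gauss_finite[of "1/8"] by (simp_all add: gauss8_def)

text \<open>For a non-integrable function the Bochner integral has the default value 0, which makes
  the inequality trivial in that case.\<close>

lemma abs_LINT_le:
  fixes f :: "'a \<Rightarrow> real"
  shows "ennreal \<bar>LINT x|M. f x\<bar> \<le> (\<integral>\<^sup>+x. ennreal \<bar>f x\<bar> \<partial>M)"
proof (cases "integrable M f")
  case True
  then show ?thesis using integral_norm_bound_ennreal[of M f] by simp
next
  case False
  then show ?thesis by (simp add: not_integrable_integral_eq)
qed

lemma deriv1_tcut_bound:
  assumes "a < b" "\<delta> > 0" "b \<le> t - 2 * \<delta>"
  shows "\<bar>deriv1 (tcut a b t \<delta>) \<tau>\<bar> \<le> step_const / (b - a) * indicator {a..b} \<tau> + step_const / \<delta> * indicator {t - 2 * \<delta>..t - \<delta>} \<tau>"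
proof -
  have 1: "\<bar>deriv1 step ((\<tau> - a) / (b - a)) / (b - a)\<bar> \<le> step_const / (b - a) * indicator {a..b} \<tau>"
  proof (cases "\<tau> \<in> {a..b}")
    case True
    then show ?thesis using step_const(2)[of "(\<tau> - a) / (b - a)"] assms by (simp add: abs_divide divide_right_mono)
  next
    case False
    then have "(\<tau> - a) / (b - a) < 0 \<or> (\<tau> - a) / (b - a) > 1" using assms by (auto simp: divide_neg_pos less_divide_eq)
    then show ?thesis using False by (simp add: deriv1_step_0)
  qed
  have 2: "\<bar>deriv1 step ((t - \<tau>) / \<delta> - 1) / \<delta>\<bar> \<le> step_const / \<delta> * indicator {t - 2 * \<delta>..t - \<delta>} \<tau>"
  proof (cases "\<tau> \<in> {t - 2 * \<delta>..t - \<delta>}")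
    case True
    then show ?thesis using step_const(2)[of "(t - \<tau>) / \<delta> - 1"] assms by (simp add: abs_divide divide_right_mono)
  next
    case False
    then have "(t - \<tau>) / \<delta> - 1 < 0 \<or> (t - \<tau>) / \<delta> - 1 > 1" using assms by (auto simp: divide_less_eq less_divide_eq)
    then show ?thesis using False by (simp add: deriv1_step_0)
  qed
  show ?thesis unfolding tcut_props(5)[OF assms]
    by (rule order_trans[OF abs_triangle_ineq4 add_mono[OF 1 2]])
qed

lemma nn_integral_indicator_interval:
  fixes c x y :: real
  assumes "c \<ge> 0" "x \<le> y"
  shows "(\<integral>\<^sup>+\<tau>. ennreal (c * indicator {x..y} \<tau>) \<partial>lborel) = ennreal (c * (y - x))"
proof -
  have "(\<integral>\<^sup>+\<tau>. ennreal (c * indicator {x..y} \<tau>) \<partial>lborel) = (\<integral>\<^sup>+\<tau>. ennreal c * indicator {x..y} \<tau> \<partial>lborel)"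
    by (intro nn_integral_cong) (auto simp: indicator_def)
  also have "\<dots> = ennreal (c * (y - x))" using assms by (simp add: nn_integral_cmult ennreal_mult)
  finally show ?thesis .
qed

text \<open>The height \<open>step_const / \<delta>\<close> of the late layer is compensated by its
  length \<open>\<delta>\<close>; the result does not deteriorate as \<open>\<delta>\<close> tends
  to 0.\<close>

lemma deriv1_tcut_nn:
  assumes "a < b" "\<delta> > 0" "b \<le> t - 2 * \<delta>"
  shows "(\<integral>\<^sup>+\<tau>. ennreal \<bar>deriv1 (tcut a b t \<delta>) \<tau>\<bar> \<partial>lborel) \<le> ennreal (2 * step_const)"
proof -
  have "(\<integral>\<^sup>+\<tau>. ennreal \<bar>deriv1 (tcut a b t \<delta>) \<tau>\<bar> \<partial>lborel)
    \<le> (\<integral>\<^sup>+\<tau>. ennreal (step_const / (b - a) * indicator {a..b} \<tau>) + ennreal (step_const / \<delta> * indicator {t - 2 * \<delta>..t - \<delta>} \<tau>) \<partial>lborel)"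
    using assms step_const(1) deriv1_tcut_bound[OF assms]
    by (intro nn_integral_mono) (simp flip: ennreal_plus)
  also have "\<dots> = ennreal (step_const / (b - a) * (b - a)) + ennreal (step_const / \<delta> * ((t - \<delta>) - (t - 2 * \<delta>)))"
  proof -
    have 1: "(\<integral>\<^sup>+\<tau>. ennreal (step_const / (b - a) * indicator {a..b} \<tau>) \<partial>lborel) = ennreal (step_const / (b - a) * (b - a))"
      by (rule nn_integral_indicator_interval) (use assms step_const(1) in auto)
    have 2: "(\<integral>\<^sup>+\<tau>. ennreal (step_const / \<delta> * indicator {t - 2 * \<delta>..t - \<delta>} \<tau>) \<partial>lborel) = ennreal (step_const / \<delta> * ((t - \<delta>) - (t - 2 * \<delta>)))"
      by (rule nn_integral_indicator_interval) (use assms step_const(1) in auto)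
    show ?thesis by (subst nn_integral_add) (simp, simp, simp only: 1 2)
  qed
  also have "\<dots> = ennreal (2 * step_const)" using assms step_const(1) by (simp flip: ennreal_plus)
  finally show ?thesis .
qed

lemma tcut_nn:
  assumes "a < b" "\<delta> > 0" "b \<le> t - 2 * \<delta>"
  shows "(\<integral>\<^sup>+\<tau>. ennreal \<bar>tcut a b t \<delta> \<tau>\<bar> \<partial>lborel) \<le> ennreal (t - a)"
proof -
  have "(\<integral>\<^sup>+\<tau>. ennreal \<bar>tcut a b t \<delta> \<tau>\<bar> \<partial>lborel) \<le> (\<integral>\<^sup>+\<tau>. ennreal (1 * indicator {a..t} \<tau>) \<partial>lborel)"
  proof (intro nn_integral_mono ennreal_leI)
    fix \<tau> show "\<bar>tcut a b t \<delta> \<tau>\<bar> \<le> 1 * indicator {a..t} \<tau>"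
      using tcut_props(2,3,4)[OF assms, of \<tau>] assms by (cases "\<tau> \<in> {a..t}") auto
  qed
  also have "\<dots> = ennreal (1 * (t - a))" by (rule nn_integral_indicator_interval) (use assms in auto)
  finally show ?thesis by simp
qed

lemma (in heat_test) test_A:
  assumes h: "smooth h" and f: "smooth f" and "\<And>r. r \<notin> {c..d} \<Longrightarrow> h r = 0" "{c..d} \<subseteq> I"
  shows "test_function (UNIV \<times> I) (\<lambda>z. A z * (h (snd z) * f z))"
proof (rule test_functionI)
  show "smooth (\<lambda>z. A z * (h (snd z) * f z))" by (intro smooth_intros smooth_A snd_props h f)
  show "compact (cball x0 2 \<times> {c..d})" by (intro compact_Times) auto
  show "cball x0 2 \<times> {c..d} \<subseteq> UNIV \<times> I" using assms by auto
  show "A z * (h (snd z) * f z) = 0" if "z \<notin> cball x0 2 \<times> {c..d}" for z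
  proof (cases "fst z \<in> cball x0 2")
    case True then show ?thesis using that assms(3)[of "snd z"] by (cases z) auto
  next
    case False
    then have "2\<^sup>2 \<le> (norm (fst z - x0))\<^sup>2" by (intro power_mono) (auto simp: dist_norm norm_minus_commute)
    then have "A z = 0" by (intro A_bounds) (simp add: q_def)
    then show ?thesis by simp
  qed
qed

definition ball_vol :: real where "ball_vol = measure lborel {y::real^3. (norm y)\<^sup>2 \<le> 2}"

lemma
  fixes x0 :: "real^3"
  shows ball_vol: "(\<integral>\<^sup>+x. indicator {x. (norm (x - x0))\<^sup>2 \<le> 2} x \<partial>lborel) = ennreal ball_vol"
    and ball_vol_nonneg: "ball_vol \<ge> 0"
proof -
  have [measurable]: "{y::real^3. (norm y)\<^sup>2 \<le> 2} \<in> sets borel" by measurable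
  have sub: "{y::real^3. (norm y)\<^sup>2 \<le> 2} \<subseteq> cball 0 2"
  proof (rule subsetI)
    fix y :: "real^3" assume "y \<in> {y. (norm y)\<^sup>2 \<le> 2}"
    then have "(norm y)\<^sup>2 \<le> 2\<^sup>2" by simp
    then show "y \<in> cball 0 2" using power2_le_imp_le[of "norm y" 2] by simp
  qed
  have fin: "emeasure lborel {y::real^3. (norm y)\<^sup>2 \<le> 2} < \<infinity>"
    using emeasure_mono[OF sub, of lborel] emeasure_compact_finite[OF compact_cball[of "0::real^3" 2]] by (simp add: le_less_trans)
  have "(\<integral>\<^sup>+x. indicator {x. (norm (x - x0))\<^sup>2 \<le> 2} x \<partial>lborel) = (\<integral>\<^sup>+x. indicator {y. (norm y)\<^sup>2 \<le> 2} (- x0 + x) \<partial>lborel)"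
    by (intro nn_integral_cong) (auto simp: indicator_def)
  also have "\<dots> = emeasure lborel {y::real^3. (norm y)\<^sup>2 \<le> 2}" by (subst nn_integral_shift) auto
  also have "\<dots> = ennreal ball_vol" unfolding ball_vol_def using fin by (intro emeasure_eq_ennreal_measure) auto
  finally show "(\<integral>\<^sup>+x. indicator {x. (norm (x - x0))\<^sup>2 \<le> 2} x \<partial>lborel) = ennreal ball_vol" .
  show "ball_vol \<ge> 0" by (simp add: ball_vol_def)
qed

context weak_flow
begin

lemma energy_nn: "AE t in lborel. \<forall>i. (\<integral>\<^sup>+x. ennreal ((u i (x, t))\<^sup>2) \<partial>lborel) \<le> ennreal K"
  using slices energy
proof eventually_elim
  case (elim t)
  then obtain M where "div_free_slice (\<lambda>i x. u i (x, t)) (\<lambda>i j x. D i j (x, t)) M" by blast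
  then interpret div_free_slice "\<lambda>i x. u i (x, t)" "\<lambda>i j x. D i j (x, t)" M .
  show ?case using elim(2) U2 by (simp add: nn_integral_eq_integral ennreal_leI)
qed

text \<open>On the ball supporting the spatial cutoff, |u| \<le> 1 + u^2 bounds the L1 norm by
  volume plus energy. Cutoff errors that are linear in u are controlled in this way.\<close>

lemma local_energy:
  "AE t in lborel. \<forall>i. (\<integral>\<^sup>+x. ennreal (\<bar>u i (x, t)\<bar> * indicator {x. (norm (x - x0))\<^sup>2 \<le> 2} x) \<partial>lborel) \<le> ennreal (ball_vol + K)"
  using energy_nn
proof eventually_elim
  case (elim t)
  show ?case
  proof
    fix i
    have [measurable]: "{x. (norm (x - x0))\<^sup>2 \<le> 2} \<in> sets borel" by measurable
    have "(\<integral>\<^sup>+x. ennreal (\<bar>u i (x, t)\<bar> * indicator {x. (norm (x - x0))\<^sup>2 \<le> 2} x) \<partial>lborel)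
      \<le> (\<integral>\<^sup>+x. indicator {x. (norm (x - x0))\<^sup>2 \<le> 2} x + ennreal ((u i (x, t))\<^sup>2) \<partial>lborel)"
    proof (intro nn_integral_mono)
      fix x
      have 1: "\<bar>u i (x, t)\<bar> \<le> 1 + (u i (x, t))\<^sup>2"
        using zero_le_power2[of "\<bar>u i (x, t)\<bar> - 1/2"] by (simp add: power2_eq_square algebra_simps)
      show "ennreal (\<bar>u i (x, t)\<bar> * indicator {x. (norm (x - x0))\<^sup>2 \<le> 2} x) \<le> indicator {x. (norm (x - x0))\<^sup>2 \<le> 2} x + ennreal ((u i (x, t))\<^sup>2)"
        using 1 ennreal_leI[OF 1] by (auto simp: indicator_def ennreal_plus[of 1, simplified])
    qed
    also have "\<dots> = ennreal ball_vol + (\<integral>\<^sup>+x. ennreal ((u i (x, t))\<^sup>2) \<partial>lborel)"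
      by (subst nn_integral_add) (auto simp: ball_vol[unfolded nn_integral_indicator])
    also have "\<dots> \<le> ennreal ball_vol + ennreal K" using elim by (intro add_left_mono) auto
    also have "\<dots> = ennreal (ball_vol + K)" using ball_vol_nonneg K_nonneg by simp
    finally show "(\<integral>\<^sup>+x. ennreal (\<bar>u i (x, t)\<bar> * indicator {x. (norm (x - x0))\<^sup>2 \<le> 2} x) \<partial>lborel) \<le> ennreal (ball_vol + K)" .
  qed
qed

lemma slab_estimate:
  assumes [measurable]: "h \<in> borel_measurable borel" and h: "\<And>\<tau>. h \<tau> \<ge> 0"
  shows "(\<integral>\<^sup>+z. ennreal (\<bar>u i z\<bar> * indicator {z. (norm (fst z - x0))\<^sup>2 \<le> 2} z * h (snd z)) \<partial>lborel)
    \<le> ennreal (ball_vol + K) * (\<integral>\<^sup>+\<tau>. ennreal (h \<tau>) \<partial>lborel)"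
proof -
  have [measurable]: "u i \<in> borel_measurable (borel \<Otimes>\<^sub>M borel)" using u_meas[of i] by (simp add: borel_prod)
  have "(\<integral>\<^sup>+z. ennreal (\<bar>u i z\<bar> * indicator {z. (norm (fst z - x0))\<^sup>2 \<le> 2} z * h (snd z)) \<partial>lborel)
    = (\<integral>\<^sup>+\<tau>. \<integral>\<^sup>+x. ennreal (\<bar>u i (x, \<tau>)\<bar> * indicator {x. (norm (x - x0))\<^sup>2 \<le> 2} x * h \<tau>) \<partial>lborel \<partial>lborel)"
    by (subst lborel_nn_snd[symmetric]) (auto simp: borel_prod[symmetric] indicator_def intro!: nn_integral_cong)
  also have "\<dots> = (\<integral>\<^sup>+\<tau>. (\<integral>\<^sup>+x. ennreal (\<bar>u i (x, \<tau>)\<bar> * indicator {x. (norm (x - x0))\<^sup>2 \<le> 2} x) \<partial>lborel) * ennreal (h \<tau>) \<partial>lborel)"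
    using h by (intro nn_integral_cong) (simp add: ennreal_mult nn_integral_multc)
  also have "\<dots> \<le> (\<integral>\<^sup>+\<tau>. ennreal (ball_vol + K) * ennreal (h \<tau>) \<partial>lborel)"
    using local_energy[of x0] by (intro nn_integral_mono_AE) (auto intro!: mult_right_mono elim!: eventually_mono)
  also have "\<dots> = ennreal (ball_vol + K) * (\<integral>\<^sup>+\<tau>. ennreal (h \<tau>) \<partial>lborel)" by (rule nn_integral_cmult) simp
  finally show ?thesis .
qed

lemma slab_estimate2:
  assumes [measurable]: "h \<in> borel_measurable borel" and h: "\<And>\<tau>. h \<tau> \<ge> 0"
  shows "(\<integral>\<^sup>+z. ennreal ((u i z)\<^sup>2 * h (snd z)) \<partial>lborel) \<le> ennreal K * (\<integral>\<^sup>+\<tau>. ennreal (h \<tau>) \<partial>lborel)"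
proof -
  have [measurable]: "u i \<in> borel_measurable (borel \<Otimes>\<^sub>M borel)" using u_meas[of i] by (simp add: borel_prod)
  have "(\<integral>\<^sup>+z. ennreal ((u i z)\<^sup>2 * h (snd z)) \<partial>lborel)
    = (\<integral>\<^sup>+\<tau>. \<integral>\<^sup>+x. ennreal ((u i (x, \<tau>))\<^sup>2 * h \<tau>) \<partial>lborel \<partial>lborel)"
    by (subst lborel_nn_snd[symmetric]) (auto simp: borel_prod[symmetric])
  also have "\<dots> = (\<integral>\<^sup>+\<tau>. (\<integral>\<^sup>+x. ennreal ((u i (x, \<tau>))\<^sup>2) \<partial>lborel) * ennreal (h \<tau>) \<partial>lborel)"
    using h by (intro nn_integral_cong) (simp add: ennreal_mult nn_integral_multc)
  also have "\<dots> \<le> (\<integral>\<^sup>+\<tau>. ennreal K * ennreal (h \<tau>) \<partial>lborel)"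
    using energy_nn by (intro nn_integral_mono_AE) (auto intro!: mult_right_mono elim!: eventually_mono)
  also have "\<dots> = ennreal K * (\<integral>\<^sup>+\<tau>. ennreal (h \<tau>) \<partial>lborel)" by (rule nn_integral_cmult) simp
  finally show ?thesis .
qed

text \<open>The first summand collects the cutoff errors on the linear side, where
  \<open>T - a0\<close> and \<open>2 * step_const\<close> bound the L1 norms of the time cutoff and
  of its derivative. The second collects those of the quadratic term, with 288 = 36 * 8 and the
  energy of three components. Neither depends on x0, s or \<delta>.\<close>

definition main_const :: real where
  "main_const = 200 * cut_const * annulus_const * (ball_vol + K) * ((T - a0) + 2 * step_const)
     + 288 * cut_const * annulus_const * (3 * K * (T - a0))"

text \<open>The integral on the left is the main part of \<open>u k\<close> against
  \<open>lap (bheat W)\<close>; \<open>pressure_free\<close> trades the whole for the quadratic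
  term. There |u_i u_j| is estimated in two ways: by \<open>V\<close> against the singular kernel,
  and by the energy density against the bounded annulus term, so \<open>V\<close> enters only
  through the kernel.\<close>

lemma main_bound:
  assumes ab: "a0 < a" "a < b" "\<delta> > 0" "b \<le> t - 2 * \<delta>" "t \<le> T" "t \<le> s"
    and V[measurable]: "V \<in> borel_measurable borel" and V0: "\<And>\<tau>. V \<tau> \<ge> 0"
    and uV: "AE z in lborel. snd z \<in> {a..t} \<longrightarrow> (\<forall>i. (u i z)\<^sup>2 \<le> V (snd z))"
  shows "ennreal \<bar>LINT z|lborel. u k z * (cut (fst z - x0) * (deriv1 (tcut a b t \<delta>) (snd z) * dhk (fst z - x0) (s - snd z)))\<bar>
    \<le> ennreal main_const + ennreal (36 * kernel_const * gauss8) * (\<integral>\<^sup>+\<tau>. ennreal (V \<tau> * (s - \<tau>) powr (-3/2)) * indicator {a..<t} \<tau> \<partial>lborel)"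
proof -
  define th where "th = tcut a b t \<delta>"
  define lam where "lam = plam \<delta> s"
  note tp = tcut_props[OF ab(2,3,4), folded th_def]
  note lp = plam_props[OF ab(3), of s, folded lam_def]
  have th0: "th \<tau> = 0" if "\<tau> \<notin> {a..t - \<delta>}" for \<tau> using tp(4)[of \<tau>] that by auto
  have dth0: "deriv1 th \<tau> = 0" if "\<tau> \<notin> {a..t - \<delta>}" for \<tau>
    unfolding deriv1_def by (rule pd_eq_0[of "{a..t - \<delta>}", OF _ th0 that]) auto
  \<comment> \<open>The time cutoff lives on [a, t - \<delta>], where s - \<tau> is at least
    \<delta> since t \<le> s; there \<open>plam\<close> coincides with s - \<tau> and has slope
    -1.\<close>
  interpret heat_test x0 lam th
  proof
    fix r assume "th r \<noteq> 0"
    then have "r \<in> {a..t - \<delta>}" using th0 by blast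
    then have "s - r > \<delta> / 2" using ab by simp
    then show "deriv1 lam r = -1" by (rule lp(4))
  qed (use tp lp in auto)
  have lam_s: "lam \<tau> = s - \<tau>" if "\<tau> \<in> {a..t - \<delta>}" for \<tau> using that ab by (intro lp(3)) auto
  note CB = cut_const
  have [measurable]: "u i \<in> borel_measurable (borel \<Otimes>\<^sub>M borel)" for i using u_meas[of i] by (simp add: borel_prod)
  have [measurable]: "th \<in> borel_measurable borel" "deriv1 th \<in> borel_measurable borel" "lam \<in> borel_measurable borel"
    using smooth_borel[OF tp(1)] smooth_borel[OF smooth_deriv1[OF tp(1)]] smooth_borel[OF lp(1)] by auto
  have TW: "test_function (UNIV \<times> {a0<..<T}) W"
    by (rule test_W[of a "t - \<delta>"]) (use th0 ab in auto)
  have sW: "smooth W" by (rule test_smooth[OF TW])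
  define mf where "mf z = A z * (deriv1 th (snd z) * lap P z)" for z
  have Tm: "test_function (UNIV \<times> {a0<..<T}) mf"
    unfolding mf_def[abs_def] by (rule test_A[OF smooth_deriv1[OF tp(1)] smooth_lap[OF smooth_P] dth0]) (use ab in auto)
  have mf_eq: "mf z = cut (fst z - x0) * (deriv1 th (snd z) * dhk (fst z - x0) (s - snd z))" for z
    unfolding mf_def A_def lap_P_dhk using lam_s[of "snd z"] dth0[of "snd z"] by (cases "snd z \<in> {a..t - \<delta>}") auto
  have im: "integrable lborel (\<lambda>z. u k z * mf z)" by (rule integrable_mult_test(1)[OF Tm u_meas u2])
  have iW: "integrable lborel (\<lambda>z. u k z * lap (bheat W) z)"
    by (rule integrable_mult_test(1)[OF test_lap[OF test_bheat[OF TW]] u_meas u2])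
  define err where "err z = 200 * cut_const * annulus_const * (\<bar>u k z\<bar> * indicator {z. (norm (fst z - x0))\<^sup>2 \<le> 2} z * (\<bar>th (snd z)\<bar> + \<bar>deriv1 th (snd z)\<bar>))" for z
  have e1: "\<bar>u k z * mf z - u k z * lap (bheat W) z\<bar> \<le> err z" for z
  proof -
    have "\<bar>lap (bheat W) z - mf z\<bar> \<le> 200 * cut_const * annulus_const * (\<bar>th (snd z)\<bar> + \<bar>deriv1 th (snd z)\<bar>) * indicator {z. q z \<le> 2} z"
      unfolding mf_def by (rule lap_bheat_W[OF CB])
    then have "\<bar>u k z\<bar> * \<bar>lap (bheat W) z - mf z\<bar> \<le> \<bar>u k z\<bar> * (200 * cut_const * annulus_const * (\<bar>th (snd z)\<bar> + \<bar>deriv1 th (snd z)\<bar>) * indicator {z. q z \<le> 2} z)"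
      by (intro mult_left_mono) auto
    moreover have "\<bar>u k z * mf z - u k z * lap (bheat W) z\<bar> = \<bar>u k z\<bar> * \<bar>lap (bheat W) z - mf z\<bar>"
      unfolding right_diff_distrib[symmetric] abs_mult by (simp only: abs_minus_commute)
    moreover have "err z = \<bar>u k z\<bar> * (200 * cut_const * annulus_const * (\<bar>th (snd z)\<bar> + \<bar>deriv1 th (snd z)\<bar>) * indicator {z. q z \<le> 2} z)"
      unfolding err_def q_def by (simp only: mult_ac)
    ultimately show ?thesis by linarith
  qed
  have cc: "0 \<le> 200 * cut_const * annulus_const" using cut_const(1) annulus_const_nonneg by simp
  have E1: "(\<integral>\<^sup>+z. ennreal (err z) \<partial>lborel) \<le> ennreal (200 * cut_const * annulus_const * (ball_vol + K) * ((T - a0) + 2 * step_const))"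
  proof -
    have "(\<integral>\<^sup>+z. ennreal (err z) \<partial>lborel) = ennreal (200 * cut_const * annulus_const) *
       (\<integral>\<^sup>+z. ennreal (\<bar>u k z\<bar> * indicator {z. (norm (fst z - x0))\<^sup>2 \<le> 2} z * (\<bar>th (snd z)\<bar> + \<bar>deriv1 th (snd z)\<bar>)) \<partial>lborel)"
      unfolding err_def using cc by (subst nn_integral_cmult[symmetric]) (auto simp: ennreal_mult borel_prod[symmetric])
    also have "\<dots> \<le> ennreal (200 * cut_const * annulus_const) * (ennreal (ball_vol + K) * (\<integral>\<^sup>+\<tau>. ennreal (\<bar>th \<tau>\<bar> + \<bar>deriv1 th \<tau>\<bar>) \<partial>lborel))"
      by (intro mult_left_mono slab_estimate[of "\<lambda>\<tau>. \<bar>th \<tau>\<bar> + \<bar>deriv1 th \<tau>\<bar>"]) auto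
    also have "(\<integral>\<^sup>+\<tau>. ennreal (\<bar>th \<tau>\<bar> + \<bar>deriv1 th \<tau>\<bar>) \<partial>lborel) \<le> ennreal (t - a) + ennreal (2 * step_const)"
      using tcut_nn[OF ab(2,3,4), folded th_def] deriv1_tcut_nn[OF ab(2,3,4), folded th_def]
      by (simp add: nn_integral_add add_mono)
    also have "\<dots> \<le> ennreal ((T - a0) + 2 * step_const)"
      using ab step_const(1) by (simp flip: ennreal_plus add: ennreal_leI)
    finally have "(\<integral>\<^sup>+z. ennreal (err z) \<partial>lborel) \<le> ennreal (200 * cut_const * annulus_const) * (ennreal (ball_vol + K) * ennreal ((T - a0) + 2 * step_const))"
      by (simp add: mult_left_mono)
    also have "\<dots> = ennreal (200 * cut_const * annulus_const * ((ball_vol + K) * ((T - a0) + 2 * step_const)))"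
    proof -
      have "0 \<le> ball_vol + K" "0 \<le> (T - a0) + 2 * step_const" using ball_vol_nonneg K_nonneg ab step_const(1) by auto
      then show ?thesis using cc by (simp only: ennreal_mult mult_nonneg_nonneg)
    qed
    finally show ?thesis by (simp only: mult.assoc)
  qed
  define R where "R z = (\<Sum>i\<in>UNIV. \<Sum>j\<in>UNIV. u i z * u j z * pd (ex j) (flux k W i) z)" for z
  define E where "E z = (\<Sum>l\<in>UNIV. (u l z)\<^sup>2)" for z
  define g1 where "g1 z = 36 * kernel_const * (V (snd z) * (th (snd z) * (mu z ^ 3 * exp (- (1/8) * (mu z * q z)))))" for z
  define g2 where "g2 z = 288 * cut_const * annulus_const * (E z * th (snd z))" for z
  have R_le: "AE z in lborel. \<bar>R z\<bar> \<le> g1 z + g2 z"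
    using uV
  proof eventually_elim
    case (elim z)
    let ?t = "th (snd z)"
    let ?k = "kernel_const * mu z ^ 3 * exp (- (1/8) * (mu z * q z))" and ?c = "8 * cut_const * annulus_const"
    let ?B = "?t * (?k + ?c)"
    have t0: "?t \<ge> 0" by (rule tp)
    have k0: "?k \<ge> 0" using kernel_const_nonneg mu_props(3)[of z] by simp
    have c0: "?c \<ge> 0" using cut_const(1) annulus_const_nonneg by simp
    have B: "\<bar>pds ex [c, b, a] W z\<bar> \<le> ?B" for a b c
    proof -
      have "\<bar>pds ex [c, b, a] W z\<bar> \<le> \<bar>?t\<bar> * (?k + 8 * cut_const * annulus_const * indicator {z. q z \<le> 2} z)"
        by (rule W3_bound[OF CB])
      also have "\<dots> \<le> ?B" using t0 c0 by (auto intro!: mult_left_mono simp: indicator_def)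
      finally show ?thesis .
    qed
    \<comment> \<open>One third derivative of \<open>W\<close>, and on the diagonal three more from
      the Laplacian. Nine index pairs then turn the factor 4 into 36.\<close>
    have F: "\<bar>pd (ex j) (flux k W i) z\<bar> \<le> 4 * ?B" for i j
    proof -
      have eq: "pd (ex j) (flux k W i) z = pds ex [j, i, k] W z - (if i = k then 1 else 0) * (\<Sum>l\<in>UNIV. pds ex [j, l, l] W z)"
        unfolding flux_def by (subst pd_diff_cmult) (auto intro!: smooth_intros sW simp: lap_def pd_sum sW smooth_pd)
      have "\<bar>\<Sum>l\<in>UNIV. pds ex [j, l, l] W z\<bar> \<le> (\<Sum>l\<in>(UNIV::3 set). ?B)"
        by (rule order_trans[OF sum_abs]) (rule sum_mono, rule B)
      then have "\<bar>\<Sum>l\<in>UNIV. pds ex [j, l, l] W z\<bar> \<le> 3 * ?B" by simp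
      then show ?thesis unfolding eq using B[of j i k] by (cases "i = k") auto
    qed
    have uu: "\<bar>u i z * u j z\<bar> \<le> E z" for i j
    proof -
      have "2 * (\<bar>u i z\<bar> * \<bar>u j z\<bar>) \<le> (u i z)\<^sup>2 + (u j z)\<^sup>2"
        using sum_squares_bound[of "\<bar>u i z\<bar>" "\<bar>u j z\<bar>"] by simp
      moreover have "(u i z)\<^sup>2 \<le> E z" "(u j z)\<^sup>2 \<le> E z"
        unfolding E_def by (rule member_le_sum; simp)+
      ultimately show ?thesis by (simp add: abs_mult)
    qed
    \<comment> \<open>The factor \<open>?t\<close> vanishes outside the interval on which
      \<open>V\<close> is known to dominate.\<close>
    have uuV: "?t * \<bar>u i z * u j z\<bar> \<le> ?t * V (snd z)" for i j
    proof (cases "snd z \<in> {a..t}")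
      case True
      have "2 * (\<bar>u i z\<bar> * \<bar>u j z\<bar>) \<le> (u i z)\<^sup>2 + (u j z)\<^sup>2"
        using sum_squares_bound[of "\<bar>u i z\<bar>" "\<bar>u j z\<bar>"] by simp
      moreover have "(u i z)\<^sup>2 \<le> V (snd z)" "(u j z)\<^sup>2 \<le> V (snd z)" using elim True by auto
      ultimately have "\<bar>u i z * u j z\<bar> \<le> V (snd z)" by (simp add: abs_mult)
      then show ?thesis using t0 by (intro mult_left_mono)
    next
      case False then show ?thesis using th0[of "snd z"] ab by auto
    qed
    have "\<bar>u i z * u j z * pd (ex j) (flux k W i) z\<bar> \<le> 4 * (?t * V (snd z) * ?k + E z * ?t * ?c)" for i j
    proof -
      have "\<bar>u i z * u j z * pd (ex j) (flux k W i) z\<bar> \<le> \<bar>u i z * u j z\<bar> * (4 * ?B)"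
        unfolding abs_mult[of "u i z * u j z"] by (intro mult_left_mono F) auto
      also have "\<dots> = 4 * ((?t * \<bar>u i z * u j z\<bar>) * ?k + \<bar>u i z * u j z\<bar> * ?t * ?c)" by (simp add: algebra_simps)
      also have "\<dots> \<le> 4 * (?t * V (snd z) * ?k + E z * ?t * ?c)"
        by (rule mult_left_mono[OF add_mono[OF mult_right_mono[OF uuV k0] mult_right_mono[OF mult_right_mono[OF uu t0] c0]]]) simp
      finally show ?thesis .
    qed
    then have "\<bar>R z\<bar> \<le> (\<Sum>i\<in>(UNIV::3 set). \<Sum>j\<in>(UNIV::3 set). 4 * (?t * V (snd z) * ?k + E z * ?t * ?c))"
      unfolding R_def by (intro order_trans[OF sum_abs] sum_mono)
    also have "\<dots> = g1 z + g2 z" unfolding g1_def g2_def by (simp add: algebra_simps)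
    finally show ?case .
  qed
  have q_meas[measurable]: "q \<in> borel_measurable (borel \<Otimes>\<^sub>M borel)" unfolding q_def[abs_def] by measurable
  have mu_meas[measurable]: "mu \<in> borel_measurable (borel \<Otimes>\<^sub>M borel)" unfolding mu_def[abs_def] by measurable
  have E_meas[measurable]: "E \<in> borel_measurable (borel \<Otimes>\<^sub>M borel)" unfolding E_def[abs_def] by measurable
  have k1: "0 \<le> 36 * kernel_const" using kernel_const_nonneg by simp
  have G1: "(\<integral>\<^sup>+z. ennreal (g1 z) \<partial>lborel) \<le> ennreal (36 * kernel_const * gauss8) * (\<integral>\<^sup>+\<tau>. ennreal (V \<tau> * (s - \<tau>) powr (-3/2)) * indicator {a..<t} \<tau> \<partial>lborel)"
  proof -
    have "(\<integral>\<^sup>+z. ennreal (g1 z) \<partial>lborel) = (\<integral>\<^sup>+\<tau>. \<integral>\<^sup>+x. ennreal (g1 (x, \<tau>)) \<partial>lborel \<partial>lborel)"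
      unfolding g1_def by (subst lborel_nn_snd) (auto simp: borel_prod[symmetric])
    also have "\<dots> = (\<integral>\<^sup>+\<tau>. ennreal (36 * kernel_const * gauss8) * ennreal (V \<tau> * (th \<tau> * lam \<tau> powr (-3/2))) \<partial>lborel)"
    proof (rule nn_integral_cong)
      fix \<tau>
      let ?l = "lam \<tau>"
      have c: "0 \<le> 36 * kernel_const * (V \<tau> * (th \<tau> * (?l powr (-1)) ^ 3))" using k1 V0 tp(2) by simp
      have "(\<integral>\<^sup>+x. ennreal (g1 (x, \<tau>)) \<partial>lborel) = (\<integral>\<^sup>+x. ennreal (36 * kernel_const * (V \<tau> * (th \<tau> * (?l powr (-1)) ^ 3))) * ennreal (exp (- (1/8) * (?l powr (-1) * (norm (x - x0))\<^sup>2))) \<partial>lborel)"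
        unfolding g1_def mu_def q_def by (intro nn_integral_cong) (subst ennreal_mult[symmetric, OF c], auto simp: mult_ac)
      also have "\<dots> = ennreal (36 * kernel_const * (V \<tau> * (th \<tau> * (?l powr (-1)) ^ 3))) * (ennreal (?l powr (3/2)) * ennreal gauss8)"
        by (subst nn_integral_cmult) (simp, subst gauss_scaled[OF lam_pos], simp add: gauss8)
      also have "\<dots> = ennreal (36 * kernel_const * (V \<tau> * (th \<tau> * (?l powr (-1)) ^ 3)) * (?l powr (3/2) * gauss8))"
        using c gauss8(2) by (simp add: ennreal_mult)
      also have "36 * kernel_const * (V \<tau> * (th \<tau> * (?l powr (-1)) ^ 3)) * (?l powr (3/2) * gauss8)
          = 36 * kernel_const * gauss8 * (V \<tau> * (th \<tau> * ((?l powr (-1)) ^ 3 * ?l powr (3/2))))" by (simp add: mult_ac)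
      \<comment> \<open>The cube from \<open>P3_bound\<close> loses 3/2 powers to the volume factor
        of the Gaussian integral, which leaves the announced exponent -3/2.\<close>
      also have "(?l powr (-1)) ^ 3 * ?l powr (3/2) = ?l powr (-3/2)"
      proof -
        have "(?l powr (-1)) ^ 3 = ?l powr (-1) * (?l powr (-1) * ?l powr (-1))" by (simp add: power3_eq_cube)
        also have "\<dots> = ?l powr (-3)" by (simp only: powr_add[symmetric]) simp
        finally show ?thesis by (simp only: powr_add[symmetric]) simp
      qed
      also have "ennreal (36 * kernel_const * gauss8 * (V \<tau> * (th \<tau> * ?l powr (-3/2)))) = ennreal (36 * kernel_const * gauss8) * ennreal (V \<tau> * (th \<tau> * ?l powr (-3/2)))"
        using k1 gauss8(2) V0 tp(2) by (intro ennreal_mult) auto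
      finally show "(\<integral>\<^sup>+x. ennreal (g1 (x, \<tau>)) \<partial>lborel) = ennreal (36 * kernel_const * gauss8) * ennreal (V \<tau> * (th \<tau> * lam \<tau> powr (-3/2)))" .
    qed
    also have "\<dots> = ennreal (36 * kernel_const * gauss8) * (\<integral>\<^sup>+\<tau>. ennreal (V \<tau> * (th \<tau> * lam \<tau> powr (-3/2))) \<partial>lborel)"
      by (rule nn_integral_cmult) simp
    also have "\<dots> \<le> ennreal (36 * kernel_const * gauss8) * (\<integral>\<^sup>+\<tau>. ennreal (V \<tau> * (s - \<tau>) powr (-3/2)) * indicator {a..<t} \<tau> \<partial>lborel)"
    proof (intro mult_left_mono nn_integral_mono)
      fix \<tau>
      show "ennreal (V \<tau> * (th \<tau> * lam \<tau> powr (-3/2))) \<le> ennreal (V \<tau> * (s - \<tau>) powr (-3/2)) * indicator {a..<t} \<tau>"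
      proof (cases "\<tau> \<in> {a..t - \<delta>}")
        case True
        have "V \<tau> * (th \<tau> * lam \<tau> powr (-3/2)) \<le> V \<tau> * (1 * lam \<tau> powr (-3/2))"
          using V0 tp(3)[of \<tau>] by (intro mult_left_mono mult_right_mono) auto
        then show ?thesis using True ab lam_s[OF True] by (auto intro: ennreal_leI)
      qed (simp add: th0)
    qed simp
    finally show ?thesis .
  qed
  have c2: "0 \<le> 288 * cut_const * annulus_const" using cut_const(1) annulus_const_nonneg by simp
  have G2: "(\<integral>\<^sup>+z. ennreal (g2 z) \<partial>lborel) \<le> ennreal (288 * cut_const * annulus_const * (3 * K * (T - a0)))"
  proof -
    have "(\<integral>\<^sup>+z. ennreal (g2 z) \<partial>lborel) = ennreal (288 * cut_const * annulus_const) * (\<integral>\<^sup>+z. (\<Sum>l\<in>UNIV. ennreal ((u l z)\<^sup>2 * th (snd z))) \<partial>lborel)"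
    proof -
      have "ennreal (g2 z) = ennreal (288 * cut_const * annulus_const) * (\<Sum>l\<in>UNIV. ennreal ((u l z)\<^sup>2 * th (snd z)))" for z
      proof -
        have "(\<Sum>l\<in>UNIV. ennreal ((u l z)\<^sup>2 * th (snd z))) = ennreal (\<Sum>l\<in>UNIV. (u l z)\<^sup>2 * th (snd z))"
          by (rule sum_ennreal) (use tp(2) in auto)
        moreover have "g2 z = 288 * cut_const * annulus_const * (\<Sum>l\<in>UNIV. (u l z)\<^sup>2 * th (snd z))"
          by (simp only: g2_def E_def sum_distrib_right)
        moreover have "0 \<le> (\<Sum>l\<in>UNIV. (u l z)\<^sup>2 * th (snd z))" by (rule sum_nonneg) (use tp(2) in auto)
        ultimately show ?thesis using c2 by (simp only: ennreal_mult)
      qed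
      then show ?thesis by (simp only:) (rule nn_integral_cmult, simp add: borel_prod[symmetric])
    qed
    also have "(\<integral>\<^sup>+z. (\<Sum>l\<in>UNIV. ennreal ((u l z)\<^sup>2 * th (snd z))) \<partial>lborel) = (\<Sum>l\<in>UNIV. \<integral>\<^sup>+z. ennreal ((u l z)\<^sup>2 * th (snd z)) \<partial>lborel)"
      by (rule nn_integral_sum) (simp add: borel_prod[symmetric])
    also have "\<dots> \<le> (\<Sum>l\<in>(UNIV :: 3 set). ennreal K * ennreal (T - a0))"
    proof (rule sum_mono)
      fix l :: 3
      have "(\<integral>\<^sup>+\<tau>. ennreal (th \<tau>) \<partial>lborel) \<le> ennreal (t - a)"
        using tcut_nn[OF ab(2,3,4), folded th_def] tp(2) by simp
      also have "\<dots> \<le> ennreal (T - a0)" using ab by (intro ennreal_leI) auto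
      finally have "ennreal K * (\<integral>\<^sup>+\<tau>. ennreal (th \<tau>) \<partial>lborel) \<le> ennreal K * ennreal (T - a0)" by (intro mult_left_mono) auto
      then show "(\<integral>\<^sup>+z. ennreal ((u l z)\<^sup>2 * th (snd z)) \<partial>lborel) \<le> ennreal K * ennreal (T - a0)"
        using slab_estimate2[of th l] tp(2) by (auto intro: order_trans)
    qed
    also have "\<dots> = ennreal (3 * K * (T - a0))"
      using K_nonneg ab by (simp add: ennreal_mult mult.assoc)
    finally have "(\<integral>\<^sup>+z. ennreal (g2 z) \<partial>lborel) \<le> ennreal (288 * cut_const * annulus_const) * ennreal (3 * K * (T - a0))"
      by (simp add: mult_left_mono)
    also have "\<dots> = ennreal (288 * cut_const * annulus_const * (3 * K * (T - a0)))"
    proof -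
      have "0 \<le> 3 * K * (T - a0)" using K_nonneg ab by simp
      then show ?thesis using c2 by (simp only: ennreal_mult)
    qed
    finally show ?thesis .
  qed
  have "(LINT z|lborel. u k z * mf z) = (LINT z|lborel. u k z * mf z - u k z * lap (bheat W) z) + (LINT z|lborel. R z)"
    using im iW pressure_free[OF TW, of k] by (simp add: R_def)
  then have "ennreal \<bar>LINT z|lborel. u k z * mf z\<bar> \<le> ennreal \<bar>LINT z|lborel. u k z * mf z - u k z * lap (bheat W) z\<bar> + ennreal \<bar>LINT z|lborel. R z\<bar>"
    by (simp flip: ennreal_plus)
  also have "\<dots> \<le> (\<integral>\<^sup>+z. ennreal (err z) \<partial>lborel) + ((\<integral>\<^sup>+z. ennreal (g1 z) \<partial>lborel) + (\<integral>\<^sup>+z. ennreal (g2 z) \<partial>lborel))"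
  proof (rule add_mono)
    show "ennreal \<bar>LINT z|lborel. u k z * mf z - u k z * lap (bheat W) z\<bar> \<le> (\<integral>\<^sup>+z. ennreal (err z) \<partial>lborel)"
      by (rule order_trans[OF abs_LINT_le]) (intro nn_integral_mono ennreal_leI e1)
    have g12: "g1 z \<ge> 0" "g2 z \<ge> 0" for z
      using k1 cut_const(1) annulus_const_nonneg V0 tp(2) mu_props(3)[of z] by (auto simp: g1_def g2_def E_def intro!: mult_nonneg_nonneg sum_nonneg)
    have "ennreal \<bar>LINT z|lborel. R z\<bar> \<le> (\<integral>\<^sup>+z. ennreal (g1 z) + ennreal (g2 z) \<partial>lborel)"
      by (rule order_trans[OF abs_LINT_le]) (rule nn_integral_mono_AE, use R_le in \<open>eventually_elim\<close>, simp add: g12 ennreal_leI flip: ennreal_plus)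
    also have "\<dots> = (\<integral>\<^sup>+z. ennreal (g1 z) \<partial>lborel) + (\<integral>\<^sup>+z. ennreal (g2 z) \<partial>lborel)"
      unfolding g1_def g2_def by (rule nn_integral_add) (simp_all add: borel_prod[symmetric])
    finally show "ennreal \<bar>LINT z|lborel. R z\<bar> \<le> (\<integral>\<^sup>+z. ennreal (g1 z) \<partial>lborel) + (\<integral>\<^sup>+z. ennreal (g2 z) \<partial>lborel)" .
  qed
  also have "\<dots> \<le> ennreal (200 * cut_const * annulus_const * (ball_vol + K) * ((T - a0) + 2 * step_const))
     + (ennreal (36 * kernel_const * gauss8) * (\<integral>\<^sup>+\<tau>. ennreal (V \<tau> * (s - \<tau>) powr (-3/2)) * indicator {a..<t} \<tau> \<partial>lborel)
     + ennreal (288 * cut_const * annulus_const * (3 * K * (T - a0))))"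
    by (intro add_mono E1 G1 G2)
  also have "\<dots> = ennreal main_const + ennreal (36 * kernel_const * gauss8) * (\<integral>\<^sup>+\<tau>. ennreal (V \<tau> * (s - \<tau>) powr (-3/2)) * indicator {a..<t} \<tau> \<partial>lborel)"
  proof -
    have "ennreal main_const = ennreal (200 * cut_const * annulus_const * (ball_vol + K) * ((T - a0) + 2 * step_const)) + ennreal (288 * cut_const * annulus_const * (3 * K * (T - a0)))"
      unfolding main_const_def using cut_const(1) annulus_const_nonneg ball_vol_nonneg K_nonneg ab step_const(1) by (intro ennreal_plus mult_nonneg_nonneg) auto
    then show ?thesis by (simp add: add_ac)
  qed
  finally show ?thesis unfolding mf_eq th_def .
qed

end

section \<open>Integration over the final time\<close>

definition gauss4 :: real where "gauss4 = enn2real (gauss (1/4))"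

lemma gauss4: "ennreal gauss4 = gauss (1/4)" "gauss4 \<ge> 0"
  using gauss_finite[of "1/4"] by (simp_all add: gauss4_def)

text \<open>Concentrates at the origin as \<open>\<delta>\<close> tends to \<open>0\<close>, with total mass tending to \<^term>\<open>gauss4\<close>
  because \<^term>\<open>hk\<close> is not normalized.\<close>

definition kap :: "real \<Rightarrow> (real^3) \<times> real \<Rightarrow> real" where
  "kap \<delta> w = deriv1 step (snd w / \<delta> - 1) / \<delta> * (cut (fst w) * hk (fst w) (snd w))"

lemma cut_even: "cut (- y) = cut y" by (simp add: cut_def)

lemma integrable_mult_bounded:
  fixes f g :: "'a::euclidean_space \<Rightarrow> real"
  assumes [measurable]: "f \<in> borel_measurable borel" "g \<in> borel_measurable borel"
    and g2: "integrable lborel (\<lambda>x. (g x)\<^sup>2)"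
    and M: "\<And>x. \<bar>f x\<bar> \<le> M" and K: "compact K" "\<And>x. x \<notin> K \<Longrightarrow> f x = 0"
  shows "integrable lborel (\<lambda>x. g x * f x)"
proof (rule Bochner_Integration.integrable_bound)
  have M0: "M \<ge> 0" using M[of undefined] by linarith
  have sK: "K \<in> sets lborel" using K by (simp add: borel_compact)
  show "integrable lborel (\<lambda>x. M * (indicator K x + (g x)\<^sup>2))"
    using emeasure_compact_finite[OF K(1)] sK g2 by (intro integrable_mult_right Bochner_Integration.integrable_add) simp_all
  show "AE x in lborel. norm (g x * f x) \<le> norm (M * (indicator K x + (g x)\<^sup>2))"
  proof (rule AE_I2)
    fix x
    have 1: "\<bar>g x\<bar> \<le> 1 + (g x)\<^sup>2"
      using zero_le_power2[of "\<bar>g x\<bar> - 1/2"] by (simp add: power2_eq_square algebra_simps)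
    show "norm (g x * f x) \<le> norm (M * (indicator K x + (g x)\<^sup>2))"
    proof (cases "x \<in> K")
      case True
      have "\<bar>g x\<bar> * \<bar>f x\<bar> \<le> (1 + (g x)\<^sup>2) * M" using 1 M by (intro mult_mono) auto
      then show ?thesis using True M0 by (simp add: abs_mult mult_ac)
    qed (simp add: K)
  qed
qed simp

lemma dhk_isCont: assumes "r > 0" shows "isCont (dhk y) r"
proof -
  have "isCont (hk y) r" using DERIV_isCont[OF hk_deriv[OF assms]] .
  then show ?thesis unfolding dhk_def[abs_def] using assms by (intro continuous_intros) auto
qed

lemma hk_FTC:
  assumes "\<tau> < t" "t \<le> S"
  shows "(LINT s|lborel. dhk y (s - \<tau>) * indicator {t..S} s) = hk y (S - \<tau>) - hk y (t - \<tau>)"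
proof -
  have "has_bochner_integral lborel (\<lambda>s. dhk y (s - \<tau>) * indicator {t..S} s) (hk y (S - \<tau>) - hk y (t - \<tau>))"
  proof (rule has_bochner_integral_FTC_Icc_real[OF assms(2)])
    fix s assume s: "t \<le> s" "s \<le> S"
    then have p: "s - \<tau> > 0" using assms by simp
    have d: "((\<lambda>s. s - \<tau>) has_real_derivative 1) (at s)" by (auto intro!: derivative_eq_intros)
    show "((\<lambda>s. hk y (s - \<tau>)) has_real_derivative dhk y (s - \<tau>)) (at s)"
      using DERIV_chain2[OF hk_deriv[OF p] d] by simp
    show "isCont (\<lambda>s. dhk y (s - \<tau>)) s"
    proof (rule isCont_o2[where f="\<lambda>s. s - \<tau>" and g="dhk y"])
      show "isCont (\<lambda>s. s - \<tau>) s" by (intro continuous_intros)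
      show "isCont (dhk y) (s - \<tau>)" by (rule dhk_isCont[OF p])
    qed
  qed
  then show ?thesis by (rule has_bochner_integral_integral_eq)
qed

text \<open>An extended nonnegative integral, so that no integrability of \<open>V\<close> has to be
  settled before the integral is bounded.\<close>

definition duhamel :: "(real \<Rightarrow> real) \<Rightarrow> real \<Rightarrow> real \<Rightarrow> ennreal" where
  "duhamel V a t = (\<integral>\<^sup>+\<tau>. ennreal (V \<tau> * (t - \<tau>) powr (-1/2)) * indicator {a..<t} \<tau> \<partial>lborel)"

lemma deriv1_step_measurable [measurable]: "deriv1 step \<in> borel_measurable borel"
  by (rule smooth_borel[OF smooth_deriv1[OF smooth_step']])

lemma cut_measurable [measurable]: "cut \<in> borel_measurable borel"
  by (rule smooth_borel[OF smooth_cut])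

context weak_flow
begin

text \<open>\<open>main_bound\<close> is integrated over s from t to T + 1. On the left
  \<open>hk_FTC\<close> leaves the two endpoint kernels; on the right Tonelli lets
  \<open>time_integral\<close> act before the integral over \<tau>, and its factor 2 turns 36 into
  72.\<close>

lemma integrated_bound:
  assumes ab: "a0 < a" "a < b" "\<delta> > 0" "b \<le> t - 2 * \<delta>" "t \<le> T"
    and V[measurable]: "V \<in> borel_measurable borel" and V0: "\<And>\<tau>. V \<tau> \<ge> 0"
    and uV: "AE z in lborel. snd z \<in> {a..t} \<longrightarrow> (\<forall>i. (u i z)\<^sup>2 \<le> V (snd z))"
  shows "ennreal \<bar>LINT z|lborel. u k z * (cut (fst z - x0) * (deriv1 (tcut a b t \<delta>) (snd z) *
      (hk (fst z - x0) (T + 1 - snd z) - hk (fst z - x0) (t - snd z))))\<bar>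
    \<le> ennreal (main_const * (T + 1 - a0)) + ennreal (72 * kernel_const * gauss8) * duhamel V a t"
proof -
  define S where "S = T + 1"
  have tS: "t \<le> S" using ab by (simp add: S_def)
  define dth where "dth = deriv1 (tcut a b t \<delta>)"
  note tp = tcut_props[OF ab(2,3,4)]
  have dth_smooth: "smooth dth" unfolding dth_def by (rule smooth_deriv1[OF tp(1)])
  have dth0: "dth \<tau> = 0" if "\<tau> \<notin> {a..t - \<delta>}" for \<tau>
    unfolding dth_def deriv1_def by (rule pd_eq_0[of "{a..t - \<delta>}", OF _ _ that]) (use tp(4) in auto)
  obtain Md where Md: "\<And>\<tau>. \<bar>dth \<tau>\<bar> \<le> Md"
  proof -
    have "test_function UNIV dth" by (rule test_functionI[of _ "{a..t - \<delta>}"]) (use dth_smooth dth0 in auto)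
    from test_bounded[OF this] show ?thesis using that by auto
  qed
  have [measurable]: "dth \<in> borel_measurable borel" by (rule smooth_borel[OF dth_smooth])
  have [measurable]: "u k \<in> borel_measurable (borel \<Otimes>\<^sub>M borel)" using u_meas[of k] by (simp add: borel_prod)
  \<comment> \<open>A bound for \<open>dhk\<close> on the support of the cutoffs. It blows up with
    \<open>\<delta>\<close> but serves only to justify Fubini and does not enter the final
    estimate.\<close>
  define B where "B = (\<delta> powr (-1) * \<delta> powr (-1) + 2 * \<delta> powr (-1)) * \<delta> powr (-3/2)"
  define w where "w z = cut (fst z - x0) * dth (snd z)" for z
  have wm: "w \<in> borel_measurable (borel \<Otimes>\<^sub>M borel)" unfolding w_def[abs_def] by measurable
  have w0: "w z = 0" if "z \<notin> cball x0 2 \<times> {a..t - \<delta>}" for z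
  proof (cases "fst z \<in> cball x0 2")
    case True then show ?thesis using that dth0[of "snd z"] by (cases z) (auto simp: w_def)
  next
    case False
    then have "2\<^sup>2 \<le> (norm (fst z - x0))\<^sup>2" by (intro power_mono) (auto simp: dist_norm norm_minus_commute)
    then show ?thesis by (simp add: w_def cut_0)
  qed
  have wM: "\<bar>w z\<bar> \<le> Md" for z
  proof -
    have "\<bar>cut (fst z - x0)\<bar> * \<bar>dth (snd z)\<bar> \<le> 1 * Md" using cut_bounds Md by (intro mult_mono) auto
    then show ?thesis by (simp add: w_def abs_mult)
  qed
  have iuw: "integrable lborel (\<lambda>z. u k z * w z)"
    by (rule integrable_mult_bounded[of _ _ Md "cball x0 2 \<times> {a..t - \<delta>}"])
       (use wm w0 wM u2 in \<open>auto simp: borel_prod compact_Times\<close>)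
  define f where "f p = u k (fst p) * w (fst p) * (dhk (fst (fst p) - x0) (snd p - snd (fst p)) * indicator {t..S} (snd p))" for p
  have bound: "\<bar>w z * (dhk (fst z - x0) (s - snd z) * indicator {t..S} s)\<bar> \<le> \<bar>w z\<bar> * (B * indicator {t..S} s)" for z s
  proof (cases "w z = 0 \<or> s \<notin> {t..S}")
    case False
    then have "cut (fst z - x0) \<noteq> 0" "snd z \<in> {a..t - \<delta>}" using dth0[of "snd z"] by (auto simp: w_def)
    then have "(norm (fst z - x0))\<^sup>2 \<le> 2" "s - snd z \<ge> \<delta>" using cut_0[of "fst z - x0"] False by (force, simp)
    then have "\<bar>dhk (fst z - x0) (s - snd z)\<bar> \<le> B" unfolding B_def using ab by (intro dhk_le) auto
    then show ?thesis using False by (simp add: abs_mult mult_left_mono)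
  qed auto
  have fi: "integrable lborel f"
  proof (rule Bochner_Integration.integrable_bound)
    show "integrable lborel (\<lambda>p. \<bar>u k (fst p) * w (fst p)\<bar> * (B * indicator {t..S} (snd p)))"
      by (rule integrable_tensor[OF integrable_abs[OF iuw]])
         (intro integrable_mult_right integrable_real_indicator; simp add: emeasure_lborel_Icc_eq)
    show "f \<in> borel_measurable lborel" unfolding f_def[abs_def] using wm by (simp add: borel_prod[symmetric])
    show "AE p in lborel. norm (f p) \<le> norm (\<bar>u k (fst p) * w (fst p)\<bar> * (B * indicator {t..S} (snd p)))"
    proof (rule AE_I2)
      fix p :: "((real^3) \<times> real) \<times> real"
      have "\<bar>u k (fst p)\<bar> * \<bar>w (fst p) * (dhk (fst (fst p) - x0) (snd p - snd (fst p)) * indicator {t..S} (snd p))\<bar>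
        \<le> \<bar>u k (fst p)\<bar> * (\<bar>w (fst p)\<bar> * (B * indicator {t..S} (snd p)))" by (intro mult_left_mono bound) auto
      then show "norm (f p) \<le> norm (\<bar>u k (fst p) * w (fst p)\<bar> * (B * indicator {t..S} (snd p)))"
        by (simp add: f_def abs_mult mult.assoc B_def)
    qed
  qed
  define X where "X z = u k z * (cut (fst z - x0) * (dth (snd z) * (hk (fst z - x0) (S - snd z) - hk (fst z - x0) (t - snd z))))" for z
  have X: "(LINT s|lborel. f (z, s)) = X z" for z
  proof (cases "dth (snd z) = 0")
    case False
    then have "snd z \<in> {a..t - \<delta>}" using dth0 by blast
    then have "snd z < t" using ab by simp
    have "(LINT s|lborel. f (z, s)) = u k z * w z * (LINT s|lborel. dhk (fst z - x0) (s - snd z) * indicator {t..S} s)"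
      by (simp only: f_def fst_conv snd_conv integral_mult_right_zero)
    then show ?thesis unfolding hk_FTC[OF \<open>snd z < t\<close> tS] by (simp add: X_def w_def)
  qed (simp add: f_def X_def w_def)
  define main where "main s = (LINT z|lborel. u k z * (cut (fst z - x0) * (dth (snd z) * dhk (fst z - x0) (s - snd z))))" for s
  have M: "(LINT z|lborel. f (z, s)) = main s * indicator {t..S} s" for s
  proof -
    have "(\<lambda>z. f (z, s)) = (\<lambda>z. u k z * (cut (fst z - x0) * (dth (snd z) * dhk (fst z - x0) (s - snd z))) * indicator {t..S} s)"
      by (auto simp: f_def w_def)
    then show ?thesis by (simp only: main_def integral_mult_left_zero)
  qed
  have "(LINT z|lborel. X z) = (LINT s|lborel. main s * indicator {t..S} s)"
    using lborel_fst[OF fi] lborel_snd[OF fi] by (simp only: X M)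
  then have "ennreal \<bar>LINT z|lborel. X z\<bar> \<le> (\<integral>\<^sup>+s. ennreal \<bar>main s * indicator {t..S} s\<bar> \<partial>lborel)"
    using abs_LINT_le by metis
  also have "\<dots> \<le> (\<integral>\<^sup>+s. ennreal main_const * indicator {t..S} s + ennreal (36 * kernel_const * gauss8) *
     (\<integral>\<^sup>+\<tau>. ennreal (V \<tau>) * indicator {a..<t} \<tau> * (ennreal ((s - \<tau>) powr (-3/2)) * indicator {t..S} s) \<partial>lborel) \<partial>lborel)"
  proof (rule nn_integral_mono)
    fix s
    show "ennreal \<bar>main s * indicator {t..S} s\<bar> \<le> ennreal main_const * indicator {t..S} s + ennreal (36 * kernel_const * gauss8) *
     (\<integral>\<^sup>+\<tau>. ennreal (V \<tau>) * indicator {a..<t} \<tau> * (ennreal ((s - \<tau>) powr (-3/2)) * indicator {t..S} s) \<partial>lborel)"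
    proof (cases "s \<in> {t..S}")
      case True
      have "ennreal \<bar>main s\<bar> \<le> ennreal main_const + ennreal (36 * kernel_const * gauss8) * (\<integral>\<^sup>+\<tau>. ennreal (V \<tau> * (s - \<tau>) powr (-3/2)) * indicator {a..<t} \<tau> \<partial>lborel)"
        unfolding main_def dth_def by (rule main_bound[OF ab _ V V0 uV]) (use True in auto)
      also have "(\<integral>\<^sup>+\<tau>. ennreal (V \<tau> * (s - \<tau>) powr (-3/2)) * indicator {a..<t} \<tau> \<partial>lborel)
        = (\<integral>\<^sup>+\<tau>. ennreal (V \<tau>) * indicator {a..<t} \<tau> * (ennreal ((s - \<tau>) powr (-3/2)) * indicator {t..S} s) \<partial>lborel)"
        using V0 True by (intro nn_integral_cong) (simp add: ennreal_mult mult_ac)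
      finally show ?thesis using True by simp
    qed simp
  qed
  also have "\<dots> = ennreal main_const * (\<integral>\<^sup>+s. indicator {t..S} s \<partial>lborel) + ennreal (36 * kernel_const * gauss8) *
     (\<integral>\<^sup>+s. \<integral>\<^sup>+\<tau>. ennreal (V \<tau>) * indicator {a..<t} \<tau> * (ennreal ((s - \<tau>) powr (-3/2)) * indicator {t..S} s) \<partial>lborel \<partial>lborel)"
    by (subst nn_integral_add) (simp_all add: nn_integral_cmult)
  also have "(\<integral>\<^sup>+s. \<integral>\<^sup>+\<tau>. ennreal (V \<tau>) * indicator {a..<t} \<tau> * (ennreal ((s - \<tau>) powr (-3/2)) * indicator {t..S} s) \<partial>lborel \<partial>lborel)
    = (\<integral>\<^sup>+\<tau>. \<integral>\<^sup>+s. ennreal (V \<tau>) * indicator {a..<t} \<tau> * (ennreal ((s - \<tau>) powr (-3/2)) * indicator {t..S} s) \<partial>lborel \<partial>lborel)"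
    by (rule lborel_pair.Fubini') simp
  also have "\<dots> \<le> (\<integral>\<^sup>+\<tau>. 2 * (ennreal (V \<tau> * (t - \<tau>) powr (-1/2)) * indicator {a..<t} \<tau>) \<partial>lborel)"
  proof (rule nn_integral_mono)
    fix \<tau>
    have "(\<integral>\<^sup>+s. ennreal (V \<tau>) * indicator {a..<t} \<tau> * (ennreal ((s - \<tau>) powr (-3/2)) * indicator {t..S} s) \<partial>lborel)
      = ennreal (V \<tau>) * indicator {a..<t} \<tau> * (\<integral>\<^sup>+s. ennreal ((s - \<tau>) powr (-3/2)) * indicator {t..S} s \<partial>lborel)"
      by (rule nn_integral_cmult) simp
    also have "\<dots> \<le> 2 * (ennreal (V \<tau> * (t - \<tau>) powr (-1/2)) * indicator {a..<t} \<tau>)"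
    proof (cases "\<tau> \<in> {a..<t}")
      case True
      have "ennreal (V \<tau>) * (\<integral>\<^sup>+s. ennreal ((s - \<tau>) powr (-3/2)) * indicator {t..S} s \<partial>lborel) \<le> ennreal (V \<tau>) * ennreal (2 * (t - \<tau>) powr (-1/2))"
        using True by (intro mult_left_mono time_integral) auto
      also have "\<dots> = 2 * ennreal (V \<tau> * (t - \<tau>) powr (-1/2))"
        using V0 by (simp add: ennreal_mult mult_ac)
      finally show ?thesis using True by simp
    qed simp
    finally show "(\<integral>\<^sup>+s. ennreal (V \<tau>) * indicator {a..<t} \<tau> * (ennreal ((s - \<tau>) powr (-3/2)) * indicator {t..S} s) \<partial>lborel) \<le> 2 * (ennreal (V \<tau> * (t - \<tau>) powr (-1/2)) * indicator {a..<t} \<tau>)" .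
  qed
  also have "\<dots> = 2 * duhamel V a t" unfolding duhamel_def by (rule nn_integral_cmult) simp
  finally have fin: "ennreal \<bar>LINT z|lborel. X z\<bar> \<le> ennreal main_const * (\<integral>\<^sup>+s. indicator {t..S} s \<partial>lborel) + ennreal (36 * kernel_const * gauss8) * (2 * duhamel V a t)"
    by (simp add: mult_left_mono add_left_mono)
  have mc0: "main_const \<ge> 0"
    unfolding main_const_def using cut_const(1) annulus_const_nonneg ball_vol_nonneg K_nonneg ab step_const(1) by (intro add_nonneg_nonneg mult_nonneg_nonneg) auto
  have "ennreal main_const * (\<integral>\<^sup>+s. indicator {t..S} s \<partial>lborel) = ennreal (main_const * (S - t))"
    using mc0 tS by (simp add: ennreal_mult)
  also have "\<dots> \<le> ennreal (main_const * (T + 1 - a0))"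
    using mc0 ab by (intro ennreal_leI mult_left_mono) (auto simp: S_def)
  finally have 1: "ennreal main_const * (\<integral>\<^sup>+s. indicator {t..S} s \<partial>lborel) \<le> ennreal (main_const * (T + 1 - a0))" .
  have 2: "ennreal (36 * kernel_const * gauss8) * (2 * duhamel V a t) = ennreal (72 * kernel_const * gauss8) * duhamel V a t"
  proof -
    have "ennreal (72 * kernel_const * gauss8) = ennreal (36 * kernel_const * gauss8) * ennreal 2"
      using kernel_const_nonneg gauss8(2) by (subst ennreal_mult[symmetric]) auto
    then show ?thesis by (simp add: mult.assoc)
  qed
  show ?thesis using order_trans[OF fin add_right_mono[OF 1]] unfolding 2 X_def S_def dth_def .
qed

text \<open>In order: the integrated cutoff errors; the early layer, where |u| \<le>
  \<open>Mb\<close> and two kernels of mass \<open>gauss4\<close> occur; the endpoint kernel at time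
  T + 1, controlled by the local energy.\<close>

definition flow_const :: "real \<Rightarrow> real" where
  "flow_const Mb = main_const * (T + 1 - a0) + 2 * Mb * step_const * gauss4 + (ball_vol + K) * step_const"

text \<open>The derivative of the time cutoff splits into an early and a late layer. The late layer
  paired with the kernel ending at t is the convolution with \<open>kap\<close>, the quantity of
  interest; all other pairings are moved to the right-hand side.\<close>

lemma kap_bound:
  assumes ab: "a0 < a" "a < b" "\<delta> > 0" "b \<le> t - 2 * \<delta>" "t \<le> T"
    and V[measurable]: "V \<in> borel_measurable borel" and V0: "\<And>\<tau>. V \<tau> \<ge> 0"
    and uV: "AE z in lborel. snd z \<in> {a..t} \<longrightarrow> (\<forall>i. (u i z)\<^sup>2 \<le> V (snd z))"
    and Mb: "AE z in lborel. snd z \<in> {a..b} \<longrightarrow> (\<forall>i. \<bar>u i z\<bar> \<le> Mb)" "Mb \<ge> 0"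
  shows "ennreal \<bar>LINT z|lborel. u k z * kap \<delta> ((x0, t) - z)\<bar>
    \<le> ennreal (flow_const Mb) + ennreal (72 * kernel_const * gauss8) * duhamel V a t"
proof -
  define S where "S = T + 1"
  define dth where "dth = deriv1 (tcut a b t \<delta>)"
  define ze where "ze \<tau> = deriv1 step ((\<tau> - a) / (b - a)) / (b - a)" for \<tau>
  define rh where "rh \<tau> = deriv1 step ((t - \<tau>) / \<delta> - 1) / \<delta>" for \<tau>
  have dth_eq: "dth \<tau> = ze \<tau> - rh \<tau>" for \<tau> unfolding dth_def ze_def rh_def by (rule tcut_props(5)[OF ab(2,3,4)])
  have ze0: "\<bar>ze \<tau>\<bar> \<le> step_const / (b - a) * indicator {a..b} \<tau>" for \<tau>
  proof (cases "\<tau> \<in> {a..b}")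
    case True
    then show ?thesis using step_const(2)[of "(\<tau> - a) / (b - a)"] ab by (simp add: ze_def abs_divide divide_right_mono)
  next
    case False
    then have "(\<tau> - a) / (b - a) < 0 \<or> (\<tau> - a) / (b - a) > 1" using ab by (auto simp: divide_neg_pos less_divide_eq)
    then show ?thesis using False by (simp add: ze_def deriv1_step_0)
  qed
  have rh0: "\<bar>rh \<tau>\<bar> \<le> step_const / \<delta> * indicator {t - 2 * \<delta>..t - \<delta>} \<tau>" for \<tau>
  proof (cases "\<tau> \<in> {t - 2 * \<delta>..t - \<delta>}")
    case True
    then show ?thesis using step_const(2)[of "(t - \<tau>) / \<delta> - 1"] ab by (simp add: rh_def abs_divide divide_right_mono)
  next
    case False
    then have "(t - \<tau>) / \<delta> - 1 < 0 \<or> (t - \<tau>) / \<delta> - 1 > 1" using ab by (auto simp: divide_less_eq less_divide_eq)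
    then show ?thesis using False by (simp add: rh_def deriv1_step_0)
  qed
  have [measurable]: "ze \<in> borel_measurable borel" "rh \<in> borel_measurable borel"
    unfolding ze_def[abs_def] rh_def[abs_def] by measurable
  have um[measurable]: "u k \<in> borel_measurable (borel \<Otimes>\<^sub>M borel)" using u_meas[of k] by (simp add: borel_prod)
  let ?y = "\<lambda>z. fst z - x0"
  define X where "X z = u k z * (cut (?y z) * (dth (snd z) * (hk (?y z) (S - snd z) - hk (?y z) (t - snd z))))" for z
  define Y1 where "Y1 z = u k z * (cut (?y z) * (ze (snd z) * (hk (?y z) (S - snd z) - hk (?y z) (t - snd z))))" for z
  define Y2 where "Y2 z = u k z * (cut (?y z) * (rh (snd z) * hk (?y z) (S - snd z)))" for z
  \<comment> \<open>Evenness of \<open>cut\<close> and \<open>hk\<close> in space converts the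
    kernel centred at x0 into convolution form.\<close>
  have eq: "u k z * kap \<delta> ((x0, t) - z) = X z - Y1 z + Y2 z" for z
  proof -
    have "kap \<delta> ((x0, t) - z) = rh (snd z) * (cut (?y z) * hk (?y z) (t - snd z))"
      using cut_even[of "?y z"] hk_even[of "?y z"] by (simp add: kap_def rh_def)
    then show ?thesis unfolding X_def Y1_def Y2_def dth_eq by (simp only:) (simp add: algebra_simps)
  qed
  have int: "integrable lborel (\<lambda>z. u k z * (cut (?y z) * (h (snd z) * g z)))"
    if [measurable]: "h \<in> borel_measurable borel" "g \<in> borel_measurable (borel \<Otimes>\<^sub>M borel)"
      and h: "\<And>\<tau>. \<bar>h \<tau>\<bar> \<le> Ch" "\<And>\<tau>. \<tau> \<notin> {a..t - \<delta>} \<Longrightarrow> h \<tau> = 0"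
      and g: "\<And>z. snd z \<in> {a..t - \<delta>} \<Longrightarrow> \<bar>g z\<bar> \<le> Cg" for h g Ch Cg
  proof (rule integrable_mult_bounded[of _ _ "\<bar>Ch\<bar> * \<bar>Cg\<bar>" "cball x0 2 \<times> {a..t - \<delta>}"])
    show "(\<lambda>z. cut (?y z) * (h (snd z) * g z)) \<in> borel_measurable borel" by (simp add: borel_prod[symmetric])
    fix z :: "(real^3) \<times> real"
    show "\<bar>cut (?y z) * (h (snd z) * g z)\<bar> \<le> \<bar>Ch\<bar> * \<bar>Cg\<bar>"
    proof (cases "snd z \<in> {a..t - \<delta>}")
      case True
      have "\<bar>cut (?y z)\<bar> * (\<bar>h (snd z)\<bar> * \<bar>g z\<bar>) \<le> 1 * (\<bar>Ch\<bar> * \<bar>Cg\<bar>)"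
        using cut_bounds h(1)[of "snd z"] g[OF True] by (intro mult_mono) auto
      then show ?thesis by (simp add: abs_mult)
    qed (simp add: h)
    assume *: "z \<notin> cball x0 2 \<times> {a..t - \<delta>}"
    show "cut (?y z) * (h (snd z) * g z) = 0"
    proof (cases "fst z \<in> cball x0 2")
      case True then show ?thesis using * h(2)[of "snd z"] by (cases z) auto
    next
      case False
      then have "2\<^sup>2 \<le> (norm (?y z))\<^sup>2" by (intro power_mono) (auto simp: dist_norm norm_minus_commute)
      then show ?thesis by (simp add: cut_0)
    qed
  qed (use u2 u_meas in \<open>auto intro: compact_Times\<close>)
  have tS: "t \<le> S" "\<delta> > 0" using ab by (auto simp: S_def)
  have hkS: "\<bar>hk (?y z) (S - snd z)\<bar> \<le> \<delta> powr (-3/2)" "\<bar>hk (?y z) (t - snd z)\<bar> \<le> \<delta> powr (-3/2)" if "snd z \<in> {a..t - \<delta>}" for z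
    using that tS hk_nonneg hk_le[of \<delta> "S - snd z" "?y z"] hk_le[of \<delta> "t - snd z" "?y z"] by auto
  have ze1: "\<bar>ze \<tau>\<bar> \<le> step_const / (b - a)" and ze2: "\<tau> \<notin> {a..t - \<delta>} \<Longrightarrow> ze \<tau> = 0" for \<tau>
  proof -
    have "step_const / (b - a) * indicator {a..b} \<tau> \<le> step_const / (b - a)"
      using step_const(1) ab by (intro mult_left_le) (auto simp: indicator_def)
    with ze0[of \<tau>] show "\<bar>ze \<tau>\<bar> \<le> step_const / (b - a)" by linarith
    assume "\<tau> \<notin> {a..t - \<delta>}"
    then have "\<tau> \<notin> {a..b}" using ab by auto
    then show "ze \<tau> = 0" using ze0[of \<tau>] by simp
  qed
  have rh1: "\<bar>rh \<tau>\<bar> \<le> step_const / \<delta>" and rh2: "\<tau> \<notin> {a..t - \<delta>} \<Longrightarrow> rh \<tau> = 0" for \<tau>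
  proof -
    have "step_const / \<delta> * indicator {t - 2 * \<delta>..t - \<delta>} \<tau> \<le> step_const / \<delta>"
      using step_const(1) ab by (intro mult_left_le) (auto simp: indicator_def)
    with rh0[of \<tau>] show "\<bar>rh \<tau>\<bar> \<le> step_const / \<delta>" by linarith
    assume "\<tau> \<notin> {a..t - \<delta>}"
    then have "\<tau> \<notin> {t - 2 * \<delta>..t - \<delta>}" using ab by auto
    then show "rh \<tau> = 0" using rh0[of \<tau>] by simp
  qed
  have i1: "integrable lborel Y1" unfolding Y1_def
  proof (rule int[OF _ _ ze1 ze2])
    fix z :: "(real^3) \<times> real" assume "snd z \<in> {a..t - \<delta>}"
    from hkS[OF this] show "\<bar>hk (?y z) (S - snd z) - hk (?y z) (t - snd z)\<bar> \<le> 2 * \<delta> powr (-3/2)" by linarith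
  qed auto
  have i2: "integrable lborel Y2" unfolding Y2_def
    by (rule int[OF _ _ rh1 rh2 hkS(1)]) auto
  have d1: "\<bar>dth \<tau>\<bar> \<le> step_const / (b - a) + step_const / \<delta>" for \<tau>
    unfolding dth_eq using ze1[of \<tau>] rh1[of \<tau>] by linarith
  have d2: "\<tau> \<notin> {a..t - \<delta>} \<Longrightarrow> dth \<tau> = 0" for \<tau> unfolding dth_eq using ze2[of \<tau>] rh2[of \<tau>] by simp
  have iX: "integrable lborel X" unfolding X_def
  proof (rule int[OF _ _ d1 d2])
    show "dth \<in> borel_measurable borel" unfolding dth_eq[abs_def] by simp
    fix z :: "(real^3) \<times> real" assume "snd z \<in> {a..t - \<delta>}"
    from hkS[OF this] show "\<bar>hk (?y z) (S - snd z) - hk (?y z) (t - snd z)\<bar> \<le> 2 * \<delta> powr (-3/2)" by linarith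
  qed auto
  have N1: "(\<integral>\<^sup>+z. ennreal \<bar>Y1 z\<bar> \<partial>lborel) \<le> ennreal (2 * Mb * step_const * gauss4)"
  proof -
    have "(\<integral>\<^sup>+z. ennreal \<bar>Y1 z\<bar> \<partial>lborel) \<le> (\<integral>\<^sup>+z. ennreal (Mb * step_const / (b - a)) * indicator {a..b} (snd z) * (ennreal (hk (?y z) (S - snd z)) + ennreal (hk (?y z) (t - snd z))) \<partial>lborel)"
    proof (rule nn_integral_mono_AE)
      show "AE z in lborel. ennreal \<bar>Y1 z\<bar> \<le> ennreal (Mb * step_const / (b - a)) * indicator {a..b} (snd z) * (ennreal (hk (?y z) (S - snd z)) + ennreal (hk (?y z) (t - snd z)))"
        using Mb(1)
      proof eventually_elim
        case (elim z)
        show ?case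
        proof (cases "snd z \<in> {a..b}")
          case True
          have "\<bar>Y1 z\<bar> = \<bar>u k z\<bar> * (\<bar>cut (?y z)\<bar> * (\<bar>ze (snd z)\<bar> * \<bar>hk (?y z) (S - snd z) - hk (?y z) (t - snd z)\<bar>))"
            by (simp add: Y1_def abs_mult)
          also have "\<dots> \<le> Mb * (1 * (step_const / (b - a) * (hk (?y z) (S - snd z) + hk (?y z) (t - snd z))))"
          proof (intro mult_mono)
            show "\<bar>u k z\<bar> \<le> Mb" using elim True by auto
            show "\<bar>cut (?y z)\<bar> \<le> 1" using cut_bounds[of "?y z"] by simp
            show "\<bar>hk (?y z) (S - snd z) - hk (?y z) (t - snd z)\<bar> \<le> hk (?y z) (S - snd z) + hk (?y z) (t - snd z)"
              using hk_nonneg[of "?y z" "S - snd z"] hk_nonneg[of "?y z" "t - snd z"] by linarith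
          qed (use ze1 Mb(2) step_const(1) ab in auto)
          finally have "\<bar>Y1 z\<bar> \<le> Mb * step_const / (b - a) * (hk (?y z) (S - snd z) + hk (?y z) (t - snd z))" by simp
          moreover have "0 \<le> Mb * step_const / (b - a)" using Mb(2) step_const(1) ab by simp
          ultimately show ?thesis using True
            by (simp add: ennreal_mult[symmetric] hk_nonneg ennreal_leI flip: ennreal_plus)
        next
          case False
          then have "ze (snd z) = 0" using ze0[of "snd z"] by simp
          then show ?thesis by (simp add: Y1_def)
        qed
      qed
    qed
    also have "\<dots> = (\<integral>\<^sup>+\<tau>. \<integral>\<^sup>+x. ennreal (Mb * step_const / (b - a)) * indicator {a..b} \<tau> * (ennreal (hk (x - x0) (S - \<tau>)) + ennreal (hk (x - x0) (t - \<tau>))) \<partial>lborel \<partial>lborel)"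
      by (subst lborel_nn_snd[symmetric]) (auto simp: borel_prod[symmetric])
    also have "\<dots> = (\<integral>\<^sup>+\<tau>. ennreal (Mb * step_const / (b - a)) * indicator {a..b} \<tau> * ennreal (2 * gauss4) \<partial>lborel)"
    proof (rule nn_integral_cong)
      fix \<tau>
      show "(\<integral>\<^sup>+x. ennreal (Mb * step_const / (b - a)) * indicator {a..b} \<tau> * (ennreal (hk (x - x0) (S - \<tau>)) + ennreal (hk (x - x0) (t - \<tau>))) \<partial>lborel)
        = ennreal (Mb * step_const / (b - a)) * indicator {a..b} \<tau> * ennreal (2 * gauss4)"
      proof (cases "\<tau> \<in> {a..b}")
        case True
        then have p: "S - \<tau> > 0" "t - \<tau> > 0" using ab by (auto simp: S_def)
        have "(\<integral>\<^sup>+x. ennreal (hk (x - x0) (S - \<tau>)) + ennreal (hk (x - x0) (t - \<tau>)) \<partial>lborel) = ennreal gauss4 + ennreal gauss4"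
          by (subst nn_integral_add) (simp, simp, simp only: hk_integral[OF p(1)] hk_integral[OF p(2)] gauss4(1))
        also have "\<dots> = ennreal (2 * gauss4)" using gauss4(2) by (simp flip: ennreal_plus)
        finally show ?thesis by (subst nn_integral_cmult) auto
      qed simp
    qed
    also have "\<dots> = ennreal (Mb * step_const / (b - a)) * (\<integral>\<^sup>+\<tau>. indicator {a..b} \<tau> \<partial>lborel) * ennreal (2 * gauss4)"
      by (simp add: nn_integral_multc nn_integral_cmult)
    also have "\<dots> = ennreal (Mb * step_const / (b - a) * (b - a) * (2 * gauss4))"
    proof -
      have "(\<integral>\<^sup>+\<tau>. indicator {a..b} \<tau> \<partial>lborel) = ennreal (b - a)" using ab by simp
      moreover have "0 \<le> Mb * step_const / (b - a)" "0 \<le> b - a" "0 \<le> 2 * gauss4" using Mb(2) step_const(1) ab gauss4(2) by auto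
      ultimately show ?thesis by (simp only: ennreal_mult mult_nonneg_nonneg)
    qed
    finally show ?thesis using ab by (simp add: mult_ac)
  qed
  have N2: "(\<integral>\<^sup>+z. ennreal \<bar>Y2 z\<bar> \<partial>lborel) \<le> ennreal ((ball_vol + K) * step_const)"
  proof -
    have "(\<integral>\<^sup>+z. ennreal \<bar>Y2 z\<bar> \<partial>lborel) \<le> (\<integral>\<^sup>+z. ennreal (\<bar>u k z\<bar> * indicator {z. (norm (fst z - x0))\<^sup>2 \<le> 2} z * \<bar>rh (snd z)\<bar>) \<partial>lborel)"
    proof (intro nn_integral_mono ennreal_leI)
      fix z
      show "\<bar>Y2 z\<bar> \<le> \<bar>u k z\<bar> * indicator {z. (norm (fst z - x0))\<^sup>2 \<le> 2} z * \<bar>rh (snd z)\<bar>"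
      proof (cases "rh (snd z) = 0")
        case False
        then have "snd z \<in> {a..t - \<delta>}" using rh2 by blast
        \<comment> \<open>The reason for integrating up to T + 1 and not just to T: at the far
          endpoint the elapsed time is at least 1, so that kernel is at most 1.\<close>
        then have "S - snd z \<ge> 1" using ab by (simp add: S_def)
        then have h: "hk (?y z) (S - snd z) \<le> 1" using hk_le[of 1 "S - snd z" "?y z"] by simp
        have c: "\<bar>cut (?y z)\<bar> \<le> indicator {z. (norm (fst z - x0))\<^sup>2 \<le> 2} z"
          using cut_bounds[of "?y z"] cut_0[of "?y z"] by (auto simp: indicator_def)
        have "\<bar>Y2 z\<bar> = \<bar>u k z\<bar> * (\<bar>cut (?y z)\<bar> * (\<bar>rh (snd z)\<bar> * hk (?y z) (S - snd z)))"
          by (simp add: Y2_def abs_mult hk_nonneg)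
        also have "\<dots> \<le> \<bar>u k z\<bar> * (indicator {z. (norm (fst z - x0))\<^sup>2 \<le> 2} z * (\<bar>rh (snd z)\<bar> * 1))"
          using h c hk_nonneg by (intro mult_mono) auto
        finally show ?thesis by (simp add: mult_ac)
      qed (simp add: Y2_def)
    qed
    also have "\<dots> \<le> ennreal (ball_vol + K) * (\<integral>\<^sup>+\<tau>. ennreal \<bar>rh \<tau>\<bar> \<partial>lborel)"
      by (rule slab_estimate[of "\<lambda>\<tau>. \<bar>rh \<tau>\<bar>"]) auto
    also have "\<dots> \<le> ennreal (ball_vol + K) * ennreal step_const"
    proof (rule mult_left_mono)
      have "(\<integral>\<^sup>+\<tau>. ennreal \<bar>rh \<tau>\<bar> \<partial>lborel) \<le> (\<integral>\<^sup>+\<tau>. ennreal (step_const / \<delta> * indicator {t - 2 * \<delta>..t - \<delta>} \<tau>) \<partial>lborel)"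
        by (intro nn_integral_mono ennreal_leI rh0)
      also have "\<dots> = ennreal (step_const / \<delta> * ((t - \<delta>) - (t - 2 * \<delta>)))"
        by (rule nn_integral_indicator_interval) (use ab step_const(1) in auto)
      finally show "(\<integral>\<^sup>+\<tau>. ennreal \<bar>rh \<tau>\<bar> \<partial>lborel) \<le> ennreal step_const" using ab by simp
    qed simp
    also have "\<dots> = ennreal ((ball_vol + K) * step_const)"
      using ball_vol_nonneg K_nonneg step_const(1) by (subst ennreal_mult) auto
    finally show ?thesis .
  qed
  have "(LINT z|lborel. u k z * kap \<delta> ((x0, t) - z)) = (LINT z|lborel. X z) - (LINT z|lborel. Y1 z) + (LINT z|lborel. Y2 z)"
    unfolding eq using iX i1 i2 by simp
  then have "\<bar>LINT z|lborel. u k z * kap \<delta> ((x0, t) - z)\<bar> \<le> \<bar>LINT z|lborel. X z\<bar> + (\<bar>LINT z|lborel. Y1 z\<bar> + \<bar>LINT z|lborel. Y2 z\<bar>)" by linarith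
  then have "ennreal \<bar>LINT z|lborel. u k z * kap \<delta> ((x0, t) - z)\<bar> \<le> ennreal \<bar>LINT z|lborel. X z\<bar> + (ennreal \<bar>LINT z|lborel. Y1 z\<bar> + ennreal \<bar>LINT z|lborel. Y2 z\<bar>)"
    by (simp add: ennreal_leI flip: ennreal_plus)
  also have "\<dots> \<le> (ennreal (main_const * (T + 1 - a0)) + ennreal (72 * kernel_const * gauss8) * duhamel V a t) + (ennreal (2 * Mb * step_const * gauss4) + ennreal ((ball_vol + K) * step_const))"
    using integrated_bound[OF ab V V0 uV, of k x0] order_trans[OF abs_LINT_le N1] order_trans[OF abs_LINT_le N2]
    unfolding X_def S_def dth_def by (intro add_mono)
  also have "\<dots> = ennreal (flow_const Mb) + ennreal (72 * kernel_const * gauss8) * duhamel V a t"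
  proof -
    have "main_const \<ge> 0"
      unfolding main_const_def using cut_const(1) annulus_const_nonneg ball_vol_nonneg K_nonneg ab step_const(1) by (intro add_nonneg_nonneg mult_nonneg_nonneg) auto
    then have n: "0 \<le> main_const * (T + 1 - a0)" "0 \<le> 2 * Mb * step_const * gauss4" "0 \<le> (ball_vol + K) * step_const"
      using ab Mb(2) step_const(1) gauss4(2) ball_vol_nonneg K_nonneg by auto
    then have "ennreal (flow_const Mb) = ennreal (main_const * (T + 1 - a0)) + ennreal (2 * Mb * step_const * gauss4) + ennreal ((ball_vol + K) * step_const)"
      unfolding flow_const_def by (simp add: ennreal_plus del: ennreal_plus[symmetric])
    then show ?thesis by (simp add: add_ac)
  qed
  finally show ?thesis .
qed

end

section \<open>Approximation of the identity\<close>

definition bump :: "real \<Rightarrow> real \<Rightarrow> real" where "bump \<delta> \<sigma> = deriv1 step (\<sigma> / \<delta> - 1) / \<delta>"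
text \<open>\<open>kap\<close> without its spatial cutoff. Its mass equals \<open>gauss4\<close>
  exactly for every \<delta> > 0, and \<open>kap\<close> differs from it only by a Gaussian
  tail.\<close>

definition kap0 :: "real \<Rightarrow> (real^3) \<times> real \<Rightarrow> real" where "kap0 \<delta> w = bump \<delta> (snd w) * hk (fst w) (snd w)"

lemma kap_kap0: "kap \<delta> w = cut (fst w) * kap0 \<delta> w"
  by (simp add: kap_def kap0_def bump_def)

lemma bump_measurable [measurable]: "bump \<delta> \<in> borel_measurable borel"
  unfolding bump_def[abs_def] by measurable

lemma bump_bound:
  assumes "\<delta> > 0" shows "\<bar>bump \<delta> \<sigma>\<bar> \<le> step_const / \<delta> * indicator {\<delta>..2 * \<delta>} \<sigma>"
proof (cases "\<sigma> \<in> {\<delta>..2 * \<delta>}")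
  case True
  then show ?thesis using step_const(2)[of "\<sigma> / \<delta> - 1"] assms by (simp add: bump_def abs_divide divide_right_mono)
next
  case False
  then have "\<sigma> / \<delta> - 1 < 0 \<or> \<sigma> / \<delta> - 1 > 1" using assms by (auto simp: divide_less_eq less_divide_eq)
  then show ?thesis using False by (simp add: bump_def deriv1_step_0)
qed

lemma bump_0: "\<delta> > 0 \<Longrightarrow> \<sigma> \<notin> {\<delta>..2 * \<delta>} \<Longrightarrow> bump \<delta> \<sigma> = 0"
  using bump_bound[of \<delta> \<sigma>] by simp

lemma bump_nn: assumes "\<delta> > 0" shows "(\<integral>\<^sup>+\<sigma>. ennreal \<bar>bump \<delta> \<sigma>\<bar> \<partial>lborel) \<le> ennreal step_const"
proof -
  have "(\<integral>\<^sup>+\<sigma>. ennreal \<bar>bump \<delta> \<sigma>\<bar> \<partial>lborel) \<le> (\<integral>\<^sup>+\<sigma>. ennreal (step_const / \<delta> * indicator {\<delta>..2 * \<delta>} \<sigma>) \<partial>lborel)"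
    by (intro nn_integral_mono ennreal_leI bump_bound assms)
  also have "\<dots> = ennreal (step_const / \<delta> * (2 * \<delta> - \<delta>))"
    by (rule nn_integral_indicator_interval) (use assms step_const(1) in auto)
  finally show ?thesis using assms by simp
qed

lemma bump_integral: assumes "\<delta> > 0" shows "(LINT \<sigma>|lborel. bump \<delta> \<sigma>) = 1"
proof -
  have "has_bochner_integral lborel (\<lambda>\<sigma>. bump \<delta> \<sigma> * indicator {\<delta>..2 * \<delta>} \<sigma>) (step (2 * \<delta> / \<delta> - 1) - step (\<delta> / \<delta> - 1))"
  proof (rule has_bochner_integral_FTC_Icc_real)
    fix \<sigma>
    have d: "((\<lambda>\<sigma>. \<sigma> / \<delta> - 1) has_real_derivative 1 / \<delta>) (at \<sigma>)" using assms by (auto intro!: derivative_eq_intros)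
    show "((\<lambda>\<sigma>. step (\<sigma> / \<delta> - 1)) has_real_derivative bump \<delta> \<sigma>) (at \<sigma>)"
      using DERIV_chain2[OF smooth_DERIV[OF smooth_step'] d] by (simp add: bump_def)
    have c: "isCont (deriv1 step) x" for x
      using smooth_continuous[OF smooth_deriv1[OF smooth_step'], of UNIV] by (simp add: continuous_on_eq_continuous_at)
    have c2: "isCont (\<lambda>\<sigma>. \<sigma> / \<delta> - 1) \<sigma>" using assms by (intro continuous_intros) auto
    show "isCont (bump \<delta>) \<sigma>" unfolding bump_def[abs_def]
      using assms isCont_o2[OF c2 c] by (intro continuous_intros) auto
  qed (use assms in auto)
  moreover have "bump \<delta> \<sigma> * indicator {\<delta>..2 * \<delta>} \<sigma> = bump \<delta> \<sigma>" for \<sigma>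
    using bump_0[OF assms, of \<sigma>] by (cases "\<sigma> \<in> {\<delta>..2 * \<delta>}") simp_all
  moreover have "step (2 * \<delta> / \<delta> - 1) - step (\<delta> / \<delta> - 1) = 1" using assms by (simp add: step_ge1 step_le0)
  ultimately show ?thesis by (simp add: has_bochner_integral_integral_eq)
qed

lemma kap0_measurable [measurable]: "kap0 \<delta> \<in> borel_measurable (borel \<Otimes>\<^sub>M borel)"
  unfolding kap0_def[abs_def] by measurable

lemma kap_measurable [measurable]: "kap \<delta> \<in> borel_measurable (borel \<Otimes>\<^sub>M borel)"
  unfolding kap_kap0[abs_def] by measurable

lemma hk_integral0: "r > 0 \<Longrightarrow> (\<integral>\<^sup>+x. ennreal (hk x r) \<partial>lborel) = ennreal gauss4"
  using hk_integral[of r 0] by (simp add: gauss4)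

lemma kap0_nn:
  assumes "\<delta> > 0" shows "(\<integral>\<^sup>+w. ennreal \<bar>kap0 \<delta> w\<bar> \<partial>lborel) \<le> ennreal (step_const * gauss4)"
proof -
  have "(\<integral>\<^sup>+w. ennreal \<bar>kap0 \<delta> w\<bar> \<partial>lborel) = (\<integral>\<^sup>+\<sigma>. \<integral>\<^sup>+y. ennreal \<bar>bump \<delta> \<sigma>\<bar> * ennreal (hk y \<sigma>) \<partial>lborel \<partial>lborel)"
    by (subst lborel_nn_snd[symmetric]) (auto simp: borel_prod[symmetric] kap0_def abs_mult hk_nonneg ennreal_mult)
  also have "\<dots> = (\<integral>\<^sup>+\<sigma>. ennreal \<bar>bump \<delta> \<sigma>\<bar> * ennreal gauss4 \<partial>lborel)"
  proof (rule nn_integral_cong)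
    fix \<sigma>
    show "(\<integral>\<^sup>+y. ennreal \<bar>bump \<delta> \<sigma>\<bar> * ennreal (hk y \<sigma>) \<partial>lborel) = ennreal \<bar>bump \<delta> \<sigma>\<bar> * ennreal gauss4"
    proof (cases "\<sigma> > 0")
      case True then show ?thesis by (simp add: nn_integral_cmult hk_integral0)
    next
      case False then have "bump \<delta> \<sigma> = 0" using bump_bound[OF assms, of \<sigma>] assms by simp
      then show ?thesis by simp
    qed
  qed
  also have "\<dots> = (\<integral>\<^sup>+\<sigma>. ennreal \<bar>bump \<delta> \<sigma>\<bar> \<partial>lborel) * ennreal gauss4" by (rule nn_integral_multc) simp
  also have "\<dots> \<le> ennreal step_const * ennreal gauss4" by (intro mult_right_mono bump_nn assms) simp
  finally show ?thesis using step_const(1) gauss4(2) by (simp add: ennreal_mult)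
qed

lemma kap0_integrable: assumes "\<delta> > 0" shows "integrable lborel (kap0 \<delta>)"
proof (rule integrableI_bounded)
  show "kap0 \<delta> \<in> borel_measurable lborel" by (simp add: borel_prod[symmetric])
  show "(\<integral>\<^sup>+w. ennreal (norm (kap0 \<delta> w)) \<partial>lborel) < \<infinity>" using kap0_nn[OF assms] by (simp add: le_less_trans)
qed

lemma kap0_integral: assumes "\<delta> > 0" shows "(LINT w|lborel. kap0 \<delta> w) = gauss4"
proof -
  have "(LINT w|lborel. kap0 \<delta> w) = (LINT \<sigma>|lborel. LINT y|lborel. kap0 \<delta> (y, \<sigma>))" by (rule lborel_snd[OF kap0_integrable[OF assms], symmetric])
  also have "\<dots> = (LINT \<sigma>|lborel. bump \<delta> \<sigma> * gauss4)"
  proof (rule Bochner_Integration.integral_cong[OF refl])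
    fix \<sigma>
    show "(LINT y|lborel. kap0 \<delta> (y, \<sigma>)) = bump \<delta> \<sigma> * gauss4"
    proof (cases "\<sigma> > 0")
      case True
      have "(LINT y|lborel. hk y \<sigma>) = enn2real (\<integral>\<^sup>+y. ennreal (hk y \<sigma>) \<partial>lborel)"
        by (rule integral_eq_nn_integral) (auto simp: hk_nonneg)
      also have "\<dots> = gauss4" using gauss4(2) by (simp add: hk_integral0[OF True])
      finally show ?thesis by (simp add: kap0_def)
    next
      case False then have "bump \<delta> \<sigma> = 0" using bump_bound[OF assms, of \<sigma>] assms by simp
      then show ?thesis by (simp add: kap0_def)
    qed
  qed
  also have "\<dots> = gauss4" by (simp add: bump_integral[OF assms])
  finally show ?thesis .
qed

text \<open>Half of the exponent is evaluated at the smallest distance \<open>e\<close> and the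
  largest time 2\<delta>, giving a factor that tends to 0 with \<delta>; the other half remains
  integrable in y.\<close>

lemma hk_tail:
  assumes "0 < \<sigma>" "\<sigma> \<le> 2 * \<delta>" "e \<le> norm y" "e > 0"
  shows "hk y \<sigma> \<le> exp (- e\<^sup>2 / (16 * \<delta>)) * (\<sigma> powr (-3/2) * exp (- (1/8) * (\<sigma> powr (-1) * (norm y)\<^sup>2)))"
proof -
  let ?v = "\<sigma> powr (-1) * (norm y)\<^sup>2"
  have "e\<^sup>2 \<le> (norm y)\<^sup>2" using assms by (intro power_mono) auto
  have "e\<^sup>2 / (2 * \<delta>) \<le> (norm y)\<^sup>2 / \<sigma>" using assms \<open>e\<^sup>2 \<le> (norm y)\<^sup>2\<close> by (intro frac_le) auto
  also have "\<dots> = ?v" using assms by (simp add: powr_minus divide_inverse)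
  finally have v: "e\<^sup>2 / (2 * \<delta>) \<le> ?v" .
  have "e\<^sup>2 / (16 * \<delta>) = (e\<^sup>2 / (2 * \<delta>)) / 8" by simp
  then have "- (1/4) * ?v \<le> - e\<^sup>2 / (16 * \<delta>) + (- (1/8) * ?v)" using v by (simp add: minus_divide_left[symmetric])
  then have "exp (- (1/4) * ?v) \<le> exp (- e\<^sup>2 / (16 * \<delta>) + (- (1/8) * ?v))" by (simp only: exp_le_cancel_iff)
  then have "\<sigma> powr (-3/2) * exp (- (1/4) * ?v) \<le> \<sigma> powr (-3/2) * (exp (- e\<^sup>2 / (16 * \<delta>)) * exp (- (1/8) * ?v))"
    unfolding exp_add by (intro mult_left_mono) auto
  then show ?thesis unfolding hk_def by (simp only: mult_ac)
qed

lemma kap0_tail: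
  assumes d: "\<delta> > 0" and e: "e > 0"
  shows "(LINT w|lborel. \<bar>kap0 \<delta> w\<bar> * indicator {w. e \<le> norm (fst w)} w) \<le> step_const * gauss8 * exp (- e\<^sup>2 / (16 * \<delta>))"
proof -
  let ?E = "exp (- e\<^sup>2 / (16 * \<delta>))"
  have "ennreal (LINT w|lborel. \<bar>kap0 \<delta> w\<bar> * indicator {w. e \<le> norm (fst w)} w)
     \<le> (\<integral>\<^sup>+w. ennreal (\<bar>kap0 \<delta> w\<bar> * indicator {w. e \<le> norm (fst w)} w) \<partial>lborel)"
    using abs_LINT_le[of lborel "\<lambda>w. \<bar>kap0 \<delta> w\<bar> * indicator {w. e \<le> norm (fst w)} w"]
    by (simp add: abs_mult)
  also have "\<dots> = (\<integral>\<^sup>+\<sigma>. \<integral>\<^sup>+y. ennreal (\<bar>kap0 \<delta> (y, \<sigma>)\<bar> * indicator {w. e \<le> norm (fst w)} (y, \<sigma>)) \<partial>lborel \<partial>lborel)"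
    by (rule lborel_nn_snd[symmetric]) (simp add: borel_prod[symmetric])
  also have "\<dots> \<le> (\<integral>\<^sup>+\<sigma>. ennreal \<bar>bump \<delta> \<sigma>\<bar> * ennreal (?E * gauss8) \<partial>lborel)"
  proof (rule nn_integral_mono)
    fix \<sigma>
    show "(\<integral>\<^sup>+y. ennreal (\<bar>kap0 \<delta> (y, \<sigma>)\<bar> * indicator {w. e \<le> norm (fst w)} (y, \<sigma>)) \<partial>lborel) \<le> ennreal \<bar>bump \<delta> \<sigma>\<bar> * ennreal (?E * gauss8)"
    proof (cases "\<sigma> \<in> {\<delta>..2 * \<delta>}")
      case True
      then have s: "\<sigma> > 0" using d by simp
      have "(\<integral>\<^sup>+y. ennreal (\<bar>kap0 \<delta> (y, \<sigma>)\<bar> * indicator {w. e \<le> norm (fst w)} (y, \<sigma>)) \<partial>lborel)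
        \<le> (\<integral>\<^sup>+y. ennreal (\<bar>bump \<delta> \<sigma>\<bar> * (?E * \<sigma> powr (-3/2))) * ennreal (exp (- (1/8) * (\<sigma> powr (-1) * (norm (y - 0 :: real^3))\<^sup>2))) \<partial>lborel)"
      proof (rule nn_integral_mono)
        fix y :: "real^3"
        have "\<bar>kap0 \<delta> (y, \<sigma>)\<bar> * indicator {w. e \<le> norm (fst w)} (y, \<sigma>) \<le> \<bar>bump \<delta> \<sigma>\<bar> * (?E * \<sigma> powr (-3/2)) * exp (- (1/8) * (\<sigma> powr (-1) * (norm (y - 0))\<^sup>2))"
        proof (cases "e \<le> norm y")
          case e': True
          have "\<bar>bump \<delta> \<sigma>\<bar> * hk y \<sigma> \<le> \<bar>bump \<delta> \<sigma>\<bar> * (?E * (\<sigma> powr (-3/2) * exp (- (1/8) * (\<sigma> powr (-1) * (norm y)\<^sup>2))))"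
            using True by (intro mult_left_mono hk_tail[OF s _ e' e]) auto
          then show ?thesis using e' by (simp add: kap0_def abs_mult hk_nonneg mult_ac)
        qed simp
        then show "ennreal (\<bar>kap0 \<delta> (y, \<sigma>)\<bar> * indicator {w. e \<le> norm (fst w)} (y, \<sigma>)) \<le> ennreal (\<bar>bump \<delta> \<sigma>\<bar> * (?E * \<sigma> powr (-3/2))) * ennreal (exp (- (1/8) * (\<sigma> powr (-1) * (norm (y - 0))\<^sup>2)))"
          by (subst ennreal_mult[symmetric]) (auto intro: ennreal_leI)
      qed
      also have "\<dots> = ennreal (\<bar>bump \<delta> \<sigma>\<bar> * (?E * \<sigma> powr (-3/2))) * (ennreal (\<sigma> powr (3/2)) * ennreal gauss8)"
        by (subst nn_integral_cmult) (simp, subst gauss_scaled[OF s], simp add: gauss8)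
      also have "\<dots> = ennreal (\<bar>bump \<delta> \<sigma>\<bar> * (?E * \<sigma> powr (-3/2)) * (\<sigma> powr (3/2) * gauss8))"
        using gauss8(2) by (simp add: ennreal_mult)
      also have "\<bar>bump \<delta> \<sigma>\<bar> * (?E * \<sigma> powr (-3/2)) * (\<sigma> powr (3/2) * gauss8) = \<bar>bump \<delta> \<sigma>\<bar> * (?E * gauss8) * (\<sigma> powr (-3/2) * \<sigma> powr (3/2))"
        by (simp only: mult_ac)
      also have "\<sigma> powr (-3/2) * \<sigma> powr (3/2) = 1" using s by (simp add: powr_add[symmetric])
      finally show ?thesis using gauss8(2) by (simp add: ennreal_mult)
    next
      case False
      then have "bump \<delta> \<sigma> = 0" using bump_bound[OF d, of \<sigma>] by simp
      then show ?thesis by (simp add: kap0_def)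
    qed
  qed
  also have "\<dots> = (\<integral>\<^sup>+\<sigma>. ennreal \<bar>bump \<delta> \<sigma>\<bar> \<partial>lborel) * ennreal (?E * gauss8)" by (rule nn_integral_multc) simp
  also have "\<dots> \<le> ennreal step_const * ennreal (?E * gauss8)" by (intro mult_right_mono bump_nn d) simp
  also have "\<dots> = ennreal (step_const * gauss8 * ?E)" using step_const(1) gauss8(2) by (simp add: ennreal_mult[symmetric] mult_ac)
  finally show ?thesis using step_const(1) gauss8(2) by (subst (asm) ennreal_le_iff) auto
qed

lemma kap_le_kap0: "\<bar>kap \<delta> w\<bar> \<le> \<bar>kap0 \<delta> w\<bar>"
  using cut_bounds[of "fst w"] by (simp add: kap_kap0 abs_mult mult_left_le_one_le)

lemma kap_integrable: assumes "\<delta> > 0" shows "integrable lborel (kap \<delta>)"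
  by (rule Bochner_Integration.integrable_bound[OF kap0_integrable[OF assms]])
     (auto simp: borel_prod[symmetric] kap_le_kap0)

lemma tail_integrable:
  fixes f :: "'a::euclidean_space \<Rightarrow> real"
  assumes f: "integrable lborel f" and [measurable]: "A \<in> sets borel"
  shows "integrable lborel (\<lambda>w. \<bar>f w\<bar> * indicator A w)"
  by (rule Bochner_Integration.integrable_bound[OF f]) (use f in \<open>auto simp: indicator_def\<close>)

lemma exp_tail_limit: assumes "e > 0" shows "(\<lambda>n. step_const * gauss8 * exp (- e\<^sup>2 / (16 * (1 / real (Suc n))))) \<longlonglongrightarrow> 0"
proof -
  have "(\<lambda>n. exp (- (e\<^sup>2 / 16)) ^ Suc n) \<longlonglongrightarrow> 0"
    using assms by (intro LIMSEQ_Suc LIMSEQ_realpow_zero) auto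
  moreover have "exp (- e\<^sup>2 / (16 * (1 / real (Suc n)))) = exp (- (e\<^sup>2 / 16)) ^ Suc n" for n
    by (subst exp_of_nat_mult[symmetric]) (simp add: field_simps)
  ultimately have "(\<lambda>n. exp (- e\<^sup>2 / (16 * (1 / real (Suc n))))) \<longlonglongrightarrow> 0" by simp
  from tendsto_mult_left[OF this, of "step_const * gauss8"] show ?thesis by (simp only: mult_zero_right)
qed

lemma eventually_inverse_Suc_less:
  assumes "d > 0" shows "\<forall>\<^sub>F n in sequentially. 1 / real (Suc n) < d"
proof -
  obtain N where N: "inverse (real (Suc N)) < d" using reals_Archimedean[OF assms] by blast
  have "1 / real (Suc n) < d" if "n \<ge> N" for n
  proof -
    have "1 / real (Suc n) \<le> 1 / real (Suc N)" using that by (intro divide_left_mono) auto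
    then show ?thesis using N by (simp only: inverse_eq_divide)
  qed
  then show ?thesis by (auto simp: eventually_sequentially)
qed

lemma fst_tail_sets: "{w :: (real^3) \<times> real. e \<le> norm (fst w)} \<in> sets borel" "{w :: (real^3) \<times> real. e \<le> norm w} \<in> sets borel"
  by (intro borel_closed closed_Collect_le continuous_intros)+

text \<open>Every condition is reduced to the tail of \<open>kap0\<close> in the spatial variable.
  The cutoff changes nothing at distance up to 1, which gives the limiting mass; and once 2\<delta>
  is below d/2, a point of norm at least d in the support has spatial part at least d/2.\<close>

lemma kap_approximate_identity:
  assumes b: "integrable lborel b" and a: "a \<in> borel_measurable borel" and A: "\<And>x. \<bar>a x\<bar> \<le> A"
  shows "(\<lambda>n. LINT x|lborel. a x * (LINT y|lborel. b y * kap (1 / real (Suc n)) (x - y))) \<longlonglongrightarrow> gauss4 * (LINT x|lborel. a x * b x)"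
proof (rule approximate_identity[OF _ _ _ _ b a A])
  have dp: "1 / real (Suc n) > 0" for n by simp
  show "integrable lborel (kap (1 / real (Suc n)))" for n by (rule kap_integrable[OF dp])
  show "(LINT w|lborel. \<bar>kap (1 / real (Suc n)) w\<bar>) \<le> step_const * gauss4" for n
  proof -
    have "ennreal (LINT w|lborel. \<bar>kap (1 / real (Suc n)) w\<bar>) \<le> (\<integral>\<^sup>+w. ennreal \<bar>kap (1 / real (Suc n)) w\<bar> \<partial>lborel)"
      using abs_LINT_le[of lborel "\<lambda>w. \<bar>kap (1 / real (Suc n)) w\<bar>"] by simp
    also have "\<dots> \<le> (\<integral>\<^sup>+w. ennreal \<bar>kap0 (1 / real (Suc n)) w\<bar> \<partial>lborel)" by (intro nn_integral_mono ennreal_leI kap_le_kap0)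
    also have "\<dots> \<le> ennreal (step_const * gauss4)" by (rule kap0_nn[OF dp])
    finally show ?thesis using step_const(1) gauss4(2) by (subst (asm) ennreal_le_iff) auto
  qed
  have T: "(\<lambda>n. LINT w|lborel. \<bar>kap0 (1 / real (Suc n)) w\<bar> * indicator {w. e \<le> norm (fst w)} w) \<longlonglongrightarrow> 0" if e: "e > 0" for e
  proof (rule tendsto_sandwich[OF _ _ tendsto_const exp_tail_limit[OF e]])
    show "\<forall>\<^sub>F n in sequentially. 0 \<le> (LINT w|lborel. \<bar>kap0 (1 / real (Suc n)) w\<bar> * indicator {w. e \<le> norm (fst w)} w)"
      by (auto intro!: always_eventually Bochner_Integration.integral_nonneg)
    show "\<forall>\<^sub>F n in sequentially. (LINT w|lborel. \<bar>kap0 (1 / real (Suc n)) w\<bar> * indicator {w. e \<le> norm (fst w)} w) \<le> step_const * gauss8 * exp (- e\<^sup>2 / (16 * (1 / real (Suc n))))"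
      by (rule always_eventually, rule allI, rule kap0_tail[OF dp e])
  qed
  show "(\<lambda>n. LINT w|lborel. kap (1 / real (Suc n)) w) \<longlonglongrightarrow> gauss4"
  proof -
    have "\<bar>(LINT w|lborel. kap (1 / real (Suc n)) w) - gauss4\<bar> \<le> (LINT w|lborel. \<bar>kap0 (1 / real (Suc n)) w\<bar> * indicator {w. 1 \<le> norm (fst w)} w)" for n
    proof -
      have "(LINT w|lborel. kap (1 / real (Suc n)) w) - gauss4 = (LINT w|lborel. kap (1 / real (Suc n)) w - kap0 (1 / real (Suc n)) w)"
        using kap_integrable[OF dp] kap0_integrable[OF dp] kap0_integral[OF dp] by simp
      also have "\<bar>\<dots>\<bar> \<le> (LINT w|lborel. \<bar>kap (1 / real (Suc n)) w - kap0 (1 / real (Suc n)) w\<bar>)" by (rule integral_abs_bound)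
      also have "\<dots> \<le> (LINT w|lborel. \<bar>kap0 (1 / real (Suc n)) w\<bar> * indicator {w. 1 \<le> norm (fst w)} w)"
      proof (rule integral_mono)
        show "integrable lborel (\<lambda>w. \<bar>kap (1 / real (Suc n)) w - kap0 (1 / real (Suc n)) w\<bar>)"
          using kap_integrable[OF dp] kap0_integrable[OF dp] by simp
        show "integrable lborel (\<lambda>w. \<bar>kap0 (1 / real (Suc n)) w\<bar> * indicator {w. 1 \<le> norm (fst w)} w)"
          by (rule tail_integrable[OF kap0_integrable[OF dp] fst_tail_sets(1)])
        fix w :: "(real^3) \<times> real"
        have eq: "\<bar>kap (1 / real (Suc n)) w - kap0 (1 / real (Suc n)) w\<bar> = (1 - cut (fst w)) * \<bar>kap0 (1 / real (Suc n)) w\<bar>"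
        proof -
          have "kap (1 / real (Suc n)) w - kap0 (1 / real (Suc n)) w = - ((1 - cut (fst w)) * kap0 (1 / real (Suc n)) w)"
            by (simp add: kap_kap0 algebra_simps)
          then show ?thesis using cut_bounds[of "fst w"] by (simp add: abs_mult)
        qed
        show "\<bar>kap (1 / real (Suc n)) w - kap0 (1 / real (Suc n)) w\<bar> \<le> \<bar>kap0 (1 / real (Suc n)) w\<bar> * indicator {w. 1 \<le> norm (fst w)} w"
        proof (cases "1 \<le> norm (fst w)")
          case True
          have "(1 - cut (fst w)) * \<bar>kap0 (1 / real (Suc n)) w\<bar> \<le> 1 * \<bar>kap0 (1 / real (Suc n)) w\<bar>"
            using cut_bounds[of "fst w"] by (intro mult_right_mono) auto
          then show ?thesis unfolding eq using True by simp
        next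
          case False
          then have "(norm (fst w))\<^sup>2 \<le> 1\<^sup>2" by (intro power_mono) auto
          then have "cut (fst w) = 1" by (intro cut_1) simp
          then show ?thesis unfolding eq by simp
        qed
      qed
      finally show ?thesis .
    qed
    then have "(\<lambda>n. (LINT w|lborel. kap (1 / real (Suc n)) w) - gauss4) \<longlonglongrightarrow> 0"
      by (intro tendsto_0_le[OF T[of 1], of _ 1]) (auto intro!: always_eventually simp: order_trans[OF _ abs_ge_self])
    then show ?thesis by (simp add: LIM_zero_iff)
  qed
  fix d :: real assume d: "d > 0"
  show "(\<lambda>n. LINT w|lborel. \<bar>kap (1 / real (Suc n)) w\<bar> * indicator {w. d \<le> norm w} w) \<longlonglongrightarrow> 0"
  proof (rule tendsto_sandwich[OF _ _ tendsto_const T[of "d/2"]])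
    show "\<forall>\<^sub>F n in sequentially. 0 \<le> (LINT w|lborel. \<bar>kap (1 / real (Suc n)) w\<bar> * indicator {w. d \<le> norm w} w)"
      by (auto intro!: always_eventually Bochner_Integration.integral_nonneg)
    have "\<forall>\<^sub>F n in sequentially. 1 / real (Suc n) < d / 4"
      using d by (intro eventually_inverse_Suc_less) simp
    then show "\<forall>\<^sub>F n in sequentially. (LINT w|lborel. \<bar>kap (1 / real (Suc n)) w\<bar> * indicator {w. d \<le> norm w} w)
       \<le> (LINT w|lborel. \<bar>kap0 (1 / real (Suc n)) w\<bar> * indicator {w. d / 2 \<le> norm (fst w)} w)"
    proof eventually_elim
      case (elim n)
      show ?case
      proof (rule integral_mono)
        show "integrable lborel (\<lambda>w. \<bar>kap (1 / real (Suc n)) w\<bar> * indicator {w. d \<le> norm w} w)"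
          by (rule tail_integrable[OF kap_integrable[OF dp] fst_tail_sets(2)])
        show "integrable lborel (\<lambda>w. \<bar>kap0 (1 / real (Suc n)) w\<bar> * indicator {w. d / 2 \<le> norm (fst w)} w)"
          by (rule tail_integrable[OF kap0_integrable[OF dp] fst_tail_sets(1)])
        fix w :: "(real^3) \<times> real"
        show "\<bar>kap (1 / real (Suc n)) w\<bar> * indicator {w. d \<le> norm w} w \<le> \<bar>kap0 (1 / real (Suc n)) w\<bar> * indicator {w. d / 2 \<le> norm (fst w)} w"
        proof (cases "kap0 (1 / real (Suc n)) w = 0 \<or> norm w < d")
          case True then show ?thesis by (auto simp: kap_kap0)
        next
          case False
          then have "bump (1 / real (Suc n)) (snd w) \<noteq> 0" by (auto simp: kap0_def)
          then have "snd w \<in> {1 / real (Suc n)..2 * (1 / real (Suc n))}"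
            using bump_0[OF dp] by blast
          then have "\<bar>snd w\<bar> \<le> d / 2" using elim dp[of n] by (simp only: atLeastAtMost_iff) linarith
          moreover have "norm w \<le> norm (fst w) + norm (snd w)" by (metis norm_Pair_le prod.collapse)
          ultimately have "d / 2 \<le> norm (fst w)" using False by auto
          then show ?thesis using False kap_le_kap0[of "1 / real (Suc n)" w] by simp
        qed
      qed
    qed
  qed (use d in auto)
qed

lemma gauss4_pos: "gauss4 > 0"
proof -
  have "gauss (1/4) \<noteq> 0"
  proof
    assume "gauss (1/4) = 0"
    then have "AE y::real^3 in lborel. ennreal (exp (- (1/4) * (norm y)\<^sup>2)) = 0"
      unfolding gauss_def by (subst (asm) nn_integral_0_iff_AE) auto
    then have "AE y::real^3 in lborel. False" by eventually_elim simp
    then have "emeasure lborel (UNIV :: (real^3) set) = 0" by (subst (asm) AE_iff_measurable[of UNIV]) auto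
    then show False by simp
  qed
  then show ?thesis using gauss4 by (metis ennreal_0 less_eq_real_def)
qed

text \<open>A crude uniform support bound, which lets \<open>u\<close>, only locally integrable, be
  truncated to a ball before the approximate identity is applied.\<close>

lemma kap_support:
  assumes "0 < \<delta>" "\<delta> \<le> 1" "kap \<delta> w \<noteq> 0" shows "norm w \<le> 4"
proof -
  have "\<not> 2 \<le> (norm (fst w))\<^sup>2" using assms(3) cut_0[of "fst w"] by (auto simp: kap_kap0)
  then have "(norm (fst w))\<^sup>2 \<le> 2\<^sup>2" by simp
  then have 1: "norm (fst w) \<le> 2" by (rule power2_le_imp_le) simp
  have "bump \<delta> (snd w) \<noteq> 0" using assms(3) by (auto simp: kap_kap0 kap0_def)
  then have "snd w \<in> {\<delta>..2 * \<delta>}" using bump_0[OF assms(1)] by blast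
  then have 2: "norm (snd w) \<le> 2" using assms by simp
  have "norm w \<le> norm (fst w) + norm (snd w)" by (metis norm_Pair_le prod.collapse)
  then show ?thesis using 1 2 by linarith
qed

context weak_flow
begin

lemma integrable_local: "integrable lborel (\<lambda>z. u k z * indicator (cball 0 r) z)"
proof (rule integrable_mult_bounded[of _ _ 1 "cball 0 r"])
  show "(indicator (cball 0 r) :: (real^3) \<times> real \<Rightarrow> real) \<in> borel_measurable borel"
    by (intro borel_measurable_indicator borel_closed closed_cball)
qed (use u2 u_meas in auto)

text \<open>The averages of \<open>u\<close> against \<open>kap\<close> obey the bound at every
  point, but they converge only after integration against a bounded function. So the limit is taken
  against the indicator of the set where the claim fails; the resulting inequality forces that set
  to be null.\<close>

lemma pointwise_bound:
  assumes ab: "a0 < a" "a < b" "b < t1" "t1 \<le> T"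
    and V[measurable]: "V \<in> borel_measurable borel" and V0: "\<And>\<tau>. V \<tau> \<ge> 0"
    and uV: "AE z in lborel. snd z \<in> {a..<t1} \<longrightarrow> (\<forall>i. (u i z)\<^sup>2 \<le> V (snd z))"
    and Mb: "AE z in lborel. snd z \<in> {a..b} \<longrightarrow> (\<forall>i. \<bar>u i z\<bar> \<le> Mb)" "Mb \<ge> 0"
    and Q[measurable]: "Q \<in> borel_measurable borel" and Q0: "\<And>t. Q t \<ge> 0"
    and QH: "\<And>t. b < t \<Longrightarrow> t < t1 \<Longrightarrow> duhamel V a t \<le> ennreal (Q t)"
  shows "AE z in lborel. snd z \<in> {b<..<t1} \<longrightarrow> (\<forall>k. gauss4 * \<bar>u k z\<bar> \<le> flow_const Mb + 72 * kernel_const * gauss8 * Q (snd z))"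
proof -
  define c where "c = 72 * kernel_const * gauss8"
  have c0: "c \<ge> 0" using kernel_const_nonneg gauss8(2) by (simp add: c_def)
  have fc0: "flow_const Mb \<ge> 0"
    unfolding flow_const_def main_const_def
    using cut_const(1) annulus_const_nonneg ball_vol_nonneg K_nonneg ab step_const(1) gauss4(2) Mb(2)
    by (intro add_nonneg_nonneg mult_nonneg_nonneg) auto
  define F where "F z = flow_const Mb + c * Q (snd z)" for z :: "(real^3) \<times> real"
  have F0: "F z \<ge> 0" for z unfolding F_def using fc0 c0 Q0 by simp
  have um[measurable]: "u k \<in> borel_measurable (borel \<Otimes>\<^sub>M borel)" for k using u_meas[of k] by (simp add: borel_prod)
  have Fm[measurable]: "F \<in> borel_measurable (borel \<Otimes>\<^sub>M borel)" unfolding F_def[abs_def] by measurable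
  have kb: "\<bar>LINT y|lborel. u k y * kap \<delta> (x - y)\<bar> \<le> F x"
    if "\<delta> > 0" "b \<le> snd x - 2 * \<delta>" "snd x < t1" for k \<delta> x
  proof -
    have "ennreal \<bar>LINT y|lborel. u k y * kap \<delta> ((fst x, snd x) - y)\<bar> \<le> ennreal (flow_const Mb) + ennreal (72 * kernel_const * gauss8) * duhamel V a (snd x)"
    proof (rule kap_bound[OF ab(1,2) that(1,2) _ V V0 _ Mb])
      show "AE z in lborel. snd z \<in> {a..snd x} \<longrightarrow> (\<forall>i. (u i z)\<^sup>2 \<le> V (snd z))"
        using uV by eventually_elim (use that in auto)
    qed (use that ab in auto)
    also have "\<dots> \<le> ennreal (flow_const Mb) + ennreal c * ennreal (Q (snd x))"
      unfolding c_def using that by (intro add_left_mono mult_left_mono QH) auto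
    also have "\<dots> = ennreal (F x)" unfolding F_def using fc0 c0 Q0 by (simp add: ennreal_mult[symmetric] ennreal_plus[symmetric] del: ennreal_plus)
    finally show ?thesis using F0[of x] by (simp add: ennreal_le_iff)
  qed
  have null: "AE z in lborel. \<not> (gauss4 * (\<sigma> * u k z) > F z \<and> norm z \<le> real n \<and> b + 1 / real (Suc m) \<le> snd z \<and> snd z < t1)"
    if \<sigma>: "\<bar>\<sigma>\<bar> = 1" for \<sigma> k n m
  proof -
    \<comment> \<open>The failure set for one sign \<open>\<sigma>\<close> and one component.
      Boundedness in norm makes the integrals finite, and the distance 1/(m+1) from b leaves room
      for a layer of width 2\<delta>. Countably many such sets exhaust the strip.\<close>
    define E where "E = {z. gauss4 * (\<sigma> * u k z) > F z \<and> norm z \<le> real n \<and> b + 1 / real (Suc m) \<le> snd z \<and> snd z < t1}"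
    have "E \<in> sets (borel \<Otimes>\<^sub>M borel)"
    proof -
      have "E = {z \<in> space (borel \<Otimes>\<^sub>M borel). gauss4 * (\<sigma> * u k z) > F z \<and> norm z \<le> real n \<and> b + 1 / real (Suc m) \<le> snd z \<and> snd z < t1}"
        by (simp add: E_def space_pair_measure)
      also have "\<dots> \<in> sets (borel \<Otimes>\<^sub>M borel)"
      proof -
        have [measurable]: "(norm :: (real^3) \<times> real \<Rightarrow> real) \<in> borel_measurable (borel \<Otimes>\<^sub>M borel)"
          unfolding borel_prod by (rule borel_measurable_norm)
        show ?thesis by measurable
      qed
      finally show ?thesis .
    qed
    then have Em[measurable]: "E \<in> sets borel" unfolding borel_prod .
    \<comment> \<open>For x in \<open>E\<close> the kernel sees only points within distance 4, so
      this truncation does not change the averages there.\<close>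
    define bb where "bb z = u k z * indicator (cball 0 (real n + 4)) z" for z
    have ibb: "integrable lborel bb" unfolding bb_def by (rule integrable_local)
    \<comment> \<open>On \<open>E\<close> the bound \<open>F\<close> is, by definition of
      \<open>E\<close>, smaller than a multiple of |u|, which is integrable there.\<close>
    have iF: "integrable lborel (\<lambda>z. indicator E z * F z)"
    proof (rule Bochner_Integration.integrable_bound[OF integrable_mult_right[OF integrable_abs[OF ibb], of gauss4]])
      show "(\<lambda>z. indicator E z * F z) \<in> borel_measurable lborel" using Em by (simp add: borel_prod[symmetric])
      show "AE z in lborel. norm (indicator E z * F z) \<le> norm (gauss4 * \<bar>bb z\<bar>)"
      proof (rule AE_I2)
        fix z
        show "norm (indicator E z * F z) \<le> norm (gauss4 * \<bar>bb z\<bar>)"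
        proof (cases "z \<in> E")
          case True
          then have le: "F z \<le> gauss4 * (\<sigma> * u k z)" and "norm z \<le> real n" by (auto simp: E_def)
          note le
          also have "gauss4 * (\<sigma> * u k z) \<le> gauss4 * \<bar>\<sigma> * u k z\<bar>" using gauss4(2) by (intro mult_left_mono) auto
          finally have "F z \<le> gauss4 * \<bar>u k z\<bar>" using \<sigma> by (simp add: abs_mult)
          then show ?thesis using True F0[of z] \<open>norm z \<le> real n\<close> gauss4(2) by (simp add: bb_def abs_mult)
        qed simp
      qed
    qed
    have iu: "integrable lborel (\<lambda>z. indicator E z * bb z)"
      by (rule Bochner_Integration.integrable_bound[OF ibb]) (use ibb in \<open>auto simp: indicator_def\<close>)
    have L: "(\<lambda>N. \<sigma> * (LINT x|lborel. indicator E x * (LINT y|lborel. bb y * kap (1 / real (Suc N)) (x - y)))) \<longlonglongrightarrow> \<sigma> * (gauss4 * (LINT x|lborel. indicator E x * bb x))"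
      by (intro tendsto_mult_left kap_approximate_identity[OF ibb, of _ 1]) (auto simp: indicator_def)
    have "\<forall>\<^sub>F N in sequentially. 1 / real (Suc N) < 1 / (2 * real (Suc m))"
      by (rule eventually_inverse_Suc_less) simp
    then have U: "\<forall>\<^sub>F N in sequentially. \<sigma> * (LINT x|lborel. indicator E x * (LINT y|lborel. bb y * kap (1 / real (Suc N)) (x - y))) \<le> (LINT x|lborel. indicator E x * F x)"
    proof eventually_elim
      case (elim N)
      define \<delta> where "\<delta> = 1 / real (Suc N)"
      have "2 * \<delta> < 2 * (1 / (2 * real (Suc m)))" using elim unfolding \<delta>_def by (rule mult_strict_left_mono) simp
      also have "\<dots> = 1 / real (Suc m)"
      proof -
        have "2 * (1 / (2 * x)) = 1 / x" for x :: real by simp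
        then show ?thesis .
      qed
      finally have "2 * \<delta> \<le> 1 / real (Suc m)" by (rule less_imp_le)
      then have \<delta>: "\<delta> > 0" "\<delta> \<le> 1" "2 * \<delta> \<le> 1 / real (Suc m)" by (auto simp: \<delta>_def)
      have "(LINT x|lborel. \<sigma> * (indicator E x * (LINT y|lborel. bb y * kap \<delta> (x - y)))) \<le> (LINT x|lborel. indicator E x * F x)"
      proof (rule integral_mono'[OF iF])
        fix x
        show "0 \<le> indicator E x * F x" using F0 by simp
        show "\<sigma> * (indicator E x * (LINT y|lborel. bb y * kap \<delta> (x - y))) \<le> indicator E x * F x"
        proof (cases "x \<in> E")
          case True
          then have x: "norm x \<le> real n" "b + 1 / real (Suc m) \<le> snd x" "snd x < t1" by (auto simp: E_def)
          have eq: "(LINT y|lborel. bb y * kap \<delta> (x - y)) = (LINT y|lborel. u k y * kap \<delta> (x - y))"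
          proof (rule Bochner_Integration.integral_cong[OF refl])
            fix y
            show "bb y * kap \<delta> (x - y) = u k y * kap \<delta> (x - y)"
            proof (cases "kap \<delta> (x - y) = 0")
              case False
              then have "norm (x - y) \<le> 4" by (rule kap_support[OF \<delta>(1,2)])
              then have "norm y \<le> real n + 4" using x(1) norm_triangle_ineq2[of y x] by (simp add: norm_minus_commute)
              then show ?thesis by (simp add: bb_def)
            qed simp
          qed
          have "\<sigma> * (LINT y|lborel. u k y * kap \<delta> (x - y)) \<le> \<bar>\<sigma> * (LINT y|lborel. u k y * kap \<delta> (x - y))\<bar>" by (rule abs_ge_self)
          also have "\<dots> \<le> F x" unfolding abs_mult \<sigma> using kb[OF \<delta>(1), of x k] x \<delta>(3) by simp
          finally show ?thesis using True by (simp add: eq)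
        qed simp
      qed
      then show ?case by (simp add: \<delta>_def)
    qed
    have "\<sigma> * (gauss4 * (LINT x|lborel. indicator E x * bb x)) \<le> (LINT x|lborel. indicator E x * F x)"
      by (rule tendsto_upperbound[OF L U]) simp
    then have le: "(LINT x|lborel. \<sigma> * (gauss4 * (indicator E x * bb x)) - indicator E x * F x) \<le> 0"
      using iu iF by simp
    have nn: "0 \<le> \<sigma> * (gauss4 * (indicator E x * bb x)) - indicator E x * F x" for x
      by (auto simp: E_def bb_def indicator_def mult_ac)
    have "AE x in lborel. \<sigma> * (gauss4 * (indicator E x * bb x)) - indicator E x * F x = 0"
    proof (subst integral_nonneg_eq_0_iff_AE[symmetric])
      show "integrable lborel (\<lambda>x. \<sigma> * (gauss4 * (indicator E x * bb x)) - indicator E x * F x)" using iu iF by simp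
      show "AE x in lborel. 0 \<le> \<sigma> * (gauss4 * (indicator E x * bb x)) - indicator E x * F x" using nn by simp
      show "(LINT x|lborel. \<sigma> * (gauss4 * (indicator E x * bb x)) - indicator E x * F x) = 0"
        using le Bochner_Integration.integral_nonneg[of lborel "\<lambda>x. \<sigma> * (gauss4 * (indicator E x * bb x)) - indicator E x * F x"] nn by force
    qed
    then have "AE x in lborel. x \<notin> E"
      by eventually_elim (auto simp: E_def bb_def indicator_def mult_ac split: if_splits)
    then show ?thesis unfolding E_def by simp
  qed
  have "AE z in lborel. \<forall>k n m. \<not> (gauss4 * (1 * u k z) > F z \<and> norm z \<le> real n \<and> b + 1 / real (Suc m) \<le> snd z \<and> snd z < t1) \<and>
      \<not> (gauss4 * (- 1 * u k z) > F z \<and> norm z \<le> real n \<and> b + 1 / real (Suc m) \<le> snd z \<and> snd z < t1)"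
    unfolding AE_all_countable AE_conj_iff by (intro allI conjI null) simp_all
  then show ?thesis
  proof eventually_elim
    case (elim z)
    show ?case
    proof (intro impI allI)
      fix k assume z: "snd z \<in> {b<..<t1}"
      obtain n where n: "norm z \<le> real n" using real_arch_simple by blast
      obtain m where "inverse (real (Suc m)) < snd z - b" using reals_Archimedean[of "snd z - b"] z by auto
      then have m: "b + 1 / real (Suc m) \<le> snd z" by (simp add: inverse_eq_divide)
      have "gauss4 * u k z \<le> F z" "gauss4 * (- u k z) \<le> F z"
        using elim[rule_format, of k n m] n m z by auto
      then have "gauss4 * \<bar>u k z\<bar> \<le> F z" by (cases "u k z \<ge> 0") auto
      then show "gauss4 * \<bar>u k z\<bar> \<le> flow_const Mb + 72 * kernel_const * gauss8 * Q (snd z)" by (simp add: F_def c_def)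
    qed
  qed
qed

end

section \<open>The bootstrap argument\<close>

lemma nn_powr_from_0:
  assumes "p > -1" "d \<ge> 0"
  shows "(\<integral>\<^sup>+\<tau>. ennreal ((t - \<tau>) powr p) * indicator {t - d..t} \<tau> \<partial>lborel) = ennreal (d powr (p + 1) / (p + 1))"
proof -
  have "(\<integral>\<^sup>+\<tau>. ennreal ((t - \<tau>) powr p) * indicator {t - d..t} \<tau> \<partial>lborel)
    = (\<integral>\<^sup>+\<tau>. (\<lambda>r. ennreal (r powr p) * indicator {0..d} r) (t + (-1) * \<tau>) \<partial>lborel)"
    by (intro nn_integral_cong) (auto simp: indicator_def)
  also have "\<dots> = (\<integral>\<^sup>+r. ennreal (r powr p) * indicator {0..d} r \<partial>lborel)"
    by (subst (2) nn_integral_real_affine[where c="-1" and t=t]) auto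
  also have "\<dots> = ennreal (d powr (p + 1) / (p + 1))"
    by (rule nn_integral_has_integral_lebesgue'[OF _ has_integral_powr_from_0[OF assms]]) simp
  finally show ?thesis .
qed

lemma nn_powr_to_inf:
  assumes "p < -1" "d > 0"
  shows "(\<integral>\<^sup>+\<tau>. ennreal ((t - \<tau>) powr p) * indicator {..t - d} \<tau> \<partial>lborel) = ennreal (- (d powr (p + 1)) / (p + 1))"
proof -
  have "(\<integral>\<^sup>+\<tau>. ennreal ((t - \<tau>) powr p) * indicator {..t - d} \<tau> \<partial>lborel)
    = (\<integral>\<^sup>+\<tau>. (\<lambda>r. ennreal (r powr p) * indicator {d..} r) (t + (-1) * \<tau>) \<partial>lborel)"
    by (intro nn_integral_cong) (auto simp: indicator_def)
  also have "\<dots> = (\<integral>\<^sup>+r. ennreal (r powr p) * indicator {d..} r \<partial>lborel)"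
    by (subst (2) nn_integral_real_affine[where c="-1" and t=t]) auto
  also have "\<dots> = ennreal (- (d powr (p + 1)) / (p + 1))"
    by (rule nn_integral_has_integral_lebesgue'[OF _ has_integral_powr_to_inf[OF assms]]) simp
  finally show ?thesis .
qed

text \<open>Split at distance d = T - t before t. Nearer than d the weight is at most d^(-5/8) and
  the kernel integrates to 2 d^(1/2); farther away the weight is dominated by the same power of t -
  \<tau>, and r^(-9/8) integrates to 8 d^(-1/8). Hence 10 d^(-1/8): the very weight that was assumed
  for u.\<close>

lemma duhamel_singular:
  assumes t: "t < T" and c: "c \<ge> 0"
  shows "duhamel (\<lambda>\<tau>. c * (T - \<tau>) powr (-5/8)) a t \<le> ennreal (c * (10 * (T - t) powr (-1/8)))"
proof -
  define d where "d = T - t"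
  have d: "d > 0" using t by (simp add: d_def)
  have "duhamel (\<lambda>\<tau>. c * (T - \<tau>) powr (-5/8)) a t
    \<le> (\<integral>\<^sup>+\<tau>. ennreal c * (ennreal (d powr (-5/8)) * (ennreal ((t - \<tau>) powr (-1/2)) * indicator {t - d..t} \<tau>) + ennreal ((t - \<tau>) powr (-9/8)) * indicator {..t - d} \<tau>) \<partial>lborel)"
    unfolding duhamel_def
  proof (rule nn_integral_mono)
    fix \<tau>
    show "ennreal (c * (T - \<tau>) powr (-5/8) * (t - \<tau>) powr (-1/2)) * indicator {a..<t} \<tau>
      \<le> ennreal c * (ennreal (d powr (-5/8)) * (ennreal ((t - \<tau>) powr (-1/2)) * indicator {t - d..t} \<tau>) + ennreal ((t - \<tau>) powr (-9/8)) * indicator {..t - d} \<tau>)"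
    proof (cases "\<tau> \<in> {a..<t}")
      case True
      then have r: "t - \<tau> > 0" "T - \<tau> \<ge> d" "T - \<tau> \<ge> t - \<tau>" using t by (auto simp: d_def)
      show ?thesis
      proof (cases "\<tau> \<ge> t - d")
        case near: True
        have "(T - \<tau>) powr (-5/8) \<le> d powr (-5/8)" using r d by (intro powr_mono2') auto
        then have "c * (T - \<tau>) powr (-5/8) * (t - \<tau>) powr (-1/2) \<le> c * (d powr (-5/8) * (t - \<tau>) powr (-1/2))"
          using c by (simp add: mult.assoc mult_left_mono mult_right_mono)
        then have "ennreal (c * (T - \<tau>) powr (-5/8) * (t - \<tau>) powr (-1/2)) \<le> ennreal c * (ennreal (d powr (-5/8)) * ennreal ((t - \<tau>) powr (-1/2)))"
          using c by (simp add: ennreal_mult[symmetric] ennreal_leI)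
        also have "\<dots> \<le> ennreal c * (ennreal (d powr (-5/8)) * (ennreal ((t - \<tau>) powr (-1/2)) * indicator {t - d..t} \<tau>) + ennreal ((t - \<tau>) powr (-9/8)) * indicator {..t - d} \<tau>)"
          using near True by (intro mult_left_mono) auto
        finally show ?thesis using True by simp
      next
        case False
        have "(T - \<tau>) powr (-5/8) \<le> (t - \<tau>) powr (-5/8)" using r by (intro powr_mono2') auto
        then have "(T - \<tau>) powr (-5/8) * (t - \<tau>) powr (-1/2) \<le> (t - \<tau>) powr (-5/8) * (t - \<tau>) powr (-1/2)" by (intro mult_right_mono) auto
        also have "\<dots> = (t - \<tau>) powr (-9/8)" by (simp add: powr_add[symmetric])
        finally have "c * (T - \<tau>) powr (-5/8) * (t - \<tau>) powr (-1/2) \<le> c * (t - \<tau>) powr (-9/8)"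
          using c by (simp add: mult.assoc mult_left_mono)
        then show ?thesis using True False c by (simp add: ennreal_mult[symmetric] ennreal_leI)
      qed
    qed simp
  qed
  also have "\<dots> = ennreal c * (ennreal (d powr (-5/8)) * ennreal (d powr (-1/2 + 1) / (-1/2 + 1)) + ennreal (- (d powr (-9/8 + 1)) / (-9/8 + 1)))"
  proof -
    have p1: "(\<integral>\<^sup>+\<tau>. ennreal ((t - \<tau>) powr (-1/2)) * indicator {t - d..t} \<tau> \<partial>lborel) = ennreal (d powr (-1/2 + 1) / (-1/2 + 1))"
      by (rule nn_powr_from_0) (use d in auto)
    have p2: "(\<integral>\<^sup>+\<tau>. ennreal ((t - \<tau>) powr (-9/8)) * indicator {..t - d} \<tau> \<partial>lborel) = ennreal (- (d powr (-9/8 + 1)) / (-9/8 + 1))"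
      by (rule nn_powr_to_inf) (use d in auto)
    show ?thesis
      by (subst nn_integral_cmult, simp, subst nn_integral_add, simp, simp, subst nn_integral_cmult, simp, simp only: p1 p2)
  qed
  also have "\<dots> = ennreal (c * (d powr (-5/8) * (2 * d powr (1/2)) + 8 * d powr (-1/8)))"
    using c by (simp add: ennreal_mult[symmetric] ennreal_plus[symmetric] mult_ac del: ennreal_plus)
  also have "d powr (-5/8) * (2 * d powr (1/2)) + 8 * d powr (-1/8) = 10 * d powr (-1/8)"
  proof -
    have "d powr (-5/8) * d powr (1/2) = d powr (-1/8)" by (simp add: powr_add[symmetric])
    then show ?thesis by simp
  qed
  finally show ?thesis by (simp add: d_def)
qed

text \<open>The exponents -1/4 and -1/2 add up to -3/4, which is integrable, so the result stays
  bounded up to time T.\<close>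

lemma duhamel_regular:
  assumes t: "a < t" "t \<le> T" and c: "c \<ge> 0"
  shows "duhamel (\<lambda>\<tau>. c * (T - \<tau>) powr (-1/4)) a t \<le> ennreal (c * (4 * (T - a) powr (1/4)))"
proof -
  have "duhamel (\<lambda>\<tau>. c * (T - \<tau>) powr (-1/4)) a t \<le> (\<integral>\<^sup>+\<tau>. ennreal c * (ennreal ((t - \<tau>) powr (-3/4)) * indicator {t - (t - a)..t} \<tau>) \<partial>lborel)"
    unfolding duhamel_def
  proof (rule nn_integral_mono)
    fix \<tau>
    show "ennreal (c * (T - \<tau>) powr (-1/4) * (t - \<tau>) powr (-1/2)) * indicator {a..<t} \<tau> \<le> ennreal c * (ennreal ((t - \<tau>) powr (-3/4)) * indicator {t - (t - a)..t} \<tau>)"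
    proof (cases "\<tau> \<in> {a..<t}")
      case True
      then have r: "t - \<tau> > 0" "T - \<tau> \<ge> t - \<tau>" using t by auto
      have "(T - \<tau>) powr (-1/4) \<le> (t - \<tau>) powr (-1/4)" using r by (intro powr_mono2') auto
      then have "(T - \<tau>) powr (-1/4) * (t - \<tau>) powr (-1/2) \<le> (t - \<tau>) powr (-1/4) * (t - \<tau>) powr (-1/2)" by (intro mult_right_mono) auto
      also have "\<dots> = (t - \<tau>) powr (-3/4)" by (simp add: powr_add[symmetric])
      finally have "c * (T - \<tau>) powr (-1/4) * (t - \<tau>) powr (-1/2) \<le> c * (t - \<tau>) powr (-3/4)"
        using c by (simp add: mult.assoc mult_left_mono)
      then show ?thesis using True c by (simp add: ennreal_mult[symmetric] ennreal_leI)
    qed simp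
  qed
  also have "\<dots> = ennreal c * ennreal ((t - a) powr (-3/4 + 1) / (-3/4 + 1))"
  proof -
    have p: "(\<integral>\<^sup>+\<tau>. ennreal ((t - \<tau>) powr (-3/4)) * indicator {t - (t - a)..t} \<tau> \<partial>lborel) = ennreal ((t - a) powr (-3/4 + 1) / (-3/4 + 1))"
      by (rule nn_powr_from_0) (use t in auto)
    show ?thesis by (subst nn_integral_cmult, simp, simp only: p)
  qed
  also have "\<dots> = ennreal (c * (4 * (t - a) powr (1/4)))" using c by (simp add: ennreal_mult[symmetric] mult_ac)
  also have "\<dots> \<le> ennreal (c * (4 * (T - a) powr (1/4)))"
    using t c by (intro ennreal_leI mult_left_mono powr_mono2) auto
  finally show ?thesis .
qed

text \<open>Chosen so that the coefficient of the iteration, 10 \<open>small_const\<close> times 72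
  \<open>kernel_const * gauss8\<close>, is at most half of \<open>gauss4\<close>. The added 1 keeps
  the denominator positive.\<close>

definition small_const :: real where
  "small_const = gauss4 / (20 * (72 * kernel_const * gauss8 + 1))"

lemma small_const_pos: "small_const > 0"
  using gauss4_pos kernel_const_nonneg gauss8(2) by (simp add: small_const_def add_nonneg_pos)

context weak_flow
begin

text \<open>Since \<open>\<bar>u\<bar>\<^sup>2 \<le> Cs (T - t) powr (-1/2) \<bar>u\<bar>\<close>, a bound \<open>\<bar>u\<bar> \<le> N (T - t) powr (-1/8)\<close> before time
  \<open>t\<^sub>1 < T\<close> improves to one with constant \<open>A + N / 2\<close>, where \<open>A\<close> does not depend on \<open>t\<^sub>1\<close>. Such a bound
  holds trivially for some \<open>N\<close>, so iteration yields it with \<open>2 A\<close>, which is uniform in \<open>t\<^sub>1\<close>. Then \<open>\<bar>u\<bar>\<^sup>2\<close> is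
  only singular like \<open>(T - t) powr (-1/4)\<close>, and one more step gives boundedness.\<close>

lemma bounded_near_end:
  assumes a0T: "a0 < T" and Cs: "0 \<le> Cs" "Cs \<le> small_const"
    and hyp: "AE z in lborel. snd z \<in> {a0<..<T} \<longrightarrow> (\<forall>i. \<bar>u i z\<bar> \<le> Cs * (T - snd z) powr (-1/2))"
  shows "\<exists>M. AE z in lborel. snd z \<in> {a0<..<T} \<longrightarrow> (\<forall>i. \<bar>u i z\<bar> \<le> M)"
proof -
  \<comment> \<open>The early layer [a,b] lies strictly inside the interval: to the right of
    \<open>a0\<close>, because test functions have compact support in the open strip, and away from
    \<open>T\<close>, so that the hypothesis already bounds u by \<open>Mb\<close> up to time
    b.\<close>
  define a where "a = a0 + (T - a0) / 4"
  define b where "b = a0 + (T - a0) / 2"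
  have ab: "a0 < a" "a < b" "b < T" using a0T by (simp_all add: a_def b_def field_simps)
  define Mb where "Mb = Cs * (T - b) powr (-1/2)"
  have Mb0: "Mb \<ge> 0" using Cs by (simp add: Mb_def)
  have Mb: "AE z in lborel. snd z \<in> {a0<..b} \<longrightarrow> (\<forall>i. \<bar>u i z\<bar> \<le> Mb)"
    using hyp
  proof eventually_elim
    case (elim z)
    show ?case
    proof (intro impI allI)
      fix i assume z: "snd z \<in> {a0<..b}"
      have "\<bar>u i z\<bar> \<le> Cs * (T - snd z) powr (-1/2)" using elim z ab by auto
      also have "\<dots> \<le> Mb" unfolding Mb_def using z ab Cs by (intro mult_left_mono powr_mono2') auto
      finally show "\<bar>u i z\<bar> \<le> Mb" .
    qed
  qed
  have Mb': "AE z in lborel. snd z \<in> {a..b} \<longrightarrow> (\<forall>i. \<bar>u i z\<bar> \<le> Mb)"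
    using Mb by eventually_elim (use ab in auto)
  define c where "c = 72 * kernel_const * gauss8"
  have c0: "c \<ge> 0" using kernel_const_nonneg gauss8(2) by (simp add: c_def)
  have small: "c * 10 * Cs \<le> gauss4 / 2"
  proof -
    have "c * 10 * Cs \<le> c * 10 * small_const" using c0 Cs by (intro mult_left_mono) auto
    also have "\<dots> \<le> (c + 1) * 10 * small_const" using small_const_pos by (intro mult_right_mono) auto
    also have "\<dots> = gauss4 / 2"
    proof -
      have "x * 10 * (g / (20 * x)) = g / 2" if "x > 0" for x g :: real using that by simp
      from this[of "c + 1" gauss4] show ?thesis using c0 unfolding small_const_def c_def by simp
    qed
    finally show ?thesis .
  qed
  define F where "F = flow_const Mb"
  have F0: "F \<ge> 0"
    unfolding F_def flow_const_def main_const_def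
    using cut_const(1) annulus_const_nonneg ball_vol_nonneg K_nonneg a0T step_const(1) gauss4(2) Mb0
    by (intro add_nonneg_nonneg mult_nonneg_nonneg) auto
  \<comment> \<open>Serves both before b, where \<open>Mb\<close> is the bound, and after b, where
    \<open>F / gauss4\<close> is. The power of T - a0 converts constants into multiples of the
    weight (T - t)^(-1/8), by \<open>grow\<close>.\<close>
  define A where "A = (F / gauss4 + Mb) * (T - a0) powr (1/8)"
  have A0: "A \<ge> 0" using F0 gauss4_pos Mb0 by (simp add: A_def)
  define P where "P t1 N \<longleftrightarrow> (AE z in lborel. snd z \<in> {a..<t1} \<longrightarrow> (\<forall>i. \<bar>u i z\<bar> \<le> N * (T - snd z) powr (-1/8)))" for t1 N
  have grow: "1 \<le> (T - a0) powr (1/8) * (T - t) powr (-1/8)" if "a0 < t" "t < T" for t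
  proof -
    have "(T - t) powr (1/8) \<le> (T - a0) powr (1/8)" using that by (intro powr_mono2) auto
    then have "(T - t) powr (1/8) * (T - t) powr (-1/8) \<le> (T - a0) powr (1/8) * (T - t) powr (-1/8)" by (intro mult_right_mono) auto
    moreover have "(T - t) powr (1/8) * (T - t) powr (-1/8) = 1" using that by (simp add: powr_add[symmetric])
    ultimately show ?thesis by simp
  qed
  \<comment> \<open>The interval [a, t1) is the same before and after, so the improvement can be
    repeated indefinitely.\<close>
  have step: "P t1 (A + N / 2)" if t1: "b < t1" "t1 < T" and N: "N \<ge> 0" and PN: "P t1 N" for t1 N
  proof -
    define V where "V = (\<lambda>\<tau>. (N * Cs) * (T - \<tau>) powr (-5/8))"
    define Q where "Q = (\<lambda>t. (N * Cs) * (10 * (T - t) powr (-1/8)))"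
    have uV: "AE z in lborel. snd z \<in> {a..<t1} \<longrightarrow> (\<forall>i. (u i z)\<^sup>2 \<le> V (snd z))"
      using PN[unfolded P_def] hyp
    proof eventually_elim
      case (elim z)
      show ?case
      proof (intro impI allI)
        fix i assume z: "snd z \<in> {a..<t1}"
        have "\<bar>u i z\<bar> * \<bar>u i z\<bar> \<le> (N * (T - snd z) powr (-1/8)) * (Cs * (T - snd z) powr (-1/2))"
          using elim z ab t1 N by (intro mult_mono) auto
        also have "\<dots> = (N * Cs) * ((T - snd z) powr (-1/8) * (T - snd z) powr (-1/2))" by (simp only: mult_ac)
        also have "(T - snd z) powr (-1/8) * (T - snd z) powr (-1/2) = (T - snd z) powr (-5/8)" by (simp add: powr_add[symmetric])
        finally show "(u i z)\<^sup>2 \<le> V (snd z)" by (simp add: V_def power2_eq_square)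
      qed
    qed
    have "AE z in lborel. snd z \<in> {b<..<t1} \<longrightarrow> (\<forall>k. gauss4 * \<bar>u k z\<bar> \<le> flow_const Mb + 72 * kernel_const * gauss8 * Q (snd z))"
    proof (rule pointwise_bound[OF ab(1,2) t1(1) less_imp_le[OF t1(2)] _ _ uV Mb' Mb0])
      show "V \<in> borel_measurable borel" "Q \<in> borel_measurable borel" unfolding V_def Q_def by measurable
      show "\<And>\<tau>. V \<tau> \<ge> 0" "\<And>\<tau>. Q \<tau> \<ge> 0" unfolding V_def Q_def using N Cs by auto
      show "duhamel V a t \<le> ennreal (Q t)" if "b < t" "t < t1" for t
        unfolding V_def Q_def by (rule duhamel_singular) (use that t1 N Cs in auto)
    qed
    then show ?thesis unfolding P_def using Mb'
    proof eventually_elim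
      case (elim z)
      show ?case
      proof (intro impI allI)
        fix i assume z: "snd z \<in> {a..<t1}"
        let ?p = "(T - snd z) powr (-1/8)"
        have g: "1 \<le> (T - a0) powr (1/8) * ?p" using grow[of "snd z"] z ab t1 by auto
        show "\<bar>u i z\<bar> \<le> (A + N / 2) * ?p"
        proof (cases "snd z \<le> b")
          case True
          have "\<bar>u i z\<bar> \<le> (F / gauss4 + Mb) * 1" using elim(2) z True F0 gauss4_pos by (auto simp: add_increasing)
          also have "\<dots> \<le> (F / gauss4 + Mb) * ((T - a0) powr (1/8) * ?p)" using g F0 gauss4_pos Mb0 by (intro mult_left_mono) auto
          also have "\<dots> = A * ?p" by (simp add: A_def)
          also have "\<dots> \<le> (A + N / 2) * ?p" using N by (intro mult_right_mono) auto
          finally show ?thesis .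
        next
          case False
          have "gauss4 * \<bar>u i z\<bar> \<le> F + c * (N * Cs * (10 * ?p))" using elim(1) z False by (simp add: F_def c_def Q_def)
          also have "c * (N * Cs * (10 * ?p)) = (c * 10 * Cs) * (N * ?p)" by (simp only: mult_ac)
          also have "F + (c * 10 * Cs) * (N * ?p) \<le> F + gauss4 / 2 * (N * ?p)" using small N by (intro add_left_mono mult_right_mono) auto
          finally have "\<bar>u i z\<bar> \<le> F / gauss4 * 1 + N / 2 * ?p" using gauss4_pos by (simp add: field_simps)
          also have "\<dots> \<le> F / gauss4 * ((T - a0) powr (1/8) * ?p) + N / 2 * ?p"
            using g F0 gauss4_pos by (intro add_right_mono mult_left_mono) auto
          also have "\<dots> \<le> (F / gauss4 + Mb) * ((T - a0) powr (1/8) * ?p) + N / 2 * ?p"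
            using Mb0 by (intro add_right_mono mult_right_mono) auto
          also have "\<dots> = (A + N / 2) * ?p" by (simp add: A_def algebra_simps)
          finally show ?thesis .
        qed
      qed
    qed
  qed
  have P2A: "P t1 (2 * A)" if t1: "b < t1" "t1 < T" for t1
  proof -
    \<comment> \<open>From -1/2 = -3/8 - 1/8, the first power frozen at t1. It diverges as t1 tends
      to T, but only as a starting value.\<close>
    define N0 where "N0 = Cs * (T - t1) powr (-3/8)"
    have N0: "N0 \<ge> 0" using Cs by (simp add: N0_def)
    have start: "P t1 (2 * A + N0)" unfolding P_def using hyp
    proof eventually_elim
      case (elim z)
      show ?case
      proof (intro impI allI)
        fix i assume z: "snd z \<in> {a..<t1}"
        have "\<bar>u i z\<bar> \<le> Cs * (T - snd z) powr (-1/2)" using elim z ab t1 by auto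
        also have "(T - snd z) powr (-1/2) = (T - snd z) powr (-3/8) * (T - snd z) powr (-1/8)" by (simp add: powr_add[symmetric])
        also have "Cs * \<dots> \<le> Cs * ((T - t1) powr (-3/8) * (T - snd z) powr (-1/8))"
          using z t1 Cs by (intro mult_left_mono mult_right_mono powr_mono2') auto
        also have "\<dots> = N0 * (T - snd z) powr (-1/8)" by (simp add: N0_def)
        also have "\<dots> \<le> (2 * A + N0) * (T - snd z) powr (-1/8)" using A0 by (intro mult_right_mono) auto
        finally show "\<bar>u i z\<bar> \<le> (2 * A + N0) * (T - snd z) powr (-1/8)" .
      qed
    qed
    \<comment> \<open>The map taking N to A + N/2 has fixed point 2A and halves the distance to
      it.\<close>
    have "P t1 (2 * A + N0 / 2 ^ n)" for n
    proof (induction n)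
      case 0 then show ?case using start by simp
    next
      case (Suc n)
      have "P t1 (A + (2 * A + N0 / 2 ^ n) / 2)" by (rule step[OF t1 _ Suc]) (use A0 N0 in auto)
      then show ?case by (simp add: add_divide_distrib algebra_simps)
    qed
    then have "AE z in lborel. \<forall>n. snd z \<in> {a..<t1} \<longrightarrow> (\<forall>i. \<bar>u i z\<bar> \<le> (2 * A + N0 / 2 ^ n) * (T - snd z) powr (-1/8))"
      unfolding AE_all_countable P_def by blast
    then show ?thesis unfolding P_def
    proof eventually_elim
      case (elim z)
      show ?case
      proof (intro impI allI)
        fix i assume z: "snd z \<in> {a..<t1}"
        have "(\<lambda>n. (1 / 2 :: real) ^ n) \<longlonglongrightarrow> 0" by (rule LIMSEQ_realpow_zero) auto
        have "(\<lambda>n. N0 / 2 ^ n) = (\<lambda>n. N0 * (1 / 2) ^ n)" by (simp add: power_one_over)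
        with tendsto_mult_left[OF \<open>(\<lambda>n. (1 / 2 :: real) ^ n) \<longlonglongrightarrow> 0\<close>, of N0] have l: "(\<lambda>n. N0 / 2 ^ n) \<longlonglongrightarrow> 0" by (simp only: mult_zero_right)
        from tendsto_mult_right[OF tendsto_add[OF tendsto_const[of "2 * A"] l], of "(T - snd z) powr (-1/8)"]
        have "(\<lambda>n. (2 * A + N0 / 2 ^ n) * (T - snd z) powr (-1/8)) \<longlonglongrightarrow> 2 * A * (T - snd z) powr (-1/8)" by (simp only: add_0_right)
        then show "\<bar>u i z\<bar> \<le> 2 * A * (T - snd z) powr (-1/8)"
        proof (rule tendsto_lowerbound)
          show "\<forall>\<^sub>F n in sequentially. \<bar>u i z\<bar> \<le> (2 * A + N0 / 2 ^ n) * (T - snd z) powr (-1/8)"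
            using elim z by (intro always_eventually) blast
        qed simp
      qed
    qed
  qed
  \<comment> \<open>A sequence increasing to T, so that countably many almost-everywhere statements
    can be combined; the shift by 2 keeps every term beyond b.\<close>
  define tn where "tn n = T - (T - b) / real (n + 2)" for n
  have tn: "b < tn n" "tn n < T" for n
  proof -
    have "(T - b) / real (n + 2) < T - b" using ab by (simp add: divide_less_eq)
    then show "b < tn n" by (simp add: tn_def)
    show "tn n < T" using ab by (simp add: tn_def)
  qed
  have "AE z in lborel. \<forall>n. snd z \<in> {a..<tn n} \<longrightarrow> (\<forall>i. \<bar>u i z\<bar> \<le> 2 * A * (T - snd z) powr (-1/8))"
    unfolding AE_all_countable using P2A[OF tn] by (simp add: P_def)
  then have PT: "AE z in lborel. snd z \<in> {a..<T} \<longrightarrow> (\<forall>i. \<bar>u i z\<bar> \<le> 2 * A * (T - snd z) powr (-1/8))"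
  proof eventually_elim
    case (elim z)
    show ?case
    proof
      assume z: "snd z \<in> {a..<T}"
      then have "(T - snd z) / (T - b) > 0" using ab by simp
      then obtain n where "inverse (real (Suc n)) < (T - snd z) / (T - b)" using reals_Archimedean by blast
      then have "(T - b) * inverse (real (Suc n)) < (T - b) * ((T - snd z) / (T - b))"
        using ab by (intro mult_strict_left_mono) auto
      moreover have "(T - b) * ((T - snd z) / (T - b)) = T - snd z" using ab by simp
      ultimately have "(T - b) / real (Suc n) < T - snd z" by (simp only: divide_inverse)
      moreover have "(T - b) / real (n + 2) \<le> (T - b) / real (Suc n)" by (rule divide_left_mono) (use ab in auto)
      ultimately have "snd z < tn n" by (simp add: tn_def)
      then show "\<forall>i. \<bar>u i z\<bar> \<le> 2 * A * (T - snd z) powr (-1/8)" using elim z by auto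
    qed
  qed
  \<comment> \<open>The uniform bound is squared, this time without the hypothesis on either factor:
    the exponent -1/4 is covered by \<open>duhamel_regular\<close>.\<close>
  define V where "V = (\<lambda>\<tau>. (2 * A)\<^sup>2 * (T - \<tau>) powr (-1/4))"
  define Q where "Q = (2 * A)\<^sup>2 * (4 * (T - a) powr (1/4))"
  have uV: "AE z in lborel. snd z \<in> {a..<T} \<longrightarrow> (\<forall>i. (u i z)\<^sup>2 \<le> V (snd z))"
    using PT
  proof eventually_elim
    case (elim z)
    show ?case
    proof (intro impI allI)
      fix i assume z: "snd z \<in> {a..<T}"
      have "\<bar>u i z\<bar> * \<bar>u i z\<bar> \<le> (2 * A * (T - snd z) powr (-1/8)) * (2 * A * (T - snd z) powr (-1/8))"
        using elim z A0 by (intro mult_mono) auto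
      also have "\<dots> = (2 * A)\<^sup>2 * ((T - snd z) powr (-1/8) * (T - snd z) powr (-1/8))" by (simp only: power2_eq_square mult_ac)
      also have "(T - snd z) powr (-1/8) * (T - snd z) powr (-1/8) = (T - snd z) powr (-1/4)" by (simp only: powr_add[symmetric]) simp
      finally show "(u i z)\<^sup>2 \<le> V (snd z)" by (simp only: V_def power2_eq_square abs_mult_self_eq)
    qed
  qed
  have "AE z in lborel. snd z \<in> {b<..<T} \<longrightarrow> (\<forall>k. gauss4 * \<bar>u k z\<bar> \<le> flow_const Mb + 72 * kernel_const * gauss8 * Q)"
  proof (rule pointwise_bound[OF ab(1,2,3) order_refl _ _ uV Mb' Mb0, of "\<lambda>_. Q"])
    show "V \<in> borel_measurable borel" unfolding V_def by measurable
    show "\<And>\<tau>. V \<tau> \<ge> 0" unfolding V_def by simp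
    show "Q \<ge> 0" unfolding Q_def by simp
    show "duhamel V a t \<le> ennreal Q" if "b < t" "t < T" for t
      unfolding V_def Q_def by (rule duhamel_regular) (use that ab in auto)
  qed auto
  then have "AE z in lborel. snd z \<in> {a0<..<T} \<longrightarrow> (\<forall>k. \<bar>u k z\<bar> \<le> max Mb ((F + c * Q) / gauss4))"
    using Mb
  proof eventually_elim
    case (elim z)
    show ?case
    proof (intro impI allI)
      fix k assume z: "snd z \<in> {a0<..<T}"
      show "\<bar>u k z\<bar> \<le> max Mb ((F + c * Q) / gauss4)"
      proof (cases "snd z \<le> b")
        case True then show ?thesis using elim(2) z by (auto simp: le_max_iff_disj)
      next
        case False
        then have "gauss4 * \<bar>u k z\<bar> \<le> F + c * Q" using elim(1) z by (simp add: F_def c_def)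
        then have "\<bar>u k z\<bar> \<le> (F + c * Q) / gauss4" using gauss4_pos by (simp add: pos_le_divide_eq mult.commute)
        then show ?thesis by simp
      qed
    qed
  qed
  then show ?thesis by blast
qed

end

section \<open>From weak solutions to Borel representatives\<close>

lemma AE_lebesgue_on_iff:
  "S \<in> sets lebesgue \<Longrightarrow> (AE x in lebesgue_on S. P x) \<longleftrightarrow> (AE x in lborel. x \<in> S \<longrightarrow> P x)"
  by (simp add: AE_restrict_space_iff AE_completion_iff)

lemma borel_representative:
  fixes f :: "'a::euclidean_space \<Rightarrow> real"
  assumes "f \<in> borel_measurable (lebesgue_on S)" "S \<in> sets lebesgue"
  shows "\<exists>g\<in>borel_measurable borel. AE x in lborel. x \<in> S \<longrightarrow> g x = f x"
proof -
  obtain g where "g \<in> borel_measurable lborel" "AE x in lborel. (if x \<in> S then f x else 0) = g x"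
    using completion_ex_borel_measurable_real[OF borel_measurable_if_I[OF assms]] by auto
  then show ?thesis by (intro bexI[of _ g]) (auto elim!: eventually_mono)
qed

text \<open>Measurability of \<open>g\<close> for the completed measure is inherited from
  \<open>f\<close> by almost-everywhere equality, and completion does not change the integral of a
  Borel function.\<close>

lemma lebesgue_integral_borel_representative:
  fixes f g :: "'a::euclidean_space \<Rightarrow> real"
  assumes f [measurable]: "f \<in> borel_measurable borel" and eq: "AE x in lborel. f x = g x"
  shows "integral\<^sup>L lebesgue g = integral\<^sup>L lborel f" "integrable lebesgue g \<longleftrightarrow> integrable lborel f"
proof -
  have eq': "AE x in lebesgue. f x = g x" using eq by (simp add: AE_completion_iff)
  have fm: "f \<in> borel_measurable lebesgue" using f by (simp add: measurable_completion)
  have gm: "g \<in> borel_measurable lebesgue" by (rule borel_measurable_AE[OF fm eq'])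
  have "integral\<^sup>L lebesgue f = integral\<^sup>L lborel f" using f by (intro integral_completion) simp
  then show "integral\<^sup>L lebesgue g = integral\<^sup>L lborel f"
    using integral_cong_AE[OF fm gm eq'] by simp
  have "integrable lebesgue f = integrable lborel f" using f by (intro integrable_completion) simp
  then show "integrable lebesgue g \<longleftrightarrow> integrable lborel f"
    using integrable_cong_AE[OF fm gm eq'] by simp
qed

lemma component_square_integral:
  fixes f :: "real^3 \<Rightarrow> 'b::euclidean_space"
  assumes f: "in_L2 f" and g [measurable]: "g \<in> borel_measurable borel"
    and le: "AE x in lborel. \<bar>g x\<bar> \<le> norm (f x)"
  shows "integrable lborel (\<lambda>x. (g x)\<^sup>2)" "(LINT x|lborel. (g x)\<^sup>2) \<le> (L2_norm f)\<^sup>2"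
    "(\<integral>\<^sup>+x. ennreal ((g x)\<^sup>2) \<partial>lborel) \<le> ennreal ((L2_norm f)\<^sup>2)"
proof -
  have le': "AE x in lebesgue. (g x)\<^sup>2 \<le> (norm (f x))\<^sup>2"
    unfolding AE_completion_iff using le by eventually_elim (simp add: abs_le_square_iff[symmetric])
  have gm: "(\<lambda>x. (g x)\<^sup>2) \<in> borel_measurable lborel" by simp
  have i: "integrable lebesgue (\<lambda>x. (g x)\<^sup>2)"
  proof (rule Bochner_Integration.integrable_bound)
    show "integrable lebesgue (\<lambda>x. (norm (f x))\<^sup>2)" using f by (simp add: in_L2_def)
    show "AE x in lebesgue. norm ((g x)\<^sup>2) \<le> norm ((norm (f x))\<^sup>2)" using le' by simp
  qed (rule measurable_completion[OF gm])
  then show i': "integrable lborel (\<lambda>x. (g x)\<^sup>2)" using integrable_completion[OF gm] by simp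
  have "(LINT x|lborel. (g x)\<^sup>2) = (LINT x|lebesgue. (g x)\<^sup>2)" by (rule integral_completion[OF gm, symmetric])
  also have "\<dots> \<le> (LINT x|lebesgue. (norm (f x))\<^sup>2)"
    using f le' i by (intro integral_mono_AE) (simp_all add: in_L2_def)
  also have "\<dots> = (L2_norm f)\<^sup>2" by (simp add: L2_norm_def)
  finally show le2: "(LINT x|lborel. (g x)\<^sup>2) \<le> (L2_norm f)\<^sup>2" .
  have "(\<integral>\<^sup>+x. ennreal ((g x)\<^sup>2) \<partial>lborel) = ennreal (LINT x|lborel. (g x)\<^sup>2)"
    using i' by (intro nn_integral_eq_integral) simp_all
  then show "(\<integral>\<^sup>+x. ennreal ((g x)\<^sup>2) \<partial>lborel) \<le> ennreal ((L2_norm f)\<^sup>2)"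
    using le2 by (simp add: ennreal_leI)
qed

lemma component_le_norm_matrix: "\<bar>A $ i $ j\<bar> \<le> norm (A :: real^'n^'m)"
  by (rule order_trans[OF component_le_norm_cart Finite_Cartesian_Product.norm_nth_le])

text \<open>Membership in H1 and the weak gradient are invariant under changes on null sets, so they
  transfer from the given slice to Borel components.\<close>

lemma div_free_slice_of_H1:
  fixes f :: "real^3 \<Rightarrow> real^3"
  assumes H: "H1_with_gradient f G"
    and U [measurable]: "\<And>i. U i \<in> borel_measurable borel" and Gm [measurable]: "\<And>i j. Gc i j \<in> borel_measurable borel"
    and eq: "AE x in lborel. (\<forall>i. U i x = f x $ i) \<and> (\<forall>i j. Gc i j x = G x $ i $ j) \<and> trace (G x) = 0"
    and b: "\<And>i x. \<bar>U i x\<bar> \<le> M"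
  shows "div_free_slice U Gc M"
proof
  show "integrable lborel (\<lambda>x. (U i x)\<^sup>2)" for i
    by (rule component_square_integral(1)[of f])
       (use H in \<open>simp_all add: H1_with_gradient_def\<close>, use eq in eventually_elim, simp add: component_le_norm_cart)
  show "integrable lborel (\<lambda>x. (Gc i j x)\<^sup>2)" for i j
    by (rule component_square_integral(1)[of G])
       (use H in \<open>simp_all add: H1_with_gradient_def\<close>, use eq in eventually_elim, simp add: component_le_norm_matrix)
  show "(LINT x|lborel. U i x * pd (axis j 1) \<psi> x) = - (LINT x|lborel. Gc i j x * \<psi> x)"
    if \<psi>: "test_function UNIV \<psi>" for \<psi> i j
  proof -
    have [measurable]: "\<psi> \<in> borel_measurable borel" "pd (axis j 1) \<psi> \<in> borel_measurable borel"
      using \<psi> by (auto intro!: smooth_borel test_smooth smoothD(2))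
    have "(LINT x|lborel. U i x * pd (axis j 1) \<psi> x) = (LINT x|lebesgue. f x $ i * dir_deriv \<psi> (axis j 1) x)"
      by (rule lebesgue_integral_borel_representative(1)[symmetric])
         (simp, use eq in eventually_elim, simp add: pd_def)
    moreover have "(LINT x|lborel. Gc i j x * \<psi> x) = (LINT x|lebesgue. G x $ i $ j * \<psi> x)"
      by (rule lebesgue_integral_borel_representative(1)[symmetric])
         (simp, use eq in eventually_elim, simp)
    ultimately show ?thesis using H \<psi> by (simp add: H1_with_gradient_def weak_gradient_def)
  qed
  show "AE x in lborel. (\<Sum>i\<in>UNIV. Gc i i x) = 0"
    using eq by eventually_elim (simp add: trace_def)
qed (use b in auto)

lemma div_free_slice_zero: "div_free_slice (\<lambda>i x. 0) (\<lambda>i j x. 0) 0"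
  by standard auto

section \<open>Vector-valued test fields assembled from scalar components\<close>

lemma has_derivative_vec:
  fixes \<phi> :: "'n::finite \<Rightarrow> 'a::real_normed_vector \<Rightarrow> real"
  assumes "\<And>i. (\<phi> i has_derivative \<phi>' i) (at z)"
  shows "((\<lambda>z. \<chi> i. \<phi> i z) has_derivative (\<lambda>v. \<chi> i. \<phi>' i v)) (at z)"
  using assms by (subst has_derivative_componentwise_within) (auto simp: Basis_vec_def inner_axis)

lemma pd_vec:
  fixes \<phi> :: "'n::finite \<Rightarrow> 'a::real_normed_vector \<Rightarrow> real"
  assumes "\<And>i. smooth (\<phi> i)"
  shows "pd v (\<lambda>z. \<chi> i. \<phi> i z) = (\<lambda>z. \<chi> i. pd v (\<phi> i) z)"
  by (rule ext, rule pd_eqI, rule has_derivative_vec) (rule smooth_has_derivative[OF assms])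

lemma smooth_vec:
  fixes \<phi> :: "'n::finite \<Rightarrow> 'a::real_normed_vector \<Rightarrow> real"
  assumes "\<And>i. smooth (\<phi> i)"
  shows "smooth (\<lambda>z. \<chi> i. \<phi> i z)"
proof (rule smooth_coinduct[where P = "\<lambda>g. \<exists>\<phi>. (\<forall>i. smooth (\<phi> i)) \<and> g = (\<lambda>z. \<chi> i. \<phi> i z)"])
  show "\<exists>\<psi>. (\<forall>i. smooth (\<psi> i)) \<and> (\<lambda>z. \<chi> i. \<phi> i z) = (\<lambda>z. \<chi> i. \<psi> i z)" using assms by blast
next
  fix g :: "'a \<Rightarrow> real^'n" and x :: 'a
  assume "\<exists>\<phi>. (\<forall>i. smooth (\<phi> i)) \<and> g = (\<lambda>z. \<chi> i. \<phi> i z)"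
  then obtain \<psi> where "\<And>i. smooth (\<psi> i)" "g = (\<lambda>z. \<chi> i. \<psi> i z)" by blast
  then show "g differentiable (at x)"
    using has_derivative_vec[OF smooth_has_derivative, of \<psi> x] by (auto intro: differentiableI)
next
  fix g :: "'a \<Rightarrow> real^'n" and v :: 'a
  assume "\<exists>\<phi>. (\<forall>i. smooth (\<phi> i)) \<and> g = (\<lambda>z. \<chi> i. \<phi> i z)"
  then obtain \<psi> where \<psi>: "\<And>i. smooth (\<psi> i)" "g = (\<lambda>z. \<chi> i. \<psi> i z)" by blast
  show "\<exists>\<phi>. (\<forall>i. smooth (\<phi> i)) \<and> pd v g = (\<lambda>z. \<chi> i. \<phi> i z)"
    by (rule exI[of _ "\<lambda>i. pd v (\<psi> i)"]) (use \<psi> in \<open>simp add: pd_vec smoothD(2)\<close>)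
qed

lemma test_vec:
  fixes \<phi> :: "'n::finite \<Rightarrow> 'a::real_normed_vector \<Rightarrow> real"
  assumes \<phi>: "\<And>i. test_function S (\<phi> i)"
  shows "test_function S (\<lambda>z. \<chi> i. \<phi> i z)"
proof -
  obtain K where K: "\<And>i. compact (K i)" "\<And>i. K i \<subseteq> S" "\<And>i z. z \<notin> K i \<Longrightarrow> \<phi> i z = 0"
    using test_functionD[OF \<phi>] by metis
  show ?thesis
    by (rule test_functionI[OF smooth_vec[OF test_smooth[OF \<phi>]], of "\<Union>i. K i"])
       (use K in \<open>auto simp: vec_eq_iff intro!: compact_UN\<close>)
qed

text \<open>Components of u and of its gradient are replaced by Borel functions, cut off to the
  strip, which alters them inside the strip only on a null set. Test fields supported in the strip
  do not notice the extension by zero, so the weak formulation survives.\<close>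

lemma weak_flow_of_weak_solution:
  fixes u :: "(real^3) \<times> real \<Rightarrow> real^3"
  assumes a0: "0 \<le> a0" "a0 < T" and C: "0 \<le> C" and sol: "weak_solution T u"
    and bd: "AE z in lborel. snd z \<in> {a0<..<T} \<longrightarrow> norm (u z) \<le> C * (T - snd z) powr (-1/2)"
  shows "\<exists>K w D. weak_flow a0 T K w D \<and> (AE z in lborel. snd z \<in> {a0<..<T} \<longrightarrow> (\<forall>i. w i z = u z $ i))"
proof -
  define S :: "((real^3) \<times> real) set" where "S = UNIV \<times> {0<..<T}"
  obtain Du where L: "Linf_L2 T u" and H: "L2_H1 T u Du"
    and tr: "AE z in lebesgue_on S. trace (Du z) = 0"
    and wf: "\<And>\<phi> :: (real^3) \<times> real \<Rightarrow> real^3.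
           test_function S \<phi> \<Longrightarrow> (\<And>z. trace (space_gradient \<phi> z) = 0) \<Longrightarrow>
           (LINT z|lebesgue_on S.
              - (u z \<bullet> time_deriv \<phi> z) + Du z \<bullet> space_gradient \<phi> z + (Du z *v u z) \<bullet> \<phi> z) = 0"
    using sol unfolding weak_solution_def S_def by blast
  have "open S" unfolding S_def by (intro open_Times) auto
  then have S: "S \<in> sets lebesgue" by simp
  have um: "u \<in> borel_measurable (lebesgue_on S)" and Dm: "Du \<in> borel_measurable (lebesgue_on S)"
    using H by (simp_all add: L2_H1_def S_def)
  have nth: "(\<lambda>v :: real^3. v $ i) \<in> borel_measurable borel" "(\<lambda>A :: real^3^3. A $ i $ j) \<in> borel_measurable borel" for i j
    by (intro borel_measurable_continuous_onI continuous_on_component continuous_on_id)+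
  have "(\<lambda>z. u z $ i) \<in> borel_measurable (lebesgue_on S)" for i
    using measurable_compose[OF um nth(1)] .
  then have "\<forall>i. \<exists>g\<in>borel_measurable borel. AE z in lborel. z \<in> S \<longrightarrow> g z = u z $ i"
    by (intro allI borel_representative[OF _ S])
  then obtain U where U [measurable]: "\<And>i. U i \<in> borel_measurable borel"
    and Ueq: "\<And>i. AE z in lborel. z \<in> S \<longrightarrow> U i z = u z $ i" unfolding Bex_def choice_iff by blast
  have "(\<lambda>z. Du z $ i $ j) \<in> borel_measurable (lebesgue_on S)" for i j
    using measurable_compose[OF Dm nth(2)] .
  then have "\<forall>i j. \<exists>g\<in>borel_measurable borel. AE z in lborel. z \<in> S \<longrightarrow> g z = Du z $ i $ j"
    by (intro allI borel_representative[OF _ S])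
  then obtain E where E [measurable]: "\<And>i j. E i j \<in> borel_measurable borel"
    and Eeq: "\<And>i j. AE z in lborel. z \<in> S \<longrightarrow> E i j z = Du z $ i $ j" unfolding Bex_def choice_iff by blast
  \<comment> \<open>Besides the restriction to the strip, values above the assumed bound are set to
    0: \<open>div_free_slice\<close> asks for a bound at every point, while the hypothesis holds
    only almost everywhere.\<close>
  define w where "w i z = (if snd z \<in> {a0<..<T} \<and> \<bar>U i z\<bar> \<le> C * (T - snd z) powr (-1/2) then U i z else 0)"
    for i and z :: "(real^3) \<times> real"
  define D where "D i j z = (if snd z \<in> {a0<..<T} then E i j z else 0)" for i j and z :: "(real^3) \<times> real"
  have snd_m: "snd \<in> (borel :: ((real^3) \<times> real) measure) \<rightarrow>\<^sub>M borel"
    by (intro borel_measurable_continuous_onI continuous_intros)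
  have w_m [measurable]: "w i \<in> borel_measurable borel" for i
  proof -
    note snd_m[measurable]
    show ?thesis unfolding w_def greaterThanLessThan_iff by measurable
  qed
  have D_m [measurable]: "D i j \<in> borel_measurable borel" for i j
  proof -
    note snd_m[measurable]
    show ?thesis unfolding D_def greaterThanLessThan_iff by measurable
  qed
  have tr': "AE z in lborel. z \<in> S \<longrightarrow> trace (Du z) = 0"
    using tr unfolding AE_lebesgue_on_iff[OF S] .
  have "AE z in lborel. \<forall>i. z \<in> S \<longrightarrow> U i z = u z $ i" unfolding AE_all_countable using Ueq by blast
  moreover have "AE z in lborel. \<forall>i j. z \<in> S \<longrightarrow> E i j z = Du z $ i $ j" unfolding AE_all_countable using Eeq by blast
  ultimately have eq: "AE z in lborel. snd z \<in> {a0<..<T} \<longrightarrow>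
      (\<forall>i. w i z = u z $ i) \<and> (\<forall>i j. D i j z = Du z $ i $ j) \<and> trace (Du z) = 0"
    using bd tr'
  proof eventually_elim
    case (elim z)
    show ?case
    proof
      assume z: "snd z \<in> {a0<..<T}"
      then have zS: "z \<in> S" using a0 by (cases z) (auto simp: S_def)
      have "\<bar>u z $ i\<bar> \<le> C * (T - snd z) powr (-1/2)" for i
        by (rule order_trans[OF component_le_norm_cart]) (use elim(3) z in blast)
      then show "(\<forall>i. w i z = u z $ i) \<and> (\<forall>i j. D i j z = Du z $ i $ j) \<and> trace (Du z) = 0"
        using elim zS z by (simp add: w_def D_def)
    qed
  qed
  obtain K0 where K0: "AE t in lebesgue_on {0<..<T}. in_L2 (\<lambda>x. u (x, t)) \<and> L2_norm (\<lambda>x. u (x, t)) \<le> K0"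
    using L by (auto simp: Linf_L2_def)
  have K0': "AE t in lborel. t \<in> {0<..<T} \<longrightarrow> L2_norm (\<lambda>x. u (x, t)) \<le> K0"
    using K0 by (subst (asm) AE_lebesgue_on_iff) (auto elim!: eventually_mono)
  have H1: "AE t in lborel. t \<in> {0<..<T} \<longrightarrow> H1_with_gradient (\<lambda>x. u (x, t)) (\<lambda>x. Du (x, t))"
    using H by (subst AE_lebesgue_on_iff[symmetric]) (auto simp: L2_H1_def)
  \<comment> \<open>Everything required of one slice at a single time, including the identification
    of representatives for almost every x, which \<open>lborel_AE_snd\<close> provides.\<close>
  define good where "good t \<longleftrightarrow> H1_with_gradient (\<lambda>x. u (x, t)) (\<lambda>x. Du (x, t)) \<and> L2_norm (\<lambda>x. u (x, t)) \<le> K0 \<and>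
     (AE x in lborel. (\<forall>i. w i (x, t) = u (x, t) $ i) \<and> (\<forall>i j. D i j (x, t) = Du (x, t) $ i $ j) \<and> trace (Du (x, t)) = 0)" for t
  have good: "AE t in lborel. t \<in> {a0<..<T} \<longrightarrow> good t"
    using K0' H1 lborel_AE_snd[OF eq]
  proof eventually_elim
    case (elim t)
    show ?case
    proof
      assume t: "t \<in> {a0<..<T}"
      then have "t \<in> {0<..<T}" using a0 by auto
      then show "good t" using elim t by (simp add: good_def)
    qed
  qed
  have sl_m: "(\<lambda>x. w i (x, t)) \<in> borel_measurable borel" "(\<lambda>x. D i j (x, t)) \<in> borel_measurable borel" for i j t
    by (rule measurable_compose[OF _ w_m] measurable_compose[OF _ D_m], simp add: borel_prod[symmetric])+
  have off: "w i (x, t) = 0" "D i j (x, t) = 0" if "t \<notin> {a0<..<T}" for i j t x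
    using that by (simp_all only: w_def D_def snd_conv simp_thms if_False)
  have w_le: "\<bar>w i (x, t)\<bar> \<le> \<bar>C * (T - t) powr (-1/2)\<bar>" for i x t
    using abs_ge_self[of "C * (T - t) powr (-1/2)"] by (simp only: w_def snd_conv split: if_split) (simp, linarith?)
  define h where "h t = indicator {0<..<T} t * ((L2_norm (\<lambda>x. u (x, t)))\<^sup>2 + (L2_norm (\<lambda>x. Du (x, t)))\<^sup>2)" for t
  have "integrable lebesgue h"
    using H integrable_restrict_space[of "{0<..<T}" lebesgue "\<lambda>t. (L2_norm (\<lambda>x. u (x, t)))\<^sup>2 + (L2_norm (\<lambda>x. Du (x, t)))\<^sup>2"]
    unfolding h_def[abs_def] by (simp add: L2_H1_def)
  then have "(\<integral>\<^sup>+t. ennreal (norm (h t)) \<partial>lebesgue) < \<infinity>" by (simp add: integrable_iff_bounded)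
  \<comment> \<open>\<open>h\<close> is only known to be Lebesgue measurable; the nonnegative
    integral takes the same value for a measure and its completion, so \<open>h\<close> can still
    serve as a majorant under \<open>lborel\<close>.\<close>
  then have h: "(\<integral>\<^sup>+t. ennreal (h t) \<partial>lborel) < \<infinity>"
    unfolding nn_integral_completion by (simp add: h_def)
  have h_fin: "integrable lborel (\<lambda>z. (g z)\<^sup>2)"
    if g [measurable]: "g \<in> borel_measurable borel"
      and le: "AE t in lborel. (\<integral>\<^sup>+x. ennreal ((g (x, t))\<^sup>2) \<partial>lborel) \<le> ennreal (h t)" for g :: "(real^3) \<times> real \<Rightarrow> real"
  proof (rule integrableI_bounded)
    have "(\<integral>\<^sup>+z. ennreal (norm ((g z)\<^sup>2)) \<partial>lborel) = (\<integral>\<^sup>+t. \<integral>\<^sup>+x. ennreal ((g (x, t))\<^sup>2) \<partial>lborel \<partial>lborel)"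
      by (subst lborel_nn_snd) simp_all
    also have "\<dots> \<le> (\<integral>\<^sup>+t. ennreal (h t) \<partial>lborel)" by (rule nn_integral_mono_AE[OF le])
    finally show "(\<integral>\<^sup>+z. ennreal (norm ((g z)\<^sup>2)) \<partial>lborel) < \<infinity>" using h by (rule order_le_less_trans)
  qed simp
  have goodD: "(\<integral>\<^sup>+x. ennreal ((w i (x, t))\<^sup>2) \<partial>lborel) \<le> ennreal (h t)"
      "(\<integral>\<^sup>+x. ennreal ((D i j (x, t))\<^sup>2) \<partial>lborel) \<le> ennreal (h t)"
      "(LINT x|lborel. (w i (x, t))\<^sup>2) \<le> K0\<^sup>2"
      "div_free_slice (\<lambda>i x. w i (x, t)) (\<lambda>i j x. D i j (x, t)) \<bar>C * (T - t) powr (-1/2)\<bar>"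
    if t: "t \<in> {a0<..<T}" and g: "good t" for i j t
  proof -
    have t0: "t \<in> {0<..<T}" using t a0 by auto
    have l2: "in_L2 (\<lambda>x. u (x, t))" "in_L2 (\<lambda>x. Du (x, t))" "L2_norm (\<lambda>x. u (x, t)) \<le> K0"
      and ae: "AE x in lborel. (\<forall>i. w i (x, t) = u (x, t) $ i) \<and> (\<forall>i j. D i j (x, t) = Du (x, t) $ i $ j) \<and> trace (Du (x, t)) = 0"
      using g by (auto simp only: good_def H1_with_gradient_def)
    have 1: "AE x in lborel. \<bar>w i (x, t)\<bar> \<le> norm (u (x, t))"
      using ae by eventually_elim (simp add: component_le_norm_cart)
    have 2: "AE x in lborel. \<bar>D i j (x, t)\<bar> \<le> norm (Du (x, t))"
      using ae by eventually_elim (simp add: component_le_norm_matrix)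
    note c1 = component_square_integral[OF l2(1) sl_m(1) 1]
    show "(\<integral>\<^sup>+x. ennreal ((w i (x, t))\<^sup>2) \<partial>lborel) \<le> ennreal (h t)"
      by (rule order_trans[OF c1(3)]) (use t0 in \<open>simp add: h_def ennreal_leI\<close>)
    show "(\<integral>\<^sup>+x. ennreal ((D i j (x, t))\<^sup>2) \<partial>lborel) \<le> ennreal (h t)"
      by (rule order_trans[OF component_square_integral(3)[OF l2(2) sl_m(2) 2]]) (use t0 in \<open>simp add: h_def ennreal_leI\<close>)
    have "(L2_norm (\<lambda>x. u (x, t)))\<^sup>2 \<le> K0\<^sup>2"
      using l2(3) by (intro power_mono) (auto simp: L2_norm_def)
    then show "(LINT x|lborel. (w i (x, t))\<^sup>2) \<le> K0\<^sup>2" using c1(2) by linarith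
    show "div_free_slice (\<lambda>i x. w i (x, t)) (\<lambda>i j x. D i j (x, t)) \<bar>C * (T - t) powr (-1/2)\<bar>"
      by (rule div_free_slice_of_H1[OF _ sl_m ae w_le]) (use g in \<open>simp add: good_def\<close>)
  qed
  have "weak_flow a0 T (K0\<^sup>2) w D"
  proof
    show "integrable lborel (\<lambda>z. (w i z)\<^sup>2)" for i
    proof (rule h_fin[OF w_m])
      show "AE t in lborel. (\<integral>\<^sup>+x. ennreal ((w i (x, t))\<^sup>2) \<partial>lborel) \<le> ennreal (h t)"
        using good
      proof eventually_elim
        case (elim t)
        show ?case by (cases "t \<in> {a0<..<T}") (use goodD(1) elim in blast, simp add: off)
      qed
    qed
    show "integrable lborel (\<lambda>z. (D i j z)\<^sup>2)" for i j
    proof (rule h_fin[OF D_m])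
      show "AE t in lborel. (\<integral>\<^sup>+x. ennreal ((D i j (x, t))\<^sup>2) \<partial>lborel) \<le> ennreal (h t)"
        using good
      proof eventually_elim
        case (elim t)
        show ?case by (cases "t \<in> {a0<..<T}") (use goodD(2) elim in blast, simp add: off)
      qed
    qed
    show "AE t in lborel. \<exists>M. div_free_slice (\<lambda>i x. w i (x, t)) (\<lambda>i j x. D i j (x, t)) M"
      using good
    proof eventually_elim
      case (elim t)
      show ?case
      proof (cases "t \<in> {a0<..<T}")
        case False
        have "div_free_slice (\<lambda>i x. w i (x, t)) (\<lambda>i j x. D i j (x, t)) 0"
          unfolding off[OF False] by (rule div_free_slice_zero)
        then show ?thesis by blast
      qed (use goodD(4) elim in blast)
    qed
    show "AE t in lborel. \<forall>i. (LINT x|lborel. (w i (x, t))\<^sup>2) \<le> K0\<^sup>2"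
      using good
    proof eventually_elim
      case (elim t)
      show ?case by (cases "t \<in> {a0<..<T}") (use goodD(3) elim in blast, simp add: off)
    qed
    fix \<phi> :: "3 \<Rightarrow> (real^3) \<times> real \<Rightarrow> real"
    assume \<phi>: "\<And>i. test_function (UNIV \<times> {a0<..<T}) (\<phi> i)" and dv: "\<And>z. (\<Sum>i\<in>UNIV. pd (ex i) (\<phi> i) z) = 0"
    define \<Phi> where "\<Phi> z = (\<chi> i. \<phi> i z)" for z
    have sm: "\<And>i. smooth (\<phi> i)" using \<phi> by (rule test_smooth)
    have "test_function S (\<phi> i)" for i by (rule test_mono[OF \<phi>]) (use a0 in \<open>auto simp: S_def\<close>)
    then have \<Phi>: "test_function S \<Phi>" unfolding \<Phi>_def by (rule test_vec)
    have pd\<Phi>: "pd v \<Phi> z = (\<chi> i. pd v (\<phi> i) z)" for v z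
      unfolding \<Phi>_def using pd_vec[of \<phi>, OF sm] by simp
    have td: "time_deriv \<Phi> z = (\<chi> i. pd et (\<phi> i) z)" for z
      using pd\<Phi>[of et z] by (simp add: time_deriv_def pd_def et_def)
    have sg: "space_gradient \<Phi> z = (\<chi> i j. pd (ex j) (\<phi> i) z)" for z
      using pd\<Phi>[of "ex _" z] by (simp add: space_gradient_def pd_def ex_def vec_eq_iff)
    have "trace (space_gradient \<Phi> z) = 0" for z using dv by (simp add: sg trace_def)
    from wf[OF \<Phi> this] have z0: "(LINT z|lebesgue. indicator S z *
        (- (u z \<bullet> time_deriv \<Phi> z) + Du z \<bullet> space_gradient \<Phi> z + (Du z *v u z) \<bullet> \<Phi> z)) = 0"
      using S by (subst (asm) integral_restrict_space) simp_all
    have [measurable]: "\<phi> i \<in> borel_measurable borel" "pd v (\<phi> i) \<in> borel_measurable borel" for i v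
      using sm by (auto intro!: smooth_borel smoothD(2))
    \<comment> \<open>Off the strip the test field and its derivatives vanish, so the integrands
      agree there although \<open>w\<close> and u differ.\<close>
    have z_off: "\<phi> i z = 0" "pd v (\<phi> i) z = 0" if z: "snd z \<notin> {a0<..<T}" for i v z
    proof -
      obtain K where K: "compact K" "K \<subseteq> UNIV \<times> {a0<..<T}" "\<And>z. z \<notin> K \<Longrightarrow> \<phi> i z = 0"
        using test_functionD[OF \<phi>] by metis
      have "z \<notin> K" using K(2) z by (cases z) auto
      then show "\<phi> i z = 0" "pd v (\<phi> i) z = 0" using K pd_eq_0[of K "\<phi> i" z v] compact_imp_closed by blast+
    qed
    let ?e = "\<lambda>z. (\<Sum>i\<in>UNIV. - (w i z * pd et (\<phi> i) z)) + (\<Sum>i\<in>UNIV. \<Sum>j\<in>UNIV. D i j z * pd (ex j) (\<phi> i) z)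
         + (\<Sum>i\<in>UNIV. \<Sum>j\<in>UNIV. w j z * D i j z * \<phi> i z)"
    have "AE z in lborel. ?e z = indicator S z *
        (- (u z \<bullet> time_deriv \<Phi> z) + Du z \<bullet> space_gradient \<Phi> z + (Du z *v u z) \<bullet> \<Phi> z)"
      using eq
    proof eventually_elim
      case (elim z)
      show ?case
      proof (cases "snd z \<in> {a0<..<T}")
        case True
        then have zS: "z \<in> S" using a0 by (cases z) (auto simp: S_def)
        have 1: "w i z = u z $ i" "D i j z = Du z $ i $ j" for i j using elim True by auto
        show ?thesis
          using zS by (simp add: 1 td sg \<Phi>_def inner_vec_def matrix_vector_mult_def sum_negf sum_distrib_left sum_distrib_right mult_ac)
      next
        case False
        show ?thesis by (simp add: z_off[OF False] td sg \<Phi>_def inner_vec_def)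
      qed
    qed
    from lebesgue_integral_borel_representative(1)[OF _ this] z0
    show "(LINT z|lborel. ?e z) = 0" by simp
  qed (use w_m D_m in simp_all)
  moreover have "AE z in lborel. snd z \<in> {a0<..<T} \<longrightarrow> (\<forall>i. w i z = u z $ i)"
    using eq by eventually_elim blast
  ultimately show ?thesis by blast
qed

theorem mainTheorem2:
  shows "\<exists>C::real. C > 0 \<and>
    (\<forall>(T::real) (R::real) (u :: (real^3) \<times> real \<Rightarrow> real^3).
       0 < T \<longrightarrow> 0 < R \<longrightarrow> R \<le> T \<longrightarrow> weak_solution T u \<longrightarrow>
       (AE (x, t) in lebesgue_on (UNIV \<times> {T - R<..<T}). norm (u (x, t)) \<le> C / sqrt (T - t)) \<longrightarrow>
       ess_bounded_on (UNIV \<times> {T - R<..T}) u)"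
proof (intro exI[of _ small_const] conjI small_const_pos allI impI)
  \<comment> \<open>\<open>small_const\<close> involves only Gaussian integrals and
    \<open>kernel_const\<close>. The energy, the cutoffs and the length of the interval enter
    through \<open>flow_const\<close>, which affects the size of the final bound but not the
    smallness condition.\<close>
  fix T R :: real and u :: "(real^3) \<times> real \<Rightarrow> real^3"
  assume R: "0 < R" "R \<le> T" and sol: "weak_solution T u"
    and bd: "AE (x, t) in lebesgue_on (UNIV \<times> {T - R<..<T}). norm (u (x, t)) \<le> small_const / sqrt (T - t)"
  have "open (UNIV \<times> {T - R<..<T} :: ((real^3) \<times> real) set)" by (intro open_Times) auto
  then have S: "UNIV \<times> {T - R<..<T} \<in> sets (lebesgue :: ((real^3) \<times> real) measure)" by simp
  have bd': "AE z in lborel. snd z \<in> {T - R<..<T} \<longrightarrow> norm (u z) \<le> small_const * (T - snd z) powr (-1/2)"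
    using bd unfolding AE_lebesgue_on_iff[OF S]
  proof eventually_elim
    case (elim z)
    show ?case
    proof
      assume z: "snd z \<in> {T - R<..<T}"
      then have "norm (u z) \<le> small_const / sqrt (T - snd z)" using elim by (cases z) auto
      also have "\<dots> = small_const * (T - snd z) powr (-1/2)"
        using z by (simp add: powr_half_sqrt[symmetric] powr_minus_divide)
      finally show "norm (u z) \<le> small_const * (T - snd z) powr (-1/2)" .
    qed
  qed
  obtain K w D where "weak_flow (T - R) T K w D"
    and eq: "AE z in lborel. snd z \<in> {T - R<..<T} \<longrightarrow> (\<forall>i. w i z = u z $ i)"
    using weak_flow_of_weak_solution[OF _ _ _ sol bd'] R small_const_pos by auto
  then interpret weak_flow "T - R" T K w D by blast
  have "AE z in lborel. snd z \<in> {T - R<..<T} \<longrightarrow> (\<forall>i. \<bar>w i z\<bar> \<le> small_const * (T - snd z) powr (-1/2))"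
    using bd' eq
  proof eventually_elim
    case (elim z)
    show ?case
    proof (intro impI allI)
      fix i assume z: "snd z \<in> {T - R<..<T}"
      then have "\<bar>w i z\<bar> \<le> norm (u z)" using elim(2) by (simp add: component_le_norm_cart)
      then show "\<bar>w i z\<bar> \<le> small_const * (T - snd z) powr (-1/2)" using elim(1) z by (blast intro: order_trans)
    qed
  qed
  from bounded_near_end[OF _ _ _ this] obtain M where
    M: "AE z in lborel. snd z \<in> {T - R<..<T} \<longrightarrow> (\<forall>i. \<bar>w i z\<bar> \<le> M)" using R small_const_pos by auto
  \<comment> \<open>The final time slice is a null set of space-time, so closing the time interval
    at T costs nothing for an essential bound.\<close>
  have "(UNIV \<times> {T} :: ((real^3) \<times> real) set) \<in> sets borel" by (intro borel_closed closed_Times) auto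
  moreover have "emeasure lborel (UNIV \<times> {T} :: ((real^3) \<times> real) set) = 0"
    unfolding lborel_prod[symmetric] by (subst lborel.emeasure_pair_measure_Times) simp_all
  ultimately have "AE z in lborel. z \<notin> (UNIV \<times> {T} :: ((real^3) \<times> real) set)"
    by (intro AE_not_in) (simp add: null_sets_def)
  with M eq have "AE z in lborel. z \<in> UNIV \<times> {T - R<..T} \<longrightarrow> norm (u z) \<le> (\<Sum>i\<in>(UNIV::3 set). M)"
  proof eventually_elim
    case (elim z)
    show ?case
    proof
      assume "z \<in> UNIV \<times> {T - R<..T}"
      then have z: "snd z \<in> {T - R<..<T}" using elim(3) by (cases z) auto
      have "norm (u z) \<le> (\<Sum>i\<in>UNIV. \<bar>u z $ i\<bar>)" by (rule norm_le_l1_cart)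
      also have "\<dots> \<le> (\<Sum>i\<in>(UNIV::3 set). M)" using elim z by (intro sum_mono) auto
      finally show "norm (u z) \<le> (\<Sum>i\<in>(UNIV::3 set). M)" .
    qed
  qed
  moreover have "UNIV \<times> {T - R<..T} \<in> sets (lebesgue :: ((real^3) \<times> real) measure)"
    using \<open>_ \<in> sets borel\<close> by (intro sets_completionI_sets) (simp add: borel_prod[symmetric])
  ultimately show "ess_bounded_on (UNIV \<times> {T - R<..T}) u"
    unfolding ess_bounded_on_def by (subst AE_lebesgue_on_iff) auto
qed

end
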